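(* Let $\Lambda=[\lambda^{xy}]_{x,y\in S}$ satisfy the canonical conditions relative to $(S,\mathbb F)$. Let $\xi$ be an $S$-valued random variable such that for every $x\in S$, $\mathbb Q(\xi=x\mid\mathcal F_T)=\mu_x$ for some $\mathcal F_0$-measurable $[0,1]$-valued random variable $\mu_x$. Suppose that the intensities $a^{xy}$ of the Poisson processes $N^{xy}$ are strictly positive for all $x\ne y$, and let $X$ be the unique solution of $$dX_t=\sum_{x,y\in S,\ x\neq y}(y-x)\,\mathbf 1_{\{x\}}(X_{t-})\,dN^{xy}_t,\quad t\in[0,T],\qquad X_0=\xi .$$ Put $\kappa^{xy}_t=\lambda^{xy}_{t-}/a^{xy}-1$, $t\in[0,T]$, for $x\ne y$, assume that $$\vartheta=\prod_{x,y\in S:\,x\ne y}\exp\Big(-\int_0^T H^x_{u-}a^{xy}\kappa^{xy}_u\,du\Big)\prod_{0<u\le T}\big(1+\kappa^{xy}_u\,\Delta H^{xy}_u\big)$$ satisfies $\mathbb E_{\mathbb Q}\vartheta=1$, and define $\mathbb P$ on $(\Omega,\widehat{\mathcal G}_T)$ by $\frac{d\mathbb P}{d\mathbb Q}\big|_{\widehat{\mathcal G}_T}=\vartheta$ (so that under $\mathbb P$ the process $X$ is an $(\mathbb F,\mathbb G)$-CMC with $\mathbb F$-intensity process $\Lambda$). Then, under $\mathbb P$, $X$ is also an $(\mathbb F,\mathbb G)$-DSMC with an intensity process $\Gamma=\Lambda$.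
   Context: $T>0$ is fixed, $S=\{1,\dots,d\}$, $(\Omega,\mathcal A,\mathbb Q)$ is a complete probability space. All filtrations are indexed by $[0,T]$ and completed. On this space are given: a (reference) filtration $\mathbb F=(\mathcal F_t)$ satisfying the usual conditions; the $S$-valued random variable $\xi$; a family $(N^{xy})_{x\ne y}$ of mutually independent Poisson processes with constant intensities $a^{xy}$, independent of $\mathcal F_T\vee\sigma(\xi)$. Put $\mathcal G_t=\big(\bigvee_{x\neq y}\mathcal F^{N^{xy}}_t\big)\vee\sigma(\xi)$, where $\mathbb F^U=(\mathcal F^U_t)$ denotes the completed right-continuous filtration generated by a process $U$; $\mathbb G=(\mathcal G_t)$, $\widehat{\mathcal G}_t=\mathcal F_T\vee\mathcal G_t$, $\mathbb F\vee\mathbb G=(\mathcal F_t\vee\mathcal G_t)$. $H^x_t=\mathbf 1_{\{X_t=x\}}$, $H_t=(H^x_t)_{x\in S}^\top$, and $H^{xy}_t=\int_{]0,t]}H^x_{u-}\,dH^y_u$ for $x\ne y$ (the number of transitions of $X$ from $x$ to $y$ up to time $t$). Convention: $U_{0-}:=0$ for any real valued process $U$. Canonical conditions relative to $(S,\mathbb F)$: (C1) $\Lambda$ is $\mathbb F$-progressively measurable, $\lambda^{xy}_t\ge 0$ for $x\ne y$ and $\sum_{y\in S}\lambda^{xy}_t=0$ for all $x\in S$; (C2) the processes $\lambda^{xy}$, $x\neq y$, have countably many jumps $\mathbb Q$-a.s., and their trajectories admit left limits. $(\mathbb F,\mathbb G)$-CMC (conditional Markov chain) under $\mathbb P$: an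 $S$-valued $\mathbb G$-adapted càdlàg process $X$ such that for all $x_1,\dots,x_k\in S$, $0\le t\le t_1\le\dots\le t_k\le T$: $\mathbb P(X_{t_1}=x_1,\dots,X_{t_k}=x_k\mid\mathcal F_t\vee\mathcal G_t)=\mathbb P(X_{t_1}=x_1,\dots,X_{t_k}=x_k\mid\mathcal F_t\vee\sigma(X_t))$. Its $\mathbb F$-intensity: an $\mathbb F$-adapted matrix-valued process $\Lambda$ with $\lambda^{xy}\ge0$ for $x\neq y$ and zero row sums such that $H_t-\int_0^t\Lambda_u^\top H_u\,du$ is an $\mathbb F\vee\mathbb G$-local martingale under $\mathbb P$. $(\mathbb F,\mathbb G)$-DSMC (doubly stochastic Markov chain) under $\mathbb P$: a $\mathbb G$-adapted càdlàg $S$-valued process $X$ such that for all $0\le s\le t\le T$ and $y\in S$, $\mathbb P(X_t=y\mid\mathcal F_T\vee\mathcal G_s)=\mathbb P(X_t=y\mid\mathcal F_t\vee\sigma(X_s))$. The c-transition field (conditional transition probability matrix field) of a DSMC $X$ is the matrix valued random field $P(s,t)=(p_{xy}(s,t))_{x,y\in S}$, $0\le s\le t\le T$, defined by $$p_{xy}(s,t)=\frac{\mathbb P(X_t=y,X_s=x\mid\mathcal F_t)}{\mathbb P(X_s=x\mid\mathcal F_t)}\mathbf 1_{\{\mathbb P(X_s=x\mid\mathcal F_t)>0\}}+\mathbf 1_{\{x=y\}}\mathbf 1_{\{\mathbb P(X_s=x\mid\mathcal F_t)=0\}}.$$ An $\mathbb F$-adapted matrix-valued process $\Gamma=[\gamma^{xy}]_{x,y\in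 S}$ is an intensity of the DSMC $X$ with c-transition field $P$ if: 1) $\int_{]0,T]}\sum_{x\in S}|\gamma^{xx}_s|\,ds<\infty$; 2) $\gamma^{xy}_s\ge0$ for $x\ne y$ and $\gamma^{xx}_s=-\sum_{y\ne x}\gamma^{xy}_s$ for all $x\in S$; 3) $P(v,t)-\mathrm I=\int_v^t\Gamma_uP(u,t)\,du$ for all $v\le t$; 4) $P(v,t)-\mathrm I=\int_v^tP(v,u)\Gamma_u\,du$ for all $v\le t$. Here $\mathrm I$ is the identity matrix.
   Formalization: That Λ is an intensity is claimed only if, a.s., μ_x=0 implies λ^{xy}=0 for almost every time, y≠x; otherwise it fails, e.g. d=2, ξ=2, λ^{21}=0, λ^{12}=1. The DSMC property is unconditional. The CMC property recalled in parentheses is not restated. *)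

theory Defs
  imports "HOL-Probability.Probability"
begin

text \<open>
  Processes are functions \<open>U t \<omega>\<close> of a real time \<open>t\<close>; only times in \<open>[0,T]\<close> are ever inspected.
  The state space is \<open>S = {1..d}\<close>, with states of type \<open>nat\<close>. A sub-sigma-algebra is
  represented by a measure whose \<open>sets\<close> are its members, as in the library's \<open>subalgebra\<close>
  and \<open>real_cond_exp\<close>.
\<close>

section \<open>Paths\<close>

definition cadlag_on :: "real \<Rightarrow> (real \<Rightarrow> 'b::topological_space) \<Rightarrow> bool" where
  "cadlag_on T f \<longleftrightarrow>
     (\<forall>t\<in>{0..<T}. (f \<longlongrightarrow> f t) (at_right t)) \<and>
     (\<forall>t\<in>{0<..T}. \<exists>l. (f \<longlongrightarrow> l) (at_left t))"

text \<open>\<open>f(t-)\<close>, with the convention \<open>f(0-) = 0\<close>.\<close>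
definition left_lim :: "(real \<Rightarrow> real) \<Rightarrow> real \<Rightarrow> real" where
  "left_lim f t = (if t = 0 then 0 else Lim (at_left t) f)"

definition jump :: "(real \<Rightarrow> real) \<Rightarrow> real \<Rightarrow> real" where
  "jump f t = f t - left_lim f t"

text \<open>The pathwise Stieltjes integral of \<open>f\<close> against \<open>dg\<close> over \<open>]0,t]\<close> for an integrator \<open>g\<close>
  that is piecewise constant with finitely many jumps. All integrators used below
  (paths of Poisson processes and of state indicators) are almost surely of this kind.\<close>
definition jump_integral :: "(real \<Rightarrow> real) \<Rightarrow> (real \<Rightarrow> real) \<Rightarrow> real \<Rightarrow> real" where
  "jump_integral f g t = (\<Sum>u\<in>{u\<in>{0<..t}. jump g u \<noteq> 0}. f u * jump g u)"

section \<open>Filtrations\<close>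

definition sigma_join :: "'a measure \<Rightarrow> 'a measure \<Rightarrow> 'a measure \<Rightarrow> 'a measure" where
  "sigma_join M A B = sigma (space M) (sets A \<union> sets B)"

definition sigma_var :: "'a measure \<Rightarrow> ('a \<Rightarrow> nat) \<Rightarrow> 'a measure" where
  "sigma_var M Z = vimage_algebra (space M) Z (count_space UNIV)"

definition sigma_upto :: "'a measure \<Rightarrow> (real \<Rightarrow> 'a \<Rightarrow> real) \<Rightarrow> real \<Rightarrow> 'a measure" where
  "sigma_upto M U t =
     sigma (space M) (\<Union>r\<in>{0..t}. sets (vimage_algebra (space M) (U r) borel))"

definition adapted :: "real \<Rightarrow> (real \<Rightarrow> 'a measure) \<Rightarrow> 'b measure \<Rightarrow> (real \<Rightarrow> 'a \<Rightarrow> 'b) \<Rightarrow> bool" where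
  "adapted T F B U \<longleftrightarrow> (\<forall>t\<in>{0..T}. U t \<in> measurable (F t) B)"

definition usual_conditions :: "real \<Rightarrow> 'a measure \<Rightarrow> (real \<Rightarrow> 'a measure) \<Rightarrow> bool" where
  "usual_conditions T M F \<longleftrightarrow>
     (\<forall>t\<in>{0..T}. subalgebra M (F t)) \<and>
     (\<forall>s\<in>{0..T}. \<forall>t\<in>{s..T}. sets (F s) \<subseteq> sets (F t)) \<and>
     (\<forall>t\<in>{0..T}. null_sets M \<subseteq> sets (F t)) \<and>
     (\<forall>t\<in>{0..<T}. sets (F t) = (\<Inter>s\<in>{t<..T}. sets (F s)))"

text \<open>The completed right-continuous filtration generated by \<open>U\<close>; at the terminal time \<open>T\<close>
  there is no right limit to take.\<close>
definition gen_filtration ::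
  "real \<Rightarrow> 'a measure \<Rightarrow> (real \<Rightarrow> 'a \<Rightarrow> real) \<Rightarrow> real \<Rightarrow> 'a measure" where
  "gen_filtration T M U t =
     sigma (space M)
       (\<Inter>s\<in>(if t < T then {t<..T} else {t}).
          sets (sigma (space M) (sets (sigma_upto M U s) \<union> null_sets M)))"

definition state_pairs :: "nat \<Rightarrow> (nat \<times> nat) set" where
  "state_pairs d = {(x, y). x \<in> {1..d} \<and> y \<in> {1..d} \<and> x \<noteq> y}"

text \<open>The filtration \<open>G\<close> generated by the driving processes and \<open>\<xi>\<close>. The null sets are already
  contained in each generated filtration; adding them matters only for \<open>d = 1\<close>.\<close>
definition driving_filtration ::
  "real \<Rightarrow> 'a measure \<Rightarrow> nat \<Rightarrow> (nat \<Rightarrow> nat \<Rightarrow> real \<Rightarrow> 'a \<Rightarrow> real) \<Rightarrow> ('a \<Rightarrow> nat) \<Rightarrow> real \<Rightarrow> 'a measure"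
where
  "driving_filtration T M d N \<xi> t =
     sigma (space M)
       ((\<Union>(x, y)\<in>state_pairs d. sets (gen_filtration T M (N x y) t)) \<union>
        sets (sigma_var M \<xi>) \<union> null_sets M)"

section \<open>The driving Poisson processes and the equation for \<open>X\<close>\<close>

definition poisson_process :: "real \<Rightarrow> 'a measure \<Rightarrow> real \<Rightarrow> (real \<Rightarrow> 'a \<Rightarrow> real) \<Rightarrow> bool" where
  "poisson_process T M a U \<longleftrightarrow>
     (\<forall>t\<in>{0..T}. U t \<in> borel_measurable M) \<and>
     (AE \<omega> in M. U 0 \<omega> = 0 \<and> cadlag_on T (\<lambda>t. U t \<omega>)) \<and>
     (\<forall>s\<in>{0..T}. \<forall>t\<in>{s..T}. \<forall>k::nat.
        measure M {\<omega> \<in> space M. U t \<omega> - U s \<omega> = real k} =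
          (a * (t - s)) ^ k / fact k * exp (- (a * (t - s)))) \<and>
     (\<forall>s\<in>{0..T}. \<forall>t\<in>{s..T}.
        prob_space.indep_set M
          (sets (sigma_upto M U s))
          (sets (vimage_algebra (space M) (\<lambda>\<omega>. U t \<omega> - U s \<omega>) borel)))"

text \<open>Mutual independence of the family, and joint independence of the whole family from the
  sigma-algebra \<open>A\<close>.\<close>
definition indep_poisson_family ::
  "real \<Rightarrow> 'a measure \<Rightarrow> nat \<Rightarrow> (nat \<Rightarrow> nat \<Rightarrow> real) \<Rightarrow> (nat \<Rightarrow> nat \<Rightarrow> real \<Rightarrow> 'a \<Rightarrow> real) \<Rightarrow>
   'a measure \<Rightarrow> bool"
where
  "indep_poisson_family T M d a N A \<longleftrightarrow>
     (\<forall>(x, y)\<in>state_pairs d. poisson_process T M (a x y) (N x y)) \<and>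
     prob_space.indep_sets M (\<lambda>(x, y). sets (sigma_upto M (N x y) T)) (state_pairs d) \<and>
     prob_space.indep_set M
       (sets (sigma (space M) (\<Union>(x, y)\<in>state_pairs d. sets (sigma_upto M (N x y) T))))
       (sets A)"

text \<open>The SDE in integrated form, almost surely for all times; it contains \<open>X 0 = \<xi>\<close>.
  Solutions are sought among \<open>S\<close>-valued \<open>G\<close>-adapted cadlag processes, where a solution is
  unique up to indistinguishability.\<close>
definition solves_sde ::
  "real \<Rightarrow> 'a measure \<Rightarrow> nat \<Rightarrow> (real \<Rightarrow> 'a measure) \<Rightarrow> (nat \<Rightarrow> nat \<Rightarrow> real \<Rightarrow> 'a \<Rightarrow> real) \<Rightarrow>
   ('a \<Rightarrow> nat) \<Rightarrow> (real \<Rightarrow> 'a \<Rightarrow> nat) \<Rightarrow> bool"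
where
  "solves_sde T M d G N \<xi> X \<longleftrightarrow>
     (\<forall>t\<in>{0..T}. \<forall>\<omega>\<in>space M. X t \<omega> \<in> {1..d}) \<and>
     (\<forall>\<omega>\<in>space M. cadlag_on T (\<lambda>t. X t \<omega>)) \<and>
     adapted T G (count_space UNIV) X \<and>
     (AE \<omega> in M. \<forall>t\<in>{0..T}.
        real (X t \<omega>) = real (\<xi> \<omega>) +
          (\<Sum>(x, y)\<in>state_pairs d. (real y - real x) *
             jump_integral (\<lambda>u. indicator {x} (Lim (at_left u) (\<lambda>s. X s \<omega>))) (\<lambda>u. N x y u \<omega>) t))"

section \<open>Canonical conditions and the density\<close>

definition progressive :: "real \<Rightarrow> (real \<Rightarrow> 'a measure) \<Rightarrow> (real \<Rightarrow> 'a \<Rightarrow> real) \<Rightarrow> bool" where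
  "progressive T F U \<longleftrightarrow>
     (\<forall>t\<in>{0..T}. (\<lambda>(s, \<omega>). U s \<omega>) \<in> borel_measurable (restrict_space borel {0..t} \<Otimes>\<^sub>M F t))"

definition canonical_conditions ::
  "real \<Rightarrow> 'a measure \<Rightarrow> nat \<Rightarrow> (real \<Rightarrow> 'a measure) \<Rightarrow> (nat \<Rightarrow> nat \<Rightarrow> real \<Rightarrow> 'a \<Rightarrow> real) \<Rightarrow> bool"
where
  "canonical_conditions T M d F \<Lambda> \<longleftrightarrow>
     (\<forall>x\<in>{1..d}. \<forall>y\<in>{1..d}. progressive T F (\<Lambda> x y)) \<and>
     (\<forall>t\<in>{0..T}. \<forall>\<omega>\<in>space M.
        (\<forall>(x, y)\<in>state_pairs d. 0 \<le> \<Lambda> x y t \<omega>) \<and>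
        (\<forall>x\<in>{1..d}. (\<Sum>y\<in>{1..d}. \<Lambda> x y t \<omega>) = 0)) \<and>
     (\<forall>(x, y)\<in>state_pairs d. AE \<omega> in M.
        (\<forall>t\<in>{0<..T}. \<exists>l. ((\<lambda>s. \<Lambda> x y s \<omega>) \<longlongrightarrow> l) (at_left t)) \<and>
        countable {t\<in>{0<..T}. jump (\<lambda>s. \<Lambda> x y s \<omega>) t \<noteq> 0})"

definition state_ind :: "(real \<Rightarrow> 'a \<Rightarrow> nat) \<Rightarrow> nat \<Rightarrow> real \<Rightarrow> 'a \<Rightarrow> real" where
  "state_ind X x t \<omega> = indicator {x} (X t \<omega>)"

definition transitions :: "(real \<Rightarrow> 'a \<Rightarrow> nat) \<Rightarrow> nat \<Rightarrow> nat \<Rightarrow> real \<Rightarrow> 'a \<Rightarrow> real" where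
  "transitions X x y t \<omega> =
     jump_integral (left_lim (\<lambda>s. state_ind X x s \<omega>)) (\<lambda>s. state_ind X y s \<omega>) t"

definition kappa ::
  "(nat \<Rightarrow> nat \<Rightarrow> real) \<Rightarrow> (nat \<Rightarrow> nat \<Rightarrow> real \<Rightarrow> 'a \<Rightarrow> real) \<Rightarrow> nat \<Rightarrow> nat \<Rightarrow> real \<Rightarrow> 'a \<Rightarrow> real"
where
  "kappa a \<Lambda> x y t \<omega> = left_lim (\<lambda>s. \<Lambda> x y s \<omega>) t / a x y - 1"

text \<open>\<open>exp (- \<integral>\<^sub>0\<^sup>T f)\<close> for a measurable integrand bounded below: such an \<open>f\<close> fails to be integrable
  only if its integral is \<open>+\<infinity>\<close>, and then the exponential is \<open>0\<close>. (The library integral would be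
  \<open>0\<close> and the exponential \<open>1\<close>.)\<close>
definition exp_neg_integral :: "real \<Rightarrow> (real \<Rightarrow> real) \<Rightarrow> real" where
  "exp_neg_integral T f =
     (if set_integrable lborel {0..T} f then exp (- (LINT u:{0..T}|lborel. f u)) else 0)"

text \<open>The product over \<open>0 < u \<le> T\<close> runs over the finitely many \<open>u\<close> at which the factor can
  differ from \<open>1\<close>.\<close>
definition theta ::
  "real \<Rightarrow> nat \<Rightarrow> (nat \<Rightarrow> nat \<Rightarrow> real) \<Rightarrow> (nat \<Rightarrow> nat \<Rightarrow> real \<Rightarrow> 'a \<Rightarrow> real) \<Rightarrow> (real \<Rightarrow> 'a \<Rightarrow> nat) \<Rightarrow>
   'a \<Rightarrow> real"
where
  "theta T d a \<Lambda> X \<omega> =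
     (\<Prod>(x, y)\<in>state_pairs d.
        exp_neg_integral T
          (\<lambda>u. left_lim (\<lambda>s. state_ind X x s \<omega>) u * a x y * kappa a \<Lambda> x y u \<omega>) *
        (\<Prod>u\<in>{u\<in>{0<..T}. jump (\<lambda>s. transitions X x y s \<omega>) u \<noteq> 0}.
           1 + kappa a \<Lambda> x y u \<omega> * jump (\<lambda>s. transitions X x y s \<omega>) u))"

section \<open>Doubly stochastic Markov chains\<close>

definition cond_probability :: "'a measure \<Rightarrow> 'a measure \<Rightarrow> ('a \<Rightarrow> bool) \<Rightarrow> 'a \<Rightarrow> real" where
  "cond_probability P A E = real_cond_exp P A (indicator {\<omega> \<in> space P. E \<omega>})"

definition is_dsmc ::
  "real \<Rightarrow> 'a measure \<Rightarrow> nat \<Rightarrow> (real \<Rightarrow> 'a measure) \<Rightarrow> (real \<Rightarrow> 'a measure) \<Rightarrow>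
   (real \<Rightarrow> 'a \<Rightarrow> nat) \<Rightarrow> bool"
where
  "is_dsmc T P d F G X \<longleftrightarrow>
     (\<forall>t\<in>{0..T}. \<forall>\<omega>\<in>space P. X t \<omega> \<in> {1..d}) \<and>
     adapted T G (count_space UNIV) X \<and>
     (\<forall>\<omega>\<in>space P. cadlag_on T (\<lambda>t. X t \<omega>)) \<and>
     (\<forall>s\<in>{0..T}. \<forall>t\<in>{s..T}. \<forall>y\<in>{1..d}. AE \<omega> in P.
        cond_probability P (sigma_join P (F T) (G s)) (\<lambda>\<omega>. X t \<omega> = y) \<omega> =
        cond_probability P (sigma_join P (F t) (sigma_var P (X s))) (\<lambda>\<omega>. X t \<omega> = y) \<omega>)"

text \<open>\<open>p x y s t\<close> is a version of the c-transition field of \<open>X\<close>: conditional probabilities are only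
  determined almost surely, for each pair of times separately.\<close>
definition c_transition_field ::
  "real \<Rightarrow> 'a measure \<Rightarrow> nat \<Rightarrow> (real \<Rightarrow> 'a measure) \<Rightarrow> (real \<Rightarrow> 'a \<Rightarrow> nat) \<Rightarrow>
   (nat \<Rightarrow> nat \<Rightarrow> real \<Rightarrow> real \<Rightarrow> 'a \<Rightarrow> real) \<Rightarrow> bool"
where
  "c_transition_field T P d F X p \<longleftrightarrow>
     (\<forall>s\<in>{0..T}. \<forall>t\<in>{s..T}. \<forall>x\<in>{1..d}. \<forall>y\<in>{1..d}.
        p x y s t \<in> borel_measurable (F t) \<and>
        (AE \<omega> in P.
           p x y s t \<omega> =
             cond_probability P (F t) (\<lambda>\<omega>. X t \<omega> = y \<and> X s \<omega> = x) \<omega> /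
               cond_probability P (F t) (\<lambda>\<omega>. X s \<omega> = x) \<omega> *
               of_bool (cond_probability P (F t) (\<lambda>\<omega>. X s \<omega> = x) \<omega> > 0) +
             of_bool (x = y) * of_bool (cond_probability P (F t) (\<lambda>\<omega>. X s \<omega> = x) \<omega> = 0)))"

text \<open>The path integrals in the two Kolmogorov equations need a version of the field that is
  measurable in its time arguments, hence the existential quantifier over versions. The equations
  hold on one almost sure event simultaneously for all \<open>v \<le> t\<close>, and the integrals exist.\<close>
definition is_dsmc_intensity ::
  "real \<Rightarrow> 'a measure \<Rightarrow> nat \<Rightarrow> (real \<Rightarrow> 'a measure) \<Rightarrow> (real \<Rightarrow> 'a \<Rightarrow> nat) \<Rightarrow>
   (nat \<Rightarrow> nat \<Rightarrow> real \<Rightarrow> 'a \<Rightarrow> real) \<Rightarrow> bool"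
where
  "is_dsmc_intensity T P d F X \<Gamma> \<longleftrightarrow>
     (\<forall>x\<in>{1..d}. \<forall>y\<in>{1..d}. adapted T F borel (\<Gamma> x y)) \<and>
     (AE \<omega> in P. set_integrable lborel {0<..T} (\<lambda>s. \<Sum>x\<in>{1..d}. \<bar>\<Gamma> x x s \<omega>\<bar>)) \<and>
     (\<forall>t\<in>{0..T}. \<forall>\<omega>\<in>space P.
        (\<forall>(x, y)\<in>state_pairs d. 0 \<le> \<Gamma> x y t \<omega>) \<and>
        (\<forall>x\<in>{1..d}. \<Gamma> x x t \<omega> = - (\<Sum>y\<in>{1..d} - {x}. \<Gamma> x y t \<omega>))) \<and>
     (\<exists>p. c_transition_field T P d F X p \<and>
        (AE \<omega> in P. \<forall>v\<in>{0..T}. \<forall>t\<in>{v..T}. \<forall>x\<in>{1..d}. \<forall>y\<in>{1..d}.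
           set_integrable lborel {v..t} (\<lambda>u. \<Sum>z\<in>{1..d}. \<Gamma> x z u \<omega> * p z y u t \<omega>) \<and>
           p x y v t \<omega> - of_bool (x = y) =
             (LINT u:{v..t}|lborel. (\<Sum>z\<in>{1..d}. \<Gamma> x z u \<omega> * p z y u t \<omega>)) \<and>
           set_integrable lborel {v..t} (\<lambda>u. \<Sum>z\<in>{1..d}. p x z v u \<omega> * \<Gamma> z y u \<omega>) \<and>
           p x y v t \<omega> - of_bool (x = y) =
             (LINT u:{v..t}|lborel. (\<Sum>z\<in>{1..d}. p x z v u \<omega> * \<Gamma> z y u \<omega>))))"

text \<open>Almost surely, every state that has conditional initial probability \<open>0\<close> is absorbing for \<open>\<Lambda>\<close>;
  in particular this holds whenever all \<open>\<mu> x\<close> are strictly positive. It cannot be dispensed with: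
  on \<open>\<mu> x = 0\<close> the convention in the c-transition field forces \<open>p x y 0 t = \<delta>\<close> for all \<open>t\<close>, and
  the forward equation then forces \<open>\<Lambda> x y = 0\<close> almost everywhere for \<open>y \<noteq> x\<close>. For instance,
  with \<open>d = 2\<close>, \<open>\<xi> = 2\<close>, \<open>\<Lambda> 2 1 = 0\<close> and \<open>\<Lambda> 1 2 = 1\<close>, the field is the identity matrix
  while \<open>\<Lambda> \<noteq> 0\<close>.\<close>
definition null_initial_states_absorbing ::
  "real \<Rightarrow> 'a measure \<Rightarrow> nat \<Rightarrow> (nat \<Rightarrow> 'a \<Rightarrow> real) \<Rightarrow> (nat \<Rightarrow> nat \<Rightarrow> real \<Rightarrow> 'a \<Rightarrow> real) \<Rightarrow> bool"
where
  "null_initial_states_absorbing T M d \<mu> \<Lambda> \<longleftrightarrow>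
     (AE \<omega> in M. \<forall>(x, y)\<in>state_pairs d.
        \<mu> x \<omega> = 0 \<longrightarrow> (AE u in lborel. u \<in> {0..T} \<longrightarrow> \<Lambda> x y u \<omega> = 0))"

end

theory Submission
  imports Defs
begin

text \<open>
  Write \<open>\<G>\<^sub>s\<close> for \<open>F T \<or> G s\<close> (\<open>Gh s\<close> below). Given the rates, the law of \<open>X\<close> under \<open>P\<close> can only be
  that of the chain with killing rates \<open>k\<^sub>x = (\<Sum>z\<noteq>x. \<lambda>\<^sub>x\<^sub>z)\<close> and jump rates \<open>\<lambda>\<close>, so its transition
  function must be the minimal solution \<open>Z\<close> of Feller's equations, computed path by path (\<open>min_trans\<close>).
  Nothing is assumed about the integrability of \<open>\<lambda>\<close>; therefore \<open>Z\<close> is built as a supremum in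
  \<open>ennreal\<close>, and a priori it is only sub-Markovian: \<open>(\<Sum>y. Z x y s t) <= 1\<close>.

  The density factorizes over time, \<open>theta = weight 0 T = weight 0 s * weight s T\<close> (\<open>theta_eq_weight\<close>,
  \<open>weight_mult\<close>), and the heart of the proof is the identity (\<open>weight_identity\<close>)
  \<open>E\<^sub>Q[1\<^sub>A * weight s t * 1{X t = y}] = E\<^sub>Q[1\<^sub>A * Z (X s) y s t]\<close> for \<open>A \<in> \<G>\<^sub>s\<close>. It is proved on a grid. Over a
  short interval the Poisson increments are independent of \<open>\<G>\<^sub>s\<close> (\<open>incr_event_indep\<close>), so that up to an
  error of second order \<open>X\<close> stays or makes one jump (\<open>one_step_change\<close>, \<open>one_step_stay\<close>). Replacing the
  density by a product over cells, and pairing it with the Feller iteration evaluated at the current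
  state, gives a process whose expectation is almost constant along the grid (\<open>gval_step\<close>): the
  defect per cell comes from freezing the rates at the left end point, and it vanishes in the limit
  because the rates have left limits (\<open>defect_tendsto\<close>). To have bounded integrands the jump rates are
  truncated at a level and only paths with fewer than \<open>n\<close> jumps are counted (\<open>truncated_identity\<close>);
  monotone convergence removes both restrictions.

  Now let \<open>E\<^sub>Q theta = 1\<close>. Then no mass may get lost: after time \<open>t\<close>, on the event that \<open>weight 0 t\<close> is
  positive, \<open>Z\<close> has total mass \<open>1\<close> (\<open>weight_full_mass\<close>). Hence \<open>weight 0 t\<close> is the density of \<open>P\<close> on \<open>\<G>\<^sub>t\<close>,
  and the identity says that \<open>Z (X s) y s t\<close> is the conditional probability of \<open>X t = y\<close> given \<open>\<G>\<^sub>s\<close>. It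
  is measurable with respect to \<open>F t\<close> and \<open>X s\<close>, so it is also the conditional probability given the
  smaller \<open>\<sigma>\<close>-algebra: \<open>X\<close> is a DSMC.

  For the intensity, \<open>Z\<close> serves as version of the c-transition field. At time \<open>0\<close> conservation of mass
  shows that \<open>Z x\<close> has mass \<open>1\<close> wherever \<open>\<mu>\<^sub>x > 0\<close>. A rate with left limits that is not integrable
  explodes to the right of some time and would kill mass (\<open>min_trans_explosion\<close>); so \<open>k\<^sub>x\<close> is integrable
  there, and where \<open>\<mu>\<^sub>x = 0\<close> it vanishes by assumption. For integrable rates Feller's two integral
  equations turn into Kolmogorov's backward and forward equations by Tonelli's theorem. Finally, where
  \<open>P(X s = x | F t)\<close> is zero, also \<open>\<mu>\<^sub>x\<close> is zero, and then \<open>Z x y s t\<close> is the unit matrix, in agreement with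
  the convention in the c-transition field.
\<close>

section \<open>Survival functions of nonnegative rates\<close>

text \<open>The function \<open>exp (- a)\<close> on \<open>[0, \<infinity>]\<close>; the value
  \<open>0\<close> at infinity makes survival probabilities meaningful for rates that are not
  integrable.\<close>
definition neg_exp :: "ennreal => ennreal" where
 "neg_exp a = (if a = \<top> then 0 else ennreal (exp (- enn2real a)))"

lemma neg_exp_0 [simp]: "neg_exp 0 = 1"
 by (simp add: neg_exp_def)

lemma neg_exp_top [simp]: "neg_exp \<top> = 0"
 by (simp add: neg_exp_def)

lemma neg_exp_ennreal: "0 <= a ==> neg_exp (ennreal a) = ennreal (exp (- a))"
 by (simp add: neg_exp_def)

lemma neg_exp_add: "neg_exp (a + b) = neg_exp a * neg_exp b"
 by (cases a; cases b)
   (auto simp: neg_exp_ennreal exp_add[symmetric] ennreal_mult[symmetric] simp flip: ennreal_plus)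

lemma neg_exp_antimono: "a <= b ==> neg_exp b <= neg_exp a"
 by (cases a; cases b) (auto simp: neg_exp_ennreal top_unique)

lemma neg_exp_le_1 [simp]: "neg_exp a <= 1"
 using neg_exp_antimono[of 0 a] by simp

lemma neg_exp_sum: "neg_exp (\<Sum>i\<in>I. f i) = (\<Prod>i\<in>I. neg_exp (f i))"
 by (induction I rule: infinite_finite_induct) (auto simp: neg_exp_add)

lemma neg_exp_measurable [measurable]: "neg_exp \<in> borel_measurable borel"
 unfolding neg_exp_def by measurable

lemma tendsto_neg_exp:
 assumes "(f \<longlongrightarrow> a) F"
 shows "((%i. neg_exp (f i)) \<longlongrightarrow> neg_exp a) F"
proof (cases "a = \<top>")
 case False
 then have ev: "eventually (%i. f i < \<top>) F"
  using assms by (simp add: order_tendsto_iff less_top)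
 have "((%i. ennreal (exp (- enn2real (f i)))) \<longlongrightarrow> ennreal (exp (- enn2real a))) F"
  using assms False by (intro tendsto_intros) (auto simp: less_top)
 moreover have "eventually (%i. neg_exp (f i) = ennreal (exp (- enn2real (f i)))) F"
  using ev by eventually_elim (auto simp: neg_exp_def)
 ultimately show ?thesis
  using False by (simp add: tendsto_cong neg_exp_def[of a])
next
 case True
 show ?thesis
 proof (rule order_tendstoI)
  fix b assume "neg_exp a < b"
  then obtain e where e: "0 < e" "e < b"
   using dense[of 0 b] True by auto
  define c where "c = enn2real e"
  have "e < \<top>" using e(2) top_greatest less_le_trans by blast
  then have c: "0 < c" "ennreal c < b"
   using e by (auto simp: c_def enn2real_positive_iff)
  define r where "r = max 0 (- ln c)"
  have "eventually (%i. ennreal r < f i) F"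
   using assms True by (simp add: order_tendsto_iff)
  then show "eventually (%i. neg_exp (f i) < b) F"
  proof eventually_elim
   case (elim i)
   have "neg_exp (f i) <= neg_exp (ennreal r)"
    using elim by (intro neg_exp_antimono) auto
   also have "... <= ennreal c"
    using c by (simp add: r_def neg_exp_ennreal max_def ln_le_zero_iff)
   finally show ?case using c by simp
  qed
 qed (use True in auto)
qed

text \<open>The probability to survive the open interval under the killing rate \<open>k\<close>. Open
  intervals avoid case distinctions at their end points, which are null sets.\<close>
definition surv :: "(real => ennreal) => real => real => ennreal" where
 "surv k s t = neg_exp (\<integral>\<^sup>+u\<in>{s<..<t}. k u \<partial>lborel)"

lemma indicator_interval: "indicator {s<..<t} u = (if s < u \<and> u < t then 1 else 0)"
 by (simp add: indicator_def)

lemma nn_integral_interval_split: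
 fixes k :: "real => ennreal"
 assumes [measurable]: "k \<in> borel_measurable borel" and "s <= u" "u <= t"
 shows "(\<integral>\<^sup>+v\<in>{s<..<t}. k v \<partial>lborel) =
      (\<integral>\<^sup>+v\<in>{s<..<u}. k v \<partial>lborel) + (\<integral>\<^sup>+v\<in>{u<..<t}. k v \<partial>lborel)"
proof -
 have "(\<integral>\<^sup>+v\<in>{s<..<t}. k v \<partial>lborel) =
   (\<integral>\<^sup>+v. k v * indicator {s<..<u} v + k v * indicator {u<..<t} v \<partial>lborel)"
  using AE_lborel_singleton[of u] assms
  by (intro nn_integral_cong_AE) (auto elim!: eventually_mono simp: indicator_def)
 then show ?thesis by (simp add: nn_integral_add)
qed

lemma surv_refl [simp]: "surv k s s = 1"
 by (simp add: surv_def)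

lemma surv_le_1 [simp]: "surv k s t <= 1"
 by (simp add: surv_def)

lemma surv_mult:
 assumes "k \<in> borel_measurable borel" "s <= u" "u <= t"
 shows "surv k s t = surv k s u * surv k u t"
 unfolding surv_def nn_integral_interval_split[OF assms] neg_exp_add ..

lemma measurable_surv_param:
 assumes [measurable]: "(%(u, p). k u p) \<in> borel_measurable (borel \<Otimes>\<^sub>M M)"
  and [measurable]: "s \<in> borel_measurable N" "t \<in> borel_measurable N" "f \<in> measurable N M"
 shows "(%q. surv (%u. k u (f q)) (s q) (t q)) \<in> borel_measurable N"
 unfolding surv_def indicator_interval by measurable

lemma measurable_surv [measurable]:
 assumes [measurable]: "k \<in> borel_measurable borel" "s \<in> borel_measurable N" "t \<in> borel_measurable N"
 shows "(%q. surv k (s q) (t q)) \<in> borel_measurable N"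
 unfolding surv_def indicator_interval by measurable

lemma nn_integral_power_primitive:
 fixes k :: "real => ennreal"
 assumes [measurable]: "k \<in> borel_measurable borel"
 shows "of_nat (Suc n) * (\<integral>\<^sup>+u\<in>{s<..<w}. k u * (\<integral>\<^sup>+v\<in>{s<..<u}. k v \<partial>lborel) ^ n \<partial>lborel) =
      (\<integral>\<^sup>+u\<in>{s<..<w}. k u \<partial>lborel) ^ Suc n"
proof (induction n arbitrary: w)
 case 0
 show ?case by simp
next
 case (Suc n)
 define K where "K u = (\<integral>\<^sup>+v\<in>{s<..<u}. k v \<partial>lborel)" for u
 have [measurable]: "K \<in> borel_measurable borel"
  unfolding K_def indicator_interval by measurable
 define c :: ennreal where "c = of_nat (Suc n)"
 have IH: "c * (\<integral>\<^sup>+u\<in>{s<..<w}. k u * K u ^ n \<partial>lborel) = K w ^ Suc n" for w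
  using Suc.IH by (simp add: K_def c_def)
 let ?g = "%q. c * (k q * K q ^ n)"
 have g: "(\<integral>\<^sup>+q\<in>{s<..<w}. ?g q \<partial>lborel) = K w ^ Suc n" for w
  by (subst IH[symmetric], subst nn_integral_cmult[symmetric]) (auto simp: mult_ac)
 have "K w ^ Suc (Suc n) = K w * (\<integral>\<^sup>+q\<in>{s<..<w}. ?g q \<partial>lborel)"
  by (simp add: g)
 also have "... = (\<integral>\<^sup>+q. K w * (?g q * indicator {s<..<w} q) \<partial>lborel)"
  by (rule nn_integral_cmult[symmetric]) measurable
 also have "... = (\<integral>\<^sup>+q. (\<integral>\<^sup>+p. k p * indicator {s<..<w} p * (?g q * indicator {s<..<w} q) \<partial>lborel) \<partial>lborel)"
  by (subst nn_integral_multc) (auto simp: K_def)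
 also have "... = (\<integral>\<^sup>+q. (\<integral>\<^sup>+p. ?g q * indicator {s<..<w} q * (k p * indicator {s<..<q} p) +
    k p * indicator {s<..<w} p * (?g q * indicator {s<..<p} q) \<partial>lborel) \<partial>lborel)"
 proof (rule nn_integral_cong)
  fix q :: real
  show "(\<integral>\<^sup>+p. k p * indicator {s<..<w} p * (?g q * indicator {s<..<w} q) \<partial>lborel) =
    (\<integral>\<^sup>+p. ?g q * indicator {s<..<w} q * (k p * indicator {s<..<q} p) +
    k p * indicator {s<..<w} p * (?g q * indicator {s<..<p} q) \<partial>lborel)"
   using AE_lborel_singleton[of q]
   by (intro nn_integral_cong_AE) (auto elim!: eventually_mono simp: indicator_def mult_ac)
 qed
 also have "... = (\<integral>\<^sup>+q. (\<integral>\<^sup>+p. ?g q * indicator {s<..<w} q * (k p * indicator {s<..<q} p) \<partial>lborel) \<partial>lborel) +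
    (\<integral>\<^sup>+q. (\<integral>\<^sup>+p. k p * indicator {s<..<w} p * (?g q * indicator {s<..<p} q) \<partial>lborel) \<partial>lborel)"
 proof -
  have "(\<integral>\<^sup>+q. (\<integral>\<^sup>+p. ?g q * indicator {s<..<w} q * (k p * indicator {s<..<q} p) +
    k p * indicator {s<..<w} p * (?g q * indicator {s<..<p} q) \<partial>lborel) \<partial>lborel) =
   (\<integral>\<^sup>+q. (\<integral>\<^sup>+p. ?g q * indicator {s<..<w} q * (k p * indicator {s<..<q} p) \<partial>lborel) +
    (\<integral>\<^sup>+p. k p * indicator {s<..<w} p * (?g q * indicator {s<..<p} q) \<partial>lborel) \<partial>lborel)"
   unfolding indicator_interval by (intro nn_integral_cong nn_integral_add) measurable
  also have "... = (\<integral>\<^sup>+q. (\<integral>\<^sup>+p. ?g q * indicator {s<..<w} q * (k p * indicator {s<..<q} p) \<partial>lborel) \<partial>lborel) +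
    (\<integral>\<^sup>+q. (\<integral>\<^sup>+p. k p * indicator {s<..<w} p * (?g q * indicator {s<..<p} q) \<partial>lborel) \<partial>lborel)"
   unfolding indicator_interval by (intro nn_integral_add) measurable
  finally show ?thesis .
 qed
 also have "(\<integral>\<^sup>+q. (\<integral>\<^sup>+p. ?g q * indicator {s<..<w} q * (k p * indicator {s<..<q} p) \<partial>lborel) \<partial>lborel) =
   (\<integral>\<^sup>+q. ?g q * indicator {s<..<w} q * K q \<partial>lborel)"
  by (simp add: nn_integral_cmult K_def)
 also have "... = c * (\<integral>\<^sup>+u\<in>{s<..<w}. k u * K u ^ Suc n \<partial>lborel)"
  by (subst nn_integral_cmult[symmetric]) (auto simp: mult_ac)
 also have "(\<integral>\<^sup>+q. (\<integral>\<^sup>+p. k p * indicator {s<..<w} p * (?g q * indicator {s<..<p} q) \<partial>lborel) \<partial>lborel) =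
   (\<integral>\<^sup>+p. (\<integral>\<^sup>+q. k p * indicator {s<..<w} p * (?g q * indicator {s<..<p} q) \<partial>lborel) \<partial>lborel)"
  unfolding indicator_interval by (intro lborel_pair.Fubini') measurable
 also have "... = (\<integral>\<^sup>+u\<in>{s<..<w}. k u * K u ^ Suc n \<partial>lborel)"
  by (simp add: nn_integral_cmult g del: power_Suc) (simp add: mult_ac)
 finally show ?case
  by (simp add: K_def c_def algebra_simps)
qed

lemma ennreal_exp_series:
 assumes "a < \<top>"
 shows "ennreal (exp (enn2real a)) = (\<Sum>n. a ^ n / fact n)"
proof -
 obtain r where r: "0 <= r" "a = ennreal r"
  using assms by (cases a) auto
 have "(\<Sum>n. a ^ n / fact n) = (\<Sum>n. ennreal (r ^ n / fact n))"
 proof (intro suminf_cong)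
  fix n
  have "(fact n :: ennreal) = ennreal (fact n)"
   by (metis ennreal_of_nat_eq_real_of_nat of_nat_fact)
  then show "a ^ n / fact n = ennreal (r ^ n / fact n)"
   using r by (simp add: ennreal_power divide_ennreal)
 qed
 also have "... = ennreal (exp r)"
  using r summable_exp_generic[of r]
  by (subst suminf_ennreal2) (auto simp: exp_def divide_inverse mult_ac)
 finally show ?thesis using r by simp
qed

text \<open>The fundamental theorem of calculus for \<open>exp (\<integral> k)\<close> with merely integrable \<open>k\<close>: the power
 series reduces it to the powers of the primitive, and these to Tonelli's theorem.\<close>
lemma surv_backward_identity:
 fixes k :: "real => ennreal"
 assumes [measurable]: "k \<in> borel_measurable borel"
  and fin: "(\<integral>\<^sup>+u\<in>{s<..<w}. k u \<partial>lborel) < \<top>" and sw: "s <= w"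
 shows "surv k s w + (\<integral>\<^sup>+u\<in>{s<..<w}. k u * surv k u w \<partial>lborel) = 1"
proof -
 define K where "K u = (\<integral>\<^sup>+v\<in>{s<..<u}. k v \<partial>lborel)" for u
 have [measurable]: "K \<in> borel_measurable borel"
  unfolding K_def indicator_interval by measurable
 define E where "E a = ennreal (exp (enn2real a))" for a
 have Kw: "K w < \<top>" using fin by (simp add: K_def)
 have KK: "K u <= K w" if "u <= w" for u
  unfolding K_def using that by (intro nn_integral_mono) (auto simp: indicator_def)
 have surv_E: "surv k u w * E (K w) = E (K u)" if u: "s <= u" "u <= w" for u
 proof -
  have *: "K w = K u + (\<integral>\<^sup>+v\<in>{u<..<w}. k v \<partial>lborel)"
   unfolding K_def using u by (intro nn_integral_interval_split) auto
  obtain x y where xy: "0 <= x" "0 <= y" "K u = ennreal x" "(\<integral>\<^sup>+v\<in>{u<..<w}. k v \<partial>lborel) = ennreal y"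
   using Kw unfolding * by (cases "K u"; cases "(\<integral>\<^sup>+v\<in>{u<..<w}. k v \<partial>lborel)") auto
  show ?thesis
   unfolding surv_def * xy(3,4) E_def using xy(1,2)
   by (simp add: neg_exp_ennreal ennreal_mult[symmetric] exp_add[symmetric] flip: ennreal_plus)
 qed
 have pow: "(\<integral>\<^sup>+u\<in>{s<..<w}. k u * (K u ^ n / fact n) \<partial>lborel) = K w ^ Suc n / fact (Suc n)" for n
 proof -
  let ?I = "\<integral>\<^sup>+u\<in>{s<..<w}. k u * K u ^ n \<partial>lborel"
  have "of_nat (Suc n) * ?I = K w ^ Suc n"
   using nn_integral_power_primitive[of k n s w] by (simp add: K_def)
  moreover have "(\<integral>\<^sup>+u\<in>{s<..<w}. k u * (K u ^ n / fact n) \<partial>lborel) = ?I / fact n"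
   by (subst nn_integral_divide[symmetric]) (auto simp: divide_ennreal_def mult_ac)
  moreover have "(fact (Suc n) :: ennreal) = of_nat (Suc n) * fact n"
   by simp
  moreover have "of_nat (Suc n) * ?I / (of_nat (Suc n) * fact n) = ?I / fact n"
   unfolding mult.commute[of "of_nat (Suc n)"] by (rule divide_mult_eq) (auto simp del: of_nat_Suc)
  ultimately show ?thesis by metis
 qed
 have "(\<integral>\<^sup>+u\<in>{s<..<w}. k u * E (K u) \<partial>lborel) =
   (\<integral>\<^sup>+u. (\<Sum>n. k u * (K u ^ n / fact n) * indicator {s<..<w} u) \<partial>lborel)"
 proof (intro nn_integral_cong)
  fix u
  show "k u * E (K u) * indicator {s<..<w} u = (\<Sum>n. k u * (K u ^ n / fact n) * indicator {s<..<w} u)"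
  proof (cases "u \<in> {s<..<w}")
   case True
   then have "K u < \<top>" using KK[of u] Kw by (auto simp: le_less_trans)
   then show ?thesis using True
    by (simp add: E_def ennreal_exp_series)
  qed simp
 qed
 also have "... = (\<Sum>n. K w ^ Suc n / fact (Suc n))"
  unfolding pow[symmetric] by (rule nn_integral_suminf) measurable
 finally have int: "(\<integral>\<^sup>+u\<in>{s<..<w}. k u * E (K u) \<partial>lborel) = (\<Sum>n. K w ^ Suc n / fact (Suc n))" .
 have "(%n. K w ^ Suc n / fact (Suc n)) sums (\<integral>\<^sup>+u\<in>{s<..<w}. k u * E (K u) \<partial>lborel)"
  unfolding int by (rule summable_sums) simp
 from sums_Suc[OF this] have "(%n. K w ^ n / fact n) sums ((\<integral>\<^sup>+u\<in>{s<..<w}. k u * E (K u) \<partial>lborel) + 1)"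
  by (simp add: divide_ennreal_def)
 then have main: "(\<integral>\<^sup>+u\<in>{s<..<w}. k u * E (K u) \<partial>lborel) + 1 = E (K w)"
  unfolding E_def ennreal_exp_series[OF Kw] by (simp add: sums_iff)
 have "(surv k s w + (\<integral>\<^sup>+u\<in>{s<..<w}. k u * surv k u w \<partial>lborel)) * E (K w) =
   surv k s w * E (K w) + (\<integral>\<^sup>+u\<in>{s<..<w}. k u * surv k u w * E (K w) \<partial>lborel)"
  unfolding distrib_right by (subst nn_integral_multc[symmetric]) (auto simp: mult_ac)
 also have "(\<integral>\<^sup>+u\<in>{s<..<w}. k u * surv k u w * E (K w) \<partial>lborel) = (\<integral>\<^sup>+u\<in>{s<..<w}. k u * E (K u) \<partial>lborel)"
  by (intro nn_integral_cong) (auto simp: indicator_def mult.assoc surv_E)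
 also have "surv k s w * E (K w) = 1"
  using surv_E[of s] sw by (simp add: K_def E_def)
 finally have eq: "(surv k s w + (\<integral>\<^sup>+u\<in>{s<..<w}. k u * surv k u w \<partial>lborel)) * E (K w) = 1 * E (K w)"
  using main by (simp add: add.commute)
 have "E (K w) ~= 0" "E (K w) ~= \<top>" by (auto simp: E_def)
 then show ?thesis
  using eq by (metis (no_types, lifting) mult.commute ennreal_mult_cancel_left)
qed

lemma nn_integral_reflect:
 fixes k :: "real => ennreal"
 assumes [measurable]: "k \<in> borel_measurable borel"
 shows "(\<integral>\<^sup>+u\<in>{a<..<b}. k (r - u) \<partial>lborel) = (\<integral>\<^sup>+u\<in>{r - b<..<r - a}. k u \<partial>lborel)"
proof -
 have "(\<integral>\<^sup>+u\<in>{r - b<..<r - a}. k u \<partial>lborel) =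
   (\<integral>\<^sup>+u. k (r + (-1) * u) * indicator {r - b<..<r - a} (r + (-1) * u) \<partial>lborel)"
  by (subst nn_integral_real_affine[where c="-1" and t=r]) auto
 also have "... = (\<integral>\<^sup>+u\<in>{a<..<b}. k (r - u) \<partial>lborel)"
  by (intro nn_integral_cong) (auto simp: indicator_def)
 finally show ?thesis by simp
qed

lemma surv_forward_identity:
 fixes k :: "real => ennreal"
 assumes [measurable]: "k \<in> borel_measurable borel"
  and fin: "(\<integral>\<^sup>+u\<in>{s<..<w}. k u \<partial>lborel) < \<top>" and sw: "s <= w"
 shows "surv k s w + (\<integral>\<^sup>+u\<in>{s<..<w}. k u * surv k s u \<partial>lborel) = 1"
proof -
 define k' where "k' u = k (s + w - u)" for u
 have [measurable]: "k' \<in> borel_measurable borel"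
  unfolding k'_def by measurable
 have int: "(\<integral>\<^sup>+u\<in>{a<..<b}. k' u \<partial>lborel) = (\<integral>\<^sup>+u\<in>{s + w - b<..<s + w - a}. k u \<partial>lborel)" for a b
  unfolding k'_def by (rule nn_integral_reflect) simp
 have sv: "surv k' a b = surv k (s + w - b) (s + w - a)" for a b
  by (simp add: surv_def int)
 have "(\<integral>\<^sup>+u\<in>{s<..<w}. k' u * surv k' u w \<partial>lborel) = (\<integral>\<^sup>+u\<in>{s<..<w}. k u * surv k s u \<partial>lborel)"
 proof -
  have "(\<integral>\<^sup>+u\<in>{s<..<w}. k' u * surv k' u w \<partial>lborel) =
    (\<integral>\<^sup>+u\<in>{s<..<w}. k (s + w - u) * surv k s (s + w - u) \<partial>lborel)"
   by (simp only: sv k'_def add_diff_cancel_right')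
  also have "... = (\<integral>\<^sup>+u\<in>{s + w - w<..<s + w - s}. k u * surv k s u \<partial>lborel)"
   by (rule nn_integral_reflect) measurable
  finally show ?thesis by simp
 qed
 with surv_backward_identity[of k' s w] show ?thesis
  using fin sw by (simp add: int sv)
qed

text \<open>Without integrability there is only an inequality: a rate that is infinite on a set of positive
  measure kills instantly and does not show up in the integral. It suffices for bounding the total
  mass.\<close>
lemma surv_forward_le:
 fixes k :: "real => ennreal"
 assumes [measurable]: "k \<in> borel_measurable borel" and sw: "s <= w"
 shows "surv k s w + (\<integral>\<^sup>+u\<in>{s<..<w}. k u * surv k s u \<partial>lborel) <= 1"
proof (cases "(\<integral>\<^sup>+u\<in>{s<..<w}. k u \<partial>lborel) < \<top>")
 case True
 then show ?thesis using surv_forward_identity assms by simp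
next
 case False
 then have "surv k s w = 0"
  by (simp add: surv_def not_less top_unique)
 moreover have "(\<integral>\<^sup>+u\<in>{s<..<w}. k u * surv k s u \<partial>lborel) <= 1"
 proof -
  define ki where "ki i u = min (k u) (of_nat i)" for i :: nat and u
  have [measurable]: "ki i \<in> borel_measurable borel" for i
   unfolding ki_def by measurable
  have sup: "k u = (SUP i. ki i u)" for u
  proof -
   have "(SUP i. ki i u) = min (k u) (SUP i. of_nat i)"
    unfolding ki_def by (simp add: inf_min[symmetric] inf_SUP)
   then show ?thesis by (simp add: ennreal_SUP_of_nat_eq_top)
  qed
  have sup_mult: "(SUP i. ki i u * c) = k u * c" for u c
   by (subst sup) (rule SUP_mult_right_ennreal[symmetric])
  have mono: "ki i u <= ki j u" if "i <= j" for i j u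
   unfolding ki_def using that by (intro min.mono) auto
  have "(\<integral>\<^sup>+u\<in>{s<..<w}. k u * surv k s u \<partial>lborel) =
    (\<integral>\<^sup>+u. (SUP i. ki i u * (surv k s u * indicator {s<..<w} u)) \<partial>lborel)"
   by (simp only: sup_mult mult.assoc)
  also have "... = (SUP i. (\<integral>\<^sup>+u. ki i u * (surv k s u * indicator {s<..<w} u) \<partial>lborel))"
   by (intro nn_integral_monotone_convergence_SUP) (auto simp: incseq_def le_fun_def intro!: mult_right_mono mono)
  also have "... <= 1"
  proof (intro SUP_least)
   fix i
   have "(\<integral>\<^sup>+u\<in>{s<..<w}. ki i u \<partial>lborel) <= (\<integral>\<^sup>+u\<in>{s<..<w}. of_nat i \<partial>lborel)"
    by (intro nn_integral_mono) (auto simp: ki_def indicator_def)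
   also have "... < \<top>"
    using sw by (simp add: nn_integral_cmult ennreal_mult_less_top of_nat_less_top)
   finally have fin: "(\<integral>\<^sup>+u\<in>{s<..<w}. ki i u \<partial>lborel) < \<top>" .
   have "surv k s u <= surv (ki i) s u" for u
    unfolding surv_def by (intro neg_exp_antimono nn_integral_mono) (auto simp: indicator_def ki_def)
   then have "(\<integral>\<^sup>+u. ki i u * (surv k s u * indicator {s<..<w} u) \<partial>lborel) <=
     (\<integral>\<^sup>+u\<in>{s<..<w}. ki i u * surv (ki i) s u \<partial>lborel)"
    by (intro nn_integral_mono) (auto simp: indicator_def intro!: mult_left_mono)
   also have "... <= 1"
    using surv_forward_identity[OF _ fin sw] by (metis add.commute le_iff_add \<open>ki i \<in> _\<close>)
   finally show "(\<integral>\<^sup>+u. ki i u * (surv k s u * indicator {s<..<w} u) \<partial>lborel) <= 1" .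
  qed
  finally show ?thesis .
 qed
 ultimately show ?thesis by simp
qed

text \<open>Monotonicity of the domains is replaced by Fatou's lemma: the dominating function may have infinite
 integral.\<close>
lemma nn_integral_tendsto_below:
 fixes f :: "nat => 'a => ennreal"
 assumes [measurable]: "\<And>i. f i \<in> borel_measurable M" "g \<in> borel_measurable M"
  and le: "eventually (%i. AE x in M. f i x <= g x) sequentially"
  and lim: "AE x in M. (%i. f i x) \<longlonglongrightarrow> g x"
 shows "(%i. \<integral>\<^sup>+x. f i x \<partial>M) \<longlonglongrightarrow> (\<integral>\<^sup>+x. g x \<partial>M)"
proof -
 have "(\<integral>\<^sup>+x. g x \<partial>M) = (\<integral>\<^sup>+x. liminf (%i. f i x) \<partial>M)"
  using lim by (intro nn_integral_cong_AE) (auto elim!: eventually_mono simp: lim_imp_Liminf)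
 also have "... <= liminf (%i. \<integral>\<^sup>+x. f i x \<partial>M)"
  by (rule nn_integral_liminf) simp
 finally have "(\<integral>\<^sup>+x. g x \<partial>M) <= liminf (%i. \<integral>\<^sup>+x. f i x \<partial>M)" .
 moreover have "limsup (%i. \<integral>\<^sup>+x. f i x \<partial>M) <= (\<integral>\<^sup>+x. g x \<partial>M)"
  using le by (intro Limsup_bounded) (auto elim!: eventually_mono intro!: nn_integral_mono_AE)
 moreover have "liminf (%i. \<integral>\<^sup>+x. f i x \<partial>M) <= limsup (%i. \<integral>\<^sup>+x. f i x \<partial>M)"
  by (rule Liminf_le_Limsup) simp
 ultimately show ?thesis
  by (intro limsup_le_liminf_real Liminf_eq_Limsup) auto
qed

lemma tendsto_surv:
 assumes [measurable]: "k \<in> borel_measurable borel" and "s < t"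
  and s: "\<And>i. s <= a i" "a \<longlonglongrightarrow> s" and t: "\<And>i. b i <= t" "b \<longlonglongrightarrow> t"
 shows "(%i. surv k (a i) (b i)) \<longlonglongrightarrow> surv k s t"
 unfolding surv_def
proof (intro tendsto_neg_exp nn_integral_tendsto_below AE_I2)
 show "eventually (%i. AE u in lborel. k u * indicator {a i<..<b i} u <= k u * indicator {s<..<t} u) sequentially"
 proof (intro always_eventually allI AE_I2)
  fix i u
  show "k u * indicator {a i<..<b i} u <= k u * indicator {s<..<t} u"
   using s(1)[of i] t(1)[of i] by (auto simp: indicator_def)
 qed
 fix u
 show "(%i. k u * indicator {a i<..<b i} u) \<longlonglongrightarrow> k u * indicator {s<..<t} u"
 proof (cases "s < u \<and> u < t")
  case True
  have "eventually (%i. a i < u) sequentially" "eventually (%i. u < b i) sequentially"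
   using True s(2) t(2) by (auto simp: order_tendsto_iff)
  then have "eventually (%i. k u * indicator {s<..<t} u = k u * indicator {a i<..<b i} u) sequentially"
   by eventually_elim (use True in \<open>auto simp: indicator_def\<close>)
  then show ?thesis by (rule Lim_transform_eventually[OF tendsto_const])
 next
  case False
  then have "indicator {a i<..<b i} u = (0::ennreal)" for i
   using s(1)[of i] t(1)[of i] by (auto simp: indicator_def)
  moreover have "indicator {s<..<t} u = (0::ennreal)" using False by (auto simp: indicator_def)
  ultimately show ?thesis by (simp only: mult_zero_right tendsto_const)
 qed
qed auto

lemmas tendsto_surv_left = tendsto_surv[where b="%_. t" and t=t for t, OF _ _ _ _ order_refl tendsto_const]

section \<open>The Feller iteration\<close>

text \<open>The weight of all paths from \<open>x\<close> at time \<open>s\<close> to \<open>y\<close> at time \<open>t\<close> with fewer than \<open>n\<close> jumps,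
 for jump rates \<open>l x z\<close> and killing rates \<open>k x\<close>. With values in \<open>ennreal\<close> no integrability of
 the rates is needed.\<close>
primrec feller :: "nat set => (nat => real => ennreal) => (nat => nat => real => ennreal) =>
  nat => nat => nat => real => real => ennreal" where
 "feller S k l 0 x y s t = 0"
| "feller S k l (Suc n) x y s t = of_bool (x = y) * surv (k x) s t +
   (\<integral>\<^sup>+w\<in>{s<..<t}. surv (k x) s w * (\<Sum>z\<in>S - {x}. l x z w * feller S k l n z y w t) \<partial>lborel)"

lemma measurable_feller_triple:
 assumes k: "\<And>x. (%(u, p). k x u p) \<in> borel_measurable (borel \<Otimes>\<^sub>M M)"
  and l: "\<And>x z. (%(u, p). l x z u p) \<in> borel_measurable (borel \<Otimes>\<^sub>M M)"
 shows "(%(s, t, p). feller S (%x u. k x u p) (%x z u. l x z u p) n x y s t)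
      \<in> borel_measurable (borel \<Otimes>\<^sub>M borel \<Otimes>\<^sub>M M)"
proof (induction n arbitrary: x)
 case 0
 show ?case by simp
next
 case (Suc n)
 note [measurable] = l
 let ?N = "(borel :: real measure) \<Otimes>\<^sub>M (borel :: real measure) \<Otimes>\<^sub>M M"
 have [measurable]: "(%q. surv (%u. k x u (snd (snd q))) (fst q) (fst (snd q))) \<in> borel_measurable ?N" for x
  by (intro measurable_surv_param[OF k]) measurable
 have [measurable]: "(%(q, w). surv (%u. k x u (snd (snd q))) (fst q) w) \<in> borel_measurable (?N \<Otimes>\<^sub>M lborel)" for x
  unfolding split_beta by (intro measurable_surv_param[OF k]) measurable
 have "(%q. (%(s, t, p). feller S (%x u. k x u p) (%x z u. l x z u p) n z y s t)
   (snd q, fst (snd (fst q)), snd (snd (fst q)))) \<in> borel_measurable (?N \<Otimes>\<^sub>M lborel)" for z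
  by (rule measurable_compose[OF _ Suc.IH]) measurable
 then have [measurable]: "(%(q, w). feller S (%x u. k x u (snd (snd q))) (%x z u. l x z u (snd (snd q))) n z y
   w (fst (snd q))) \<in> borel_measurable (?N \<Otimes>\<^sub>M lborel)" for z
  by (simp add: split_beta)
 show ?case
  unfolding feller.simps split_beta indicator_interval by measurable
qed

lemma measurable_feller_param:
 assumes k: "\<And>x. (%(u, p). k x u p) \<in> borel_measurable (borel \<Otimes>\<^sub>M M)"
  and l: "\<And>x z. (%(u, p). l x z u p) \<in> borel_measurable (borel \<Otimes>\<^sub>M M)"
  and [measurable]: "s \<in> borel_measurable N" "t \<in> borel_measurable N" "f \<in> measurable N M"
 shows "(%q. feller S (%x u. k x u (f q)) (%x z u. l x z u (f q)) n x y (s q) (t q)) \<in> borel_measurable N"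
proof -
 have "(%q. (%(s, t, p). feller S (%x u. k x u p) (%x z u. l x z u p) n x y s t) (s q, t q, f q))
   \<in> borel_measurable N"
  by (rule measurable_compose[OF _ measurable_feller_triple[OF k l]]) measurable
 then show ?thesis by simp
qed

lemma feller_cong:
 assumes "\<And>x u. s < u ==> u < t ==> k x u = k' x u" "\<And>x z u. s < u ==> u < t ==> l x z u = l' x z u"
 shows "feller S k l n x y s t = feller S k' l' n x y s t"
 using assms
proof (induction n arbitrary: x s)
 case (Suc n)
 have *: "surv (k x) s w = surv (k' x) s w" if "w <= t" for w
  unfolding surv_def using Suc.prems(1) that
  by (intro arg_cong[of _ _ neg_exp] nn_integral_cong) (auto simp: indicator_def)
 have "feller S k l n z y w t = feller S k' l' n z y w t" if "s < w" for w z
  using that Suc.prems by (intro Suc.IH) auto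
 then show ?case
  unfolding feller.simps using Suc.prems *
  by (intro arg_cong2[of _ _ _ _ "(+)"] nn_integral_cong) (auto simp: indicator_def)
qed simp

lemma feller_mono:
 assumes "\<And>x z u. l x z u <= l' x z u" "n <= n'"
 shows "feller S k l n x y s t <= feller S k l' n' x y s t"
 using assms(2)
proof (induction n arbitrary: x s n')
 case (Suc n)
 then obtain n'' where "n' = Suc n''" "n <= n''" by (cases n') auto
 then show ?case
  using Suc.IH assms(1)
  by (auto intro!: add_left_mono nn_integral_mono mult_right_mono mult_left_mono sum_mono mult_mono)
qed simp

context
 fixes S :: "nat set" and k :: "nat => real => ennreal" and l :: "nat => nat => real => ennreal"
 assumes fin_S: "finite S"
  and k_meas [measurable]: "\<And>x. k x \<in> borel_measurable borel"
  and l_meas [measurable]: "\<And>x z. l x z \<in> borel_measurable borel"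
begin

lemma measurable_feller [measurable]:
 assumes [measurable]: "s \<in> borel_measurable N" "t \<in> borel_measurable N"
 shows "(%q. feller S k l n x y (s q) (t q)) \<in> borel_measurable N"
 by (rule measurable_feller_param[where M="borel :: real measure" and f="%_. 0" and k="%x u _. k x u"
    and l="%x z u _. l x z u"]) measurable

text \<open>Either the path stays in \<open>x\<close> up to time \<open>u\<close>, or it leaves \<open>x\<close> before.\<close>
lemma feller_Suc_split:
 assumes "s <= u" "u <= t"
 shows "feller S k l (Suc n) x y s t = surv (k x) s u * feller S k l (Suc n) x y u t +
  (\<integral>\<^sup>+w\<in>{s<..<u}. surv (k x) s w * (\<Sum>z\<in>S - {x}. l x z w * feller S k l n z y w t) \<partial>lborel)"
proof -
 let ?g = "%w. (\<Sum>z\<in>S - {x}. l x z w * feller S k l n z y w t)"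
 have split: "surv (k x) s w = surv (k x) s u * surv (k x) u w" if "u < w" for w
  using assms that by (intro surv_mult) auto
 have "(\<integral>\<^sup>+w\<in>{s<..<t}. surv (k x) s w * ?g w \<partial>lborel) =
   (\<integral>\<^sup>+w\<in>{s<..<u}. surv (k x) s w * ?g w \<partial>lborel) + (\<integral>\<^sup>+w\<in>{u<..<t}. surv (k x) s w * ?g w \<partial>lborel)"
  using assms by (intro nn_integral_interval_split) measurable
 also have "(\<integral>\<^sup>+w\<in>{u<..<t}. surv (k x) s w * ?g w \<partial>lborel) =
   (\<integral>\<^sup>+w. surv (k x) s u * (surv (k x) u w * ?g w * indicator {u<..<t} w) \<partial>lborel)"
  by (intro nn_integral_cong) (simp add: indicator_interval split mult.assoc)
 also have "... = surv (k x) s u * (\<integral>\<^sup>+w\<in>{u<..<t}. surv (k x) u w * ?g w \<partial>lborel)"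
  by (rule nn_integral_cmult) measurable
 finally show ?thesis
  using surv_mult[of "k x" s u t] assms by (simp add: algebra_simps)
qed

text \<open>Each state is left at rate at most \<open>k x\<close>, so the mass that leaves is covered by the
  mass that does not survive; induction on the number of jumps.\<close>
lemma feller_sum_le_1:
 assumes sub: "\<And>x u. (\<Sum>z\<in>S - {x}. l x z u) <= k x u" and "s <= t"
 shows "(\<Sum>y\<in>S. feller S k l n x y s t) <= 1"
 using \<open>s <= t\<close>
proof (induction n arbitrary: x s)
 case (Suc n)
 have "(\<Sum>y\<in>S. feller S k l (Suc n) x y s t) = (\<Sum>y\<in>S. of_bool (x = y) * surv (k x) s t) +
   (\<integral>\<^sup>+w. (\<Sum>y\<in>S. surv (k x) s w * (\<Sum>z\<in>S - {x}. l x z w * feller S k l n z y w t) * indicator {s<..<t} w) \<partial>lborel)"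
  by (simp add: sum.distrib nn_integral_sum)
 also have "(\<Sum>y\<in>S. of_bool (x = y) * surv (k x) s t) <= surv (k x) s t"
  using fin_S by (cases "x \<in> S") (auto simp: sum.delta' of_bool_def if_distrib[of "%a. a * _"] cong: if_cong)
 also have "(\<integral>\<^sup>+w. (\<Sum>y\<in>S. surv (k x) s w * (\<Sum>z\<in>S - {x}. l x z w * feller S k l n z y w t) * indicator {s<..<t} w) \<partial>lborel)
   <= (\<integral>\<^sup>+w\<in>{s<..<t}. k x w * surv (k x) s w \<partial>lborel)"
 proof (intro nn_integral_mono)
  fix w
  show "(\<Sum>y\<in>S. surv (k x) s w * (\<Sum>z\<in>S - {x}. l x z w * feller S k l n z y w t) * indicator {s<..<t} w)
    <= k x w * surv (k x) s w * indicator {s<..<t} w"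
  proof (cases "w \<in> {s<..<t}")
   case True
   have "(\<Sum>y\<in>S. surv (k x) s w * (\<Sum>z\<in>S - {x}. l x z w * feller S k l n z y w t)) =
     surv (k x) s w * (\<Sum>z\<in>S - {x}. l x z w * (\<Sum>y\<in>S. feller S k l n z y w t))"
    unfolding sum_distrib_left by (rule sum.swap)
   also have "... <= surv (k x) s w * (\<Sum>z\<in>S - {x}. l x z w * 1)"
    using True Suc.IH by (intro mult_left_mono sum_mono) auto
   also have "... <= surv (k x) s w * k x w"
    using sub by (intro mult_left_mono) auto
   finally show ?thesis using True by (simp add: mult.commute)
  qed simp
 qed
 also have "surv (k x) s t + (\<integral>\<^sup>+w\<in>{s<..<t}. k x w * surv (k x) s w \<partial>lborel) <= 1"
  using Suc.prems by (intro surv_forward_le) auto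
 finally show ?case by (simp add: add_left_mono add_right_mono)
qed simp

lemma feller_le_1:
 assumes "\<And>x u. (\<Sum>z\<in>S - {x}. l x z u) <= k x u" "s <= t" "y \<in> S"
 shows "feller S k l n x y s t <= 1"
 using feller_sum_le_1[OF assms(1,2), of n x] member_le_sum[of y S "%y. feller S k l n x y s t"] fin_S assms(3)
 by (auto intro: order_trans)

text \<open>The equation of the last jump.\<close>
lemma feller_forward:
 assumes "x \<in> S" "y \<in> S"
 shows "feller S k l (Suc n) x y s t = of_bool (x = y) * surv (k x) s t +
  (\<Sum>z\<in>S - {y}. \<integral>\<^sup>+w\<in>{s<..<t}. feller S k l n x z s w * l z y w * surv (k y) w t \<partial>lborel)"
 using assms(1)
proof (induction n arbitrary: x s)
 case 0
 then show ?case by simp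
next
 case (Suc n)
 let ?f = "feller S k l"
 let ?A = "\<integral>\<^sup>+w\<in>{s<..<t}. surv (k x) s w * l x y w * surv (k y) w t \<partial>lborel"
 let ?h = "%z z' u w. surv (k x) s u * l x z u * ?f n z z' u w * l z' y w * surv (k y) w t *
   (indicator {s<..<t} u * indicator {u<..<t} w)"
 let ?I = "%z z'. \<integral>\<^sup>+u. \<integral>\<^sup>+w. ?h z z' u w \<partial>lborel \<partial>lborel"
 have "(\<integral>\<^sup>+u\<in>{s<..<t}. surv (k x) s u * (\<Sum>z\<in>S - {x}. l x z u * ?f (Suc n) z y u t) \<partial>lborel) =
   (\<integral>\<^sup>+u\<in>{s<..<t}. (\<Sum>z\<in>S - {x}. surv (k x) s u * l x z u * (of_bool (z = y) * surv (k z) u t)) +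
    (\<Sum>z\<in>S - {x}. \<Sum>z'\<in>S - {y}. surv (k x) s u * l x z u *
     (\<integral>\<^sup>+w\<in>{u<..<t}. ?f n z z' u w * l z' y w * surv (k y) w t \<partial>lborel)) \<partial>lborel)"
  by (intro nn_integral_cong arg_cong2[of _ _ _ _ "(*)"] refl)
    (simp add: Suc.IH sum_distrib_left sum.distrib[symmetric] distrib_left mult.assoc del: feller.simps)
 also have "... = (\<Sum>z\<in>S - {x}. \<integral>\<^sup>+u\<in>{s<..<t}. surv (k x) s u * l x z u * (of_bool (z = y) * surv (k z) u t) \<partial>lborel) +
   (\<Sum>z\<in>S - {x}. \<Sum>z'\<in>S - {y}. \<integral>\<^sup>+u\<in>{s<..<t}. surv (k x) s u * l x z u *
     (\<integral>\<^sup>+w\<in>{u<..<t}. ?f n z z' u w * l z' y w * surv (k y) w t \<partial>lborel) \<partial>lborel)"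
  unfolding distrib_right sum_distrib_right indicator_interval
  by (simp add: nn_integral_add nn_integral_sum)
 also have "(\<Sum>z\<in>S - {x}. \<integral>\<^sup>+u\<in>{s<..<t}. surv (k x) s u * l x z u * (of_bool (z = y) * surv (k z) u t) \<partial>lborel) =
   of_bool (x ~= y) * ?A"
 proof -
  have "(\<Sum>z\<in>S - {x}. \<integral>\<^sup>+u\<in>{s<..<t}. surv (k x) s u * l x z u * (of_bool (z = y) * surv (k z) u t) \<partial>lborel) =
    (\<Sum>z\<in>S - {x}. if z = y then ?A else 0)"
   by (intro sum.cong) auto
  then show ?thesis using fin_S assms(2) by (auto simp: sum.delta)
 qed
 also have "(\<Sum>z\<in>S - {x}. \<Sum>z'\<in>S - {y}. \<integral>\<^sup>+u\<in>{s<..<t}. surv (k x) s u * l x z u *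
     (\<integral>\<^sup>+w\<in>{u<..<t}. ?f n z z' u w * l z' y w * surv (k y) w t \<partial>lborel) \<partial>lborel) =
   (\<Sum>z\<in>S - {x}. \<Sum>z'\<in>S - {y}. ?I z z')"
  unfolding indicator_interval
  by (intro sum.cong refl nn_integral_cong) (simp add: nn_integral_cmult[symmetric] nn_integral_multc[symmetric] mult_ac)
 finally have lhs: "?f (Suc (Suc n)) x y s t = of_bool (x = y) * surv (k x) s t +
   (of_bool (x ~= y) * ?A + (\<Sum>z\<in>S - {x}. \<Sum>z'\<in>S - {y}. ?I z z'))"
  by (simp only: feller.simps(2)[of S k l "Suc n"])
 have I: "?I z z' = (\<integral>\<^sup>+w\<in>{s<..<t}. (\<integral>\<^sup>+u\<in>{s<..<w}. surv (k x) s u * l x z u * ?f n z z' u w \<partial>lborel) *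
   l z' y w * surv (k y) w t \<partial>lborel)" for z z'
 proof -
  have "?I z z' = (\<integral>\<^sup>+w. \<integral>\<^sup>+u. ?h z z' u w \<partial>lborel \<partial>lborel)"
   unfolding indicator_interval by (intro lborel_pair.Fubini'[symmetric]) measurable
  also have "... = (\<integral>\<^sup>+w. \<integral>\<^sup>+u. surv (k x) s u * l x z u * ?f n z z' u w * indicator {s<..<w} u *
     (l z' y w * surv (k y) w t * indicator {s<..<t} w) \<partial>lborel \<partial>lborel)"
   by (intro nn_integral_cong) (auto simp: indicator_def mult.assoc)
  also have "... = (\<integral>\<^sup>+w\<in>{s<..<t}. (\<integral>\<^sup>+u\<in>{s<..<w}. surv (k x) s u * l x z u * ?f n z z' u w \<partial>lborel) *
   l z' y w * surv (k y) w t \<partial>lborel)"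
   by (subst nn_integral_multc) (auto simp: mult.assoc)
  finally show ?thesis .
 qed
 have "(\<Sum>z'\<in>S - {y}. \<integral>\<^sup>+w\<in>{s<..<t}. ?f (Suc n) x z' s w * l z' y w * surv (k y) w t \<partial>lborel) =
  (\<Sum>z'\<in>S - {y}. (if z' = x then ?A else 0) + (\<Sum>z\<in>S - {x}. ?I z z'))"
 proof (intro sum.cong refl)
  fix z' assume z': "z' \<in> S - {y}"
  have "(\<integral>\<^sup>+w\<in>{s<..<t}. ?f (Suc n) x z' s w * l z' y w * surv (k y) w t \<partial>lborel) =
   (\<integral>\<^sup>+w\<in>{s<..<t}. (of_bool (x = z') * surv (k x) s w * l z' y w * surv (k y) w t) +
    (\<Sum>z\<in>S - {x}. (\<integral>\<^sup>+u\<in>{s<..<w}. surv (k x) s u * l x z u * ?f n z z' u w \<partial>lborel) *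
   l z' y w * surv (k y) w t) \<partial>lborel)"
   by (intro nn_integral_cong)
     (simp add: distrib_right sum_distrib_left sum_distrib_right nn_integral_sum mult.assoc)
  also have "... = (\<integral>\<^sup>+w\<in>{s<..<t}. (of_bool (x = z') * surv (k x) s w * l z' y w * surv (k y) w t) \<partial>lborel) +
    (\<Sum>z\<in>S - {x}. ?I z z')"
   unfolding I unfolding distrib_right sum_distrib_right indicator_interval
   by (simp add: nn_integral_add nn_integral_sum)
  also have "(\<integral>\<^sup>+w\<in>{s<..<t}. (of_bool (x = z') * surv (k x) s w * l z' y w * surv (k y) w t) \<partial>lborel) =
    (if z' = x then ?A else 0)" by auto
  finally show "(\<integral>\<^sup>+w\<in>{s<..<t}. ?f (Suc n) x z' s w * l z' y w * surv (k y) w t \<partial>lborel) =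
   (if z' = x then ?A else 0) + (\<Sum>z\<in>S - {x}. ?I z z')" .
 qed
 also have "... = of_bool (x ~= y) * ?A + (\<Sum>z'\<in>S - {y}. \<Sum>z\<in>S - {x}. ?I z z')"
  using fin_S Suc.prems by (auto simp: sum.distrib sum.delta)
 also have "(\<Sum>z'\<in>S - {y}. \<Sum>z\<in>S - {x}. ?I z z') = (\<Sum>z\<in>S - {x}. \<Sum>z'\<in>S - {y}. ?I z z')"
  by (rule sum.swap)
 finally show ?case unfolding lhs by simp
qed

text \<open>Bounded jump rates dominate the integrand of the first jump, while the killing rates may explode
  to the right of \<open>s\<close>: the survival probabilities converge even then.\<close>
lemma feller_tendsto_right:
 assumes sub: "\<And>x u. (\<Sum>z\<in>S - {x}. l x z u) <= k x u"
  and bd: "\<And>x z u. l x z u <= ennreal L" and "0 <= L"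
  and s: "s < t" "\<And>i. s <= r i" "\<And>i. r i <= t" "r \<longlonglongrightarrow> s" and y: "y \<in> S"
 shows "(%i. feller S k l n x y (r i) t) \<longlonglongrightarrow> feller S k l n x y s t"
proof (cases n)
 case (Suc m)
 have surv_lim: "(%i. surv (k x) (r i) w) \<longlonglongrightarrow> surv (k x) s w" if "s < w" for w
  by (rule tendsto_surv_left) (use s that in auto)
 let ?g = "%q w. surv (k x) q w * (\<Sum>z\<in>S - {x}. l x z w * feller S k l m z y w t) * indicator {q<..<t} w"
 have g_bd: "?g q w <= ennreal (card S * L) * indicator {s<..<t} w" if "s <= q" for q w
 proof (cases "q < w \<and> w < t")
  case True
  have "surv (k x) q w * (\<Sum>z\<in>S - {x}. l x z w * feller S k l m z y w t) <= 1 * (\<Sum>z\<in>S - {x}. ennreal L * 1)"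
   using True by (intro mult_mono sum_mono bd feller_le_1 sub y) auto
  also have "... <= (\<Sum>z\<in>S. ennreal L)"
   unfolding mult_1_right mult_1_left using fin_S by (intro sum_mono2) auto
  also have "... = ennreal (card S * L)"
   using \<open>0 <= L\<close> by (simp add: ennreal_mult ennreal_of_nat_eq_real_of_nat)
  finally show ?thesis using True that by (simp add: indicator_interval)
 qed (auto simp: indicator_def)
 have "(%i. \<integral>\<^sup>+w. ?g (r i) w \<partial>lborel) \<longlonglongrightarrow> (\<integral>\<^sup>+w. ?g s w \<partial>lborel)"
 proof (rule nn_integral_dominated_convergence[where w="%w. ennreal (card S * L) * indicator {s<..<t} w"])
  show "(\<integral>\<^sup>+w\<in>{s<..<t}. ennreal (card S * L) \<partial>lborel) < \<infinity>"
   using s(1) by (simp add: nn_integral_cmult ennreal_mult_less_top)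
  show "AE w in lborel. (%i. ?g (r i) w) \<longlonglongrightarrow> ?g s w"
  proof (intro AE_I2)
   fix w
   show "(%i. ?g (r i) w) \<longlonglongrightarrow> ?g s w"
   proof (cases "s < w")
    case True
    let ?c = "(\<Sum>z\<in>S - {x}. l x z w * feller S k l m z y w t) * indicator {s<..<t} w"
    have "?c ~= \<top>"
    proof (cases "w < t")
     case True
     have "(\<Sum>z\<in>S - {x}. l x z w * feller S k l m z y w t) <= (\<Sum>z\<in>S - {x}. ennreal L * 1)"
      using True by (intro mult_mono sum_mono bd feller_le_1 sub y) auto
     also have "... < \<top>" by (simp add: ennreal_mult_less_top of_nat_less_top)
     finally show ?thesis by (auto simp: indicator_def)
    qed (auto simp: indicator_def)
    moreover have "surv (k x) s w ~= \<top>"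
     using surv_le_1[of "k x" s w] by (metis ennreal_one_neq_top top_unique)
    ultimately have lim: "(%i. surv (k x) (r i) w * ?c) \<longlonglongrightarrow> surv (k x) s w * ?c"
     by (intro tendsto_mult_ennreal[OF surv_lim[OF \<open>s < w\<close>] tendsto_const]) auto
    have "eventually (%i. r i < w) sequentially"
     using True s(4) by (simp add: order_tendsto_iff)
    then have "eventually (%i. surv (k x) (r i) w * ?c = ?g (r i) w) sequentially"
     by eventually_elim (use True in \<open>auto simp: indicator_def mult.assoc\<close>)
    from Lim_transform_eventually[OF lim this]
    show ?thesis by (simp add: mult.assoc)
   next
    case False
    then have "?g (r i) w = 0" for i using s(2)[of i] by (auto simp: indicator_def)
    moreover have "?g s w = 0" using False by (auto simp: indicator_def)
    ultimately show ?thesis by (simp only: tendsto_const)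
   qed
  qed
 qed (use s in \<open>auto intro!: AE_I2 g_bd\<close>)
 moreover have "(%i. of_bool (x = y) * surv (k x) (r i) t) \<longlonglongrightarrow> of_bool (x = y) * surv (k x) s t"
  using surv_lim[OF s(1)] by (cases "x = y") auto
 ultimately show ?thesis
  unfolding Suc feller.simps by (intro tendsto_add) auto
qed simp

end

lemma SUP_mult_incseq_ennreal:
 fixes f g :: "nat => ennreal"
 assumes "incseq f" "incseq g"
 shows "(SUP i. f i * g i) = (SUP i. f i) * (SUP i. g i)"
proof (rule antisym)
 show "(SUP i. f i * g i) <= (SUP i. f i) * (SUP i. g i)"
  by (intro SUP_least mult_mono SUP_upper) auto
 have "(SUP i. f i) * (SUP i. g i) = (SUP i. SUP j. f i * g j)"
  by (subst SUP_mult_right_ennreal, subst SUP_mult_left_ennreal) (rule refl)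
 also have "... <= (SUP i. f i * g i)"
 proof (intro SUP_least)
  fix i j
  have "f i * g j <= f (max i j) * g (max i j)"
   using assms by (intro mult_mono) (auto simp: incseq_def)
  then show "f i * g j <= (SUP i. f i * g i)" by (rule SUP_upper2[rotated]) simp
 qed
 finally show "(SUP i. f i) * (SUP i. g i) <= (SUP i. f i * g i)" .
qed

text \<open>All operations in the iteration are monotone and compatible with increasing suprema, so
  truncated rates may be exhausted after the fact.\<close>
lemma feller_SUP_rates:
 fixes li :: "nat => nat => nat => real => ennreal"
 assumes fin_S: "finite S" and [measurable]: "\<And>x. k x \<in> borel_measurable borel"
  "\<And>i x z. li i x z \<in> borel_measurable borel"
  and inc: "\<And>x z u. incseq (%i. li i x z u)"
 shows "(SUP i. feller S k (li i) n x y s t) = feller S k (%x z u. SUP i. li i x z u) n x y s t"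
proof (induction n arbitrary: x s)
 case (Suc n)
 let ?f = "%i. feller S k (li i)"
 have inc_f: "incseq (%i. ?f i n z y w t)" for z w
  using inc by (auto simp: incseq_def intro!: feller_mono)
 note [measurable] = measurable_feller[OF fin_S]
 have inc_g: "incseq (%i. surv (k x) s w * (\<Sum>z\<in>S - {x}. li i x z w * ?f i n z y w t) * indicator {s<..<t} w)" for w
  using inc inc_f by (auto simp: incseq_def intro!: mult_right_mono mult_left_mono sum_mono mult_mono)
 have "(SUP i. ?f i (Suc n) x y s t) = of_bool (x = y) * surv (k x) s t +
   (SUP i. \<integral>\<^sup>+w\<in>{s<..<t}. surv (k x) s w * (\<Sum>z\<in>S - {x}. li i x z w * ?f i n z y w t) \<partial>lborel)"
  by (simp add: ennreal_SUP_add_right)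
 also have "(SUP i. \<integral>\<^sup>+w\<in>{s<..<t}. surv (k x) s w * (\<Sum>z\<in>S - {x}. li i x z w * ?f i n z y w t) \<partial>lborel) =
   (\<integral>\<^sup>+w. (SUP i. surv (k x) s w * (\<Sum>z\<in>S - {x}. li i x z w * ?f i n z y w t) * indicator {s<..<t} w) \<partial>lborel)"
  using inc_g by (intro nn_integral_monotone_convergence_SUP[symmetric]) (auto simp: incseq_def le_fun_def)
 also have "(%w. (SUP i. surv (k x) s w * (\<Sum>z\<in>S - {x}. li i x z w * ?f i n z y w t) * indicator {s<..<t} w)) =
   (%w. surv (k x) s w * (\<Sum>z\<in>S - {x}. (SUP i. li i x z w) * (SUP i. ?f i n z y w t)) * indicator {s<..<t} w)"
 proof
  fix w
  have "(\<Sum>z\<in>S - {x}. (SUP i. li i x z w) * (SUP i. ?f i n z y w t)) =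
   (SUP i. \<Sum>z\<in>S - {x}. li i x z w * ?f i n z y w t)"
   using inc inc_f fin_S
   by (subst ennreal_SUP_sum) (auto simp: SUP_mult_incseq_ennreal incseq_def intro!: mult_mono)
  then show "(SUP i. surv (k x) s w * (\<Sum>z\<in>S - {x}. li i x z w * ?f i n z y w t) * indicator {s<..<t} w) =
   surv (k x) s w * (\<Sum>z\<in>S - {x}. (SUP i. li i x z w) * (SUP i. ?f i n z y w t)) * indicator {s<..<t} w"
   by (simp only: SUP_mult_left_ennreal SUP_mult_right_ennreal)
 qed
 finally show ?case by (simp add: Suc.IH)
qed simp

section \<open>The minimal transition function and its Kolmogorov equations\<close>

text \<open>Feller's minimal solution: all paths with finitely many jumps.\<close>
definition min_trans :: "nat set => (nat => real => ennreal) => (nat => nat => real => ennreal) =>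
  nat => nat => real => real => ennreal" where
 "min_trans S k l x y s t = (SUP n. feller S k l n x y s t)"

lemma incseq_feller: "incseq (%n. feller S k l n x y s t)"
 by (auto simp: incseq_def intro!: feller_mono)

lemma min_trans_Suc: "min_trans S k l x y s t = (SUP n. feller S k l (Suc n) x y s t)"
 unfolding min_trans_def
proof (rule antisym)
 show "(SUP n. feller S k l n x y s t) <= (SUP n. feller S k l (Suc n) x y s t)"
 proof (rule SUP_mono)
  fix n show "\<exists>m\<in>UNIV. feller S k l n x y s t <= feller S k l (Suc m) x y s t"
   by (intro bexI[of _ n] feller_mono) auto
 qed
 show "(SUP n. feller S k l (Suc n) x y s t) <= (SUP n. feller S k l n x y s t)"
  by (intro SUP_least SUP_upper) auto
qed

lemma min_trans_cong:
 assumes "\<And>x u. s < u ==> u < t ==> k x u = k' x u" "\<And>x z u. s < u ==> u < t ==> l x z u = l' x z u"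
 shows "min_trans S k l x y s t = min_trans S k' l' x y s t"
 unfolding min_trans_def by (intro SUP_cong refl feller_cong assms)

lemma measurable_min_trans_param:
 assumes "\<And>x. (%(u, p). k x u p) \<in> borel_measurable (borel \<Otimes>\<^sub>M M)"
  and "\<And>x z. (%(u, p). l x z u p) \<in> borel_measurable (borel \<Otimes>\<^sub>M M)"
  and "s \<in> borel_measurable N" "t \<in> borel_measurable N" "f \<in> measurable N M"
 shows "(%q. min_trans S (%x u. k x u (f q)) (%x z u. l x z u (f q)) x y (s q) (t q)) \<in> borel_measurable N"
 unfolding min_trans_def
 by (intro borel_measurable_SUP measurable_feller_param[OF assms]) auto

context
 fixes S :: "nat set" and k :: "nat => real => ennreal" and l :: "nat => nat => real => ennreal"
 assumes fin_S: "finite S"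
  and k_meas [measurable]: "\<And>x. k x \<in> borel_measurable borel"
  and l_meas [measurable]: "\<And>x z. l x z \<in> borel_measurable borel"
begin

lemma measurable_min_trans [measurable]:
 assumes [measurable]: "s \<in> borel_measurable N" "t \<in> borel_measurable N"
 shows "(%q. min_trans S k l x y (s q) (t q)) \<in> borel_measurable N"
 unfolding min_trans_def using measurable_feller[OF fin_S k_meas l_meas assms] by measurable

lemma min_trans_sum_le_1:
 assumes "\<And>x u. (\<Sum>z\<in>S - {x}. l x z u) <= k x u" and "s <= t"
 shows "(\<Sum>y\<in>S. min_trans S k l x y s t) <= 1"
proof -
 have "(\<Sum>y\<in>S. min_trans S k l x y s t) = (SUP n. \<Sum>y\<in>S. feller S k l n x y s t)"
  unfolding min_trans_def by (rule ennreal_SUP_sum[symmetric]) (rule incseq_feller)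
 also have "... <= 1"
  by (intro SUP_least feller_sum_le_1[OF fin_S] assms) auto
 finally show ?thesis .
qed

lemma min_trans_split:
 assumes "s <= u" "u <= t"
 shows "min_trans S k l x y s t = surv (k x) s u * min_trans S k l x y u t +
  (\<integral>\<^sup>+w\<in>{s<..<u}. surv (k x) s w * (\<Sum>z\<in>S - {x}. l x z w * min_trans S k l z y w t) \<partial>lborel)"
proof -
 let ?f = "feller S k l"
 note [measurable] = measurable_feller[OF fin_S k_meas l_meas]
 let ?g = "%n w. surv (k x) s w * (\<Sum>z\<in>S - {x}. l x z w * ?f n z y w t) * indicator {s<..<u} w"
 have inc_g: "incseq (%n. ?g n w)" for w
  by (auto simp: incseq_def intro!: mult_right_mono mult_left_mono sum_mono feller_mono)
 then have inc_G: "incseq (%n. \<integral>\<^sup>+w. ?g n w \<partial>lborel)"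
  by (auto simp: incseq_def intro!: nn_integral_mono)
 have inc_f: "incseq (%n. surv (k x) s u * ?f (Suc n) x y u t)"
  unfolding incseq_def by (intro allI impI mult_left_mono feller_mono) auto
 have "min_trans S k l x y s t = (SUP n. surv (k x) s u * ?f (Suc n) x y u t + (\<integral>\<^sup>+w. ?g n w \<partial>lborel))"
  unfolding min_trans_Suc using assms by (intro SUP_cong refl feller_Suc_split fin_S) auto
 also have "... = (SUP n. surv (k x) s u * ?f (Suc n) x y u t) + (SUP n. \<integral>\<^sup>+w. ?g n w \<partial>lborel)"
  using inc_f inc_G by (rule ennreal_SUP_add)
 also have "(SUP n. surv (k x) s u * ?f (Suc n) x y u t) = surv (k x) s u * min_trans S k l x y u t"
  unfolding min_trans_Suc by (rule SUP_mult_left_ennreal[symmetric])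
 also have "(SUP n. \<integral>\<^sup>+w. ?g n w \<partial>lborel) = (\<integral>\<^sup>+w. (SUP n. ?g n w) \<partial>lborel)"
  using inc_g by (intro nn_integral_monotone_convergence_SUP[symmetric]) (auto simp: incseq_def le_fun_def)
 also have "(%w. SUP n. ?g n w) =
   (%w. surv (k x) s w * (\<Sum>z\<in>S - {x}. l x z w * min_trans S k l z y w t) * indicator {s<..<u} w)"
 proof
  fix w
  have "(\<Sum>z\<in>S - {x}. l x z w * min_trans S k l z y w t) = (SUP n. \<Sum>z\<in>S - {x}. l x z w * ?f n z y w t)"
   using incseq_feller[of S k l _ y w t]
   by (subst ennreal_SUP_sum) (auto simp: min_trans_def SUP_mult_left_ennreal incseq_def intro!: mult_left_mono)
  then show "(SUP n. ?g n w) =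
   surv (k x) s w * (\<Sum>z\<in>S - {x}. l x z w * min_trans S k l z y w t) * indicator {s<..<u} w"
   by (simp only: SUP_mult_left_ennreal SUP_mult_right_ennreal)
 qed
 finally show ?thesis .
qed

lemma min_trans_first_jump:
 assumes "s <= t"
 shows "min_trans S k l x y s t = of_bool (x = y) * surv (k x) s t +
  (\<integral>\<^sup>+w\<in>{s<..<t}. surv (k x) s w * (\<Sum>z\<in>S - {x}. l x z w * min_trans S k l z y w t) \<partial>lborel)"
 using min_trans_split[OF assms order_refl, of x y]
 by (simp add: min_trans_Suc[of S k l x y t t] mult.commute)

lemma min_trans_last_jump:
 assumes "x \<in> S" "y \<in> S"
 shows "min_trans S k l x y s t = of_bool (x = y) * surv (k x) s t +
  (\<Sum>z\<in>S - {y}. \<integral>\<^sup>+w\<in>{s<..<t}. min_trans S k l x z s w * l z y w * surv (k y) w t \<partial>lborel)"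
proof -
 let ?f = "feller S k l"
 note [measurable] = measurable_feller[OF fin_S k_meas l_meas]
 let ?g = "%z n w. ?f n x z s w * l z y w * surv (k y) w t * indicator {s<..<t} w"
 have inc_g: "incseq (%n. ?g z n w)" for z w
  by (auto simp: incseq_def intro!: mult_right_mono feller_mono)
 have "min_trans S k l x y s t = of_bool (x = y) * surv (k x) s t + (SUP n. \<Sum>z\<in>S - {y}. \<integral>\<^sup>+w. ?g z n w \<partial>lborel)"
  unfolding min_trans_Suc using assms
  by (subst feller_forward[OF fin_S k_meas l_meas]) (auto simp: ennreal_SUP_add_right simp del: feller.simps)
 also have "(SUP n. \<Sum>z\<in>S - {y}. \<integral>\<^sup>+w. ?g z n w \<partial>lborel) = (\<Sum>z\<in>S - {y}. SUP n. \<integral>\<^sup>+w. ?g z n w \<partial>lborel)"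
  using inc_g by (intro ennreal_SUP_sum) (auto simp: incseq_def intro!: nn_integral_mono)
 also have "... = (\<Sum>z\<in>S - {y}. \<integral>\<^sup>+w. (SUP n. ?g z n w) \<partial>lborel)"
  using inc_g by (intro sum.cong refl nn_integral_monotone_convergence_SUP[symmetric]) (auto simp: incseq_def le_fun_def)
 also have "... = (\<Sum>z\<in>S - {y}. \<integral>\<^sup>+w\<in>{s<..<t}. min_trans S k l x z s w * l z y w * surv (k y) w t \<partial>lborel)"
  by (simp only: min_trans_def SUP_mult_right_ennreal)
 finally show ?thesis .
qed

text \<open>Insert the equation of the first jump into \<open>\<integral> k Z\<close> and exchange the integrals: the inner integral
 is the complement of a survival probability.\<close>
lemma min_trans_backward:
 assumes "s <= t" and fin: "(\<integral>\<^sup>+u\<in>{s<..<t}. k x u \<partial>lborel) < \<top>"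
 shows "min_trans S k l x y s t + (\<integral>\<^sup>+u\<in>{s<..<t}. k x u * min_trans S k l x y u t \<partial>lborel) =
  of_bool (x = y) + (\<integral>\<^sup>+u\<in>{s<..<t}. (\<Sum>z\<in>S - {x}. l x z u * min_trans S k l z y u t) \<partial>lborel)"
proof -
 define g where "g w = (\<Sum>z\<in>S - {x}. l x z w * min_trans S k l z y w t)" for w
 have [measurable]: "g \<in> borel_measurable borel"
  unfolding g_def by measurable
 have Z: "min_trans S k l x y u t = of_bool (x = y) * surv (k x) u t +
   (\<integral>\<^sup>+w\<in>{u<..<t}. surv (k x) u w * g w \<partial>lborel)" if "u <= t" for u
  using min_trans_first_jump[OF that, of x y] by (simp add: g_def)
 have fin': "(\<integral>\<^sup>+u\<in>{s<..<w}. k x u \<partial>lborel) < \<top>" if "w <= t" for w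
 proof -
  have "(\<integral>\<^sup>+u\<in>{s<..<w}. k x u \<partial>lborel) <= (\<integral>\<^sup>+u\<in>{s<..<t}. k x u \<partial>lborel)"
   using that by (intro nn_integral_mono) (auto simp: indicator_def)
  then show ?thesis using fin by (rule le_less_trans)
 qed
 have one: "surv (k x) s w + (\<integral>\<^sup>+u\<in>{s<..<w}. k x u * surv (k x) u w \<partial>lborel) = 1" if "s <= w" "w <= t" for w
  using that fin' by (intro surv_backward_identity) auto
 have "(\<integral>\<^sup>+u\<in>{s<..<t}. k x u * min_trans S k l x y u t \<partial>lborel) =
   (\<integral>\<^sup>+u. of_bool (x = y) * (k x u * surv (k x) u t * indicator {s<..<t} u) +
    k x u * indicator {s<..<t} u * (\<integral>\<^sup>+w\<in>{u<..<t}. surv (k x) u w * g w \<partial>lborel) \<partial>lborel)"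
  by (intro nn_integral_cong) (auto simp: Z indicator_interval distrib_left mult_ac)
 also have "... = of_bool (x = y) * (\<integral>\<^sup>+u\<in>{s<..<t}. k x u * surv (k x) u t \<partial>lborel) +
   (\<integral>\<^sup>+u. k x u * indicator {s<..<t} u * (\<integral>\<^sup>+w\<in>{u<..<t}. surv (k x) u w * g w \<partial>lborel) \<partial>lborel)"
  unfolding indicator_interval by (simp add: nn_integral_add nn_integral_cmult)
 also have "(\<integral>\<^sup>+u. k x u * indicator {s<..<t} u * (\<integral>\<^sup>+w\<in>{u<..<t}. surv (k x) u w * g w \<partial>lborel) \<partial>lborel) =
   (\<integral>\<^sup>+u. \<integral>\<^sup>+w. k x u * indicator {s<..<t} u * (surv (k x) u w * g w * indicator {u<..<t} w) \<partial>lborel \<partial>lborel)"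
  unfolding indicator_interval by (intro nn_integral_cong nn_integral_cmult[symmetric]) measurable
 also have "... = (\<integral>\<^sup>+w. \<integral>\<^sup>+u. k x u * indicator {s<..<t} u * (surv (k x) u w * g w * indicator {u<..<t} w) \<partial>lborel \<partial>lborel)"
  unfolding indicator_interval by (intro lborel_pair.Fubini'[symmetric]) measurable
 also have "... = (\<integral>\<^sup>+w. \<integral>\<^sup>+u. g w * indicator {s<..<t} w * (k x u * surv (k x) u w * indicator {s<..<w} u) \<partial>lborel \<partial>lborel)"
  by (intro nn_integral_cong) (auto simp: indicator_def mult_ac)
 also have "... = (\<integral>\<^sup>+w. g w * indicator {s<..<t} w * (\<integral>\<^sup>+u\<in>{s<..<w}. k x u * surv (k x) u w \<partial>lborel) \<partial>lborel)"
  unfolding indicator_interval by (intro nn_integral_cong nn_integral_cmult) measurable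
 finally have kZ: "(\<integral>\<^sup>+u\<in>{s<..<t}. k x u * min_trans S k l x y u t \<partial>lborel) =
   of_bool (x = y) * (\<integral>\<^sup>+u\<in>{s<..<t}. k x u * surv (k x) u t \<partial>lborel) +
   (\<integral>\<^sup>+w. g w * indicator {s<..<t} w * (\<integral>\<^sup>+u\<in>{s<..<w}. k x u * surv (k x) u w \<partial>lborel) \<partial>lborel)" .
 have "min_trans S k l x y s t + (\<integral>\<^sup>+u\<in>{s<..<t}. k x u * min_trans S k l x y u t \<partial>lborel) =
  of_bool (x = y) * (surv (k x) s t + (\<integral>\<^sup>+u\<in>{s<..<t}. k x u * surv (k x) u t \<partial>lborel)) +
  ((\<integral>\<^sup>+w\<in>{s<..<t}. surv (k x) s w * g w \<partial>lborel) +
   (\<integral>\<^sup>+w. g w * indicator {s<..<t} w * (\<integral>\<^sup>+u\<in>{s<..<w}. k x u * surv (k x) u w \<partial>lborel) \<partial>lborel))"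
  unfolding kZ Z[OF assms(1)] distrib_left by (simp only: ac_simps)
 also have "(\<integral>\<^sup>+w\<in>{s<..<t}. surv (k x) s w * g w \<partial>lborel) +
   (\<integral>\<^sup>+w. g w * indicator {s<..<t} w * (\<integral>\<^sup>+u\<in>{s<..<w}. k x u * surv (k x) u w \<partial>lborel) \<partial>lborel) =
   (\<integral>\<^sup>+w. surv (k x) s w * g w * indicator {s<..<t} w +
   g w * indicator {s<..<t} w * (\<integral>\<^sup>+u\<in>{s<..<w}. k x u * surv (k x) u w \<partial>lborel) \<partial>lborel)"
  unfolding indicator_interval by (rule nn_integral_add[symmetric]) measurable
 also have "... = (\<integral>\<^sup>+w\<in>{s<..<t}. g w * (surv (k x) s w + (\<integral>\<^sup>+u\<in>{s<..<w}. k x u * surv (k x) u w \<partial>lborel)) \<partial>lborel)"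
  by (intro nn_integral_cong) (simp add: distrib_left mult_ac)
 also have "... = (\<integral>\<^sup>+w\<in>{s<..<t}. g w \<partial>lborel)"
 proof (rule nn_integral_cong)
  fix w
  show "g w * (surv (k x) s w + (\<integral>\<^sup>+u\<in>{s<..<w}. k x u * surv (k x) u w \<partial>lborel)) * indicator {s<..<t} w = g w * indicator {s<..<t} w"
   by (cases "w \<in> {s<..<t}") (auto simp: one)
 qed
 finally show ?thesis
  using one[of t] assms(1) by (simp add: g_def)
qed

text \<open>The argument of the backward equation with the last jump in place of the first one.
  Integrability is now needed for every state, since the path may be killed wherever it is at time
  \<open>t\<close>.\<close>
lemma min_trans_forward:
 assumes "s <= t" and xy: "x \<in> S" "y \<in> S" and fin: "\<And>x. x \<in> S ==> (\<integral>\<^sup>+u\<in>{s<..<t}. k x u \<partial>lborel) < \<top>"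
 shows "min_trans S k l x y s t + (\<integral>\<^sup>+u\<in>{s<..<t}. min_trans S k l x y s u * k y u \<partial>lborel) =
  of_bool (x = y) + (\<integral>\<^sup>+u\<in>{s<..<t}. (\<Sum>z\<in>S - {y}. min_trans S k l x z s u * l z y u) \<partial>lborel)"
proof -
 define g where "g w = (\<Sum>z\<in>S - {y}. min_trans S k l x z s w * l z y w)" for w
 have [measurable]: "g \<in> borel_measurable borel"
  unfolding g_def by measurable
 have Z: "min_trans S k l x y s u = of_bool (x = y) * surv (k y) s u +
   (\<integral>\<^sup>+w\<in>{s<..<u}. g w * surv (k y) w u \<partial>lborel)" for u
  unfolding min_trans_last_jump[OF xy, of s u] g_def
  by (simp add: nn_integral_sum[symmetric] sum_distrib_right[symmetric] of_bool_def)
 have fin': "(\<integral>\<^sup>+u\<in>{w<..<t}. k y u \<partial>lborel) < \<top>" if "s <= w" for w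
 proof -
  have "(\<integral>\<^sup>+u\<in>{w<..<t}. k y u \<partial>lborel) <= (\<integral>\<^sup>+u\<in>{s<..<t}. k y u \<partial>lborel)"
   using that by (intro nn_integral_mono) (auto simp: indicator_def)
  then show ?thesis using fin[OF xy(2)] by (rule le_less_trans)
 qed
 have one: "surv (k y) w t + (\<integral>\<^sup>+u\<in>{w<..<t}. k y u * surv (k y) w u \<partial>lborel) = 1" if "s <= w" "w <= t" for w
  using that fin' by (intro surv_forward_identity) auto
 have "(\<integral>\<^sup>+u\<in>{s<..<t}. min_trans S k l x y s u * k y u \<partial>lborel) =
   (\<integral>\<^sup>+u. of_bool (x = y) * (k y u * surv (k y) s u * indicator {s<..<t} u) +
    k y u * indicator {s<..<t} u * (\<integral>\<^sup>+w\<in>{s<..<u}. g w * surv (k y) w u \<partial>lborel) \<partial>lborel)"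
  by (intro nn_integral_cong) (auto simp: Z indicator_interval distrib_left mult_ac)
 also have "... = of_bool (x = y) * (\<integral>\<^sup>+u\<in>{s<..<t}. k y u * surv (k y) s u \<partial>lborel) +
   (\<integral>\<^sup>+u. k y u * indicator {s<..<t} u * (\<integral>\<^sup>+w\<in>{s<..<u}. g w * surv (k y) w u \<partial>lborel) \<partial>lborel)"
  unfolding indicator_interval by (simp add: nn_integral_add nn_integral_cmult)
 also have "(\<integral>\<^sup>+u. k y u * indicator {s<..<t} u * (\<integral>\<^sup>+w\<in>{s<..<u}. g w * surv (k y) w u \<partial>lborel) \<partial>lborel) =
   (\<integral>\<^sup>+u. \<integral>\<^sup>+w. k y u * indicator {s<..<t} u * (g w * surv (k y) w u * indicator {s<..<u} w) \<partial>lborel \<partial>lborel)"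
  unfolding indicator_interval by (intro nn_integral_cong nn_integral_cmult[symmetric]) measurable
 also have "... = (\<integral>\<^sup>+w. \<integral>\<^sup>+u. k y u * indicator {s<..<t} u * (g w * surv (k y) w u * indicator {s<..<u} w) \<partial>lborel \<partial>lborel)"
  unfolding indicator_interval by (intro lborel_pair.Fubini'[symmetric]) measurable
 also have "... = (\<integral>\<^sup>+w. \<integral>\<^sup>+u. g w * indicator {s<..<t} w * (k y u * surv (k y) w u * indicator {w<..<t} u) \<partial>lborel \<partial>lborel)"
  by (intro nn_integral_cong) (auto simp: indicator_def mult_ac)
 also have "... = (\<integral>\<^sup>+w. g w * indicator {s<..<t} w * (\<integral>\<^sup>+u\<in>{w<..<t}. k y u * surv (k y) w u \<partial>lborel) \<partial>lborel)"
  unfolding indicator_interval by (intro nn_integral_cong nn_integral_cmult) measurable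
 finally have kZ: "(\<integral>\<^sup>+u\<in>{s<..<t}. min_trans S k l x y s u * k y u \<partial>lborel) =
   of_bool (x = y) * (\<integral>\<^sup>+u\<in>{s<..<t}. k y u * surv (k y) s u \<partial>lborel) +
   (\<integral>\<^sup>+w. g w * indicator {s<..<t} w * (\<integral>\<^sup>+u\<in>{w<..<t}. k y u * surv (k y) w u \<partial>lborel) \<partial>lborel)" .
 have "min_trans S k l x y s t + (\<integral>\<^sup>+u\<in>{s<..<t}. min_trans S k l x y s u * k y u \<partial>lborel) =
  of_bool (x = y) * (surv (k y) s t + (\<integral>\<^sup>+u\<in>{s<..<t}. k y u * surv (k y) s u \<partial>lborel)) +
  ((\<integral>\<^sup>+w\<in>{s<..<t}. g w * surv (k y) w t \<partial>lborel) +
   (\<integral>\<^sup>+w. g w * indicator {s<..<t} w * (\<integral>\<^sup>+u\<in>{w<..<t}. k y u * surv (k y) w u \<partial>lborel) \<partial>lborel))"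
  unfolding kZ Z[of t] distrib_left by (simp only: ac_simps)
 also have "(\<integral>\<^sup>+w\<in>{s<..<t}. g w * surv (k y) w t \<partial>lborel) +
   (\<integral>\<^sup>+w. g w * indicator {s<..<t} w * (\<integral>\<^sup>+u\<in>{w<..<t}. k y u * surv (k y) w u \<partial>lborel) \<partial>lborel) =
   (\<integral>\<^sup>+w. g w * surv (k y) w t * indicator {s<..<t} w +
   g w * indicator {s<..<t} w * (\<integral>\<^sup>+u\<in>{w<..<t}. k y u * surv (k y) w u \<partial>lborel) \<partial>lborel)"
  unfolding indicator_interval by (rule nn_integral_add[symmetric]) measurable
 also have "... = (\<integral>\<^sup>+w\<in>{s<..<t}. g w * (surv (k y) w t + (\<integral>\<^sup>+u\<in>{w<..<t}. k y u * surv (k y) w u \<partial>lborel)) \<partial>lborel)"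
  by (intro nn_integral_cong) (simp add: distrib_left mult_ac)
 also have "... = (\<integral>\<^sup>+w\<in>{s<..<t}. g w \<partial>lborel)"
 proof (rule nn_integral_cong)
  fix w
  show "g w * (surv (k y) w t + (\<integral>\<^sup>+u\<in>{w<..<t}. k y u * surv (k y) w u \<partial>lborel)) * indicator {s<..<t} w = g w * indicator {s<..<t} w"
   by (cases "w \<in> {s<..<t}") (auto simp: one)
 qed
 finally show ?thesis
  using one[of s] assms(1) by (simp add: g_def)
qed

text \<open>If \<open>k x\<close> explodes immediately after \<open>c\<close>, all mass still in \<open>x\<close> at time \<open>c\<close> is lost.\<close>
lemma min_trans_explosion:
 assumes sub: "\<And>x u. (\<Sum>z\<in>S - {x}. l x z u) <= k x u"
  and "s <= c" "c < t" and pos: "surv (k x) s c > 0"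
  and expl: "\<And>w. c < w ==> surv (k x) c w = 0"
 shows "(\<Sum>y\<in>S. min_trans S k l x y s t) < 1"
proof -
 have Zc: "min_trans S k l x y c t = 0" for y
 proof -
  have "(\<integral>\<^sup>+w\<in>{c<..<t}. surv (k x) c w * (\<Sum>z\<in>S - {x}. l x z w * min_trans S k l z y w t) \<partial>lborel) =
    (\<integral>\<^sup>+w. 0 \<partial>(lborel :: real measure))"
   by (intro nn_integral_cong) (auto simp: indicator_def expl)
  then show ?thesis
   using assms by (subst min_trans_first_jump) (auto simp: expl)
 qed
 have "(\<Sum>y\<in>S. min_trans S k l x y s t) =
  (\<integral>\<^sup>+w. (\<Sum>y\<in>S. surv (k x) s w * (\<Sum>z\<in>S - {x}. l x z w * min_trans S k l z y w t) * indicator {s<..<c} w) \<partial>lborel)"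
  using assms(2,3) by (subst min_trans_split[of s c]) (auto simp: Zc nn_integral_sum)
 also have "... <= (\<integral>\<^sup>+w\<in>{s<..<c}. k x w * surv (k x) s w \<partial>lborel)"
 proof (intro nn_integral_mono)
  fix w
  show "(\<Sum>y\<in>S. surv (k x) s w * (\<Sum>z\<in>S - {x}. l x z w * min_trans S k l z y w t) * indicator {s<..<c} w)
    <= k x w * surv (k x) s w * indicator {s<..<c} w"
  proof (cases "w \<in> {s<..<c}")
   case True
   have "(\<Sum>y\<in>S. surv (k x) s w * (\<Sum>z\<in>S - {x}. l x z w * min_trans S k l z y w t)) =
     surv (k x) s w * (\<Sum>z\<in>S - {x}. l x z w * (\<Sum>y\<in>S. min_trans S k l z y w t))"
    unfolding sum_distrib_left by (rule sum.swap)
   also have "... <= surv (k x) s w * (\<Sum>z\<in>S - {x}. l x z w * 1)"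
    using True assms by (intro mult_left_mono sum_mono min_trans_sum_le_1 sub) auto
   also have "... <= surv (k x) s w * k x w"
    using sub by (intro mult_left_mono) auto
   finally show ?thesis using True by (simp add: mult.commute)
  qed simp
 qed
 finally have le: "(\<Sum>y\<in>S. min_trans S k l x y s t) <= (\<integral>\<^sup>+w\<in>{s<..<c}. k x w * surv (k x) s w \<partial>lborel)" .
 have "surv (k x) s c + (\<integral>\<^sup>+w\<in>{s<..<c}. k x w * surv (k x) s w \<partial>lborel) <= 1"
  using assms by (intro surv_forward_le) auto
 then have "surv (k x) s c + (\<Sum>y\<in>S. min_trans S k l x y s t) <= 1"
  using le by (meson add_left_mono order_trans)
 moreover have "(\<Sum>y\<in>S. min_trans S k l x y s t) <= 1"
  using assms by (intro min_trans_sum_le_1) auto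
 moreover have False if "(\<Sum>y\<in>S. min_trans S k l x y s t) = 1" "surv (k x) s c + 1 <= 1"
 proof -
  have "1 + surv (k x) s c <= 1 + 0" using that(2) by (simp add: add.commute)
  then show False using pos by (simp add: ennreal_add_left_cancel_le)
 qed
 ultimately show ?thesis by (metis order_le_less)
qed

end

section \<open>Step paths\<close>

text \<open>Constant to the right of each time and to the left of each time. For paths with discrete values
  this is the same as cadlag, but it makes sense without a topology and is preserved by every map of the
  values.\<close>
definition step_path :: "real => (real => 'b) => bool" where
 "step_path T c \<longleftrightarrow>
   (\<forall>t\<in>{0..<T}. eventually (%r. c r = c t) (at_right t)) \<and>
   (\<forall>t\<in>{0<..T}. \<exists>b. eventually (%r. c r = b) (at_left t))"

definition left_val :: "(real => 'b) => real => 'b" where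
 "left_val c u = (SOME b. eventually (%r. c r = b) (at_left u))"

definition jump_times :: "(real => 'b) => real => real => real set" where
 "jump_times c s t = {u\<in>{s<..t}. c u ~= left_val c u}"

lemma left_val_eqI:
 assumes "eventually (%r. c r = b) (at_left u)"
 shows "left_val c u = b"
proof -
 have "eventually (%r. c r = left_val c u) (at_left u)"
  unfolding left_val_def using assms by (rule someI)
 with assms have "eventually (%r. left_val c u = b) (at_left u)"
  by eventually_elim simp
 then show ?thesis by simp
qed

lemma step_path_left:
 assumes "step_path T c" "0 < u" "u <= T"
 shows "eventually (%r. c r = left_val c u) (at_left u)"
 using assms left_val_eqI[of c _ u] unfolding step_path_def by fastforce

lemma step_path_right:
 assumes "step_path T c" "0 <= u" "u < T"
 shows "eventually (%r. c r = c u) (at_right u)"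
 using assms unfolding step_path_def by auto

text \<open>An accumulation point of jump times would have jumps arbitrarily close on one of its sides,
  where the path is constant.\<close>
lemma finite_jump_times:
 assumes c: "step_path T c" and st: "0 <= s" "t <= T"
 shows "finite (jump_times c s t)"
proof (rule ccontr)
 assume inf: "infinite (jump_times c s t)"
 have sub: "jump_times c s t \<subseteq> {s..t}" by (auto simp: jump_times_def)
 then obtain x where x: "x \<in> {s..t}" "x islimpt jump_times c s t"
  using inf compact_Icc[of s t] unfolding compact_eq_Bolzano_Weierstrass by blast
 have "\<exists>e>0. \<forall>v. x - e < v \<and> v < x \<and> s < v --> c v = left_val c v"
 proof (cases "s < x")
  case True
  then obtain b where b: "b < x" "\<forall>r>b. r < x --> c r = left_val c x"
   using step_path_left[OF c, of x] x(1) st unfolding eventually_at_left_field by auto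
  have "c v = left_val c v" if "b < v" "v < x" for v
  proof -
   have "eventually (%r. c r = c v) (at_left v)"
    unfolding eventually_at_left_field using b that by (intro exI[of _ b]) auto
   then show ?thesis by (simp add: left_val_eqI)
  qed
  then show ?thesis using b by (intro exI[of _ "x - b"]) auto
 qed (auto intro: exI[of _ 1])
 then obtain e1 where e1: "e1 > 0" "\<And>v. x - e1 < v ==> v < x ==> s < v ==> c v = left_val c v" by auto
 have "\<exists>e>0. \<forall>v. x < v \<and> v < x + e \<and> v <= t --> c v = left_val c v"
 proof (cases "x < t")
  case True
  then obtain b where b: "x < b" "\<forall>r>x. r < b --> c r = c x"
   using step_path_right[OF c, of x] x(1) st unfolding eventually_at_right_field by auto
  have "c v = left_val c v" if "x < v" "v < b" for v
  proof -
   have "eventually (%r. c r = c v) (at_left v)"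
    unfolding eventually_at_left_field using b that by (intro exI[of _ x]) auto
   then show ?thesis by (simp add: left_val_eqI)
  qed
  then show ?thesis using b by (intro exI[of _ "b - x"]) auto
 qed (auto intro: exI[of _ 1])
 then obtain e2 where e2: "e2 > 0" "\<And>v. x < v ==> v < x + e2 ==> v <= t ==> c v = left_val c v" by auto
 obtain v where v: "v \<in> jump_times c s t" "v ~= x" "dist v x < min e1 e2"
  using x(2) e1(1) e2(1) unfolding islimpt_approachable by (metis min_less_iff_conj)
 then show False
  using e1(2)[of v] e2(2)[of v] by (cases "v < x") (auto simp: jump_times_def dist_real_def)
qed

lemma step_path_const:
 assumes c: "step_path T c" and st: "0 <= s" "t <= T" "s <= r" "r < t"
  and no: "jump_times c s r = {}"
 shows "c r = c s"
proof -
 have "c constant_on {s..r}"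
 proof (rule locally_constant_imp_constant)
  fix a assume a: "a \<in> {s..r}"
  have "\<exists>e>0. \<forall>v\<in>{s..r}. a - e < v \<and> v < a --> c v = c a"
  proof (cases "s < a")
   case True
   then have "left_val c a = c a" using no a by (auto simp: jump_times_def)
   with True obtain b where "b < a" "\<forall>r>b. r < a --> c r = c a"
    using step_path_left[OF c, of a] a st unfolding eventually_at_left_field by auto
   then show ?thesis by (intro exI[of _ "a - b"]) auto
  qed (auto intro: exI[of _ 1])
  then obtain e1 where e1: "e1 > 0" "\<And>v. v\<in>{s..r} ==> a - e1 < v ==> v < a ==> c v = c a" by auto
  obtain b where b: "a < b" "\<forall>r>a. r < b --> c r = c a"
   using step_path_right[OF c, of a] a st unfolding eventually_at_right_field by auto
  define U where "U = {s..r} \<inter> {a - e1<..<b}"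
  have "openin (top_of_set {s..r}) U" unfolding U_def by (intro openin_open_Int) auto
  moreover have "a \<in> U" using a e1 b by (auto simp: U_def)
  moreover have "\<forall>v\<in>U. c v = c a"
  proof
   fix v assume "v \<in> U"
   then have v: "v \<in> {s..r}" "a - e1 < v" "v < b" by (auto simp: U_def)
   consider "v < a" | "v = a" | "a < v" by linarith
   then show "c v = c a"
   proof cases
    case 1 with v show ?thesis by (intro e1(2))
   next
    case 3 with v b(2) show ?thesis by blast
   qed simp
  qed
  ultimately show "\<exists>U. openin (top_of_set {s..r}) U \<and> a \<in> U \<and> (\<forall>v\<in>U. c v = c a)" by blast
 qed simp
 then show ?thesis using st by (auto simp: constant_on_def)
qed

lemma step_path_left_val_const:
 assumes c: "step_path T c" and st: "0 <= s" "t <= T" "s < t"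
  and no: "jump_times c s t \<subseteq> {t}"
 shows "left_val c t = c s"
proof (rule left_val_eqI)
 have "c r = c s" if "s < r" "r < t" for r
  using no that st by (intro step_path_const[OF c, of s t r]) (auto simp: jump_times_def)
 then show "eventually (%r. c r = c s) (at_left t)"
  unfolding eventually_at_left_field using st by (intro exI[of _ s]) auto
qed

lemma step_path_const':
 assumes c: "step_path T c" and st: "0 <= s" "t <= T" "s <= t"
  and no: "jump_times c s t = {}"
 shows "c t = c s"
proof (cases "s = t")
 case False
 then have "left_val c t = c s" using assms by (intro step_path_left_val_const[OF c]) auto
 moreover have "c t = left_val c t" using no False st by (auto simp: jump_times_def)
 ultimately show ?thesis by simp
qed simp

lemma cadlag_on_nat_step_path:
 fixes c :: "real => nat"
 assumes "cadlag_on T c"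
 shows "step_path T c"
 using assms unfolding cadlag_on_def step_path_def by (auto simp: tendsto_discrete)

lemma step_path_comp:
 assumes c: "step_path T c"
 shows "step_path T (%r. f (c r))"
 unfolding step_path_def
proof (intro conjI ballI)
 fix t assume "t \<in> {0..<T}"
 then show "eventually (%r. f (c r) = f (c t)) (at_right t)"
  using step_path_right[OF c, of t] by (auto elim!: eventually_mono)
next
 fix t assume "t \<in> {0<..T}"
 then show "\<exists>b. eventually (%r. f (c r) = b) (at_left t)"
  using step_path_left[OF c, of t] by (intro exI[of _ "f (left_val c t)"]) (auto elim!: eventually_mono)
qed

lemma left_val_comp:
 assumes "step_path T c" "0 < u" "u <= T"
 shows "left_val (%r. f (c r)) u = f (left_val c u)"
 using step_path_left[OF assms] by (intro left_val_eqI) (auto elim!: eventually_mono)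

lemma Lim_at_left_step:
 fixes c :: "real => 'b::t2_space"
 assumes "step_path T c" "0 < u" "u <= T"
 shows "Lim (at_left u) c = left_val c u"
 by (intro tendsto_Lim tendsto_eventually step_path_left[OF assms]) simp

lemma jump_step:
 assumes "step_path T g" "0 < u" "u <= T"
 shows "jump g u = g u - left_val g u"
 using Lim_at_left_step[OF assms] assms by (simp add: jump_def left_lim_def)

text \<open>A piecewise constant path is Borel: its level sets are open up to the finitely many jump times.\<close>
lemma measurable_step_path:
 fixes c :: "real => nat"
 assumes c: "step_path T c"
 shows "(%u. if 0 < u \<and> u < T then c u else 0) \<in> measurable borel (count_space UNIV)"
proof -
 have *: "{u. 0 < u \<and> u < T \<and> c u = x} \<in> sets borel" for x
 proof -
  define U where "U = {u. 0 < u \<and> u < T \<and> c u = x} - jump_times c 0 T"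
  have fin: "finite (jump_times c 0 T)" by (rule finite_jump_times[OF c]) auto
  have "open U"
   unfolding open_dist
  proof
   fix u assume "u \<in> U"
   then have u: "0 < u" "u < T" "c u = x" "left_val c u = x" by (auto simp: U_def jump_times_def)
   obtain a where a: "a < u" "\<forall>r>a. r < u --> c r = x"
    using step_path_left[OF c, of u] u unfolding eventually_at_left_field by auto
   obtain b where b: "u < b" "\<forall>r>u. r < b --> c r = x"
    using step_path_right[OF c, of u] u unfolding eventually_at_right_field by auto
   define e where "e = min (min (u - a) (b - u)) (min u (T - u))"
   have const: "c v = x" if "max a 0 < v" "v < min b T" for v
   proof -
    consider "v < u" | "v = u" | "u < v" by linarith
    then show ?thesis
    proof cases
     case 1 with that a(2) show ?thesis by simp
    next
     case 3 with that b(2) show ?thesis by simp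
    qed (use u in simp)
   qed
   have "v \<in> U" if "dist v u < e" for v
   proof -
    have v: "max a 0 < v" "v < min b T" using that by (auto simp: e_def dist_real_def)
    then have "left_val c v = x"
     using const by (intro left_val_eqI) (auto simp: eventually_at_left_field intro!: exI[of _ "max a 0"])
    then show ?thesis using v const[of v] by (auto simp: U_def jump_times_def)
   qed
   moreover have "e > 0" using a(1) b(1) u(1,2) by (simp add: e_def)
   ultimately show "\<exists>e>0. \<forall>y. dist y u < e --> y \<in> U" by blast
  qed
  then have "U \<union> ({u. 0 < u \<and> u < T \<and> c u = x} \<inter> jump_times c 0 T) \<in> sets borel"
   using fin by (intro sets.Un borel_open borel_closed finite_imp_closed) auto
  also have "U \<union> ({u. 0 < u \<and> u < T \<and> c u = x} \<inter> jump_times c 0 T) = {u. 0 < u \<and> u < T \<and> c u = x}"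
   by (auto simp: U_def)
  finally show ?thesis .
 qed
 show ?thesis
 proof (subst measurable_count_space_eq2_countable, safe)
  fix x
  have "(%u. if 0 < u \<and> u < T then c u else 0) -` {x} \<inter> space borel =
    {u. 0 < u \<and> u < T \<and> c u = x} \<union> (if x = 0 then - {0<..<T} else {})"
   by (auto split: if_splits)
  then show "(%u. if 0 < u \<and> u < T then c u else 0) -` {x} \<inter> space borel \<in> sets borel"
   using *[of x] by (auto intro!: sets.Un)
 qed auto
qed

section \<open>The driving equation over a short interval\<close>

lemma nat_increments_eq:
 fixes g :: "real => real"
 assumes nat: "\<And>s t. 0 <= s ==> s <= t ==> t <= T ==> g t - g s \<in> \<nat>"
  and "0 <= r" "r <= T" "0 <= t" "t <= T" "\<bar>g r - g t\<bar> < 1"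
 shows "g r = g t"
proof -
 have "\<bar>g r - g t\<bar> \<in> \<nat>"
  using nat[of r t] nat[of t r] assms(2-5)
  by (cases "r <= t") (auto simp: abs_if Nats_altdef2)
 then obtain n where "\<bar>g r - g t\<bar> = real n" by (rule Nats_cases)
 with assms(6) show ?thesis by simp
qed

lemma counting_path_step:
 fixes g :: "real => real"
 assumes cad: "cadlag_on T g"
  and nat: "\<And>s t. 0 <= s ==> s <= t ==> t <= T ==> g t - g s \<in> \<nat>"
 shows "step_path T g"
 unfolding step_path_def
proof (intro conjI ballI)
 note eq = nat_increments_eq[of T g, OF nat]
 fix t assume t: "t \<in> {0..<T}"
 then have "(g \<longlongrightarrow> g t) (at_right t)" using cad by (auto simp: cadlag_on_def)
 then have "eventually (%r. dist (g r) (g t) < 1) (at_right t)" by (rule tendstoD) simp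
 moreover have "eventually (%r. r \<in> {t<..<T}) (at_right t)"
  using t by (intro eventually_at_right_real) auto
 ultimately show "eventually (%r. g r = g t) (at_right t)"
  by eventually_elim (use t in \<open>auto simp: dist_real_def intro!: eq\<close>)
next
 note eq = nat_increments_eq[of T g, OF nat]
 fix t assume t: "t \<in> {0<..T}"
 then obtain l where "(g \<longlongrightarrow> l) (at_left t)" using cad unfolding cadlag_on_def by blast
 then have "eventually (%r. dist (g r) l < 1/2) (at_left t)" by (rule tendstoD) simp
 moreover have "eventually (%r. r \<in> {0<..<t}) (at_left t)"
  using t by (intro eventually_at_left_real) auto
 ultimately have "eventually (%r. dist (g r) l < 1/2 \<and> r \<in> {0<..<t}) (at_left t)"
  by eventually_elim auto
 then obtain b where b: "b < t" "\<And>r. b < r ==> r < t ==> dist (g r) l < 1/2 \<and> r \<in> {0<..<t}"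
  unfolding eventually_at_left_field by auto
 define m where "m = (b + t) / 2"
 have "g r = g m" if "b < r" "r < t" for r
 proof -
  have "dist (g r) l < 1/2" "r \<in> {0<..<t}" "dist (g m) l < 1/2" "m \<in> {0<..<t}"
   using b(2)[of r] b(2)[of m] b(1) that by (auto simp: m_def)
  then show ?thesis
  proof (intro eq)
   show "\<bar>g r - g m\<bar> < 1"
    using \<open>dist (g r) l < 1/2\<close> \<open>dist (g m) l < 1/2\<close> unfolding dist_real_def by linarith
  qed (use t in auto)
 qed
 then show "\<exists>x. eventually (%r. g r = x) (at_left t)"
  unfolding eventually_at_left_field using b(1) by (intro exI[of _ "g m"] exI[of _ b]) auto
qed

lemma step_path_mono_left_val:
 fixes g :: "real => real"
 assumes c: "step_path T g"
  and mono: "\<And>s t. 0 <= s ==> s <= t ==> t <= T ==> g s <= g t"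
  and u: "0 <= s" "s < u" "u <= T"
 shows "g s <= left_val g u" "left_val g u <= g u" "\<exists>r\<in>{s<..<u}. left_val g u = g r"
proof -
 have "eventually (%r. r \<in> {s<..<u} \<and> g r = left_val g u) (at_left u)"
  using step_path_left[OF c, of u] eventually_at_left_real[of s u] u by (auto simp: eventually_conj_iff)
 from eventually_happens'[OF _ this] obtain r where r: "r \<in> {s<..<u}" "g r = left_val g u"
  by auto
 then show "\<exists>r\<in>{s<..<u}. left_val g u = g r" by (intro bexI[of _ r]) auto
 show "g s <= left_val g u" "left_val g u <= g u" using r mono[of s r] mono[of r u] u by auto
qed

context
 fixes T :: real and I :: "(nat \<times> nat) set" and g :: "nat \<times> nat => real => real" and c :: "real => nat" and c0 :: real
 assumes fin_I: "finite I"
  and c: "step_path T c"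
  and g: "\<And>p. p \<in> I ==> step_path T (g p)"
  and g_nat: "\<And>p s t. p \<in> I ==> 0 <= s ==> s <= t ==> t <= T ==> g p t - g p s \<in> \<nat>"
  and sde: "\<And>t. 0 <= t ==> t <= T ==> real (c t) = c0 +
    (\<Sum>p\<in>I. (real (snd p) - real (fst p)) * jump_integral (%u. indicator {fst p} (left_val c u)) (g p) t)"
begin

lemma g_mono: "p \<in> I ==> 0 <= s ==> s <= t ==> t <= T ==> g p s <= g p t"
 using g_nat[of p s t] Nats_altdef2 by (metis diff_ge_0_iff_ge mem_Collect_eq)

lemma jump_times_jump:
 assumes "p \<in> I" "0 <= s" "t <= T"
 shows "{u\<in>{s<..t}. jump (g p) u ~= 0} = jump_times (g p) s t"
 using assms jump_step[OF g[OF assms(1)]] unfolding jump_times_def by auto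

lemma jump_times_const_incr:
 assumes "p \<in> I" "0 <= s" "s <= t" "t <= T" "g p t = g p s"
 shows "jump_times (g p) s t = {}"
proof -
 have "g p u = left_val (g p) u" if u: "s < u" "u <= t" for u
  using step_path_mono_left_val[OF g[OF assms(1)] g_mono[OF assms(1)], of s u] g_mono[OF assms(1), of u t] u assms
  by auto
 then show ?thesis by (auto simp: jump_times_def)
qed

text \<open>Differences of the integrated equation over \<open>]s,t]\<close> only involve the jumps of the
  driving paths in that interval.\<close>
lemma sde_increment:
 assumes "0 <= s" "s <= t" "t <= T"
 shows "real (c t) - real (c s) = (\<Sum>p\<in>I. (real (snd p) - real (fst p)) *
  (\<Sum>u\<in>jump_times (g p) s t. indicator {fst p} (left_val c u) * jump (g p) u))"
proof -
 have *: "jump_integral f (g p) t = jump_integral f (g p) s + (\<Sum>u\<in>jump_times (g p) s t. f u * jump (g p) u)"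
  if p: "p \<in> I" for p and f :: "real => real"
 proof -
  have "jump_times (g p) 0 t = jump_times (g p) 0 s \<union> jump_times (g p) s t"
   using assms by (auto simp: jump_times_def)
  moreover have "jump_times (g p) 0 s \<inter> jump_times (g p) s t = {}" by (auto simp: jump_times_def)
  moreover have "jump_integral f (g p) r = (\<Sum>u\<in>jump_times (g p) 0 r. f u * jump (g p) u)" if "r <= T" for r
   unfolding jump_integral_def using p that by (subst jump_times_jump) auto
  ultimately show ?thesis
   using finite_jump_times[OF g[OF p]] assms by (simp add: sum.union_disjoint)
 qed
 show ?thesis
 proof -
  let ?a = "%p. real (snd p) - real (fst p)" and ?f = "%p u. indicator {fst p} (left_val c u) :: real"
  have "real (c t) - real (c s) = (\<Sum>p\<in>I. ?a p * jump_integral (?f p) (g p) t) -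
    (\<Sum>p\<in>I. ?a p * jump_integral (?f p) (g p) s)"
   using sde[of t] sde[of s] assms by simp
  also have "... = (\<Sum>p\<in>I. ?a p * jump_integral (?f p) (g p) t - ?a p * jump_integral (?f p) (g p) s)"
   by (rule sum_subtractf[symmetric])
  also have "... = (\<Sum>p\<in>I. ?a p * (\<Sum>u\<in>jump_times (g p) s t. ?f p u * jump (g p) u))"
   by (intro sum.cong refl, subst *) (auto simp: distrib_left)
  finally show ?thesis .
 qed
qed

lemma sde_no_increment:
 assumes "0 <= s" "s <= t" "t <= T" and no: "\<And>p. p \<in> I ==> g p t = g p s"
 shows "c t = c s"
 using sde_increment[OF assms(1-3)] jump_times_const_incr assms by simp

text \<open>The single jump of the driving path \<open>q\<close> is effective exactly if the solution sits
  in the first component of \<open>q\<close> at that time; no earlier jump in the interval could have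
  changed the state.\<close>
lemma sde_one_increment:
 assumes st: "0 <= s" "s <= t" "t <= T" and q: "q \<in> I"
  and no: "\<And>p. p \<in> I ==> p ~= q ==> g p t = g p s" and one: "g q t = g q s + 1"
 shows "c t = (if c s = fst q then snd q else c s)"
proof -
 have "jump_times (g q) s t ~= {}"
  using step_path_const'[OF g[OF q], of s t] st one by auto
 then obtain u where u: "s < u" "u <= t" "g q u ~= left_val (g q) u" by (auto simp: jump_times_def)
 have vals: "g q r = g q s \<or> g q r = g q s + 1" if r: "s <= r" "r <= t" for r
 proof -
  obtain n where n: "g q r - g q s = real n" using g_nat[OF q, of s r] r st by (auto simp: Nats_def)
  moreover have "g q r <= g q t" using g_mono[OF q] r st by auto
  ultimately have "real n <= 1" using one by linarith
  then have "n = 0 \<or> n = 1" by linarith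
  then show ?thesis using n by auto
 qed
 note lv = step_path_mono_left_val[OF g[OF q] g_mono[OF q], of s]
 have jump: "left_val (g q) v = g q s \<and> g q v = g q s + 1"
  if v: "s < v" "v <= t" "g q v ~= left_val (g q) v" for v
 proof -
  obtain r where r: "s < r" "r < v" "left_val (g q) v = g q r" using lv(3)[of v] v st by auto
  have "left_val (g q) v <= g q v" using lv(2)[of v] v st by auto
  with r vals[of r] vals[of v] v show ?thesis by auto
 qed
 have uniq: "v = u" if v: "s < v" "v <= t" "g q v ~= left_val (g q) v" for v
 proof -
  have False if ab: "s < a" "a < b" "b <= t" "g q a ~= left_val (g q) a" "g q b ~= left_val (g q) b" for a b
   using jump[of a] jump[of b] ab step_path_mono_left_val(1)[OF g[OF q] g_mono[OF q], of a b] st by auto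
  then show ?thesis using u v by (metis linorder_cases)
 qed
 have Jq: "jump_times (g q) s r = (if u <= r then {u} else {})" if "s <= r" "r <= t" for r
 proof -
  have "v = u" if "v \<in> jump_times (g q) s r" for v
   using that \<open>r <= t\<close> by (intro uniq) (auto simp: jump_times_def)
  moreover have "u \<in> jump_times (g q) s r \<longleftrightarrow> u <= r"
   using u by (auto simp: jump_times_def)
  ultimately show ?thesis by auto
 qed
 have Jp: "jump_times (g p) s r = {}" if "p \<in> I" "p ~= q" "s <= r" "r <= t" for p r
  using jump_times_const_incr[of p s t] no[of p] that st by (auto simp: jump_times_def)
 have inc: "real (c r) - real (c s) = (if u <= r then (real (snd q) - real (fst q)) *
   (indicator {fst q} (left_val c u) * jump (g q) u) else 0)" if r: "s <= r" "r <= t" for r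
 proof -
  have Jq_sum: "(\<Sum>v\<in>jump_times (g q) s r. F v) = (if u <= r then F u else 0)" for F :: "real => real"
   by (simp add: Jq[OF r])
  have "real (c r) - real (c s) = (\<Sum>p\<in>I. if p = q then (if u <= r then (real (snd q) - real (fst q)) *
   (indicator {fst q} (left_val c u) * jump (g q) u) else 0) else 0)"
   unfolding sde_increment[OF st(1) r(1) order_trans[OF r(2) st(3)]]
  proof (intro sum.cong refl)
   fix p assume "p \<in> I"
   then show "(real (snd p) - real (fst p)) * (\<Sum>u\<in>jump_times (g p) s r. indicator {fst p} (left_val c u) * jump (g p) u) =
    (if p = q then (if u <= r then (real (snd q) - real (fst q)) *
     (indicator {fst q} (left_val c u) * jump (g q) u) else 0) else 0)"
    using Jp[OF _ _ r] by (cases "p = q") (simp_all only: Jq_sum, simp_all)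
  qed
  then show ?thesis using q fin_I by simp
 qed
 have "left_val c u = c s"
 proof (rule left_val_eqI)
  have "c r = c s" if "s < r" "r < u" for r using inc[of r] that u by auto
  then show "eventually (%r. c r = c s) (at_left u)"
   unfolding eventually_at_left_field using u by (intro exI[of _ s]) auto
 qed
 moreover have "jump (g q) u = 1"
  using jump[OF u] jump_step[OF g[OF q], of u] u st by auto
 ultimately have "real (c t) - real (c s) = (real (snd q) - real (fst q)) * indicator {fst q} (c s)"
  using inc[of t] u st by simp
 then show ?thesis by (cases "c s = fst q") auto
qed

end

section \<open>Equidistant grids\<close>

definition grid :: "real => real => nat => nat => real" where
 "grid s t m i = s + real i * ((t - s) / real m)"

text \<open>The index of the cell \<open>]grid s t m i, grid s t m (Suc i)]\<close> that contains
  \<open>u\<close>.\<close>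
definition cell :: "real => real => nat => real => nat" where
 "cell s t m u = nat (\<lceil>(u - s) * real m / (t - s)\<rceil> - 1)"

abbreviation "cell_lo s t m u \<equiv> grid s t m (cell s t m u)"
abbreviation "cell_hi s t m u \<equiv> grid s t m (Suc (cell s t m u))"

lemma grid_0 [simp]: "grid s t m 0 = s"
 by (simp add: grid_def)

lemma grid_end [simp]: "0 < m ==> grid s t m m = t"
 by (simp add: grid_def)

lemma grid_Suc: "grid s t m (Suc i) = grid s t m i + (t - s) / real m"
 by (simp add: grid_def algebra_simps add_divide_distrib diff_divide_distrib)

lemma grid_mono: "s <= t ==> i <= j ==> grid s t m i <= grid s t m j"
 unfolding grid_def by (intro add_left_mono mult_right_mono divide_nonneg_nonneg) auto

lemma grid_less: "s < t ==> 0 < m ==> i < j ==> grid s t m i < grid s t m j"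
 unfolding grid_def by (intro add_strict_left_mono mult_strict_right_mono divide_pos_pos) auto

lemma grid_bounds:
 assumes "s <= t" "i <= m" "0 < m"
 shows "s <= grid s t m i" "grid s t m i <= t"
 using grid_mono[OF assms(1), of 0 i m] grid_mono[OF assms(1,2), of m] assms by auto

context
 fixes s t :: real and m :: nat
 assumes st: "s < t" and m: "0 < m"
begin

lemma cell_bounds:
 assumes "s < u" "u <= t"
 shows "cell s t m u < m" "cell_lo s t m u < u" "u <= cell_hi s t m u"
proof -
 define q where "q = (u - s) * real m / (t - s)"
 have q: "0 < q" "q <= real m"
  using st m assms by (auto simp: q_def field_simps mult_left_mono)
 have c: "real (cell s t m u) = of_int (\<lceil>q\<rceil> - 1)"
  using q by (simp add: cell_def q_def[symmetric])
 have "\<lceil>q\<rceil> <= int m" using q(2) by (simp add: ceiling_le_iff)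
 then show "cell s t m u < m" using c by linarith
 have "real (cell s t m u) < q" "q <= real (cell s t m u) + 1"
  using c ceiling_correct[of q] by auto
 then show "cell_lo s t m u < u" "u <= cell_hi s t m u"
  using st m by (auto simp: grid_def q_def field_simps)
qed

lemma cell_eqI:
 assumes "grid s t m i < u" "u <= grid s t m (Suc i)" "s < u" "u <= t"
 shows "cell s t m u = i"
proof (rule ccontr)
 assume "cell s t m u ~= i"
 then have "Suc (cell s t m u) <= i \<or> Suc i <= cell s t m u" by linarith
 then show False
  using grid_mono[of s t "Suc (cell s t m u)" i m] grid_mono[of s t "Suc i" "cell s t m u" m]
   cell_bounds[of u] assms st by auto
qed

lemma cell_lo_hi_bounds:
 assumes "s < u" "u <= t"
 shows "s <= cell_lo s t m u" "cell_hi s t m u <= t"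
  "cell_hi s t m u - cell_lo s t m u = (t - s) / real m"
 using cell_bounds(1)[OF assms] grid_bounds[of s t "cell s t m u" m] grid_bounds[of s t "Suc (cell s t m u)" m] st m
 by (auto simp: grid_Suc)

lemma sum_cells:
 fixes f :: "nat => 'b::semiring_1"
 shows "(\<Sum>i<m. f i * indicator {grid s t m i<..grid s t m (Suc i)} u) =
  f (cell s t m u) * indicator {s<..t} u"
proof (cases "s < u \<and> u <= t")
 case True
 then have "(\<Sum>i<m. f i * indicator {grid s t m i<..grid s t m (Suc i)} u) =
   (\<Sum>i<m. if i = cell s t m u then f i else 0)"
  using cell_eqI cell_bounds by (intro sum.cong refl) (auto simp: indicator_def)
 then show ?thesis using True cell_bounds(1) by simp
next
 case False
 have "u \<notin> {grid s t m i<..grid s t m (Suc i)}" if "i < m" for i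
  using False grid_bounds[of s t i m] grid_bounds[of s t "Suc i" m] that st m by auto
 then show ?thesis using False by (auto simp: indicator_def intro!: sum.neutral)
qed

end

lemma measurable_cell [measurable]: "cell s t m \<in> measurable borel (count_space UNIV)"
 unfolding cell_def by measurable

lemma tendsto_cell:
 assumes st: "s < t" and u: "s < u" "u <= t"
 shows "(%m. cell_lo s t m u) \<longlonglongrightarrow> u" "(%m. cell_hi s t m u) \<longlonglongrightarrow> u"
proof -
 have lim: "(%m. (t - s) / real m) \<longlonglongrightarrow> 0" by (rule lim_const_over_n)
 have ev: "eventually (%m. 0 < m) sequentially" by (rule eventually_gt_at_top)
 show "(%m. cell_lo s t m u) \<longlonglongrightarrow> u"
 proof (rule tendsto_sandwich)
  have "(%m. u - (t - s) / real m) \<longlonglongrightarrow> u - 0" by (intro tendsto_intros lim)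
  then show "(%m. u - (t - s) / real m) \<longlonglongrightarrow> u" by simp
  show "eventually (%m. u - (t - s) / real m <= cell_lo s t m u) sequentially"
   using ev
  proof eventually_elim
   case (elim m)
   show ?case using cell_bounds[OF st elim u] cell_lo_hi_bounds[OF st elim u] by linarith
  qed
  show "eventually (%m. cell_lo s t m u <= u) sequentially"
   using ev
  proof eventually_elim
   case (elim m)
   show ?case using cell_bounds[OF st elim u] by linarith
  qed
 qed simp_all
 show "(%m. cell_hi s t m u) \<longlonglongrightarrow> u"
 proof (rule tendsto_sandwich[where f="%_. u" and h="%m. u + (t - s) / real m"])
  have "(%m. u + (t - s) / real m) \<longlonglongrightarrow> u + 0" by (intro tendsto_intros lim)
  then show "(%m. u + (t - s) / real m) \<longlonglongrightarrow> u" by simp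
  show "eventually (%m. cell_hi s t m u <= u + (t - s) / real m) sequentially"
   using ev
  proof eventually_elim
   case (elim m)
   show ?case using cell_bounds[OF st elim u] cell_lo_hi_bounds[OF st elim u] by linarith
  qed
  show "eventually (%m. u <= cell_hi s t m u) sequentially"
   using ev
  proof eventually_elim
   case (elim m)
   show ?case using cell_bounds[OF st elim u] by linarith
  qed
 qed simp_all
qed

lemma filterlim_cell_lo:
 assumes "s < t" "s < u" "u <= t"
 shows "filterlim (%m. cell_lo s t m u) (at_left u) sequentially"
proof -
 have "eventually (%m. cell_lo s t m u < u) sequentially"
  using eventually_gt_at_top[of 0]
 proof eventually_elim
  case (elim m)
  show ?case using cell_bounds(2)[OF assms(1) elim assms(2,3)] by simp
 qed
 then have "eventually (%m. cell_lo s t m u \<in> {..<u} \<and> cell_lo s t m u ~= u) sequentially"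
  by eventually_elim auto
 with tendsto_cell(1)[OF assms] show ?thesis
  unfolding filterlim_at by blast
qed

section \<open>The weight of a step path and its grid approximation\<close>

text \<open>For a path \<open>c\<close>, killing rates \<open>k\<close>, relative jump rates \<open>r\<close> and compensating growth rates \<open>b\<close>.\<close>
definition path_weight :: "(nat => real => ennreal) => (nat => real) => (nat => nat => real => real) =>
  (real => nat) => real => real => ennreal" where
 "path_weight k b r c s t = ennreal (exp (LINT u:{s<..<t}|lborel. b (c u))) *
   neg_exp (\<integral>\<^sup>+u\<in>{s<..<t}. k (c u) u \<partial>lborel) *
   (\<Prod>u\<in>jump_times c s t. ennreal (r (left_val c u) (c u) u))"

definition grid_factor :: "(nat => real => ennreal) => (nat => real) => (nat => nat => real => real) =>
  (real => nat) => real => real => real" where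
 "grid_factor k b r c p q = exp (b (c p) * (q - p)) *
   (if c p = c q then enn2real (surv (k (c p)) p q) else r (c p) (c q) p)"

definition grid_weight :: "(nat => real => ennreal) => (nat => real) => (nat => nat => real => real) =>
  (real => nat) => real => real => nat => nat => real" where
 "grid_weight k b r c s t m j = (\<Prod>i<j. grid_factor k b r c (grid s t m i) (grid s t m (Suc i)))"

definition grid_changes :: "(real => nat) => real => real => nat => nat => nat set" where
 "grid_changes c s t m j = {i. i < j \<and> c (grid s t m i) ~= c (grid s t m (Suc i))}"

context
 fixes T s t :: real and c :: "real => nat" and S :: "nat set"
 assumes c: "step_path T c" and T: "0 <= s" "s < t" "t <= T"
  and S: "finite S" "\<And>u. 0 <= u ==> u <= T ==> c u \<in> S"
begin

lemma jump_times_separated: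
 "\<exists>e>0. \<forall>u\<in>jump_times c s t. \<forall>v\<in>jump_times c s t. u ~= v --> e <= \<bar>u - v\<bar>"
proof -
 let ?J = "jump_times c s t"
 have fin: "finite ?J" using finite_jump_times[OF c] T by auto
 have "\<exists>e>0. \<forall>v\<in>?J. v ~= u --> e <= dist u v" for u by (rule finite_set_avoid[OF fin])
 then obtain e where e: "\<And>u. e u > 0" "\<And>u v. v \<in> ?J ==> v ~= u ==> e u <= dist u v" by metis
 show ?thesis
 proof (intro exI[of _ "Min (insert 1 (e ` ?J))"] conjI ballI impI)
  show "0 < Min (insert 1 (e ` ?J))" using fin e(1) by (subst Min_gr_iff) auto
  fix u v assume uv: "u \<in> ?J" "v \<in> ?J" "u ~= v"
  have "Min (insert 1 (e ` ?J)) <= e u" using fin uv by (intro Min_le) auto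
  then show "Min (insert 1 (e ` ?J)) <= \<bar>u - v\<bar>" using e(2)[of v u] uv by (auto simp: dist_real_def)
 qed
qed

text \<open>On a grid finer than the distance of the jump times, each jump is visible as a change of state
  over its cell, and conversely.\<close>
lemma grid_changes_bij:
 assumes m: "0 < m"
  and sep: "\<And>u v. u \<in> jump_times c s t ==> v \<in> jump_times c s t ==> u ~= v ==> (t - s) / real m < \<bar>u - v\<bar>"
 shows "bij_betw (cell s t m) (jump_times c s t) (grid_changes c s t m m)"
  and "\<And>u. u \<in> jump_times c s t ==> c (cell_lo s t m u) = left_val c u \<and> c (cell_hi s t m u) = c u"
proof -
 let ?J = "jump_times c s t" and ?l = "cell_lo s t m" and ?h = "cell_hi s t m"
 have J: "s < u" "u <= t" "c u ~= left_val c u" if "u \<in> ?J" for u using that by (auto simp: jump_times_def)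
 note cb = cell_bounds[OF T(2) m] cell_lo_hi_bounds[OF T(2) m]
 have one: "v = u" if "u \<in> ?J" "v \<in> ?J" "?l u < v" "v <= ?h u" for u v
 proof (rule ccontr)
  assume "v ~= u"
  then have "(t - s) / real m < \<bar>v - u\<bar>" using sep that by auto
  then show False using cb[OF J(1,2)[OF that(1)]] that(3,4) by linarith
 qed
 show *: "c (?l u) = left_val c u \<and> c (?h u) = c u" if u: "u \<in> ?J" for u
 proof
  note b = cb[OF J(1,2)[OF u]]
  have "jump_times c (?l u) u \<subseteq> {u}"
   using one[OF u] b J[OF u] by (auto simp: jump_times_def)
  then show "c (?l u) = left_val c u"
   using b J[OF u] T by (intro step_path_left_val_const[OF c, symmetric]) auto
  have "jump_times c u (?h u) = {}"
  proof -
   have False if v: "u < v" "v <= ?h u" "c v ~= left_val c v" for v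
   proof -
    have "v \<in> ?J" using v b J[OF u] by (auto simp: jump_times_def)
    then show False using one[OF u, of v] v b by auto
   qed
   then show ?thesis by (auto simp: jump_times_def)
  qed
  then show "c (?h u) = c u"
   using b J[OF u] T by (intro step_path_const'[OF c]) auto
 qed
 show "bij_betw (cell s t m) ?J (grid_changes c s t m m)"
  unfolding bij_betw_def
 proof
  show "inj_on (cell s t m) ?J"
  proof (rule inj_onI)
   fix u v assume uv: "u \<in> ?J" "v \<in> ?J" "cell s t m u = cell s t m v"
   then show "u = v" using one[of v u] cb(2,3)[OF J(1,2)[OF uv(1)]] by auto
  qed
  show "cell s t m ` ?J = grid_changes c s t m m"
  proof
   show "cell s t m ` ?J \<subseteq> grid_changes c s t m m"
   proof (rule image_subsetI)
    fix u assume u: "u \<in> ?J"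
    then show "cell s t m u \<in> grid_changes c s t m m"
     using *[OF u] J(3)[OF u] cb(1)[OF J(1,2)[OF u]] unfolding grid_changes_def by fastforce
   qed
   show "grid_changes c s t m m \<subseteq> cell s t m ` ?J"
   proof
    fix i assume i: "i \<in> grid_changes c s t m m"
    then have im: "i < m" and ne: "c (grid s t m i) ~= c (grid s t m (Suc i))" by (auto simp: grid_changes_def)
    note gb = grid_bounds[of s t i m] grid_bounds[of s t "Suc i" m] grid_mono[of s t i "Suc i" m]
    have "jump_times c (grid s t m i) (grid s t m (Suc i)) ~= {}"
     using step_path_const'[OF c, of "grid s t m i" "grid s t m (Suc i)"] ne gb im T by auto
    then obtain u where u: "grid s t m i < u" "u <= grid s t m (Suc i)" "c u ~= left_val c u"
     by (auto simp: jump_times_def)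
    then have "u \<in> ?J" using gb im T by (auto simp: jump_times_def)
    moreover have "cell s t m u = i"
     using u gb im T by (intro cell_eqI[OF T(2) m]) auto
    ultimately show "i \<in> cell s t m ` ?J" by auto
   qed
  qed
 qed
qed

lemma measurable_path_comp:
 fixes f :: "nat => real"
 shows "(%u. f (c u) * indicator {s<..<t} u) \<in> borel_measurable borel"
proof -
 have [measurable]: "(%u. if 0 < u \<and> u < T then c u else 0) \<in> measurable borel (count_space UNIV)"
  by (rule measurable_step_path[OF c])
 have "(%u. f (if 0 < u \<and> u < T then c u else 0) * indicator {s<..<t} u) \<in> borel_measurable borel"
  by measurable
 also have "(%u. f (if 0 < u \<and> u < T then c u else 0) * indicator {s<..<t} u) = (%u. f (c u) * indicator {s<..<t} u)"
  using T by (auto simp: indicator_def fun_eq_iff)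
 finally show ?thesis .
qed

lemma measurable_path_rate:
 fixes k :: "nat => real => ennreal"
 assumes k: "\<And>x. k x \<in> borel_measurable borel"
 shows "(%u. k (c u) u * indicator {s<..<t} u) \<in> borel_measurable borel"
proof -
 have [measurable]: "(%u. if 0 < u \<and> u < T then c u else 0) \<in> measurable borel (count_space UNIV)"
  by (rule measurable_step_path[OF c])
 have "(%u. k (if 0 < u \<and> u < T then c u else 0) u) \<in> borel_measurable borel"
  by (rule measurable_compose_countable[OF k]) measurable
 then have "(%u. k (if 0 < u \<and> u < T then c u else 0) u * indicator {s<..<t} u) \<in> borel_measurable borel"
  by measurable
 also have "(%u. k (if 0 < u \<and> u < T then c u else 0) u * indicator {s<..<t} u) = (%u. k (c u) u * indicator {s<..<t} u)"
  using T by (auto simp: indicator_def fun_eq_iff)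
 finally show ?thesis .
qed

lemma cell_lo_hi_eventually_path:
 assumes "s < u" "u <= t" "u \<notin> jump_times c s t"
 shows "eventually (%m. c (cell_lo s t m u) = c u \<and> c (cell_hi s t m u) = c u) sequentially"
proof -
 have "eventually (%r. c r = c u) (at_left u)"
  using step_path_left[OF c, of u] assms T by (auto simp: jump_times_def)
 then have lo: "eventually (%m. c (cell_lo s t m u) = c u) sequentially"
  using filterlim_cell_lo[OF T(2) assms(1,2)] by (auto simp: filterlim_iff)
 have hi: "eventually (%m. c (cell_hi s t m u) = c u) sequentially"
 proof (cases "u < t")
  case True
  then obtain b where b: "u < b" "\<forall>r>u. r < b --> c r = c u"
   using step_path_right[OF c, of u] assms T unfolding eventually_at_right_field by auto
  have "eventually (%m. cell_hi s t m u < b) sequentially"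
   using tendsto_cell(2)[OF T(2) assms(1,2)] b(1) by (auto simp: order_tendsto_iff)
  then show ?thesis
   using eventually_gt_at_top[of 0]
  proof eventually_elim
   case (elim m)
   then show ?case using b(2) cell_bounds(3)[OF T(2) _ assms(1,2), of m]
    by (cases "cell_hi s t m u = u") auto
  qed
 next
  case False
  then have "u = t" using assms by auto
  show ?thesis
   using eventually_gt_at_top[of 0]
  proof eventually_elim
   case (elim m)
   then have "cell_hi s t m u = u"
    using cell_bounds(3)[OF T(2) elim assms(1,2)] cell_lo_hi_bounds(2)[OF T(2) elim assms(1,2)] \<open>u = t\<close> by auto
   then show ?case by simp
  qed
 qed
 from lo hi show ?thesis by eventually_elim simp
qed

text \<open>Fine cells contain at most one jump; cells with a jump shrink to the jump times, and the killing in
 them is negligible whether or not the rates are integrable.\<close>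
lemma grid_weight_tendsto:
 assumes k: "\<And>x. k x \<in> borel_measurable borel"
  and r: "\<And>x z u. s < u ==> u <= t ==> ((%w. r x z w) \<longlongrightarrow> rv x z u) (at_left u)"
  and r_nonneg: "\<And>x z u. 0 <= r x z u"
 shows "(%m. ennreal (grid_weight k b r c s t m m)) \<longlonglongrightarrow> path_weight k b rv c s t"
  and "eventually (%m. card (grid_changes c s t m m) = card (jump_times c s t)) sequentially"
proof -
 let ?J = "jump_times c s t" and ?g = "grid s t"
 have fin: "finite ?J" using finite_jump_times[OF c] T by auto
 obtain e where e: "e > 0" "\<And>u v. u \<in> ?J ==> v \<in> ?J ==> u ~= v ==> e <= \<bar>u - v\<bar>"
  using jump_times_separated by blast
 have "(%m. (t - s) / real m) \<longlonglongrightarrow> 0" by (rule lim_const_over_n)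
 then have "eventually (%m. (t - s) / real m < e) sequentially" using e(1) by (simp add: order_tendsto_iff)
 then have fine: "eventually (%m. 0 < m \<and> (t - s) / real m < e) sequentially"
  using eventually_gt_at_top[of 0] by eventually_elim simp
 note bij = grid_changes_bij
 have bij: "bij_betw (cell s t m) ?J (grid_changes c s t m m)"
   "\<And>u. u \<in> ?J ==> c (cell_lo s t m u) = left_val c u \<and> c (cell_hi s t m u) = c u"
  if "0 < m \<and> (t - s) / real m < e" for m
  using grid_changes_bij[of m] e(2) that by (meson less_le_trans)+
 show "eventually (%m. card (grid_changes c s t m m) = card ?J) sequentially"
  using fine by eventually_elim (metis bij(1) bij_betw_same_card)
 define B where "B m = (\<Sum>i<m. b (c (?g m i)) * (?g m (Suc i) - ?g m i))" for m
 define K where "K m = (\<Sum>i\<in>{..<m} - grid_changes c s t m m. \<integral>\<^sup>+u\<in>{?g m i<..<?g m (Suc i)}. k (c (?g m i)) u \<partial>lborel)" for m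
 have eq: "eventually (%m. ennreal (exp (B m)) * neg_exp (K m) *
   (\<Prod>u\<in>?J. ennreal (r (left_val c u) (c u) (cell_lo s t m u))) =
   ennreal (grid_weight k b r c s t m m)) sequentially"
  using fine
 proof eventually_elim
  case (elim m)
  let ?N = "grid_changes c s t m m"
  have N: "?N \<subseteq> {..<m}" "finite ?N" by (auto simp: grid_changes_def)
  let ?f = "%i. if c (?g m i) = c (?g m (Suc i)) then enn2real (surv (k (c (?g m i))) (?g m i) (?g m (Suc i)))
    else r (c (?g m i)) (c (?g m (Suc i))) (?g m i)"
  have "grid_weight k b r c s t m m = exp (B m) * (\<Prod>i<m. ?f i)"
   unfolding grid_weight_def grid_factor_def prod.distrib B_def by (simp add: exp_sum)
  also have "(\<Prod>i<m. ?f i) = (\<Prod>i\<in>{..<m} - ?N. ?f i) * (\<Prod>i\<in>?N. ?f i)"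
   using N by (intro prod.subset_diff) auto
  also have "(\<Prod>i\<in>{..<m} - ?N. ?f i) = (\<Prod>i\<in>{..<m} - ?N. enn2real (surv (k (c (?g m i))) (?g m i) (?g m (Suc i))))"
   by (intro prod.cong refl) (auto simp: grid_changes_def)
  also have "(\<Prod>i\<in>?N. ?f i) = (\<Prod>i\<in>?N. r (c (?g m i)) (c (?g m (Suc i))) (?g m i))"
   by (intro prod.cong refl) (auto simp: grid_changes_def)
  also have "... = (\<Prod>u\<in>?J. r (c (cell_lo s t m u)) (c (cell_hi s t m u)) (cell_lo s t m u))"
   by (rule prod.reindex_bij_betw[OF bij(1)[OF elim], symmetric])
  also have "... = (\<Prod>u\<in>?J. r (left_val c u) (c u) (cell_lo s t m u))"
   using bij(2)[OF elim] by (intro prod.cong refl) auto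
  finally have "ennreal (grid_weight k b r c s t m m) = ennreal (exp (B m)) *
    ennreal (\<Prod>i\<in>{..<m} - ?N. enn2real (surv (k (c (?g m i))) (?g m i) (?g m (Suc i)))) *
    (\<Prod>u\<in>?J. ennreal (r (left_val c u) (c u) (cell_lo s t m u)))"
   by (simp add: ennreal_mult prod_nonneg r_nonneg prod_ennreal mult.assoc)
  also have "ennreal (\<Prod>i\<in>{..<m} - ?N. enn2real (surv (k (c (?g m i))) (?g m i) (?g m (Suc i)))) = neg_exp (K m)"
  proof -
   have "surv f p q < \<top>" for f p q
    using surv_le_1[of f p q] by (metis ennreal_one_less_top le_less_trans)
   then show ?thesis
    unfolding K_def neg_exp_sum by (simp add: prod_ennreal[symmetric] surv_def[symmetric])
  qed
  finally show ?case by simp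
 qed
 have "(%m. \<Prod>u\<in>?J. ennreal (r (left_val c u) (c u) (cell_lo s t m u))) \<longlonglongrightarrow>
   (\<Prod>u\<in>?J. ennreal (rv (left_val c u) (c u) u))"
 proof -
  have "(%m. r (left_val c u) (c u) (cell_lo s t m u)) \<longlonglongrightarrow> rv (left_val c u) (c u) u" if "u \<in> ?J" for u
   using that by (intro filterlim_compose[OF r filterlim_cell_lo[OF T(2)]]) (auto simp: jump_times_def)
  then have "(%m. ennreal (\<Prod>u\<in>?J. r (left_val c u) (c u) (cell_lo s t m u))) \<longlonglongrightarrow>
   ennreal (\<Prod>u\<in>?J. rv (left_val c u) (c u) u)"
   by (intro tendsto_ennrealI tendsto_prod) auto
  moreover have "0 <= rv x z u" if "u \<in> ?J" for x z u
   using r_nonneg that by (intro tendsto_lowerbound[OF r[of u x z]]) (auto simp: jump_times_def)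
  ultimately show ?thesis
   by (simp add: prod_ennreal r_nonneg)
 qed
 moreover have "(%m. ennreal (exp (B m))) \<longlonglongrightarrow> ennreal (exp (LINT u:{s<..<t}|lborel. b (c u)))"
 proof (intro tendsto_ennrealI tendsto_exp)
  define b1 where "b1 = (\<Sum>x\<in>S. \<bar>b x\<bar>)"
  have b1: "\<bar>b x\<bar> <= b1" if "x \<in> S" for x
   unfolding b1_def using S(1) that by (intro member_le_sum) auto
  have cS: "c (cell_lo s t m u) \<in> S" if "0 < m" "s < u" "u <= t" for m u
   using cell_bounds[OF T(2) that] cell_lo_hi_bounds[OF T(2) that] that T by (intro S(2)) auto
  have "(%m. \<integral>u. b (c (cell_lo s t (Suc m) u)) * indicator {s<..t} u \<partial>lborel) \<longlonglongrightarrow> (\<integral>u. b (c u) * indicator {s<..<t} u \<partial>lborel)"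
  proof (rule integral_dominated_convergence[where w="%u. b1 * indicator {s<..t} u"])
   show "(%u. b (c u) * indicator {s<..<t} u) \<in> borel_measurable lborel"
    using measurable_path_comp[of b] by simp
   show "(%u. b (c (cell_lo s t (Suc m) u)) * indicator {s<..t} u) \<in> borel_measurable lborel" for m
    by measurable
   show "integrable lborel (%u. b1 * indicator {s<..t} u)"
    using T by (intro integrable_mult_right integrable_real_indicator) auto
   show "AE u in lborel. (%m. b (c (cell_lo s t (Suc m) u)) * indicator {s<..t} u) \<longlonglongrightarrow> b (c u) * indicator {s<..<t} u"
   proof -
    have "AE u in lborel. u \<notin> insert t ?J"
     using fin by (intro AE_not_in finite_imp_null_set_lborel) auto
    then show ?thesis
    proof eventually_elim
     case (elim u)
     show ?case
     proof (cases "s < u \<and> u < t")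
      case True
      then have "eventually (%m. c (cell_lo s t m u) = c u \<and> c (cell_hi s t m u) = c u) sequentially"
       using elim by (intro cell_lo_hi_eventually_path) auto
      then have "eventually (%m. c (cell_lo s t (Suc m) u) = c u \<and> c (cell_hi s t (Suc m) u) = c u) sequentially"
       by (rule eventually_sequentially_Suc[THEN iffD2])
      then have "eventually (%m. b (c (cell_lo s t (Suc m) u)) * indicator {s<..t} u = b (c u) * indicator {s<..<t} u) sequentially"
       by eventually_elim (use True in auto)
      then show ?thesis by (rule tendsto_eventually)
     next
      case False
      then have "u \<notin> {s<..t}" "u \<notin> {s<..<t}" using elim by auto
      then show ?thesis by simp
     qed
    qed
   qed
   show "AE u in lborel. norm (b (c (cell_lo s t (Suc m) u)) * indicator {s<..t} u) <= b1 * indicator {s<..t} u" for m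
    using b1[OF cS, of "Suc m"] by (auto intro!: AE_I2 simp: indicator_def)
  qed
  moreover have "(\<integral>u. b (c (cell_lo s t (Suc m) u)) * indicator {s<..t} u \<partial>lborel) = B (Suc m)" for m
  proof -
   have "(\<integral>u. b (c (cell_lo s t (Suc m) u)) * indicator {s<..t} u \<partial>lborel) =
     (\<integral>u. (\<Sum>i<Suc m. b (c (?g (Suc m) i)) * indicator {?g (Suc m) i<..?g (Suc m) (Suc i)} u) \<partial>lborel)"
    by (subst sum_cells[OF T(2)]) auto
   also have "... = (\<Sum>i<Suc m. (\<integral>u. b (c (?g (Suc m) i)) * indicator {?g (Suc m) i<..?g (Suc m) (Suc i)} u \<partial>lborel))"
    using T by (intro Bochner_Integration.integral_sum integrable_mult_right integrable_real_indicator)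
      (auto simp: grid_mono)
   also have "... = B (Suc m)"
    unfolding B_def using T by (intro sum.cong refl) (simp add: grid_mono)
   finally show ?thesis .
  qed
  ultimately have "(%m. B (Suc m)) \<longlonglongrightarrow> (\<integral>u. b (c u) * indicator {s<..<t} u \<partial>lborel)" by simp
  then have "B \<longlonglongrightarrow> (\<integral>u. b (c u) * indicator {s<..<t} u \<partial>lborel)" by (rule LIMSEQ_imp_Suc)
  then show "B \<longlonglongrightarrow> (LINT u:{s<..<t}|lborel. b (c u))" by (simp add: set_lebesgue_integral_def mult.commute)
 qed
 moreover have "(%m. neg_exp (K m)) \<longlonglongrightarrow> neg_exp (\<integral>\<^sup>+u\<in>{s<..<t}. k (c u) u \<partial>lborel)"
 proof (intro tendsto_neg_exp)
  define F where "F m u = (if c (cell_lo s t m u) = c (cell_hi s t m u) then k (c (cell_lo s t m u)) u else 0) *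
    indicator {s<..t} u" for m u
  have [measurable]: "k x \<in> borel_measurable borel" for x by (rule k)
  have F_meas: "F m \<in> borel_measurable lborel" for m
  proof -
   have "(%u. k (c (grid s t m (cell s t m u))) u) \<in> borel_measurable borel"
    by (rule measurable_compose_countable[of "%i u. k (c (grid s t m i)) u", OF _ measurable_cell]) measurable
   then show ?thesis unfolding F_def by measurable
  qed
  have "(%m. \<integral>\<^sup>+u. F m u \<partial>lborel) \<longlonglongrightarrow> (\<integral>\<^sup>+u\<in>{s<..<t}. k (c u) u \<partial>lborel)"
  proof (rule nn_integral_tendsto_below)
   show "(%u. k (c u) u * indicator {s<..<t} u) \<in> borel_measurable lborel"
    using measurable_path_rate[OF k] by simp
   have AE: "AE u in lborel. u \<notin> insert t ?J"
    using fin by (intro AE_not_in finite_imp_null_set_lborel) auto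
   show "eventually (%m. AE u in lborel. F m u <= k (c u) u * indicator {s<..<t} u) sequentially"
    using fine
   proof eventually_elim
    case (elim m)
    show ?case
     using AE
    proof eventually_elim
     case (elim u)
     show ?case
     proof (cases "s < u \<and> u < t \<and> c (cell_lo s t m u) = c (cell_hi s t m u)")
      case True
      note cb = cell_bounds[OF T(2), of m u] cell_lo_hi_bounds[OF T(2), of m u]
      have mm: "0 < m" using \<open>0 < m \<and> _\<close> by simp
      have "jump_times c (cell_lo s t m u) u = {}"
      proof (rule ccontr)
       assume "jump_times c (cell_lo s t m u) u ~= {}"
       then obtain v where v: "cell_lo s t m u < v" "v <= u" "c v ~= left_val c v" by (auto simp: jump_times_def)
       have vJ: "v \<in> ?J" using v cb mm True by (auto simp: jump_times_def)
       have "cell s t m v = cell s t m u"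
        using v cb mm True by (intro cell_eqI[OF T(2)]) auto
       then show False using bij(2)[OF \<open>0 < m \<and> _\<close> vJ] True v(3) by simp
      qed
      then have "c u = c (cell_lo s t m u)"
       using cb mm True T by (intro step_path_const'[OF c]) auto
      then show ?thesis using True by (simp add: F_def)
     qed (use elim in \<open>auto simp: F_def indicator_def\<close>)
    qed
   qed
   show "AE u in lborel. (%m. F m u) \<longlonglongrightarrow> k (c u) u * indicator {s<..<t} u"
    using AE
   proof eventually_elim
    case (elim u)
    show ?case
    proof (cases "s < u \<and> u < t")
     case True
     then have "eventually (%m. c (cell_lo s t m u) = c u \<and> c (cell_hi s t m u) = c u) sequentially"
      using elim by (intro cell_lo_hi_eventually_path) auto
     then have "eventually (%m. F m u = k (c u) u * indicator {s<..<t} u) sequentially"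
      by eventually_elim (use True in \<open>auto simp: F_def\<close>)
     then show ?thesis by (rule tendsto_eventually)
    next
     case False
     then have "u \<notin> {s<..t}" "u \<notin> {s<..<t}" using elim by auto
     then show ?thesis by (simp add: F_def)
    qed
   qed
  qed (rule F_meas)
  moreover have "eventually (%m. (\<integral>\<^sup>+u. F m u \<partial>lborel) = K m) sequentially"
   using eventually_gt_at_top[of 0]
  proof eventually_elim
   case (elim m)
   let ?k = "%i u. if c (?g m i) = c (?g m (Suc i)) then k (c (?g m i)) u else 0"
   have "(\<integral>\<^sup>+u. F m u \<partial>lborel) = (\<integral>\<^sup>+u. (\<Sum>i<m. ?k i u * indicator {?g m i<..?g m (Suc i)} u) \<partial>lborel)"
    unfolding F_def by (intro nn_integral_cong) (simp add: sum_cells[OF T(2) elim])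
   also have "... = (\<Sum>i<m. \<integral>\<^sup>+u\<in>{?g m i<..?g m (Suc i)}. ?k i u \<partial>lborel)"
    by (intro nn_integral_sum) measurable
   also have "... = (\<Sum>i\<in>{..<m} - grid_changes c s t m m. \<integral>\<^sup>+u\<in>{?g m i<..?g m (Suc i)}. ?k i u \<partial>lborel)"
    by (intro sum.mono_neutral_right) (auto simp: grid_changes_def)
   also have "... = K m"
    unfolding K_def
   proof (intro sum.cong refl nn_integral_cong_AE)
    fix i assume "i \<in> {..<m} - grid_changes c s t m m"
    then have cc: "c (?g m i) = c (?g m (Suc i))" by (auto simp: grid_changes_def)
    show "AE u in lborel. ?k i u * indicator {?g m i<..?g m (Suc i)} u =
      k (c (?g m i)) u * indicator {?g m i<..<?g m (Suc i)} u"
     using AE_lborel_singleton[of "?g m (Suc i)"] by eventually_elim (auto simp: indicator_def cc)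
   qed
   finally show ?case .
  qed
  ultimately show "K \<longlonglongrightarrow> (\<integral>\<^sup>+u\<in>{s<..<t}. k (c u) u \<partial>lborel)"
   by (rule Lim_transform_eventually)
 qed
 ultimately have lim: "(%m. ennreal (exp (B m)) * neg_exp (K m) *
   (\<Prod>u\<in>?J. ennreal (r (left_val c u) (c u) (cell_lo s t m u)))) \<longlonglongrightarrow> path_weight k b rv c s t"
  unfolding path_weight_def
 proof (intro tendsto_mult_ennreal)
  have 1: "neg_exp a ~= \<top>" for a using neg_exp_le_1[of a] by (metis ennreal_one_neq_top top_unique)
  have "(\<Prod>u\<in>?J. ennreal (rv (left_val c u) (c u) u)) ~= \<top>"
   by (simp add: ennreal_prod_eq_top)
  with 1 show "\<not> (ennreal (exp (LINT u:{s<..<t}|lborel. b (c u))) * neg_exp (\<integral>\<^sup>+u\<in>{s<..<t}. k (c u) u \<partial>lborel) = 0 \<and>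
    (\<Prod>u\<in>?J. ennreal (rv (left_val c u) (c u) u)) = \<infinity> \<or>
    ennreal (exp (LINT u:{s<..<t}|lborel. b (c u))) * neg_exp (\<integral>\<^sup>+u\<in>{s<..<t}. k (c u) u \<partial>lborel) = \<infinity> \<and>
    (\<Prod>u\<in>?J. ennreal (rv (left_val c u) (c u) u)) = 0)"
   by (auto simp: ennreal_mult_eq_top_iff)
  show "\<not> (ennreal (exp (LINT u:{s<..<t}|lborel. b (c u))) = 0 \<and> neg_exp (\<integral>\<^sup>+u\<in>{s<..<t}. k (c u) u \<partial>lborel) = \<infinity> \<or>
    ennreal (exp (LINT u:{s<..<t}|lborel. b (c u))) = \<infinity> \<and> neg_exp (\<integral>\<^sup>+u\<in>{s<..<t}. k (c u) u \<partial>lborel) = 0)"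
   using 1 by auto
 qed
 show "(%m. ennreal (grid_weight k b r c s t m m)) \<longlonglongrightarrow> path_weight k b rv c s t"
  by (rule Lim_transform_eventually[OF lim eq])
qed

end

section \<open>Independent Poisson increments\<close>

lemma sets_sigma_join: "subalgebra M A ==> subalgebra M B ==>
  sets (sigma_join M A B) = sigma_sets (space M) (sets A \<union> sets B)"
 unfolding sigma_join_def subalgebra_def using sets.space_closed[of A] sets.space_closed[of B]
 by (intro sets_measure_of) auto

lemma space_sigma_join [simp]: "space (sigma_join M A B) = space M"
 unfolding sigma_join_def by (simp add: space_measure_of_conv)

lemma subalgebra_sigma_join:
 assumes "subalgebra M A" "subalgebra M B"
 shows "subalgebra M (sigma_join M A B)"
  and "sets A \<subseteq> sets (sigma_join M A B)" "sets B \<subseteq> sets (sigma_join M A B)"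
 using assms unfolding subalgebra_def sets_sigma_join[OF assms] by (auto intro!: sets.sigma_sets_subset)

lemma sigma_join_least:
 assumes "subalgebra M A" "subalgebra M B" "space C = space M" "sets A \<subseteq> sets C" "sets B \<subseteq> sets C"
 shows "sets (sigma_join M A B) \<subseteq> sets C"
 unfolding sets_sigma_join[OF assms(1,2)] using assms(3-5) sets.sigma_sets_subset[of "sets A \<union> sets B" C] by auto

lemma subalgebra_sigma_var:
 assumes "Z \<in> measurable M (count_space UNIV)"
 shows "subalgebra M (sigma_var M Z)"
 using assms unfolding subalgebra_def sigma_var_def
 by (auto simp: sets_vimage_algebra2 measurable_def)

lemma measurable_sigma_var: "Z \<in> measurable (sigma_var M Z) (count_space UNIV)"
 unfolding sigma_var_def by (intro measurable_vimage_algebra1) auto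

context
 fixes M :: "'a measure" and T :: real and U :: "real => 'a => real"
 assumes U: "\<And>t. 0 <= t ==> t <= T ==> U t \<in> borel_measurable M"
begin

lemma sets_sigma_upto:
 "sets (sigma_upto M U t) = sigma_sets (space M) (\<Union>r\<in>{0..t}. sets (vimage_algebra (space M) (U r) borel))"
 unfolding sigma_upto_def by (intro sets_measure_of) (auto simp: sets_vimage_algebra2)

lemma space_sigma_upto [simp]: "space (sigma_upto M U t) = space M"
 by (simp add: sigma_upto_def space_measure_of_conv)

lemma measurable_sigma_upto:
 assumes "0 <= r" "r <= t"
 shows "U r \<in> borel_measurable (sigma_upto M U t)"
proof (rule measurableI)
 fix B :: "real set" assume "B \<in> sets borel"
 then show "U r -` B \<inter> space (sigma_upto M U t) \<in> sets (sigma_upto M U t)"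
  using assms unfolding sets_sigma_upto space_sigma_upto
  by (intro sigma_sets.Basic UN_I[of r]) (auto simp: sets_vimage_algebra2)
qed simp

lemma sigma_upto_mono: "t <= t' ==> sets (sigma_upto M U t) \<subseteq> sets (sigma_upto M U t')"
 unfolding sets_sigma_upto by (intro sigma_sets_mono' UN_mono) auto

lemma subalgebra_sigma_upto: "t <= T ==> subalgebra M (sigma_upto M U t)"
 unfolding subalgebra_def sets_sigma_upto space_sigma_upto
proof (intro conjI sets.sigma_sets_subset subsetI refl)
 fix B assume "t <= T" "B \<in> (\<Union>r\<in>{0..t}. sets (vimage_algebra (space M) (U r) borel))"
 then obtain r C where "0 <= r" "r <= T" "C \<in> sets borel" "B = U r -` C \<inter> space M"
  by (auto simp: sets_vimage_algebra2)
 then show "B \<in> sets M" using measurable_sets[OF U, of r C] by simp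
qed

end

lemma sets_sigma_null:
 assumes "subalgebra M A"
 shows "sets (sigma (space M) (sets A \<union> null_sets M)) = sigma_sets (space M) (sets A \<union> null_sets M)"
 using assms sets.space_closed[of A] sets.space_closed[of M] unfolding subalgebra_def
 by (intro sets_measure_of) (auto simp: null_sets_def)

text \<open>Events that agree with an event of the \<open>\<pi>\<close>-system \<open>P\<close> up to a null set.\<close>
definition null_modifications :: "'a measure => 'a set set => 'a set set" where
 "null_modifications M P = {B \<in> sets M. \<exists>D\<in>P. (B - D) \<union> (D - B) \<in> null_sets M}"

text \<open>Independence from a completed \<open>\<sigma>\<close>-algebra is proved on an intersection
  stable generator; allowing null modifications absorbs the completion.\<close>
lemma Int_stable_null_modifications:
 assumes "Int_stable P" "P \<subseteq> sets M"
 shows "Int_stable (null_modifications M P)"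
 unfolding Int_stable_def
proof (intro ballI)
 fix B C assume "B \<in> null_modifications M P" "C \<in> null_modifications M P"
 then obtain D E where *: "B \<in> sets M" "C \<in> sets M" "D \<in> P" "E \<in> P"
  "(B - D) \<union> (D - B) \<in> null_sets M" "(C - E) \<union> (E - C) \<in> null_sets M"
  by (auto simp: null_modifications_def)
 have "(B \<inter> C - D \<inter> E) \<union> (D \<inter> E - B \<inter> C) \<in> null_sets M"
 proof (rule null_sets_subset)
  show "((B - D) \<union> (D - B)) \<union> ((C - E) \<union> (E - C)) \<in> null_sets M" by (rule null_sets.Un[OF *(5,6)])
 qed (use * assms(2) in auto)
 then show "B \<inter> C \<in> null_modifications M P"
  using * assms(1) unfolding null_modifications_def Int_stable_def by blast
qed

text \<open>All assumptions except those on the rates and on the density.\<close>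
locale driven_chain = prob_space Q for Q :: "'a measure" +
 fixes T :: real and d :: nat and F :: "real => 'a measure" and \<xi> :: "'a => nat"
  and a :: "nat => nat => real" and N :: "nat => nat => real => 'a => real"
  and X :: "real => 'a => nat"
 assumes T_pos: "T > 0" and complete_Q: "complete_measure Q" and usual: "usual_conditions T Q F"
  and \<xi>_meas: "\<xi> \<in> measurable Q (count_space UNIV)"
  and poisson: "indep_poisson_family T Q d a N (sigma_join Q (F T) (sigma_var Q \<xi>))"
  and a_pos: "\<And>x y. (x, y) \<in> state_pairs d ==> 0 < a x y"
  and sde: "solves_sde T Q d (driving_filtration T Q d N \<xi>) N \<xi> X"
begin

abbreviation "G \<equiv> driving_filtration T Q d N \<xi>"

definition Gh :: "real => 'a measure" where
 "Gh s = sigma_join Q (F T) (G s)"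

abbreviation "Np p \<equiv> N (fst p) (snd p)"
abbreviation "ap p \<equiv> a (fst p) (snd p)"
abbreviation "I \<equiv> state_pairs d"
abbreviation "S \<equiv> {1..d}"

lemma finite_I [simp]: "finite I"
proof (rule finite_subset)
 show "I \<subseteq> S \<times> S" by (auto simp: state_pairs_def)
qed auto

lemma poisson_p: "p \<in> I ==> poisson_process T Q (ap p) (Np p)"
 using poisson by (auto simp: indep_poisson_family_def)

lemma ap_pos: "p \<in> I ==> 0 < ap p"
 using a_pos[of "fst p" "snd p"] by simp

lemma N_meas: "p \<in> I ==> 0 <= t ==> t <= T ==> Np p t \<in> borel_measurable Q"
 using poisson_p by (auto simp: poisson_process_def)

lemma F_subalg: "0 <= t ==> t <= T ==> subalgebra Q (F t)"
 and F_mono: "0 <= s ==> s <= t ==> t <= T ==> sets (F s) \<subseteq> sets (F t)"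
 and F_null: "0 <= t ==> t <= T ==> null_sets Q \<subseteq> sets (F t)"
 using usual by (auto simp: usual_conditions_def)

lemma null_subset: "B \<in> null_sets Q ==> A \<subseteq> B ==> A \<in> null_sets Q"
 using complete_Q by (metis complete_measure.complete2 null_sets_subset)

lemma sigma_null_subset:
 assumes "subalgebra Q A"
 shows "sigma_sets (space Q) (sets A \<union> null_sets Q) \<subseteq> sets Q"
 using assms unfolding subalgebra_def by (intro sets.sigma_sets_subset) auto

lemma sets_gen_filtration:
 fixes p t
 defines "A \<equiv> (\<Inter>s\<in>(if t < T then {t<..T} else {t}).
   sigma_sets (space Q) (sets (sigma_upto Q (Np p) s) \<union> null_sets Q))"
 assumes "p \<in> I" "0 <= t" "t <= T"
 shows "sets (gen_filtration T Q (Np p) t) = sigma_sets (space Q) A" and "A \<subseteq> sets Q"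
proof -
 let ?A = A
 have sub: "subalgebra Q (sigma_upto Q (Np p) s)" if "s \<in> (if t < T then {t<..T} else {t})" for s
  using that assms N_meas by (intro subalgebra_sigma_upto[of T]) (auto split: if_splits)
 have eq: "(\<Inter>s\<in>(if t < T then {t<..T} else {t}).
     sets (sigma (space Q) (sets (sigma_upto Q (Np p) s) \<union> null_sets Q))) = ?A"
  unfolding A_def by (intro INF_cong refl sets_sigma_null sub)
 have ne: "(if t < T then {t<..T} else {t}) ~= {}" by auto
 show A: "?A \<subseteq> sets Q"
  unfolding A_def using sigma_null_subset[OF sub] ne by blast
 show "sets (gen_filtration T Q (Np p) t) = sigma_sets (space Q) ?A"
  unfolding gen_filtration_def eq using A sets.space_closed[of Q] by (intro sets_measure_of) blast
qed

lemma gen_filtration_subset: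
 assumes "p \<in> I" "0 <= s" "s < r" "r <= T"
 shows "sets (gen_filtration T Q (Np p) s) \<subseteq> sigma_sets (space Q) (sets (sigma_upto Q (Np p) r) \<union> null_sets Q)"
proof -
 interpret S: sigma_algebra "space Q" "sigma_sets (space Q) (sets (sigma_upto Q (Np p) r) \<union> null_sets Q)"
  using sigma_null_subset[OF subalgebra_sigma_upto[of T "Np p" Q r]] assms N_meas sets.space_closed[of Q]
   subalgebra_sigma_upto[of T "Np p" Q r]
  by (intro sigma_algebra_sigma_sets) (auto simp: subalgebra_def null_sets_def)
 show ?thesis
  unfolding sets_gen_filtration[OF assms(1,2) order_trans[OF less_imp_le[OF assms(3)] assms(4)]]
  using assms by (intro S.sigma_sets_subset) auto
qed

lemma G_sets:
 fixes t
 defines "A \<equiv> (\<Union>p\<in>I. sets (gen_filtration T Q (Np p) t)) \<union> sets (sigma_var Q \<xi>) \<union> null_sets Q"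
 assumes "0 <= t" "t <= T"
 shows "sets (G t) = sigma_sets (space Q) A" and "A \<subseteq> sets Q"
proof -
 let ?A = A
 have "sets (gen_filtration T Q (Np p) t) \<subseteq> sets Q" if "p \<in> I" for p
  unfolding sets_gen_filtration(1)[OF that assms(2,3)]
  by (intro sets.sigma_sets_subset sets_gen_filtration(2) that assms)
 then show A: "?A \<subseteq> sets Q"
  unfolding A_def using subalgebra_sigma_var[OF \<xi>_meas] by (auto simp: subalgebra_def)
 have "(\<Union>(x, y)\<in>I. sets (gen_filtration T Q (N x y) t)) = (\<Union>p\<in>I. sets (gen_filtration T Q (Np p) t))"
  by (auto simp: split_beta)
 then show "sets (G t) = sigma_sets (space Q) ?A"
  unfolding driving_filtration_def A_def[symmetric] using A sets.space_closed[of Q]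
  by (simp add: A_def[symmetric] sets_measure_of subset_trans)
qed

lemma G_subalg: "0 <= t ==> t <= T ==> subalgebra Q (G t)"
 using sets.sigma_sets_subset[OF G_sets(2)] unfolding subalgebra_def G_sets(1)
 by (auto simp: driving_filtration_def space_measure_of_conv)

lemma G_mono:
 assumes "0 <= s" "s <= t" "t <= T"
 shows "sets (G s) \<subseteq> sets (G t)"
proof (cases "s = t")
 case False
 have "sets (gen_filtration T Q (Np p) s) \<subseteq> sets (gen_filtration T Q (Np p) t)" if p: "p \<in> I" for p
 proof -
  let ?\<Sigma> = "%r. sigma_sets (space Q) (sets (sigma_upto Q (Np p) r) \<union> null_sets Q)"
  have sub: "?\<Sigma> r \<subseteq> ?\<Sigma> r'" if "r <= r'" "r' <= T" for r r'
   using sigma_upto_mono[of T "Np p" Q r r'] N_meas[OF p] that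
   by (intro sigma_sets_mono') auto
  have "(\<Inter>r\<in>(if s < T then {s<..T} else {s}). ?\<Sigma> r) \<subseteq> (\<Inter>r\<in>(if t < T then {t<..T} else {t}). ?\<Sigma> r)"
  proof (intro INF_greatest INF_lower)
   fix r assume "r \<in> (if t < T then {t<..T} else {t})"
   then show "r \<in> (if s < T then {s<..T} else {s})" using False assms by (auto split: if_splits)
  qed
  then show ?thesis
   unfolding sets_gen_filtration(1)[OF p assms(1) order_trans[OF assms(2,3)]]
    sets_gen_filtration(1)[OF p order_trans[OF assms(1,2)] assms(3)]
   by (rule sigma_sets_mono')
 qed
 then show ?thesis
  using assms by (subst (1 2) G_sets) (auto intro!: sigma_sets_mono' del: subsetI simp: UN_mono le_supI1 Un_mono)
qed simp

lemma Gh_subalg: "0 <= t ==> t <= T ==> subalgebra Q (Gh t)"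
 and FT_Gh: "0 <= t ==> t <= T ==> sets (F T) \<subseteq> sets (Gh t)"
 and G_Gh: "0 <= t ==> t <= T ==> sets (G t) \<subseteq> sets (Gh t)"
 unfolding Gh_def using T_pos by (auto intro!: subalgebra_sigma_join F_subalg G_subalg del: subsetI)

lemma space_Gh [simp]: "space (Gh t) = space Q"
 by (simp add: Gh_def)

lemma F_Gh: "0 <= s ==> s <= T ==> 0 <= t ==> t <= T ==> sets (F s) \<subseteq> sets (Gh t)"
 using F_mono[of s T] FT_Gh[of t] by auto

lemma Gh_null: "0 <= t ==> t <= T ==> null_sets Q \<subseteq> sets (Gh t)"
 using F_null[of T] FT_Gh[of t] T_pos by auto

lemma Gh_mono:
 assumes "0 <= s" "s <= t" "t <= T"
 shows "sets (Gh s) \<subseteq> sets (Gh t)"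
 unfolding Gh_def[of s]
 using assms T_pos G_mono[OF assms] G_Gh[of t] FT_Gh[of t] by (intro sigma_join_least F_subalg G_subalg) auto

text \<open>The increments over \<open>]s,t]\<close> are independent of the enlarged \<open>\<sigma>\<close>-algebra at time \<open>s\<close>. For increments
 over \<open>]r,t]\<close> with \<open>r > s\<close> this follows from the natural filtrations; right continuity allows \<open>r\<close> to
 decrease to \<open>s\<close>.\<close>

definition incr_event :: "(nat \<times> nat => nat) => real => real => 'a set" where
 "incr_event \<kappa> r t = {om \<in> space Q. \<forall>p\<in>I. Np p t om - Np p r om = real (\<kappa> p)}"

definition incr_prob :: "(nat \<times> nat => nat) => real => real" where
 "incr_prob \<kappa> h = (\<Prod>p\<in>I. (ap p * h) ^ \<kappa> p / fact (\<kappa> p) * exp (- (ap p * h)))"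

lemma incr_event_meas:
 assumes "0 <= r" "r <= t" "t <= T"
 shows "incr_event \<kappa> r t \<in> sets Q"
proof -
 have [measurable]: "Np p t \<in> borel_measurable Q" "Np p r \<in> borel_measurable Q" if "p \<in> I" for p
  using N_meas[OF that] assms by auto
 show ?thesis unfolding incr_event_def by measurable
qed

lemma incr_event_indep_natural:
 assumes r: "0 <= r" "r <= t" "t <= T"
  and C: "C \<in> sets (sigma_join Q (F T) (sigma_var Q \<xi>))" and A: "\<And>p. p \<in> I ==> A p \<in> sets (sigma_upto Q (Np p) r)"
 shows "prob (C \<inter> {om \<in> space Q. \<forall>p\<in>I. om \<in> A p} \<inter> incr_event \<kappa> r t) =
  prob (C \<inter> {om \<in> space Q. \<forall>p\<in>I. om \<in> A p}) * incr_prob \<kappa> (t - r)"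
proof -
 let ?H = "%p. sigma_upto Q (Np p) T"
 have sub: "subalgebra Q (sigma_upto Q (Np p) t)" if "p \<in> I" "t <= T" for p t
  using that N_meas by (intro subalgebra_sigma_upto[of T]) auto
 have A_T: "A p \<in> sets (?H p)" if "p \<in> I" for p
  using A[OF that] sigma_upto_mono[of T "Np p" Q r T] N_meas[OF that] r by auto
 define D where "D p = {om \<in> space Q. Np p t om - Np p r om = real (\<kappa> p)}" for p
 have D_T: "D p \<in> sets (?H p)" if p: "p \<in> I" for p
 proof -
  have [measurable]: "Np p t \<in> borel_measurable (?H p)" "Np p r \<in> borel_measurable (?H p)"
   using r N_meas[OF p] by (auto intro!: measurable_sigma_upto[of T])
  have "{om \<in> space (?H p). Np p t om - Np p r om = real (\<kappa> p)} \<in> sets (?H p)" by measurable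
  then show ?thesis using space_sigma_upto[of T "Np p" Q T] N_meas[OF p] by (simp add: D_def)
 qed
 let ?\<Sigma> = "sigma (space Q) (\<Union>(x, y)\<in>state_pairs d. sets (sigma_upto Q (N x y) T))"
 have "sets (sigma_upto Q (N x y) T) \<subseteq> Pow (space Q)" if "(x, y) \<in> I" for x y
  using sub[OF that, of T] sets.space_closed[of Q] by (auto simp: subalgebra_def)
 then have "(\<Union>(x, y)\<in>state_pairs d. sets (sigma_upto Q (N x y) T)) \<subseteq> Pow (space Q)"
  by blast
 then have \<Sigma>: "sets ?\<Sigma> = sigma_sets (space Q) (\<Union>p\<in>I. sets (?H p))"
  by (subst sets_measure_of) (auto simp: split_beta)
 have \<Sigma>_in: "{om \<in> space Q. \<forall>p\<in>I. om \<in> B p} \<in> sets ?\<Sigma>" if B: "\<And>p. p \<in> I ==> B p \<in> sets (?H p)" for B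
 proof -
  have sp: "space ?\<Sigma> = space Q" by (simp add: space_measure_of_conv)
  have "B p \<in> sets ?\<Sigma>" if "p \<in> I" for p
   unfolding \<Sigma> using B[OF that] that by (intro sigma_sets.Basic) auto
  then have *: "space ?\<Sigma> \<inter> B p \<in> sets ?\<Sigma>" if "p \<in> I" for p
   using that by (intro sets.Int sets.top) auto
  have "{om \<in> space ?\<Sigma>. om \<in> B p} \<in> sets ?\<Sigma>" if "p \<in> I" for p
   using *[OF that] by (simp only: Int_def Collect_mem_eq)
  then have "{om \<in> space ?\<Sigma>. \<forall>p\<in>I. om \<in> B p} \<in> sets ?\<Sigma>"
   by (rule sets.sets_Collect_finite_All[OF _ finite_I])
  then show ?thesis by (simp only: sp)
 qed
 have ind1: "prob (M \<inter> C) = prob M * prob C" if "M \<in> sets ?\<Sigma>" for M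
  using poisson C that unfolding indep_poisson_family_def by (auto intro: indep_setD)
 have ind2: "prob {om \<in> space Q. \<forall>p\<in>I. om \<in> B p} = (\<Prod>p\<in>I. prob (B p))" if B: "\<And>p. p \<in> I ==> B p \<in> sets (?H p)" for B
 proof (cases "I = {}")
  case False
  have "B p \<subseteq> space Q" if "p \<in> I" for p
   using B[OF that] sub[OF that order_refl] sets.sets_into_space[of "B p" Q] by (auto simp: subalgebra_def)
  then have "{om \<in> space Q. \<forall>p\<in>I. om \<in> B p} = (\<Inter>p\<in>I. B p)" using False by auto
  moreover have "indep_sets (%p. sets (?H p)) I"
   using poisson unfolding indep_poisson_family_def by (simp add: split_beta')
  ultimately show ?thesis
   using indep_setsD[of "%p. sets (?H p)" I I B] B False by simp
 qed (simp add: prob_space)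
 have ind3: "prob (A p \<inter> D p) = prob (A p) * prob (D p)" if p: "p \<in> I" for p
 proof -
  have "indep_set (sets (sigma_upto Q (Np p) r)) (sets (vimage_algebra (space Q) (%om. Np p t om - Np p r om) borel))"
   using poisson_p[OF p] r by (auto simp: poisson_process_def)
  moreover have "D p \<in> sets (vimage_algebra (space Q) (%om. Np p t om - Np p r om) borel)"
   unfolding D_def by (subst sets_vimage_algebra2) (auto intro!: exI[of _ "{real (\<kappa> p)}"])
  ultimately show ?thesis using A[OF p] by (intro indep_setD)
 qed
 have pD: "prob (D p) = (ap p * (t - r)) ^ \<kappa> p / fact (\<kappa> p) * exp (- (ap p * (t - r)))" if "p \<in> I" for p
  using poisson_p[OF that] r unfolding D_def poisson_process_def by auto
 have AD: "A p \<inter> D p \<in> sets (?H p)" if "p \<in> I" for p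
  using A_T D_T that by (intro sets.Int)
 have "C \<inter> {om \<in> space Q. \<forall>p\<in>I. om \<in> A p} \<inter> incr_event \<kappa> r t = {om \<in> space Q. \<forall>p\<in>I. om \<in> A p \<inter> D p} \<inter> C"
  by (auto simp: D_def incr_event_def)
 then have "prob (C \<inter> {om \<in> space Q. \<forall>p\<in>I. om \<in> A p} \<inter> incr_event \<kappa> r t) = (\<Prod>p\<in>I. prob (A p \<inter> D p)) * prob C"
  by (simp only: ind1[OF \<Sigma>_in[OF AD]] ind2[OF AD])
 also have "... = (\<Prod>p\<in>I. prob (A p)) * prob C * incr_prob \<kappa> (t - r)"
 proof -
  have "(\<Prod>p\<in>I. prob (A p \<inter> D p)) = (\<Prod>p\<in>I. prob (A p)) * incr_prob \<kappa> (t - r)"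
   unfolding incr_prob_def prod.distrib[symmetric] by (intro prod.cong refl) (simp add: ind3 pD)
  then show ?thesis by (simp only: mult_ac)
 qed
 also have "(\<Prod>p\<in>I. prob (A p)) * prob C = prob ({om \<in> space Q. \<forall>p\<in>I. om \<in> A p} \<inter> C)"
  by (simp only: ind1[OF \<Sigma>_in[OF A_T]] ind2[OF A_T])
 finally show ?thesis by (simp add: Int_commute)
qed

text \<open>The events \<open>A \<inter> B\<close> with \<open>A\<close> from \<open>F T \<or>
  \<sigma>(\<xi>)\<close> and \<open>B\<close> a product of events from the natural filtrations up to
  \<open>r\<close> generate all of \<open>Gh s\<close> up to null sets, because the right limits at \<open>s
  < r\<close> are contained in time \<open>r\<close>.\<close>
lemma incr_event_indep_after:
 assumes r: "0 <= s" "s < r" "r <= t" "t <= T" and B: "B \<in> sets (Gh s)"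
 shows "prob (B \<inter> incr_event \<kappa> r t) = prob B * incr_prob \<kappa> (t - r)"
proof -
 define P where "P = {C \<inter> {om \<in> space Q. \<forall>p\<in>I. om \<in> A p} | C A.
   C \<in> sets (sigma_join Q (F T) (sigma_var Q \<xi>)) \<and> (\<forall>p\<in>I. A p \<in> sets (sigma_upto Q (Np p) r))}"
 have r0: "0 <= r" "s <= T" using r by auto
 have sub: "subalgebra Q (sigma_upto Q (Np p) r)" if "p \<in> I" for p
  using that N_meas r by (intro subalgebra_sigma_upto[of T]) auto
 have sub0: "subalgebra Q (sigma_join Q (F T) (sigma_var Q \<xi>))"
  using T_pos by (intro subalgebra_sigma_join F_subalg subalgebra_sigma_var \<xi>_meas) auto
 have P_sets: "P \<subseteq> sets Q"
 proof
  fix D assume "D \<in> P"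
  then obtain C A where D: "D = C \<inter> {om \<in> space Q. \<forall>p\<in>I. om \<in> A p}" "C \<in> sets (sigma_join Q (F T) (sigma_var Q \<xi>))"
   "\<forall>p\<in>I. A p \<in> sets (sigma_upto Q (Np p) r)" by (auto simp: P_def)
  have [measurable]: "C \<in> sets Q" using D(2) sub0 by (auto simp: subalgebra_def)
  have [measurable]: "A p \<in> sets Q" if "p \<in> I" for p
   using D(3) sub[OF that] that by (auto simp: subalgebra_def simp del: split_paired_All)
  show "D \<in> sets Q" unfolding D(1) by measurable
 qed
 have P_Int: "Int_stable P"
  unfolding Int_stable_def
 proof (intro ballI)
  fix D E assume "D \<in> P" "E \<in> P"
  then obtain C A C' A' where D: "D = C \<inter> {om \<in> space Q. \<forall>p\<in>I. om \<in> A p}" "C \<in> sets (sigma_join Q (F T) (sigma_var Q \<xi>))"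
   "\<forall>p\<in>I. A p \<in> sets (sigma_upto Q (Np p) r)"
   and E: "E = C' \<inter> {om \<in> space Q. \<forall>p\<in>I. om \<in> A' p}" "C' \<in> sets (sigma_join Q (F T) (sigma_var Q \<xi>))"
   "\<forall>p\<in>I. A' p \<in> sets (sigma_upto Q (Np p) r)" by (auto simp: P_def)
  have "D \<inter> E = (C \<inter> C') \<inter> {om \<in> space Q. \<forall>p\<in>I. om \<in> A p \<inter> A' p}" using D(1) E(1) by auto
  then show "D \<inter> E \<in> P"
   unfolding P_def using D E by (intro CollectI exI[of _ "C \<inter> C'"] exI[of _ "%p. A p \<inter> A' p"]) auto
 qed
 define P' where "P' = null_modifications Q P"
 have P'_sets: "P' \<subseteq> sets Q" by (auto simp: P'_def null_modifications_def)
 have P_P': "P \<subseteq> P'"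
 proof
  fix D assume "D \<in> P"
  then show "D \<in> P'"
   using P_sets unfolding P'_def null_modifications_def by (intro CollectI conjI bexI[of _ D]) auto
 qed
 have top_upto: "space Q \<in> sets (sigma_upto Q (Np p) r)" if "p \<in> I" for p
  using sets.top[of "sigma_upto Q (Np p) r"] sub[OF that] by (metis subalgebra_def)
 have inP: "C \<in> P" if "C \<in> sets (sigma_join Q (F T) (sigma_var Q \<xi>))" for C
  unfolding P_def using that sets.sets_into_space[OF that] top_upto
  by (intro CollectI exI[of _ C] exI[of _ "%_. space Q"]) auto
 have null_P': "null_sets Q \<subseteq> P'"
 proof
  fix B assume "B \<in> null_sets Q"
  then show "B \<in> P'"
   using inP[of "{}"] unfolding P'_def null_modifications_def by (intro CollectI conjI bexI[of _ "{}"]) auto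
 qed
 have E: "incr_event \<kappa> r t \<in> sets Q" using r by (intro incr_event_meas) auto
 have indP: "prob (D \<inter> incr_event \<kappa> r t) = prob D * incr_prob \<kappa> (t - r)" if "D \<in> P" for D
  using that r r0 unfolding P_def by (auto intro!: incr_event_indep_natural)
 have pE: "prob (incr_event \<kappa> r t) = incr_prob \<kappa> (t - r)"
 proof -
  have "space Q \<in> sets (sigma_join Q (F T) (sigma_var Q \<xi>))"
   using sets.top[of "sigma_join Q (F T) (sigma_var Q \<xi>)"] by simp
  from indP[OF inP[OF this]] show ?thesis
   using sets.Int_space_eq1[OF E] by (simp add: prob_space)
 qed
 have "indep_set P' {incr_event \<kappa> r t}"
 proof (rule indep_setI)
  fix B E' assume B: "B \<in> P'" and "E' \<in> {incr_event \<kappa> r t}"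
  then have E': "E' = incr_event \<kappa> r t" by simp
  obtain D where D: "B \<in> sets Q" "D \<in> P" "(B - D) \<union> (D - B) \<in> null_sets Q"
   using B by (auto simp: P'_def null_modifications_def)
  have AE: "AE om in Q. om \<in> B \<longleftrightarrow> om \<in> D"
   using AE_not_in[OF D(3)] by eventually_elim auto
  have "prob (B \<inter> incr_event \<kappa> r t) = prob (D \<inter> incr_event \<kappa> r t)"
   using AE D P_sets E by (intro measure_eq_AE) auto
  moreover have "prob B = prob D"
   using AE D P_sets by (intro measure_eq_AE) auto
  ultimately show "prob (B \<inter> E') = prob B * prob E'"
   by (simp add: E' indP[OF D(2)] pE)
 qed (use P'_sets E in auto)
 then have "indep_set (sigma_sets (space Q) P') (sigma_sets (space Q) {incr_event \<kappa> r t})"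
  unfolding P'_def by (intro indep_set_sigma_sets Int_stable_null_modifications P_Int P_sets) (auto simp: Int_stable_def)
 moreover have "B \<in> sigma_sets (space Q) P'"
 proof -
  define \<Sigma> where "\<Sigma> = sigma (space Q) P'"
  have P'_Pow: "P' \<subseteq> Pow (space Q)" using P'_sets sets.space_closed[of Q] by blast
  have \<Sigma>: "sets \<Sigma> = sigma_sets (space Q) P'" "space \<Sigma> = space Q"
   unfolding \<Sigma>_def using P'_Pow by (auto simp: space_measure_of_conv)
  have P'_\<Sigma>: "P' \<subseteq> sets \<Sigma>" unfolding \<Sigma>(1) by auto
  have gen: "sigma_sets (space Q) K \<subseteq> sets \<Sigma>" if "K \<subseteq> sets \<Sigma>" for K
   using sets.sigma_sets_subset[OF that] by (simp add: \<Sigma>(2))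
  have upto: "A \<in> P" if p: "p \<in> I" and A: "A \<in> sets (sigma_upto Q (Np p) r)" for p A
  proof -
   have "A \<subseteq> space Q" using A sub[OF p] sets.sets_into_space[of A Q] by (auto simp: subalgebra_def)
   have "A = space Q \<inter> {om \<in> space Q. \<forall>q\<in>I. om \<in> (if q = p then A else space Q)}" (is "_ = ?R")
   proof (intro antisym subsetI)
    fix om assume "om \<in> ?R"
    then have "om \<in> (if p = p then A else space Q)" using p by blast
    then show "om \<in> A" by simp
   next
    fix om assume om: "om \<in> A"
    then have "om \<in> space Q" using \<open>A \<subseteq> space Q\<close> by blast
    show "om \<in> ?R"
    proof (intro IntI CollectI conjI ballI)
     fix q show "om \<in> (if q = p then A else space Q)"
      using om \<open>om \<in> space Q\<close> by (cases "q = p") simp_all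
    qed fact+
   qed
   show ?thesis
    unfolding P_def
   proof (intro CollectI exI conjI ballI)
    show "A = space Q \<inter> {om \<in> space Q. \<forall>q\<in>I. om \<in> (if q = p then A else space Q)}" by fact
    show "space Q \<in> sets (sigma_join Q (F T) (sigma_var Q \<xi>))"
     using sets.top[of "sigma_join Q (F T) (sigma_var Q \<xi>)"] by simp
    fix q assume "q \<in> I"
    then show "(if q = p then A else space Q) \<in> sets (sigma_upto Q (Np q) r)"
     using A top_upto by simp
   qed
  qed
  have Gs: "sets (G s) \<subseteq> sets \<Sigma>"
   unfolding G_sets(1)[OF r(1) r0(2)]
  proof (rule gen, safe)
   fix x y B assume "(x, y) \<in> I" "B \<in> sets (gen_filtration T Q (Np (x, y)) s)"
   then have "B \<in> sigma_sets (space Q) (sets (sigma_upto Q (Np (x, y)) r) \<union> null_sets Q)"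
    using gen_filtration_subset[of "(x, y)" s r] r by auto
   moreover have "sets (sigma_upto Q (Np (x, y)) r) \<union> null_sets Q \<subseteq> sets \<Sigma>"
    using upto[OF \<open>(x, y) \<in> I\<close>] P_P' P'_\<Sigma> null_P' by blast
   ultimately show "B \<in> sets \<Sigma>" using gen by blast
  next
   fix B assume "B \<in> sets (sigma_var Q \<xi>)"
   then have "B \<in> sets (sigma_join Q (F T) (sigma_var Q \<xi>))"
    using subalgebra_sigma_join(3)[OF F_subalg[of T] subalgebra_sigma_var[OF \<xi>_meas]] T_pos by auto
   then show "B \<in> sets \<Sigma>" using inP P_P' P'_\<Sigma> by blast
  next
   fix B assume "B \<in> null_sets Q"
   then show "B \<in> sets \<Sigma>" using null_P' P'_\<Sigma> by blast
  qed
  have FT: "sets (F T) \<subseteq> sets \<Sigma>"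
   using subalgebra_sigma_join(2)[OF F_subalg[of T] subalgebra_sigma_var[OF \<xi>_meas]] T_pos inP P_P' P'_\<Sigma> by force
  have "sets (Gh s) \<subseteq> sets \<Sigma>"
   unfolding Gh_def using FT Gs \<Sigma>(2) T_pos r r0 by (intro sigma_join_least F_subalg G_subalg) auto
  then show ?thesis using B \<Sigma>(1) by auto
 qed
 ultimately show ?thesis using pE by (auto dest!: indep_setD)
qed

lemma increment_nat_AE:
 assumes "p \<in> I" "0 <= s" "s <= t" "t <= T"
 shows "AE om in Q. Np p t om - Np p s om \<in> \<nat>"
proof -
 define E where "E k = {om \<in> space Q. Np p t om - Np p s om = real k}" for k
 have [measurable]: "Np p t \<in> borel_measurable Q" "Np p s \<in> borel_measurable Q"
  using N_meas assms by auto
 have E [measurable]: "E k \<in> sets Q" for k unfolding E_def by measurable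
 define \<mu> where "\<mu> = ap p * (t - s)"
 have "prob (E k) = \<mu> ^ k / fact k * exp (- \<mu>)" for k
  using poisson_p[OF assms(1)] assms unfolding E_def poisson_process_def \<mu>_def by auto
 then have "(%k. prob (E k)) sums (exp \<mu> * exp (- \<mu>))"
  using sums_mult2[OF exp_converges[of \<mu>], of "exp (- \<mu>)"] by (simp add: divide_inverse mult.commute)
 then have "(%k. prob (E k)) sums 1" by (simp add: exp_minus)
 moreover have "(%k. prob (E k)) sums prob (\<Union>k. E k)"
  by (intro finite_measure_UNION) (auto simp: E_def disjoint_family_on_def)
 ultimately have "prob (\<Union>k. E k) = 1" using sums_unique2 by blast
 then have "AE om in Q. om \<in> (\<Union>k. E k)" by (intro AE_prob_1)
 then show ?thesis by eventually_elim (auto simp: E_def)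
qed

text \<open>Almost surely all driving paths are counting paths: their increments are natural numbers first at
 countably many times, then everywhere by right continuity.\<close>
lemma counting_paths_AE:
 "AE om in Q. \<forall>p\<in>I. cadlag_on T (%t. Np p t om) \<and>
   (\<forall>s t. 0 <= s --> s <= t --> t <= T --> Np p t om - Np p s om \<in> \<nat>)"
proof (rule AE_finite_allI)
 fix p assume p: "p \<in> I"
 define D where "D = {r \<in> \<rat>. 0 <= r \<and> r <= T} \<union> {T}"
 have "countable D" by (rule countable_subset[of _ "insert T \<rat>"]) (auto simp: D_def countable_rat)
 have "AE om in Q. \<forall>s\<in>D. \<forall>t\<in>D. s <= t --> Np p t om - Np p s om \<in> \<nat>"
  unfolding AE_ball_countable[OF \<open>countable D\<close>]
 proof (intro ballI)
  fix s t assume "s \<in> D" "t \<in> D"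
  then have "0 <= s" "t <= T" using T_pos by (auto simp: D_def)
  then show "AE om in Q. s <= t --> Np p t om - Np p s om \<in> \<nat>"
   using increment_nat_AE[OF p, of s t] by (cases "s <= t") auto
 qed
 moreover have "AE om in Q. cadlag_on T (%t. Np p t om)"
  using poisson_p[OF p] by (auto simp: poisson_process_def)
 ultimately show "AE om in Q. cadlag_on T (%t. Np p t om) \<and>
   (\<forall>s t. 0 <= s --> s <= t --> t <= T --> Np p t om - Np p s om \<in> \<nat>)"
 proof eventually_elim
  case (elim om)
  let ?g = "%t. Np p t om"
  have approx: "\<exists>q. (\<forall>n. q n \<in> D \<and> t <= q n \<and> q n <= u) \<and> q \<longlonglongrightarrow> t \<and> (%n. ?g (q n)) \<longlonglongrightarrow> ?g t"
   if t: "0 <= t" "t <= T" "u \<in> D" "t <= u" "t < u \<or> t \<in> D" for t u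
  proof (cases "t \<in> D")
   case True
   then show ?thesis using t by (intro exI[of _ "%_. t"]) auto
  next
   case False
   then have "t < u" using t by auto
   have uT: "u <= T" using t by (auto simp: D_def)
   have "\<exists>r\<in>\<rat>. t < r \<and> r < min u (t + inverse (real (Suc n)))" for n
    using Rats_dense_in_real[of t "min u (t + inverse (real (Suc n)))"] \<open>t < u\<close> by auto
   then obtain q where q: "\<And>n. q n \<in> \<rat>" "\<And>n. t < q n" "\<And>n. q n < u" "\<And>n. q n < t + inverse (real (Suc n))"
    by (metis min_less_iff_conj)
   have q_up: "(%n. t + inverse (real (Suc n))) \<longlonglongrightarrow> t"
    using tendsto_add[OF tendsto_const LIMSEQ_inverse_real_of_nat, of t] by simp
   have lim: "q \<longlonglongrightarrow> t"
   proof (rule tendsto_sandwich[where f="%_. t" and h="%n. t + inverse (real (Suc n))"])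
    show "eventually (%n. t <= q n) sequentially"
     using q(2) less_imp_le by (intro always_eventually allI) blast
    show "eventually (%n. q n <= t + inverse (real (Suc n))) sequentially"
     using q(4) less_imp_le by (intro always_eventually allI) blast
   qed (auto intro: q_up simp del: of_nat_Suc)
   have "filterlim q (at_right t) sequentially"
    unfolding filterlim_at
   proof
    show "eventually (%n. q n \<in> {t<..} \<and> q n ~= t) sequentially"
    proof (intro always_eventually allI)
     fix n show "q n \<in> {t<..} \<and> q n ~= t" using q(2)[of n] by simp
    qed
   qed (rule lim)
   moreover have "(?g \<longlongrightarrow> ?g t) (at_right t)"
    using elim(2) t \<open>t < u\<close> uT unfolding cadlag_on_def by auto
   ultimately have "(%n. ?g (q n)) \<longlonglongrightarrow> ?g t" by (rule filterlim_compose[rotated])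
   moreover have "q n \<in> D" for n
    using q(1,2)[of n] q(3)[of n] t uT by (auto simp: D_def)
   ultimately show ?thesis using lim q(2,3) by (intro exI[of _ q]) (auto intro: less_imp_le)
  qed
  have TD: "T \<in> D" by (auto simp: D_def)
  have step1: "?g u - ?g s \<in> \<nat>" if s: "0 <= s" "s <= u" "u \<in> D" for s u
  proof -
   have "s < u \<or> s \<in> D" "s <= T" "u \<in> D" using s by (auto simp: D_def)
   then obtain q where q: "\<And>n. q n \<in> D" "\<And>n. q n <= u" "(%n. ?g (q n)) \<longlonglongrightarrow> ?g s"
    using approx[of s u] s by auto
   have "(%n. ?g u - ?g (q n)) \<longlonglongrightarrow> ?g u - ?g s" by (intro tendsto_intros q)
   moreover have "?g u - ?g (q n) \<in> \<nat>" for n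
    using elim(1) q(1)[of n] q(2)[of n] s(3) by blast
   ultimately show ?thesis by (rule closed_sequentially[OF closed_Nats, rotated])
  qed
  have "?g t - ?g s \<in> \<nat>" if s: "0 <= s" "s <= t" "t <= T" for s t
  proof -
   have "t < T \<or> t \<in> D" using s by (auto simp: D_def)
   then obtain q where q: "\<And>n. q n \<in> D" "\<And>n. t <= q n" "(%n. ?g (q n)) \<longlonglongrightarrow> ?g t"
    using approx[of t T] s TD by auto
   have "(%n. ?g (q n) - ?g s) \<longlonglongrightarrow> ?g t - ?g s" by (intro tendsto_intros q)
   moreover have "?g (q n) - ?g s \<in> \<nat>" for n
    using q(1)[of n] q(2)[of n] s by (intro step1) auto
   ultimately show ?thesis by (rule closed_sequentially[OF closed_Nats, rotated])
  qed
  then show ?case using elim(2) by blast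
 qed
qed simp

lemma incr_event_indep:
 assumes st: "0 <= s" "s < t" "t <= T" and B: "B \<in> sets (Gh s)"
 shows "prob (B \<inter> incr_event \<kappa> s t) = prob B * incr_prob \<kappa> (t - s)"
proof -
 define r where "r n = s + (t - s) * inverse (real (Suc (Suc n)))" for n
 have rb: "s < r n" "r n < t" for n
 proof -
  show "s < r n" using st by (simp add: r_def)
  have "(t - s) * inverse (real (Suc (Suc n))) < (t - s) * 1"
   using st by (intro mult_strict_left_mono) (auto simp: inverse_less_1_iff)
  then show "r n < t" by (simp add: r_def)
 qed
 have "(%n. s + (t - s) * inverse (real (Suc (Suc n)))) \<longlonglongrightarrow> s + (t - s) * 0"
  by (intro tendsto_intros LIMSEQ_Suc[OF LIMSEQ_inverse_real_of_nat])
 then have r_lim: "r \<longlonglongrightarrow> s" by (simp add: r_def[abs_def])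
 have B_Q [measurable]: "B \<in> sets Q" using B Gh_subalg[of s] st by (auto simp: subalgebra_def)
 have E [measurable]: "incr_event \<kappa> (r n) t \<in> sets Q" "incr_event \<kappa> s t \<in> sets Q" for n
  using rb[of n] st by (auto intro!: incr_event_meas)
 have "(%n. \<integral>om. indicator (B \<inter> incr_event \<kappa> (r n) t) om \<partial>Q) \<longlonglongrightarrow> (\<integral>om. indicator (B \<inter> incr_event \<kappa> s t) om \<partial>Q :: real)"
 proof (rule integral_dominated_convergence[where w="%_. 1"])
  show "AE om in Q. (%n. indicator (B \<inter> incr_event \<kappa> (r n) t) om) \<longlonglongrightarrow> (indicator (B \<inter> incr_event \<kappa> s t) om :: real)"
   using counting_paths_AE
  proof eventually_elim
   case (elim om)
   have "eventually (%n. Np p (r n) om = Np p s om) sequentially" if p: "p \<in> I" for p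
   proof -
    have step: "step_path T (%t. Np p t om)"
     using elim p by (intro counting_path_step) auto
    obtain b where b: "s < b" "\<forall>q>s. q < b --> Np p q om = Np p s om"
     using step_path_right[OF step, of s] st unfolding eventually_at_right_field by auto
    have "eventually (%n. r n < b) sequentially" using r_lim b(1) by (simp add: order_tendsto_iff)
    then show ?thesis by eventually_elim (use b rb in auto)
   qed
   then have "eventually (%n. \<forall>p\<in>I. Np p (r n) om = Np p s om) sequentially"
    by (simp add: eventually_ball_finite)
   then have "eventually (%n. indicator (B \<inter> incr_event \<kappa> (r n) t) om = (indicator (B \<inter> incr_event \<kappa> s t) om :: real)) sequentially"
    by eventually_elim (auto simp: incr_event_def indicator_def)
   then show ?case by (rule tendsto_eventually)
  qed
 qed (auto simp: indicator_def)
 then have "(%n. prob (B \<inter> incr_event \<kappa> (r n) t)) \<longlonglongrightarrow> prob (B \<inter> incr_event \<kappa> s t)"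
  by simp
 moreover have "prob (B \<inter> incr_event \<kappa> (r n) t) = prob B * incr_prob \<kappa> (t - r n)" for n
  using rb[of n] st B by (intro incr_event_indep_after[of s]) auto
 moreover have "(%n. prob B * incr_prob \<kappa> (t - r n)) \<longlonglongrightarrow> prob B * incr_prob \<kappa> (t - s)"
  unfolding incr_prob_def by (intro tendsto_intros r_lim) auto
 ultimately show ?thesis using LIMSEQ_unique by simp
qed

end

section \<open>Conditional transition probabilities over a short interval\<close>

text \<open>With total rate \<open>x\<close>, this is the probability of at least two Poisson
  events.\<close>
lemma exp_second_order:
 fixes x :: real
 assumes "0 <= x"
 shows "0 <= 1 - (1 + x) * exp (- x)" "1 - (1 + x) * exp (- x) <= x\<^sup>2"
proof -
 have "(1 + x) * exp (- x) <= exp x * exp (- x)"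
  using exp_ge_add_one_self[of x] by (intro mult_right_mono) auto
 then show "0 <= 1 - (1 + x) * exp (- x)" by (simp add: exp_minus)
 have "(1 + x) * (1 - x) <= (1 + x) * exp (- x)"
  using exp_ge_add_one_self[of "- x"] assms by (intro mult_left_mono) auto
 then show "1 - (1 + x) * exp (- x) <= x\<^sup>2" by (simp add: power2_eq_square algebra_simps)
qed

context driven_chain
begin

lemma X_S: "0 <= t ==> t <= T ==> om \<in> space Q ==> X t om \<in> S"
 and X_cadlag: "om \<in> space Q ==> cadlag_on T (%t. X t om)"
 and X_meas_G: "0 <= t ==> t <= T ==> X t \<in> measurable (G t) (count_space UNIV)"
 using sde by (auto simp: solves_sde_def adapted_def)

lemma X_step: "om \<in> space Q ==> step_path T (%t. X t om)"
 by (intro cadlag_on_nat_step_path X_cadlag)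

lemma measurable_Gh_mono:
 assumes "0 <= s" "s <= t" "t <= T" "f \<in> measurable (Gh s) M"
 shows "f \<in> measurable (Gh t) M"
 using assms(4) Gh_mono[OF assms(1-3)] by (auto simp: measurable_def)

lemma measurable_Gh_Q: "0 <= t ==> t <= T ==> f \<in> measurable (Gh t) M ==> f \<in> measurable Q M"
 using Gh_subalg by (rule measurable_from_subalg)

lemma measurable_F_Gh:
 assumes "0 <= s" "s <= T" "0 <= t" "t <= T" "f \<in> measurable (F s) M"
 shows "f \<in> measurable (Gh t) M"
 using assms(5) F_Gh[OF assms(1-4)] F_subalg[OF assms(1,2)] by (auto simp: measurable_def subalgebra_def)

lemma X_meas_Gh: "0 <= t ==> t <= T ==> X t \<in> measurable (Gh t) (count_space UNIV)"
 using X_meas_G[of t] G_Gh[of t] G_subalg[of t] by (auto simp: measurable_def subalgebra_def)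

lemma X_meas: "0 <= t ==> t <= T ==> X t \<in> measurable Q (count_space UNIV)"
 using X_meas_Gh measurable_Gh_Q by blast

lemma X_increment_AE:
 assumes "0 <= s" "s <= t" "t <= T"
 shows "AE om in Q. (om \<in> incr_event (%_. 0) s t --> X t om = X s om) \<and>
  (\<forall>p\<in>I. om \<in> incr_event ((%_. 0)(p := 1)) s t --> X t om = (if X s om = fst p then snd p else X s om))"
proof -
 have "AE om in Q. \<forall>t\<in>{0..T}. real (X t om) = real (\<xi> om) + (\<Sum>(x, y)\<in>state_pairs d. (real y - real x) *
       jump_integral (%u. indicator {x} (Lim (at_left u) (%s. X s om))) (%u. N x y u om) t)"
  using sde by (simp add: solves_sde_def)
 with counting_paths_AE AE_space show ?thesis
 proof eventually_elim
  case (elim om)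
  have c: "step_path T (%t. X t om)" using elim by (intro X_step)
  have g: "step_path T (%t. Np p t om)" if "p \<in> I" for p
   using elim that by (intro counting_path_step) auto
  have g_nat: "Np p t om - Np p s om \<in> \<nat>" if "p \<in> I" "0 <= s" "s <= t" "t <= T" for p s t
   using elim(1) that by blast
  have eq: "real (X t om) = real (\<xi> om) + (\<Sum>p\<in>I. (real (snd p) - real (fst p)) *
    jump_integral (%u. indicator {fst p} (left_val (%t. X t om) u)) (%t. Np p t om) t)" if t: "0 <= t" "t <= T" for t
  proof -
   have "jump_integral (%u. indicator {fst p} (Lim (at_left u) (%s. X s om))) (%u. Np p u om) t =
    jump_integral (%u. indicator {fst p} (left_val (%t. X t om) u)) (%u. Np p u om) t" for p
    unfolding jump_integral_def using t Lim_at_left_step[OF c] by (intro sum.cong refl) auto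
   then show ?thesis using elim(3) t by (simp add: split_beta)
  qed
  note ctx = finite_I c g g_nat eq assms
  have "X t om = X s om" if "om \<in> incr_event (%_. 0) s t"
   using that by (intro sde_no_increment[of I T "%t. X t om" "%p t. Np p t om" "real (\<xi> om)"] ctx)
    (auto simp: incr_event_def)
  moreover have "X t om = (if X s om = fst p then snd p else X s om)"
   if pI: "p \<in> I" and ev: "om \<in> incr_event ((%_. 0)(p := 1)) s t" for p
  proof (rule sde_one_increment[of I T "%t. X t om" "%p t. Np p t om" "real (\<xi> om)"])
   have *: "Np q t om - Np q s om = real (((%_. 0)(p := 1)) q)" if "q \<in> I" for q
    using ev that unfolding incr_event_def by blast
   show "Np q t om = Np q s om" if "q \<in> I" "q ~= p" for q using *[of q] that by simp
   show "Np p t om = Np p s om + 1" using *[of p] pI by simp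
  qed (use pI ctx in \<open>simp_all only:\<close>)
  ultimately show ?case by blast
 qed
qed

lemma incr_event_integral:
 assumes st: "0 <= s" "s < t" "t <= T"
  and f [measurable]: "f \<in> borel_measurable (Gh s)" and f_bd: "\<And>om. om \<in> space Q ==> \<bar>f om\<bar> <= C"
 shows "(\<integral>om. f om * indicator (incr_event \<kappa> s t) om \<partial>Q) = (\<integral>om. f om \<partial>Q) * incr_prob \<kappa> (t - s)"
proof -
 have sub: "subalgebra Q (Gh s)" using st by (intro Gh_subalg) auto
 interpret sf: finite_measure_subalgebra Q "Gh s"
  by unfold_locales (rule sub)
 have fQ [measurable]: "f \<in> borel_measurable Q" using f sub by (rule measurable_from_subalg[rotated])
 have E [measurable]: "incr_event \<kappa> s t \<in> sets Q" using st by (intro incr_event_meas) auto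
 have ind: "integrable Q (indicator (incr_event \<kappa> s t) :: 'a => real)"
  using E by (intro integrable_real_indicator) (simp_all add: less_top[symmetric])
 have "AE om in Q. real_cond_exp Q (Gh s) (indicator (incr_event \<kappa> s t)) om = incr_prob \<kappa> (t - s)"
 proof (rule sf.real_cond_exp_charact)
  fix B assume B: "B \<in> sets (Gh s)"
  then have [measurable]: "B \<in> sets Q" using sub by (auto simp: subalgebra_def)
  have "(\<integral>om\<in>B. indicator (incr_event \<kappa> s t) om \<partial>Q) = (\<integral>om. indicator (B \<inter> incr_event \<kappa> s t) om \<partial>Q)"
   unfolding set_lebesgue_integral_def by (intro Bochner_Integration.integral_cong) (auto simp: indicator_def)
  also have "... = prob B * incr_prob \<kappa> (t - s)"
   using incr_event_indep[OF st B] by simp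
  also have "... = (\<integral>om\<in>B. incr_prob \<kappa> (t - s) \<partial>Q)"
   by (simp add: set_lebesgue_integral_def)
  finally show "(\<integral>om\<in>B. indicator (incr_event \<kappa> s t) om \<partial>Q) = (\<integral>om\<in>B. incr_prob \<kappa> (t - s) \<partial>Q)" .
 qed (auto simp: ind)
 then have "(\<integral>om. f om * real_cond_exp Q (Gh s) (indicator (incr_event \<kappa> s t)) om \<partial>Q) = (\<integral>om. f om * incr_prob \<kappa> (t - s) \<partial>Q)"
  by (intro integral_cong_AE) (auto elim!: eventually_mono)
 moreover have "(\<integral>om. f om * real_cond_exp Q (Gh s) (indicator (incr_event \<kappa> s t)) om \<partial>Q) =
   (\<integral>om. f om * indicator (incr_event \<kappa> s t) om \<partial>Q)"
  by (intro sf.real_cond_exp_intg integrable_const_bound[where B="\<bar>C\<bar>"])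
    (auto simp: indicator_def intro!: AE_I2 order_trans[OF f_bd])
 ultimately show ?thesis by simp
qed

definition a_total :: real where "a_total = (\<Sum>p\<in>I. ap p)"

definition exit_rate :: "nat => real" where "exit_rate x = (\<Sum>y\<in>S - {x}. a x y)"

lemma ap_nonneg: "p \<in> I ==> 0 <= ap p"
 using ap_pos[of p] by simp

lemma a_total_nonneg: "0 <= a_total"
 unfolding a_total_def by (intro sum_nonneg ap_nonneg) auto

lemma exit_rate_bounds:
 assumes "x \<in> S"
 shows "0 <= exit_rate x" "exit_rate x <= a_total" "exit_rate x = (\<Sum>p\<in>{p\<in>I. fst p = x}. ap p)"
proof -
 have "exit_rate x = (\<Sum>p\<in>Pair x ` (S - {x}). ap p)"
  unfolding exit_rate_def by (subst sum.reindex) (auto simp: inj_on_def)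
 also have "Pair x ` (S - {x}) = {p\<in>I. fst p = x}"
  using assms by (auto simp: state_pairs_def)
 finally show *: "exit_rate x = (\<Sum>p\<in>{p\<in>I. fst p = x}. ap p)" .
 show "0 <= exit_rate x" unfolding * by (intro sum_nonneg ap_nonneg) auto
 show "exit_rate x <= a_total"
  unfolding * a_total_def by (intro sum_mono2 ap_nonneg) auto
qed

lemma incr_prob_0: "incr_prob (%_. 0) h = exp (- (a_total * h))"
 by (simp add: incr_prob_def exp_sum[symmetric] a_total_def sum_distrib_right sum_negf)

lemma incr_prob_1:
 assumes "p \<in> I"
 shows "incr_prob ((%_. 0)(p := 1)) h = ap p * h * exp (- (a_total * h))"
proof -
 have "incr_prob ((%_. 0)(p := 1)) h = (\<Prod>q\<in>I. (if q = p then ap p * h else 1) * exp (- (ap q * h)))"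
  unfolding incr_prob_def by (intro prod.cong refl) auto
 also have "... = ap p * h * exp (- (a_total * h))"
  using assms by (simp add: prod.distrib exp_sum[symmetric] a_total_def sum_distrib_right sum_negf)
 finally show ?thesis .
qed

text \<open>The constant in the one-step error bound \<open>step_error * h\<^sup>2\<close>.\<close>
definition step_error :: real where
 "step_error = a_total\<^sup>2 * (2 + exp (a_total * T))"

context
 fixes s t C :: real and f :: "'a => real"
 assumes st: "0 <= s" "s < t" "t <= T"
  and f [measurable]: "f \<in> borel_measurable (Gh s)" and f0: "\<And>om. om \<in> space Q ==> 0 <= f om"
  and f_bd: "\<And>om. om \<in> space Q ==> f om <= C"
begin

definition "E0 = incr_event (%_. 0) s t"
definition "E1 p = incr_event ((%_. 0)(p := 1)) s t"
definition "rest om = (1 :: real) - indicator E0 om - (\<Sum>p\<in>I. indicator (E1 p) om)"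

lemma fQ [measurable]: "f \<in> borel_measurable Q"
 using f Gh_subalg[of s] st by (intro measurable_from_subalg[of Q "Gh s"]) auto

lemma XQ [measurable]: "X s \<in> measurable Q (count_space UNIV)" "X t \<in> measurable Q (count_space UNIV)"
 using X_meas st by auto

lemma E_meas [measurable]: "E0 \<in> sets Q" "E1 p \<in> sets Q"
 unfolding E0_def E1_def using st by (auto intro!: incr_event_meas)

lemma int_f: "g \<in> borel_measurable Q ==> (\<And>om. om \<in> space Q ==> \<bar>g om\<bar> <= B) ==> integrable Q (%om. f om * g om)" for g :: "'a => real"
 using f0 f_bd by (intro integrable_const_bound[where B="C * B"] AE_I2) (auto simp: abs_mult intro!: mult_mono')

lemma E_disjoint: "om \<in> E1 p ==> p \<in> I ==> om \<notin> E0"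
  "om \<in> E1 p ==> om \<in> E1 q ==> p \<in> I ==> q \<in> I ==> p = q"
proof -
 show "om \<in> E1 p ==> p \<in> I ==> om \<notin> E0"
  unfolding E0_def E1_def incr_event_def by fastforce
 assume *: "om \<in> E1 p" "om \<in> E1 q" "p \<in> I" "q \<in> I"
 then have "Np p t om - Np p s om = real (((%_. 0)(p := 1)) p)" "Np p t om - Np p s om = real (((%_. 0)(q := 1)) p)"
  unfolding E1_def incr_event_def by blast+
 then show "p = q" by (auto split: if_splits)
qed

lemma rest_cases: "om \<in> E0 ==> rest om = 0" "p \<in> I ==> om \<in> E1 p ==> rest om = 0"
 "om \<notin> E0 ==> (\<And>p. p \<in> I ==> om \<notin> E1 p) ==> rest om = 1"
proof -
 assume "om \<in> E0"
 then have "(\<Sum>p\<in>I. indicator (E1 p) om) = (0::real)" using E_disjoint(1) by (intro sum.neutral) (auto simp: indicator_def)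
 then show "rest om = 0" using \<open>om \<in> E0\<close> by (simp add: rest_def)
next
 assume p: "p \<in> I" "om \<in> E1 p"
 then have "(\<Sum>q\<in>I. indicator (E1 q) om) = (\<Sum>q\<in>I. if q = p then 1 else (0::real))"
 proof (intro sum.cong refl)
  fix q assume "q \<in> I"
  then show "indicator (E1 q) om = (if q = p then 1 else (0::real))"
   using E_disjoint(2)[of om q p] p by (cases "om \<in> E1 q") auto
 qed
 then show "rest om = 0" using p E_disjoint(1)[OF p(2,1)] by (simp add: rest_def)
qed (simp add: rest_def)

lemma rest_01: "rest om = 0 \<or> rest om = 1"
 using rest_cases by blast

lemma rest_meas [measurable]: "rest \<in> borel_measurable Q"
 unfolding rest_def[abs_def] by measurable

lemma int_E:
 assumes g [measurable]: "g \<in> borel_measurable (Gh s)" and B: "\<And>om. om \<in> space Q ==> \<bar>g om\<bar> <= B"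
 shows "(\<integral>om. f om * g om * indicator E0 om \<partial>Q) = (\<integral>om. f om * g om \<partial>Q) * exp (- (a_total * (t - s)))"
  and "p \<in> I ==> (\<integral>om. f om * g om * indicator (E1 p) om \<partial>Q) = (\<integral>om. f om * g om \<partial>Q) * (ap p * (t - s) * exp (- (a_total * (t - s))))"
proof -
 have bd: "\<bar>f om * g om\<bar> <= C * B" if "om \<in> space Q" for om
  using f0[OF that] f_bd[OF that] B[OF that] by (auto simp: abs_mult intro!: mult_mono')
 have fg: "(%om. f om * g om) \<in> borel_measurable (Gh s)" by measurable
 show "(\<integral>om. f om * g om * indicator E0 om \<partial>Q) = (\<integral>om. f om * g om \<partial>Q) * exp (- (a_total * (t - s)))"
  unfolding E0_def by (rule incr_event_integral[OF st fg bd, of "%_. 0", unfolded incr_prob_0])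
 show "(\<integral>om. f om * g om * indicator (E1 p) om \<partial>Q) = (\<integral>om. f om * g om \<partial>Q) * (ap p * (t - s) * exp (- (a_total * (t - s))))"
  if "p \<in> I"
  unfolding E1_def by (rule incr_event_integral[OF st fg bd, of "(%_. 0)(p := 1)", unfolded incr_prob_1[OF that]])
qed

lemma int_rest: "(\<integral>om. f om * rest om \<partial>Q) <= a_total\<^sup>2 * (t - s)\<^sup>2 * (\<integral>om. f om \<partial>Q)"
proof -
 define H where "H = a_total * (t - s)"
 have H: "0 <= H" using st a_total_nonneg by (simp add: H_def)
 define u where "u p om = f om * indicator (E1 p) om" for p om
 have i: "integrable Q f" "integrable Q (%om. f om * indicator E0 om)" "integrable Q (u p)" for p
  using int_f[of "%_. 1" 1] int_f[of "indicator E0" 1] int_f[of "indicator (E1 p)" 1]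
  by (auto simp: indicator_def u_def[abs_def])
 have "f om * rest om = f om - f om * indicator E0 om - (\<Sum>p\<in>I. u p om)" for om
  unfolding rest_def u_def sum_distrib_left[symmetric] by (simp only: right_diff_distrib mult_1_right)
 then have "(\<integral>om. f om * rest om \<partial>Q) = (\<integral>om. f om - f om * indicator E0 om - (\<Sum>p\<in>I. u p om) \<partial>Q)"
  by simp
 also have "... = (\<integral>om. f om \<partial>Q) - (\<integral>om. f om * indicator E0 om \<partial>Q) - (\<Sum>p\<in>I. \<integral>om. u p om \<partial>Q)"
  using i by (simp add: Bochner_Integration.integral_sum)
 also have "(\<Sum>p\<in>I. \<integral>om. u p om \<partial>Q) = (\<Sum>p\<in>I. (\<integral>om. f om \<partial>Q) * (ap p * (t - s) * exp (- H)))"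
  using int_E(2)[of "%_. 1" 1] by (intro sum.cong refl) (simp add: H_def u_def)
 also have "(\<integral>om. f om \<partial>Q) - (\<integral>om. f om * indicator E0 om \<partial>Q) - (\<Sum>p\<in>I. (\<integral>om. f om \<partial>Q) * (ap p * (t - s) * exp (- H))) =
   (\<integral>om. f om \<partial>Q) * (1 - exp (- H) - (\<Sum>p\<in>I. ap p * (t - s) * exp (- H)))"
  using int_E(1)[of "%_. 1" 1] by (simp add: H_def sum_distrib_left right_diff_distrib)
 also have "1 - exp (- H) - (\<Sum>p\<in>I. ap p * (t - s) * exp (- H)) = 1 - (1 + H) * exp (- H)"
 proof -
  have "(\<Sum>p\<in>I. ap p * (t - s) * exp (- H)) = H * exp (- H)"
   unfolding H_def a_total_def sum_distrib_right ..
  then show ?thesis by (simp add: algebra_simps)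
 qed
 also have "(\<integral>om. f om \<partial>Q) * (1 - (1 + H) * exp (- H)) <= (\<integral>om. f om \<partial>Q) * H\<^sup>2"
  using exp_second_order[OF H] f0 by (intro mult_left_mono integral_nonneg_AE AE_I2) auto
 finally show ?thesis by (simp add: H_def power_mult_distrib mult_ac)
qed

lemma step_error_le:
 "a_total\<^sup>2 * (t - s)\<^sup>2 * (\<integral>om. f om \<partial>Q) * (2 + exp (a_total * (t - s))) <= step_error * (t - s)\<^sup>2 * (\<integral>om. f om \<partial>Q)"
proof -
 have "a_total * (t - s) <= a_total * T" using st a_total_nonneg by (intro mult_left_mono) auto
 then have "a_total\<^sup>2 * (t - s)\<^sup>2 * (\<integral>om. f om \<partial>Q) * (2 + exp (a_total * (t - s))) <=
   a_total\<^sup>2 * (t - s)\<^sup>2 * (\<integral>om. f om \<partial>Q) * (2 + exp (a_total * T))"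
  using f0 by (intro mult_left_mono mult_nonneg_nonneg integral_nonneg_AE AE_I2) auto
 then show ?thesis by (simp add: step_error_def mult_ac)
qed

text \<open>A change to \<open>z\<close> needs an increment of exactly one in the driving process from the
  present state to \<open>z\<close>, or at least two increments in total; the latter has probability of
  second order.\<close>
lemma one_step_change:
 assumes z: "z \<in> S"
 shows "\<bar>(\<integral>om. f om * of_bool (X t om = z \<and> X s om ~= z) \<partial>Q) -
   (\<integral>om. f om * ((t - s) * a (X s om) z * of_bool (X s om ~= z)) \<partial>Q)\<bar> <= step_error * (t - s)\<^sup>2 * (\<integral>om. f om \<partial>Q)"
proof -
 define H where "H = a_total * (t - s)"
 have H: "0 <= H" using st a_total_nonneg by (simp add: H_def)
 define e :: "nat => 'a => real" where "e x om = of_bool (X s om = x)" for x om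
 have [measurable]: "X s \<in> measurable (Gh s) (count_space UNIV)" using st by (intro X_meas_Gh) auto
 have e_meas [measurable]: "e x \<in> borel_measurable (Gh s)" "e x \<in> borel_measurable Q" for x
  unfolding e_def by measurable
 have e_bd: "\<bar>e x om\<bar> <= 1" for x om by (simp add: e_def)
 have XsS: "X s om \<in> S" if "om \<in> space Q" for om using that st by (intro X_S) auto
 have pI: "(x, z) \<in> I" if "x \<in> S - {z}" for x using that z by (auto simp: state_pairs_def)
 define J where "J x = (\<integral>om. f om * e x om \<partial>Q)" for x
 have J0: "0 <= J x" for x unfolding J_def using f0 by (intro integral_nonneg_AE AE_I2) (auto simp: e_def)
 have sumJ: "(\<Sum>x\<in>S - {z}. J x) <= (\<integral>om. f om \<partial>Q)"
 proof -
  have "(\<Sum>x\<in>S - {z}. J x) = (\<integral>om. (\<Sum>x\<in>S - {z}. f om * e x om) \<partial>Q)"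
   unfolding J_def using int_f[OF e_meas(2) e_bd] by (simp add: Bochner_Integration.integral_sum)
  also have "... <= (\<integral>om. f om \<partial>Q)"
  proof (intro integral_mono_AE AE_I2)
   fix om assume om: "om \<in> space Q"
   have "(\<Sum>x\<in>S - {z}. e x om) <= 1"
    using sum_mono2[of S "S - {z}" "%x. e x om"] XsS[OF om] by (auto simp: e_def of_bool_def sum.delta')
   then have "f om * (\<Sum>x\<in>S - {z}. e x om) <= f om * 1" by (intro mult_left_mono f0 om)
   then show "(\<Sum>x\<in>S - {z}. f om * e x om) <= f om" by (simp add: sum_distrib_left)
  qed (use int_f[OF e_meas(2) e_bd] int_f[of "%_. 1" 1] in auto)
  finally show ?thesis .
 qed
 have exact: "(\<integral>om. f om * ((t - s) * a (X s om) z * of_bool (X s om ~= z)) \<partial>Q) = (\<Sum>x\<in>S - {z}. (t - s) * a x z * J x)"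
 proof -
  have "(\<integral>om. f om * ((t - s) * a (X s om) z * of_bool (X s om ~= z)) \<partial>Q) =
    (\<integral>om. (\<Sum>x\<in>S - {z}. (t - s) * a x z * (f om * e x om)) \<partial>Q)"
  proof (intro Bochner_Integration.integral_cong refl)
   fix om assume om: "om \<in> space Q"
   have "(\<Sum>x\<in>S - {z}. (t - s) * a x z * (f om * e x om)) = (\<Sum>x\<in>S - {z}. if x = X s om then (t - s) * a x z * f om else 0)"
    by (intro sum.cong refl) (auto simp: e_def)
   then show "f om * ((t - s) * a (X s om) z * of_bool (X s om ~= z)) = (\<Sum>x\<in>S - {z}. (t - s) * a x z * (f om * e x om))"
    using XsS[OF om] by (auto simp: sum.delta)
  qed
  also have "... = (\<Sum>x\<in>S - {z}. (t - s) * a x z * J x)"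
   unfolding J_def using int_f[OF e_meas(2) e_bd] by (simp add: Bochner_Integration.integral_sum)
  finally show ?thesis .
 qed
 have i1: "integrable Q (%om. f om * e x om * indicator (E1 p) om)" for x p
  using int_f[of "%om. e x om * indicator (E1 p) om" 1] by (auto simp: e_def indicator_def mult.assoc)
 have i2: "integrable Q (%om. f om * (of_bool (X t om = z \<and> X s om ~= z) * rest om))"
 proof (rule int_f)
  fix om show "\<bar>of_bool (X t om = z \<and> X s om ~= z) * rest om\<bar> <= 1" using rest_01[of om] by auto
 qed measurable
 have "(\<integral>om. f om * of_bool (X t om = z \<and> X s om ~= z) \<partial>Q) =
   (\<integral>om. (\<Sum>x\<in>S - {z}. f om * e x om * indicator (E1 (x, z)) om) + f om * (of_bool (X t om = z \<and> X s om ~= z) * rest om) \<partial>Q)"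
 proof (intro integral_cong_AE)
  show "AE om in Q. f om * of_bool (X t om = z \<and> X s om ~= z) =
   (\<Sum>x\<in>S - {z}. f om * e x om * indicator (E1 (x, z)) om) + f om * (of_bool (X t om = z \<and> X s om ~= z) * rest om)"
   using X_increment_AE[OF st(1) less_imp_le[OF st(2)] st(3)] AE_space
  proof eventually_elim
   case (elim om)
   note X = elim(1)[folded E0_def E1_def]
   have sum: "(\<Sum>x\<in>S - {z}. f om * e x om * indicator (E1 (x, z)) om) =
     f om * of_bool (X s om ~= z \<and> om \<in> E1 (X s om, z))"
   proof -
    have "(\<Sum>x\<in>S - {z}. f om * e x om * indicator (E1 (x, z)) om) =
     (\<Sum>x\<in>S - {z}. if x = X s om then f om * indicator (E1 (x, z)) om else 0)"
     by (intro sum.cong refl) (auto simp: e_def)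
    then show ?thesis using XsS[OF elim(2)] by (auto simp: sum.delta indicator_def)
   qed
   consider "om \<in> E0" | p where "p \<in> I" "om \<in> E1 p" | "om \<notin> E0" "\<And>p. p \<in> I ==> om \<notin> E1 p" by blast
   then show ?case
   proof cases
    case 1
    then have "X t om = X s om" "rest om = 0" using X rest_cases(1) by auto
    moreover have "om \<notin> E1 (X s om, z)" if "X s om ~= z"
     using E_disjoint(1)[of om "(X s om, z)"] 1 pI[of "X s om"] XsS[OF elim(2)] that by blast
    ultimately show ?thesis unfolding sum by auto
   next
    case (2 p)
    then have Xt: "X t om = (if X s om = fst p then snd p else X s om)" and r: "rest om = 0"
     using X rest_cases(2) by blast+
    have "(X t om = z \<and> X s om ~= z) \<longleftrightarrow> (X s om ~= z \<and> om \<in> E1 (X s om, z))"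
    proof
     assume "X t om = z \<and> X s om ~= z"
     then have "p = (X s om, z)" "X s om ~= z" using Xt by (auto split: if_splits simp: prod_eq_iff)
     then show "X s om ~= z \<and> om \<in> E1 (X s om, z)" using 2 by simp
    next
     assume *: "X s om ~= z \<and> om \<in> E1 (X s om, z)"
     then have "(X s om, z) = p"
      using 2 pI[of "X s om"] XsS[OF elim(2)] by (intro E_disjoint(2)[of om]) auto
     then show "X t om = z \<and> X s om ~= z" using Xt * by auto
    qed
    then show ?thesis unfolding sum r by simp
   next
    case 3
    then have "rest om = 1" by (rule rest_cases(3))
    moreover have "om \<notin> E1 (X s om, z)" if "X s om ~= z"
     using 3(2)[of "(X s om, z)"] pI[of "X s om"] XsS[OF elim(2)] that by blast
    ultimately show ?thesis unfolding sum by auto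
   qed
  qed
 qed measurable
 also have "... = (\<Sum>x\<in>S - {z}. J x * (a x z * (t - s) * exp (- H))) +
   (\<integral>om. f om * (of_bool (X t om = z \<and> X s om ~= z) * rest om) \<partial>Q)"
 proof -
  define v where "v x om = f om * e x om * indicator (E1 (x, z)) om" for x om
  define w where "w om = f om * (of_bool (X t om = z \<and> X s om ~= z) * rest om)" for om
  have iv: "integrable Q (v x)" for x unfolding v_def by (rule i1)
  have iw: "integrable Q w" unfolding w_def by (rule i2)
  have "(\<integral>om. v x om \<partial>Q) = J x * (a x z * (t - s) * exp (- H))" if "x \<in> S - {z}" for x
   using int_E(2)[OF e_meas(1) e_bd pI[OF that]] by (simp add: v_def J_def H_def)
  then have "(\<integral>om. (\<Sum>x\<in>S - {z}. v x om) + w om \<partial>Q) = (\<Sum>x\<in>S - {z}. J x * (a x z * (t - s) * exp (- H))) + (\<integral>om. w om \<partial>Q)"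
   using iv iw by (simp add: Bochner_Integration.integral_sum)
  then show ?thesis unfolding v_def w_def .
 qed
 finally have main: "(\<integral>om. f om * of_bool (X t om = z \<and> X s om ~= z) \<partial>Q) =
  (\<Sum>x\<in>S - {z}. J x * (a x z * (t - s) * exp (- H))) +
   (\<integral>om. f om * (of_bool (X t om = z \<and> X s om ~= z) * rest om) \<partial>Q)" (is "_ = _ + ?R") .
 have R: "0 <= ?R" "?R <= H\<^sup>2 * (\<integral>om. f om \<partial>Q)"
 proof -
  have r: "0 <= rest om" "\<bar>rest om\<bar> <= 1" for om using rest_01[of om] by auto
  show "0 <= ?R" using f0 r by (intro integral_nonneg_AE AE_I2 mult_nonneg_nonneg) auto
  have "?R <= (\<integral>om. f om * rest om \<partial>Q)"
   using f0 r by (intro integral_mono_AE i2 AE_I2 int_f[of _ 1] rest_meas mult_left_mono) (auto simp: of_bool_def)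
  also have "... <= H\<^sup>2 * (\<integral>om. f om \<partial>Q)" using int_rest by (simp add: H_def power_mult_distrib)
  finally show "?R <= H\<^sup>2 * (\<integral>om. f om \<partial>Q)" .
 qed
 have diff: "(\<Sum>x\<in>S - {z}. (t - s) * a x z * J x) - (\<Sum>x\<in>S - {z}. J x * (a x z * (t - s) * exp (- H))) =
   (\<Sum>x\<in>S - {z}. (t - s) * a x z * J x) * (1 - exp (- H))"
 proof -
  have "(\<Sum>x\<in>S - {z}. J x * (a x z * (t - s) * exp (- H))) = (\<Sum>x\<in>S - {z}. (t - s) * a x z * J x) * exp (- H)"
   unfolding sum_distrib_right by (intro sum.cong refl) (simp only: mult_ac)
  then show ?thesis by (simp only: right_diff_distrib mult_1_right)
 qed
 have "a x z <= a_total" if "x \<in> S - {z}" for x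
  using member_le_sum[OF pI[OF that], of ap] ap_pos finite_I by (auto simp: a_total_def intro: less_imp_le)
 then have A: "(\<Sum>x\<in>S - {z}. (t - s) * a x z * J x) <= H * (\<integral>om. f om \<partial>Q)"
 proof -
  have "(\<Sum>x\<in>S - {z}. (t - s) * a x z * J x) <= (\<Sum>x\<in>S - {z}. H * J x)"
   using \<open>\<And>x. x \<in> S - {z} ==> a x z <= a_total\<close> J0 st
   by (intro sum_mono mult_right_mono) (auto simp: H_def mult.commute intro!: mult_left_mono)
  also have "... <= H * (\<integral>om. f om \<partial>Q)"
   unfolding sum_distrib_left[symmetric] using sumJ H by (intro mult_left_mono)
  finally show ?thesis .
 qed
 have A0: "0 <= (\<Sum>x\<in>S - {z}. (t - s) * a x z * J x)"
  using J0 st a_pos pI by (intro sum_nonneg mult_nonneg_nonneg) (auto intro: less_imp_le)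
 have "1 - exp (- H) <= H" "0 <= 1 - exp (- H)" using exp_ge_add_one_self[of "- H"] H by auto
 then have D: "0 <= (\<Sum>x\<in>S - {z}. (t - s) * a x z * J x) * (1 - exp (- H))"
  "(\<Sum>x\<in>S - {z}. (t - s) * a x z * J x) * (1 - exp (- H)) <= H * (\<integral>om. f om \<partial>Q) * H"
  using A A0 H by (auto intro!: mult_mono mult_nonneg_nonneg order_trans[OF A0 A])
 have "\<bar>(\<integral>om. f om * of_bool (X t om = z \<and> X s om ~= z) \<partial>Q) - (\<Sum>x\<in>S - {z}. (t - s) * a x z * J x)\<bar> <=
   H\<^sup>2 * (\<integral>om. f om \<partial>Q) + H * (\<integral>om. f om \<partial>Q) * H"
  using R D main diff by linarith
 also have "... = a_total\<^sup>2 * (t - s)\<^sup>2 * (\<integral>om. f om \<partial>Q) * 2"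
  by (simp add: H_def power2_eq_square mult_ac)
 also have "... <= a_total\<^sup>2 * (t - s)\<^sup>2 * (\<integral>om. f om \<partial>Q) * (2 + exp (a_total * (t - s)))"
  using f0 by (intro mult_left_mono mult_nonneg_nonneg integral_nonneg_AE AE_I2) auto
 also have "... <= step_error * (t - s)\<^sup>2 * (\<integral>om. f om \<partial>Q)" by (rule step_error_le)
 finally show ?thesis unfolding exact .
qed

text \<open>The factor \<open>exp (exit_rate * h)\<close> compensates the probability that none of the
  relevant processes moves.\<close>
lemma one_step_stay:
 "\<bar>(\<integral>om. f om * (exp (exit_rate (X s om) * (t - s)) * of_bool (X t om = X s om)) \<partial>Q) - (\<integral>om. f om \<partial>Q)\<bar>
   <= step_error * (t - s)\<^sup>2 * (\<integral>om. f om \<partial>Q)"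
proof -
 define H where "H = a_total * (t - s)"
 have H: "0 <= H" using st a_total_nonneg by (simp add: H_def)
 define b where "b om = exp (exit_rate (X s om) * (t - s))" for om
 have [measurable]: "X s \<in> measurable (Gh s) (count_space UNIV)" using st by (intro X_meas_Gh) auto
 have b_measG: "b \<in> borel_measurable (Gh s)" and b_meas [measurable]: "b \<in> borel_measurable Q"
  unfolding b_def by measurable
 have [measurable]: "(%om. real (X t om)) \<in> borel_measurable Q" "(%om. real (X s om)) \<in> borel_measurable Q"
  by (rule measurable_compose[OF XQ(2)], simp) (rule measurable_compose[OF XQ(1)], simp)
 have "Measurable.pred Q (%om. real (X t om) = real (X s om))"
  unfolding pred_def by (intro borel_measurable_eq) measurable
 then have [measurable]: "Measurable.pred Q (%om. X t om = X s om)" by simp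
 have XsS: "X s om \<in> S" if "om \<in> space Q" for om using that st by (intro X_S) auto
 have b_bd: "1 <= b om" "b om <= exp H" "\<bar>b om\<bar> <= exp H" if "om \<in> space Q" for om
  using exit_rate_bounds[OF XsS[OF that]] st by (auto simp: b_def H_def intro: mult_right_mono)
 have p_bd: "\<bar>b om * of_bool (X s om ~= fst p)\<bar> <= exp H" if "om \<in> space Q" for om p
  using b_bd[OF that] by auto
 have i0: "integrable Q (%om. f om * b om * indicator E0 om)"
  using int_f[of "%om. b om * indicator E0 om" "exp H"] b_bd by (auto simp: indicator_def mult.assoc)
 have i1: "integrable Q (%om. f om * (b om * of_bool (X s om ~= fst p)) * indicator (E1 p) om)" for p
  using int_f[of "%om. b om * of_bool (X s om ~= fst p) * indicator (E1 p) om" "exp H"] b_bd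
  by (auto simp: indicator_def mult.assoc)
 have i2: "integrable Q (%om. f om * (b om * of_bool (X t om = X s om) * rest om))"
 proof (rule int_f)
  fix om assume "om \<in> space Q"
  then show "\<bar>b om * of_bool (X t om = X s om) * rest om\<bar> <= exp H"
   using b_bd[of om] rest_01[of om] by auto
 qed measurable
 have i3: "integrable Q (%om. f om * b om)" "integrable Q (%om. f om * (b om * of_bool (X s om ~= fst p)))" for p
  by (rule int_f[OF b_meas b_bd(3)]) (assumption, rule int_f[OF _ p_bd], measurable)
 have "(\<integral>om. f om * (b om * of_bool (X t om = X s om)) \<partial>Q) =
   (\<integral>om. f om * b om * indicator E0 om + (\<Sum>p\<in>I. f om * (b om * of_bool (X s om ~= fst p)) * indicator (E1 p) om) +
    f om * (b om * of_bool (X t om = X s om) * rest om) \<partial>Q)"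
 proof (intro integral_cong_AE)
  show "AE om in Q. f om * (b om * of_bool (X t om = X s om)) =
   f om * b om * indicator E0 om + (\<Sum>p\<in>I. f om * (b om * of_bool (X s om ~= fst p)) * indicator (E1 p) om) +
    f om * (b om * of_bool (X t om = X s om) * rest om)"
   using X_increment_AE[OF st(1) less_imp_le[OF st(2)] st(3)] AE_space
  proof eventually_elim
   case (elim om)
   note X = elim(1)[folded E0_def E1_def]
   consider "om \<in> E0" | p where "p \<in> I" "om \<in> E1 p" | "om \<notin> E0" "\<And>p. p \<in> I ==> om \<notin> E1 p" by blast
   then show ?case
   proof cases
    case 1
    then have "X t om = X s om" "rest om = 0" using X rest_cases(1) by auto
    moreover have "(\<Sum>p\<in>I. f om * (b om * of_bool (X s om ~= fst p)) * indicator (E1 p) om) = 0"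
     using E_disjoint(1) 1 by (intro sum.neutral) (auto simp: indicator_def)
    ultimately show ?thesis using 1 by simp
   next
    case (2 p)
    then have Xt: "X t om = (if X s om = fst p then snd p else X s om)" and r: "rest om = 0"
     using X rest_cases(2) by blast+
    have ne: "snd p ~= fst p" using 2 by (auto simp: state_pairs_def)
    have "(\<Sum>q\<in>I. f om * (b om * of_bool (X s om ~= fst q)) * indicator (E1 q) om) =
     (\<Sum>q\<in>I. if q = p then f om * (b om * of_bool (X s om ~= fst q)) else 0)"
    proof (intro sum.cong refl)
     fix q assume "q \<in> I"
     then show "f om * (b om * of_bool (X s om ~= fst q)) * indicator (E1 q) om =
       (if q = p then f om * (b om * of_bool (X s om ~= fst q)) else 0)"
      using E_disjoint(2)[of om q p] 2 by (cases "om \<in> E1 q") auto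
    qed
    also have "... = f om * (b om * of_bool (X s om ~= fst p))" using 2 by simp
    finally show ?thesis
     using E_disjoint(1)[OF 2(2,1)] Xt ne r by auto
   next
    case 3
    then have "rest om = 1" by (rule rest_cases(3))
    moreover have "(\<Sum>p\<in>I. f om * (b om * of_bool (X s om ~= fst p)) * indicator (E1 p) om) = 0"
     using 3 by (intro sum.neutral) (auto simp: indicator_def)
    ultimately show ?thesis using 3 by simp
   qed
  qed
 qed measurable
 also have "... = (\<integral>om. f om * b om \<partial>Q) * exp (- H) +
   (\<Sum>p\<in>I. (\<integral>om. f om * (b om * of_bool (X s om ~= fst p)) \<partial>Q) * (ap p * (t - s) * exp (- H))) +
   (\<integral>om. f om * (b om * of_bool (X t om = X s om) * rest om) \<partial>Q)"
 proof -
  define v where "v p om = f om * (b om * of_bool (X s om ~= fst p)) * indicator (E1 p) om" for p om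
  define w where "w om = f om * b om * indicator E0 om" for om
  have iv: "integrable Q (v p)" for p unfolding v_def by (rule i1)
  have iw: "integrable Q w" unfolding w_def by (rule i0)
  have "(\<integral>om. v p om \<partial>Q) =
   (\<integral>om. f om * (b om * of_bool (X s om ~= fst p)) \<partial>Q) * (ap p * (t - s) * exp (- H))" if "p \<in> I" for p
   unfolding H_def v_def
  proof (intro int_E(2)[OF _ p_bd that] borel_measurable_times b_measG)
   have "X s \<in> measurable (Gh s) (count_space UNIV)" using st by (intro X_meas_Gh) auto
   then show "(%om. of_bool (X s om ~= fst p)) \<in> borel_measurable (Gh s)"
    by (rule measurable_compose) simp
  qed
  moreover have "(\<integral>om. w om \<partial>Q) = (\<integral>om. f om * b om \<partial>Q) * exp (- H)"
   unfolding H_def w_def by (intro int_E(1)[OF b_measG b_bd(3)])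
  ultimately have "(\<integral>om. w om + (\<Sum>p\<in>I. v p om) + f om * (b om * of_bool (X t om = X s om) * rest om) \<partial>Q) =
   (\<integral>om. f om * b om \<partial>Q) * exp (- H) +
   (\<Sum>p\<in>I. (\<integral>om. f om * (b om * of_bool (X s om ~= fst p)) \<partial>Q) * (ap p * (t - s) * exp (- H))) +
   (\<integral>om. f om * (b om * of_bool (X t om = X s om) * rest om) \<partial>Q)"
   using iv iw i2 by (simp add: Bochner_Integration.integral_sum)
  then show ?thesis unfolding v_def w_def .
 qed
 also have "(\<integral>om. f om * b om \<partial>Q) * exp (- H) +
   (\<Sum>p\<in>I. (\<integral>om. f om * (b om * of_bool (X s om ~= fst p)) \<partial>Q) * (ap p * (t - s) * exp (- H))) =
   (\<integral>om. f om * b om * exp (- H) + (\<Sum>p\<in>I. f om * (b om * of_bool (X s om ~= fst p)) * (ap p * (t - s) * exp (- H))) \<partial>Q)"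
 proof -
  let ?v = "%p om. f om * (b om * of_bool (X s om ~= fst p)) * (ap p * (t - s) * exp (- H))"
  have "(\<integral>om. f om * b om * exp (- H) + (\<Sum>p\<in>I. ?v p om) \<partial>Q) =
    (\<integral>om. f om * b om * exp (- H) \<partial>Q) + (\<integral>om. (\<Sum>p\<in>I. ?v p om) \<partial>Q)"
   by (intro Bochner_Integration.integral_add integrable_mult_left Bochner_Integration.integrable_sum i3)
  also have "(\<integral>om. (\<Sum>p\<in>I. ?v p om) \<partial>Q) = (\<Sum>p\<in>I. \<integral>om. ?v p om \<partial>Q)"
   by (intro Bochner_Integration.integral_sum integrable_mult_left i3)
  finally show ?thesis by (simp only: integral_mult_left_zero)
 qed
 also have "... = (\<integral>om. f om * ((1 + (H - exit_rate (X s om) * (t - s))) * exp (- (H - exit_rate (X s om) * (t - s)))) \<partial>Q)"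
 proof (intro Bochner_Integration.integral_cong refl)
  fix om assume om: "om \<in> space Q"
  have eqa: "(\<Sum>p\<in>I. ap p * of_bool (X s om ~= fst p)) = a_total - exit_rate (X s om)"
  proof -
   have "a_total = (\<Sum>p\<in>I. ap p * of_bool (X s om ~= fst p) + (if fst p = X s om then ap p else 0))"
    unfolding a_total_def by (intro sum.cong refl) auto
   moreover have "(\<Sum>p\<in>I. if fst p = X s om then ap p else 0) = exit_rate (X s om)"
    unfolding exit_rate_bounds(3)[OF XsS[OF om]] by (rule sum.inter_filter[symmetric]) simp
   ultimately show ?thesis unfolding sum.distrib by linarith
  qed
  have "(\<Sum>p\<in>I. f om * (b om * of_bool (X s om ~= fst p)) * (ap p * (t - s) * exp (- H))) =
    f om * (b om * exp (- H)) * (t - s) * (a_total - exit_rate (X s om))"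
   unfolding eqa[symmetric] sum_distrib_left by (intro sum.cong refl) (simp only: mult_ac)
  moreover have "b om * exp (- H) = exp (- (H - exit_rate (X s om) * (t - s)))"
   by (simp add: b_def exp_add[symmetric])
  ultimately have "f om * (b om * exp (- H)) + (\<Sum>p\<in>I. f om * (b om * of_bool (X s om ~= fst p)) * (ap p * (t - s) * exp (- H))) =
   f om * exp (- (H - exit_rate (X s om) * (t - s))) +
   f om * exp (- (H - exit_rate (X s om) * (t - s))) * (t - s) * (a_total - exit_rate (X s om))"
   by (simp only:)
  also have "... = f om * ((1 + (H - exit_rate (X s om) * (t - s))) * exp (- (H - exit_rate (X s om) * (t - s))))"
   unfolding H_def by algebra
  finally show "f om * b om * exp (- H) + (\<Sum>p\<in>I. f om * (b om * of_bool (X s om ~= fst p)) * (ap p * (t - s) * exp (- H))) =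
   f om * ((1 + (H - exit_rate (X s om) * (t - s))) * exp (- (H - exit_rate (X s om) * (t - s))))"
   by (simp only: mult.assoc)
 qed
 finally have main: "(\<integral>om. f om * (b om * of_bool (X t om = X s om)) \<partial>Q) =
  (\<integral>om. f om * ((1 + (H - exit_rate (X s om) * (t - s))) * exp (- (H - exit_rate (X s om) * (t - s)))) \<partial>Q) +
   (\<integral>om. f om * (b om * of_bool (X t om = X s om) * rest om) \<partial>Q)" (is "_ = ?M + ?R") .
 have \<beta>: "0 <= H - exit_rate (X s om) * (t - s)" "H - exit_rate (X s om) * (t - s) <= H" if "om \<in> space Q" for om
  using exit_rate_bounds[OF XsS[OF that]] st by (auto simp: H_def intro: mult_right_mono)
 define g where "g om = (1 + (H - exit_rate (X s om) * (t - s))) * exp (- (H - exit_rate (X s om) * (t - s)))" for om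
 have g: "1 - H\<^sup>2 <= g om" "g om <= 1" if "om \<in> space Q" for om
 proof -
  have "(H - exit_rate (X s om) * (t - s))\<^sup>2 <= H\<^sup>2" using \<beta>[OF that] by (intro power_mono) auto
  then show "1 - H\<^sup>2 <= g om" "g om <= 1"
   using exp_second_order[OF \<beta>(1)[OF that]] unfolding g_def by linarith+
 qed
 have [measurable]: "g \<in> borel_measurable Q" unfolding g_def by measurable
 have if': "integrable Q f" using int_f[of "%_. 1" 1] by simp
 have ig: "integrable Q (%om. f om * g om)"
 proof (rule int_f)
  fix om assume "om \<in> space Q"
  then show "\<bar>g om\<bar> <= 1 + H\<^sup>2" using g[of om] zero_le_power2[of H] by linarith
 qed measurable
 have M: "?M <= (\<integral>om. f om \<partial>Q)" "(\<integral>om. f om \<partial>Q) - H\<^sup>2 * (\<integral>om. f om \<partial>Q) <= ?M"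
 proof -
  have "(\<integral>om. f om * g om \<partial>Q) <= (\<integral>om. f om * 1 \<partial>Q)"
   using ig if' g f0 by (intro integral_mono_AE AE_I2 mult_left_mono) auto
  then show "?M <= (\<integral>om. f om \<partial>Q)" by (simp add: g_def)
  have "(\<integral>om. f om * (1 - H\<^sup>2) \<partial>Q) <= (\<integral>om. f om * g om \<partial>Q)"
   using ig if' g f0 by (intro integral_mono_AE AE_I2 mult_left_mono) auto
  moreover have "(\<integral>om. f om * (1 - H\<^sup>2) \<partial>Q) = (\<integral>om. f om \<partial>Q) - H\<^sup>2 * (\<integral>om. f om \<partial>Q)"
   unfolding integral_mult_left_zero by algebra
  ultimately show "(\<integral>om. f om \<partial>Q) - H\<^sup>2 * (\<integral>om. f om \<partial>Q) <= ?M" by (simp only: g_def)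
 qed
 have R: "0 <= ?R" "?R <= exp H * (H\<^sup>2 * (\<integral>om. f om \<partial>Q))"
 proof -
  have r0: "0 <= rest om" for om using rest_01[of om] by auto
  show "0 <= ?R" using f0 r0 b_bd(1)
   by (intro integral_nonneg_AE AE_I2 mult_nonneg_nonneg) (auto intro: order_trans[OF zero_le_one])
  have ir: "integrable Q (%om. f om * rest om)"
  proof (rule int_f)
   fix om show "\<bar>rest om\<bar> <= 1" using rest_01[of om] by auto
  qed measurable
  have "?R <= (\<integral>om. exp H * (f om * rest om) \<partial>Q)"
  proof (intro integral_mono_AE i2 AE_I2 integrable_mult_right ir)
   fix om assume om: "om \<in> space Q"
   have "b om * of_bool (X t om = X s om) * rest om <= exp H * 1 * rest om"
    using b_bd[OF om] r0 by (intro mult_right_mono mult_mono) auto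
   then have "f om * (b om * of_bool (X t om = X s om) * rest om) <= f om * (exp H * 1 * rest om)"
    using f0[OF om] by (intro mult_left_mono)
   then show "f om * (b om * of_bool (X t om = X s om) * rest om) <= exp H * (f om * rest om)" by (simp add: mult_ac)
  qed
  also have "... <= exp H * (H\<^sup>2 * (\<integral>om. f om \<partial>Q))"
   using int_rest by (simp add: H_def power_mult_distrib)
  finally show "?R <= exp H * (H\<^sup>2 * (\<integral>om. f om \<partial>Q))" .
 qed
 have Hf: "0 <= H\<^sup>2 * (\<integral>om. f om \<partial>Q)" using f0 by (intro mult_nonneg_nonneg integral_nonneg_AE AE_I2) auto
 have "0 <= exp H * (H\<^sup>2 * (\<integral>om. f om \<partial>Q))" by (rule mult_nonneg_nonneg[OF exp_ge_zero Hf])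
 with Hf have "\<bar>(\<integral>om. f om * (b om * of_bool (X t om = X s om)) \<partial>Q) - (\<integral>om. f om \<partial>Q)\<bar> <=
   2 * (H\<^sup>2 * (\<integral>om. f om \<partial>Q)) + exp H * (H\<^sup>2 * (\<integral>om. f om \<partial>Q))"
  using main M R by linarith
 also have "... = a_total\<^sup>2 * (t - s)\<^sup>2 * (\<integral>om. f om \<partial>Q) * (2 + exp (a_total * (t - s)))"
  unfolding H_def power_mult_distrib by algebra
 also have "... <= step_error * (t - s)\<^sup>2 * (\<integral>om. f om \<partial>Q)" by (rule step_error_le)
 finally show ?thesis by (simp add: b_def)
qed

end

end

section \<open>One grid step of the Feller iteration\<close>

definition surv_real :: "(nat => real => ennreal) => nat => real => real => real" where
 "surv_real k x p q = enn2real (surv (k x) p q)"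

definition feller_real :: "nat set => (nat => real => ennreal) => (nat => nat => real => real) => nat => real =>
  nat => nat => real => real" where
 "feller_real S k lr y t i x u = enn2real (feller S k (%x z u. ennreal (lr x z u)) i x y u t)"

definition jump_density :: "nat set => (nat => real => ennreal) => (nat => nat => real => real) => nat => real =>
  nat => nat => nat => real => real => real" where
 "jump_density S k lr y t i x z p w = surv_real k x p w * (lr x z w * feller_real S k lr y t i z w)"

text \<open>The error at time \<open>w\<close> of the cell \<open>]p,q]\<close> made by freezing the jump density.\<close>
definition freeze_defect :: "nat set => (nat => real => ennreal) => (nat => nat => real => real) => nat => real =>
  (nat => real) => nat => nat => nat => real => real => real => real" where
 "freeze_defect S k lr y t b i x z p q w =
   \<bar>exp (b x * (q - p)) * (lr x z p * feller_real S k lr y t i z q) - jump_density S k lr y t i x z p w\<bar>"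

lemma surv_real_bounds: "0 <= surv_real k x p q" "surv_real k x p q <= 1"
 unfolding surv_real_def using surv_le_1[of "k x" p q] by (auto intro: enn2real_leI)

lemma feller_real_nonneg: "0 <= feller_real S k lr y t i x u"
 by (simp add: feller_real_def)

context
 fixes S :: "nat set" and k :: "nat => real => ennreal" and lr :: "nat => nat => real => real" and L :: real
  and y :: nat and t :: real
 assumes fin_S: "finite S" and y: "y \<in> S"
  and k_meas [measurable]: "\<And>x. k x \<in> borel_measurable borel"
  and lr_meas [measurable]: "\<And>x z. lr x z \<in> borel_measurable borel"
  and lr: "\<And>x z u. 0 <= lr x z u" "\<And>x z u. lr x z u <= L"
  and sub: "\<And>x u. (\<Sum>z\<in>S - {x}. ennreal (lr x z u)) <= k x u"
begin

abbreviation "rfeller \<equiv> feller_real S k lr y t"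
abbreviation "rsurv \<equiv> surv_real k"
abbreviation "jump_term \<equiv> jump_density S k lr y t"
abbreviation "defect \<equiv> freeze_defect S k lr y t"

lemma l_meas: "(%u. ennreal (lr x z u)) \<in> borel_measurable borel"
 by measurable

lemma surv_rsurv: "surv (k x) p q = ennreal (rsurv x p q)"
proof -
 have "surv (k x) p q < \<top>" using surv_le_1[of "k x" p q] by (metis ennreal_one_less_top le_less_trans)
 then show ?thesis by (simp add: surv_real_def)
qed

lemma feller_rfeller:
 assumes "u <= t"
 shows "feller S k (%x z u. ennreal (lr x z u)) i x y u t = ennreal (rfeller i x u)" "rfeller i x u <= 1"
proof -
 have le: "feller S k (%x z u. ennreal (lr x z u)) i x y u t <= 1"
  by (rule feller_le_1[OF fin_S k_meas l_meas sub assms y])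
 then have "feller S k (%x z u. ennreal (lr x z u)) i x y u t < \<top>" by (metis ennreal_one_less_top le_less_trans)
 then show "feller S k (%x z u. ennreal (lr x z u)) i x y u t = ennreal (rfeller i x u)"
  by (simp add: feller_real_def)
 show "rfeller i x u <= 1" unfolding feller_real_def using le by (auto intro: enn2real_leI)
qed

lemma rfeller_0 [simp]: "rfeller 0 x u = 0"
 by (simp add: feller_real_def)

lemma rfeller_end [simp]: "rfeller (Suc i) x t = of_bool (x = y)"
 by (simp add: feller_real_def)

lemma L_nonneg: "0 <= L"
 using lr order_trans by blast

lemma measurable_rfeller [measurable]: "rfeller i x \<in> borel_measurable borel"
 unfolding feller_real_def using measurable_feller[OF fin_S k_meas l_meas, of "%u. u" borel "%_. t"] by measurable

lemma measurable_rsurv [measurable]: "rsurv x p \<in> borel_measurable borel"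
 unfolding surv_real_def by measurable

lemma jump_term_bounds: "w <= t ==> 0 <= jump_term i x z p w" "w <= t ==> jump_term i x z p w <= L"
proof -
 assume w: "w <= t"
 have "jump_term i x z p w <= 1 * (L * 1)"
  unfolding jump_density_def using w surv_real_bounds lr feller_rfeller(2) feller_real_nonneg L_nonneg
  by (intro mult_mono) (auto intro!: mult_nonneg_nonneg)
 then show "jump_term i x z p w <= L" by simp
 show "0 <= jump_term i x z p w"
  unfolding jump_density_def using surv_real_bounds lr feller_real_nonneg by (intro mult_nonneg_nonneg) auto
qed

lemma jump_term_integrable:
 assumes "p <= q" "q <= t"
 shows "integrable lborel (%w. jump_term i x z p w * indicator {p<..<q} w)"
proof (rule Bochner_Integration.integrable_bound[of _ "%w. L * indicator {p<..<q} w"])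
 show "integrable lborel (%w. L * indicator {p<..<q} w)"
  using assms by (intro integrable_mult_right integrable_real_indicator) auto
 show "(%w. jump_term i x z p w * indicator {p<..<q} w) \<in> borel_measurable lborel"
  unfolding jump_density_def by measurable
 show "AE w in lborel. norm (jump_term i x z p w * indicator {p<..<q} w) <= norm (L * indicator {p<..<q} w)"
  using jump_term_bounds assms L_nonneg by (intro AE_I2) (auto simp: indicator_def abs_mult)
qed

lemma rfeller_split:
 assumes "p <= q" "q <= t"
 shows "rfeller (Suc i) x p = rsurv x p q * rfeller (Suc i) x q +
  (\<integral>w. (\<Sum>z\<in>S - {x}. jump_term i x z p w) * indicator {p<..<q} w \<partial>lborel)"
proof -
 let ?j = "%w. (\<Sum>z\<in>S - {x}. jump_term i x z p w) * indicator {p<..<q} w"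
 have j0: "0 <= ?j w" for w
  using jump_term_bounds(1) assms by (cases "w \<in> {p<..<q}") (auto intro!: sum_nonneg)
 have ij: "integrable lborel ?j"
  unfolding sum_distrib_right by (intro Bochner_Integration.integrable_sum jump_term_integrable assms)
 have "(\<integral>\<^sup>+w\<in>{p<..<q}. surv (k x) p w * (\<Sum>z\<in>S - {x}. ennreal (lr x z w) *
   feller S k (%x z u. ennreal (lr x z u)) i z y w t) \<partial>lborel) = (\<integral>\<^sup>+w. ennreal (?j w) \<partial>lborel)"
 proof (intro nn_integral_cong)
  fix w
  show "surv (k x) p w * (\<Sum>z\<in>S - {x}. ennreal (lr x z w) * feller S k (%x z u. ennreal (lr x z u)) i z y w t) *
   indicator {p<..<q} w = ennreal (?j w)"
  proof (cases "w \<in> {p<..<q}")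
   case True
   then have w: "w <= t" using assms by auto
   have "surv (k x) p w * (\<Sum>z\<in>S - {x}. ennreal (lr x z w) * feller S k (%x z u. ennreal (lr x z u)) i z y w t) =
    ennreal (rsurv x p w) * (\<Sum>z\<in>S - {x}. ennreal (lr x z w * rfeller i z w))"
    using w lr feller_real_nonneg by (simp add: surv_rsurv feller_rfeller(1) ennreal_mult del: feller.simps)
   also have "... = ennreal (rsurv x p w * (\<Sum>z\<in>S - {x}. lr x z w * rfeller i z w))"
    using lr feller_real_nonneg surv_real_bounds
    by (subst sum_ennreal) (auto intro!: mult_nonneg_nonneg sum_nonneg ennreal_mult[symmetric])
   finally show ?thesis using True by (simp add: jump_density_def sum_distrib_left)
  qed simp
 qed
 also have "... = ennreal (\<integral>w. ?j w \<partial>lborel)"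
  using ij j0 by (intro nn_integral_eq_integral) auto
 finally have int: "(\<integral>\<^sup>+w\<in>{p<..<q}. surv (k x) p w * (\<Sum>z\<in>S - {x}. ennreal (lr x z w) *
   feller S k (%x z u. ennreal (lr x z u)) i z y w t) \<partial>lborel) = ennreal (\<integral>w. ?j w \<partial>lborel)" .
 have "ennreal (rfeller (Suc i) x p) = ennreal (rsurv x p q) * ennreal (rfeller (Suc i) x q) + ennreal (\<integral>w. ?j w \<partial>lborel)"
  using feller_Suc_split[where S=S and k=k and l="%x z u. ennreal (lr x z u)" and n=i and x=x and y=y,
    OF fin_S k_meas l_meas assms, unfolded int]
  by (simp only: surv_rsurv feller_rfeller(1)[OF assms(2)] feller_rfeller(1)[OF order_trans[OF assms]])
 also have "... = ennreal (rsurv x p q * rfeller (Suc i) x q + (\<integral>w. ?j w \<partial>lborel))"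
  using surv_real_bounds feller_real_nonneg j0 by (simp add: ennreal_mult ennreal_plus integral_nonneg_AE)
 finally show ?thesis
  using surv_real_bounds feller_real_nonneg j0
  by (subst (asm) ennreal_inj) (auto intro!: add_nonneg_nonneg mult_nonneg_nonneg integral_nonneg_AE)
qed

lemma defect_bound:
 assumes "p <= q" "q <= t" "w <= t" "b x * (q - p) <= B"
 shows "defect b i x z p q w <= exp B * L + L"
proof -
 have "exp (b x * (q - p)) * (lr x z p * rfeller i z q) <= exp B * (L * 1)"
  using assms lr feller_rfeller(2) feller_real_nonneg L_nonneg by (intro mult_mono) (auto intro!: mult_nonneg_nonneg)
 moreover have "0 <= exp (b x * (q - p)) * (lr x z p * rfeller i z q)"
  using lr feller_real_nonneg by (intro mult_nonneg_nonneg) auto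
 ultimately show ?thesis
  unfolding freeze_defect_def using jump_term_bounds[OF assms(3), of i x z p] by (auto simp: abs_le_iff)
qed

text \<open>Compare the first-jump equation over \<open>]p,q]\<close> with the one in which the jump density
  is frozen at the left end point: the difference is the integral of the defect.\<close>
lemma rfeller_step_error:
 assumes pq: "p <= q" "q <= t"
 shows "\<bar>rsurv x p q * rfeller (Suc i) x q +
   (\<Sum>z\<in>S - {x}. (q - p) * (exp (b x * (q - p)) * (lr x z p * rfeller i z q))) - rfeller (Suc i) x p\<bar>
  <= (\<integral>w. (\<Sum>z\<in>S - {x}. defect b i x z p q w) * indicator {p<..q} w \<partial>lborel)"
proof -
 let ?c = "%z. exp (b x * (q - p)) * (lr x z p * rfeller i z q)"
 let ?j = "%w. (\<Sum>z\<in>S - {x}. jump_term i x z p w)"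
 have ic: "integrable lborel (%w. (\<Sum>z\<in>S - {x}. ?c z) * indicator {p<..<q} w)"
  using pq by (intro integrable_mult_right integrable_real_indicator) auto
 have ij: "integrable lborel (%w. ?j w * indicator {p<..<q} w)"
  unfolding sum_distrib_right by (intro Bochner_Integration.integrable_sum jump_term_integrable pq)
 have "(\<integral>w. (\<Sum>z\<in>S - {x}. ?c z) * indicator {p<..<q} w \<partial>lborel) = (\<Sum>z\<in>S - {x}. (q - p) * ?c z)"
  using pq by (simp add: sum_distrib_left mult.commute)
 then have "rsurv x p q * rfeller (Suc i) x q + (\<Sum>z\<in>S - {x}. (q - p) * ?c z) - rfeller (Suc i) x p =
   (\<integral>w. (\<Sum>z\<in>S - {x}. ?c z) * indicator {p<..<q} w \<partial>lborel) - (\<integral>w. ?j w * indicator {p<..<q} w \<partial>lborel)"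
  using rfeller_split[OF pq, of i x] by linarith
 also have "... = (\<integral>w. (\<Sum>z\<in>S - {x}. ?c z) * indicator {p<..<q} w - ?j w * indicator {p<..<q} w \<partial>lborel)"
  by (rule Bochner_Integration.integral_diff[OF ic ij, symmetric])
 finally have "\<bar>rsurv x p q * rfeller (Suc i) x q + (\<Sum>z\<in>S - {x}. (q - p) * ?c z) - rfeller (Suc i) x p\<bar> =
   \<bar>\<integral>w. (\<Sum>z\<in>S - {x}. ?c z) * indicator {p<..<q} w - ?j w * indicator {p<..<q} w \<partial>lborel\<bar>" by simp
 also have "... <= (\<integral>w. \<bar>(\<Sum>z\<in>S - {x}. ?c z) * indicator {p<..<q} w - ?j w * indicator {p<..<q} w\<bar> \<partial>lborel)"
  by (rule integral_abs_bound)
 also have "... <= (\<integral>w. (\<Sum>z\<in>S - {x}. defect b i x z p q w) * indicator {p<..q} w \<partial>lborel)"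
 proof (intro integral_mono_AE AE_I2)
  show "integrable lborel (%w. \<bar>(\<Sum>z\<in>S - {x}. ?c z) * indicator {p<..<q} w - ?j w * indicator {p<..<q} w\<bar>)"
   by (intro integrable_abs Bochner_Integration.integrable_diff ic ij)
  show "integrable lborel (%w. (\<Sum>z\<in>S - {x}. defect b i x z p q w) * indicator {p<..q} w)"
   unfolding sum_distrib_right
  proof (rule Bochner_Integration.integrable_sum)
   fix z
   show "integrable lborel (%w. defect b i x z p q w * indicator {p<..q} w)"
   proof (rule Bochner_Integration.integrable_bound)
    show "integrable lborel (%w. (exp (b x * (q - p)) * L + L) * indicator {p<..q} w)"
     using pq by (intro integrable_mult_right integrable_real_indicator) auto
    show "(%w. defect b i x z p q w * indicator {p<..q} w) \<in> borel_measurable lborel"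
     unfolding freeze_defect_def jump_density_def by measurable
    have nn: "0 <= exp (b x * (q - p)) * L + L" using L_nonneg by simp
    show "AE w in lborel. norm (defect b i x z p q w * indicator {p<..q} w) <=
      norm ((exp (b x * (q - p)) * L + L) * indicator {p<..q} w)"
    proof (rule AE_I2)
     fix w
     show "norm (defect b i x z p q w * indicator {p<..q} w) <= norm ((exp (b x * (q - p)) * L + L) * indicator {p<..q} w)"
     proof (cases "w \<in> {p<..q}")
      case True
      then have "defect b i x z p q w <= exp (b x * (q - p)) * L + L"
       using pq by (intro defect_bound) auto
      moreover have "0 <= defect b i x z p q w" by (simp add: freeze_defect_def)
      ultimately show ?thesis using nn True by simp
     qed simp
    qed
   qed
  qed
  fix w
  have "\<bar>(\<Sum>z\<in>S - {x}. ?c z) - ?j w\<bar> <= (\<Sum>z\<in>S - {x}. defect b i x z p q w)"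
   unfolding freeze_defect_def sum_subtractf[symmetric] by (rule sum_abs)
  then show "\<bar>(\<Sum>z\<in>S - {x}. ?c z) * indicator {p<..<q} w - ?j w * indicator {p<..<q} w\<bar> <=
    (\<Sum>z\<in>S - {x}. defect b i x z p q w) * indicator {p<..q} w"
   by (cases "w \<in> {p<..<q}") (auto simp: freeze_defect_def indicator_def intro!: sum_nonneg)
 qed
 finally show ?thesis .
qed

text \<open>To the left of \<open>w\<close> the rates are bounded, so nothing is killed in the limit; to the right of \<open>w\<close> the
 truncated Feller iteration is continuous.\<close>
lemma defect_tendsto:
 assumes s: "s < t" "s < w" "w < t"
  and lim: "(lr x z \<longlongrightarrow> lr x z w) (at_left w)"
  and k_bd: "eventually (%u. k x u <= ennreal C) (at_left w)"
 shows "(%m. defect b i x z (cell_lo s t m w) (cell_hi s t m w) w) \<longlonglongrightarrow> 0"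
proof -
 have w: "s < w" "w <= t" using s by auto
 have lo: "(%m. cell_lo s t m w) \<longlonglongrightarrow> w" and hi: "(%m. cell_hi s t m w) \<longlonglongrightarrow> w"
  using tendsto_cell[OF s(1) w] by auto
 have "(%m. lr x z (cell_lo s t m w)) \<longlonglongrightarrow> lr x z w"
  by (rule filterlim_compose[OF lim filterlim_cell_lo[OF s(1) w]])
 moreover have "(%m. rfeller i z (cell_hi s t m w)) \<longlonglongrightarrow> rfeller i z w"
 proof -
  define r where "r m = cell_hi s t (Suc m) w" for m
  have r: "w <= r m" "r m <= t" for m
   using cell_bounds[OF s(1) _ w, of "Suc m"] cell_lo_hi_bounds[OF s(1) _ w, of "Suc m"] by (auto simp: r_def)
  have "(%m. feller S k (%x z u. ennreal (lr x z u)) i z y (r m) t) \<longlonglongrightarrow> feller S k (%x z u. ennreal (lr x z u)) i z y w t"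
  proof (rule feller_tendsto_right[OF fin_S k_meas l_meas sub, where L=L])
   show "r \<longlonglongrightarrow> w" unfolding r_def by (rule LIMSEQ_Suc[OF hi])
  qed (use r s y lr L_nonneg in \<open>auto intro: ennreal_leI\<close>)
  then have "(%m. ennreal (rfeller i z (r m))) \<longlonglongrightarrow> ennreal (rfeller i z w)"
   using r w by (simp add: feller_rfeller(1))
  then have "(%m. rfeller i z (r m)) \<longlonglongrightarrow> rfeller i z w"
   by (rule tendsto_ennrealD) (auto simp: feller_real_nonneg)
  then show ?thesis unfolding r_def by (rule LIMSEQ_imp_Suc)
 qed
 moreover have "(%m. rsurv x (cell_lo s t m w) w) \<longlonglongrightarrow> 1"
 proof -
  obtain c where c: "c < w" "\<And>u. c < u ==> u < w ==> k x u <= ennreal C"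
   using k_bd unfolding eventually_at_left_field by auto
  define C' where "C' = max C 0"
  have "(%m. \<integral>\<^sup>+u\<in>{cell_lo s t m w<..<w}. k x u \<partial>lborel) \<longlonglongrightarrow> 0"
  proof (rule tendsto_sandwich[OF _ _ tendsto_const])
   show "eventually (%m. (\<integral>\<^sup>+u\<in>{cell_lo s t m w<..<w}. k x u \<partial>lborel) <= ennreal (C' * (w - cell_lo s t m w))) sequentially"
    using order_tendstoD(1)[OF lo c(1)] eventually_gt_at_top[of 0]
   proof eventually_elim
    case (elim m)
    have lw: "cell_lo s t m w < w" using cell_bounds(2)[OF s(1) elim(2) w] .
    have "(\<integral>\<^sup>+u\<in>{cell_lo s t m w<..<w}. k x u \<partial>lborel) <= (\<integral>\<^sup>+u\<in>{cell_lo s t m w<..<w}. ennreal C' \<partial>lborel)"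
    proof (intro nn_integral_mono)
     fix u
     have "k x u <= ennreal C'" if "cell_lo s t m w < u" "u < w"
      using c(2)[of u] that elim(1) by (auto simp: C'_def intro: order_trans ennreal_leI)
     then show "k x u * indicator {cell_lo s t m w<..<w} u <= ennreal C' * indicator {cell_lo s t m w<..<w} u"
      by (auto simp: indicator_def)
    qed
    also have "... = ennreal (C' * (w - cell_lo s t m w))"
     using lw by (simp add: nn_integral_cmult ennreal_mult C'_def)
    finally show ?case .
   qed
   have "(%m. C' * (w - cell_lo s t m w)) \<longlonglongrightarrow> C' * (w - w)"
    by (intro tendsto_intros lo)
   then have "(%m. ennreal (C' * (w - cell_lo s t m w))) \<longlonglongrightarrow> ennreal 0"
    by (intro tendsto_ennrealI) simp
   then show "(%m. ennreal (C' * (w - cell_lo s t m w))) \<longlonglongrightarrow> 0" by simp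
  qed auto
  then have "(%m. surv (k x) (cell_lo s t m w) w) \<longlonglongrightarrow> 1"
   unfolding surv_def using tendsto_neg_exp by fastforce
  then have "(%m. ennreal (rsurv x (cell_lo s t m w) w)) \<longlonglongrightarrow> ennreal 1" by (simp add: surv_rsurv)
  then show ?thesis by (rule tendsto_ennrealD) (auto simp: surv_real_bounds)
 qed
 ultimately have "(%m. defect b i x z (cell_lo s t m w) (cell_hi s t m w) w) \<longlonglongrightarrow>
   \<bar>exp (b x * (w - w)) * (lr x z w * rfeller i z w) - 1 * (lr x z w * rfeller i z w)\<bar>"
  unfolding freeze_defect_def jump_density_def by (intro tendsto_intros lo hi)
 then show ?thesis by simp
qed

end

section \<open>The grid estimate\<close>

locale driven_chain_rates = driven_chain +
 fixes \<Lambda> :: "nat => nat => real => 'a => real"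
 assumes canonical: "canonical_conditions T Q d F \<Lambda>"
begin

text \<open>Outside \<open>[0,T]\<close> and off the diagonal nothing is known about
  \<open>\<Lambda>\<close>. The cut-off makes the rates total, nonnegative and jointly measurable, without
  changing them where they matter.\<close>
definition lam :: "nat => nat => real => 'a => real" where
 "lam x z u om = (if (x, z) \<in> I \<and> 0 <= u \<and> u <= T then max 0 (\<Lambda> x z u om) else 0)"

definition kil :: "nat => real => 'a => ennreal" where
 "kil x u om = (\<Sum>z\<in>S - {x}. ennreal (lam x z u om))"

definition lam_left :: "nat => nat => real => 'a => real" where
 "lam_left x z u om = (if (x, z) \<in> I then left_lim (%s. \<Lambda> x z s om) u else 0)"

lemma lam_nonneg [simp]: "0 <= lam x z u om"
 by (simp add: lam_def)

lemma \<Lambda>_nonneg: "(x, z) \<in> I ==> 0 <= t ==> t <= T ==> om \<in> space Q ==> 0 <= \<Lambda> x z t om"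
proof -
 assume *: "(x, z) \<in> I" "0 <= t" "t <= T" "om \<in> space Q"
 then have "\<forall>(x, y)\<in>I. 0 <= \<Lambda> x y t om"
  using canonical unfolding canonical_conditions_def by (meson atLeastAtMost_iff)
 then show "0 <= \<Lambda> x z t om" using *(1) by blast
qed

lemma lam_eq: "(x, z) \<in> I ==> 0 <= t ==> t <= T ==> om \<in> space Q ==> lam x z t om = \<Lambda> x z t om"
 using \<Lambda>_nonneg[of x z t om] by (simp add: lam_def)

text \<open>Progressive measurability is what makes the transition function over \<open>]s,t]\<close>
  measurable with respect to \<open>F t\<close>, and not only \<open>F T\<close>.\<close>
lemma lam_meas_upto:
 assumes t: "0 <= t" "t <= T"
 shows "(%(u, om). lam x z u om * indicator {..t} u) \<in> borel_measurable (borel \<Otimes>\<^sub>M F t)"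
proof (cases "(x, z) \<in> I")
 case True
 let ?N = "(borel :: real measure) \<Otimes>\<^sub>M F t" and ?\<Omega> = "{0..t} \<times> space (F t)"
 have "progressive T F (\<Lambda> x z)"
  using canonical True by (auto simp: canonical_conditions_def state_pairs_def)
 then have prog: "(%(s, om). \<Lambda> x z s om) \<in> borel_measurable (restrict_space borel {0..t} \<Otimes>\<^sub>M F t)"
  using t by (auto simp: progressive_def)
 have id: "(%p. (fst p, snd p)) \<in> measurable (restrict_space ?N ?\<Omega>) (restrict_space borel {0..t} \<Otimes>\<^sub>M F t)"
 proof (intro measurable_Pair measurable_restrict_space2)
  show "fst \<in> measurable (restrict_space ?N ?\<Omega>) borel"
   by (intro measurable_restrict_space1 measurable_fst)
  show "snd \<in> measurable (restrict_space ?N ?\<Omega>) (F t)"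
   by (intro measurable_restrict_space1 measurable_snd)
 qed (auto simp: space_restrict_space)
 have "(%p. \<Lambda> x z (fst p) (snd p)) \<in> borel_measurable (restrict_space ?N ?\<Omega>)"
  using measurable_compose[OF id prog] by (simp add: split_beta)
 moreover have "?\<Omega> \<inter> space ?N \<in> sets ?N" by simp
 ultimately have *: "(%p. if p \<in> ?\<Omega> then \<Lambda> x z (fst p) (snd p) else 0) \<in> borel_measurable ?N"
  by (subst (asm) measurable_restrict_space_iff[where c=0]) auto
 have "(%p. max 0 (if p \<in> ?\<Omega> then \<Lambda> x z (fst p) (snd p) else 0)) \<in> borel_measurable ?N"
  using * by measurable
 then show ?thesis
  by (rule measurable_cong[THEN iffD1, rotated])
    (use True t in \<open>auto simp: lam_def space_pair_measure indicator_def split: prod.splits\<close>)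
qed (simp add: lam_def)

lemma lam_meas: "(%(u, om). lam x z u om) \<in> borel_measurable (borel \<Otimes>\<^sub>M F T)"
proof -
 have "(%(u, om). lam x z u om * indicator {..T} u) = (%(u, om). lam x z u om)"
  by (auto simp: lam_def fun_eq_iff indicator_def)
 then show ?thesis using lam_meas_upto[of T x z] T_pos by simp
qed

lemma kil_meas: "(%(u, om). kil x u om) \<in> borel_measurable (borel \<Otimes>\<^sub>M F T)"
 unfolding kil_def using lam_meas by (auto simp: split_beta intro!: borel_measurable_sum measurable_compose[OF _ measurable_ennreal])

lemma space_FT: "space (F T) = space Q"
 using F_subalg[of T] T_pos by (auto simp: subalgebra_def)

lemma lam_path_meas [measurable]: "om \<in> space Q ==> (%u. lam x z u om) \<in> borel_measurable borel"
 using measurable_Pair2'[of om "F T" borel] measurable_compose[OF _ lam_meas, of "%u. (u, om)" borel x z]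
 by (simp add: space_FT)

lemma kil_path_meas [measurable]: "om \<in> space Q ==> (%u. kil x u om) \<in> borel_measurable borel"
 unfolding kil_def by measurable

lemma lam_left_limits_AE:
 "AE om in Q. (\<forall>x z. \<forall>u\<in>{0<..T}. ((%r. lam x z r om) \<longlongrightarrow> lam_left x z u om) (at_left u)) \<and>
   (\<forall>x z. countable {u\<in>{0<..T}. lam x z u om ~= lam_left x z u om})"
proof -
 have "AE om in Q. \<forall>p\<in>I. (\<forall>t\<in>{0<..T}. \<exists>l. ((%s. \<Lambda> (fst p) (snd p) s om) \<longlongrightarrow> l) (at_left t)) \<and>
    countable {t\<in>{0<..T}. jump (%s. \<Lambda> (fst p) (snd p) s om) t ~= 0}"
  using canonical by (intro AE_finite_allI finite_I) (auto simp: canonical_conditions_def)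
 with AE_space show ?thesis
 proof eventually_elim
  case (elim om)
  have lim: "((%r. lam x z r om) \<longlongrightarrow> lam_left x z u om) (at_left u)" if u: "0 < u" "u <= T" for x z u
  proof (cases "(x, z) \<in> I")
   case True
   then obtain l where l: "((%s. \<Lambda> x z s om) \<longlongrightarrow> l) (at_left u)" using elim u by force
   then have "lam_left x z u om = l"
    using u True by (auto simp: lam_left_def left_lim_def intro!: tendsto_Lim)
   moreover have "eventually (%r. \<Lambda> x z r om = lam x z r om) (at_left u)"
   proof -
    have "eventually (%r. r \<in> {0<..<u}) (at_left u)" using u by (intro eventually_at_left_real) auto
    then show ?thesis by eventually_elim (use elim(1) u True in \<open>auto simp: lam_eq\<close>)
   qed
   ultimately show ?thesis using Lim_transform_eventually[OF l, of "%r. lam x z r om"] by simp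
  qed (simp add: lam_left_def lam_def)
  have "countable {u\<in>{0<..T}. lam x z u om ~= lam_left x z u om}" for x z
  proof (cases "(x, z) \<in> I")
   case True
   then have "countable {t\<in>{0<..T}. jump (%s. \<Lambda> x z s om) t ~= 0}" using elim(2) by force
   moreover have "{u\<in>{0<..T}. lam x z u om ~= lam_left x z u om} \<subseteq> {t\<in>{0<..T}. jump (%s. \<Lambda> x z s om) t ~= 0}"
    using True elim(1) by (auto simp: jump_def lam_left_def lam_eq)
   ultimately show ?thesis by (rule countable_subset[rotated])
  qed (simp add: lam_left_def lam_def)
  then show ?case using lim by auto
 qed
qed

definition lamL :: "nat => nat => nat => real => 'a => real" where
 "lamL L x z u om = min (lam x z u om) (real L)"

lemma lamL_bounds: "0 <= lamL L x z u om" "lamL L x z u om <= real L" "lamL L x z u om <= lam x z u om"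
 by (auto simp: lamL_def)

lemma lamL_meas: "(%(u, om). lamL L x z u om) \<in> borel_measurable (borel \<Otimes>\<^sub>M F T)"
 unfolding lamL_def using lam_meas by (simp add: split_beta)

lemma lamL_path_meas [measurable]: "om \<in> space Q ==> (%u. lamL L x z u om) \<in> borel_measurable borel"
 unfolding lamL_def by measurable

lemma lamL_sub: "(\<Sum>z\<in>S - {x}. ennreal (lamL L x z u om)) <= kil x u om"
 unfolding kil_def by (intro sum_mono ennreal_leI lamL_bounds)

text \<open>A process with left limits and countably many jumps is left continuous at almost every time, and
  bounded to the left of every time.\<close>
lemma lamL_left_AE:
 "AE om in Q. om \<in> space Q \<and> (AE w in lborel. 0 < w --> w <= T -->
   (\<forall>x\<in>S. \<forall>z\<in>S. ((%r. lamL L x z r om) \<longlongrightarrow> lamL L x z w om) (at_left w)) \<and>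
   (\<forall>x. \<exists>C. eventually (%u. kil x u om <= ennreal C) (at_left w)))"
 using lam_left_limits_AE AE_space
proof eventually_elim
 case (elim om)
 have kb: "\<exists>C. eventually (%u. kil x u om <= ennreal C) (at_left w)" if w: "0 < w" "w <= T" for x w
 proof -
  have "((%r. \<Sum>z\<in>S - {x}. lam x z r om) \<longlongrightarrow> (\<Sum>z\<in>S - {x}. lam_left x z w om)) (at_left w)"
   using elim w by (intro tendsto_sum) auto
  then have "eventually (%r. (\<Sum>z\<in>S - {x}. lam x z r om) < (\<Sum>z\<in>S - {x}. lam_left x z w om) + 1) (at_left w)"
   by (auto simp: order_tendsto_iff)
  then have "eventually (%r. kil x r om <= ennreal ((\<Sum>z\<in>S - {x}. lam_left x z w om) + 1)) (at_left w)"
   by eventually_elim (auto simp: kil_def sum_ennreal intro!: ennreal_leI)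
  then show ?thesis by blast
 qed
 have "AE w in lborel. \<forall>x\<in>S. \<forall>z\<in>S. w \<notin> {u\<in>{0<..T}. lam x z u om ~= lam_left x z u om}"
  using elim by (intro AE_finite_allI AE_not_in countable_imp_null_set_lborel) auto
 then have "AE w in lborel. 0 < w --> w <= T -->
   (\<forall>x\<in>S. \<forall>z\<in>S. ((%r. lamL L x z r om) \<longlongrightarrow> lamL L x z w om) (at_left w))"
 proof eventually_elim
  case (elim w)
  have "((%r. lamL L x z r om) \<longlongrightarrow> lamL L x z w om) (at_left w)" if "0 < w" "w <= T" "x \<in> S" "z \<in> S" for x z
  proof -
   have "lam x z w om = lam_left x z w om" using elim that by auto
   then show ?thesis
    using \<open>(\<forall>x z. \<forall>u\<in>{0<..T}. _ x z u) \<and> _\<close> that unfolding lamL_def by (intro tendsto_min tendsto_const) auto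
  qed
  then show ?case by blast
 qed
 then show ?case using kb elim(2) by auto
qed

text \<open>Path functionals are only almost sure limits of measurable functions. As \<open>Q\<close> is
  complete and the \<open>\<sigma>\<close>-algebras contain all null sets, this is enough.\<close>
lemma measurable_AE_version:
 assumes M: "space M = space Q" "null_sets Q \<subseteq> sets M" and u: "u \<in> measurable M B"
  and f: "\<And>om. om \<in> space Q ==> f om \<in> space B" and eq: "AE om in Q. f om = u om"
 shows "f \<in> measurable M B"
proof (rule measurableI)
 fix E assume E: "E \<in> sets B"
 obtain Z where Z: "{om\<in>space Q. f om ~= u om} \<subseteq> Z" "Z \<in> null_sets Q"
  using eq by (auto elim!: AE_E simp: null_sets_def)
 have n: "{om\<in>space Q. f om ~= u om} \<in> sets M" "f -` E \<inter> {om\<in>space Q. f om ~= u om} \<in> sets M"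
  using null_subset[OF Z(2), of "{om\<in>space Q. f om ~= u om}"] null_subset[OF Z(2), of "f -` E \<inter> {om\<in>space Q. f om ~= u om}"]
   Z(1) M(2) by blast+
 have "f -` E \<inter> space M = (u -` E \<inter> space M - {om\<in>space Q. f om ~= u om}) \<union> (f -` E \<inter> {om\<in>space Q. f om ~= u om})"
  by (auto simp: M)
 then show "f -` E \<inter> space M \<in> sets M"
  using n measurable_sets[OF u E] by auto
qed (use f M in auto)

context
 fixes s t :: real and y n L :: nat and A :: "'a set"
 assumes st: "0 <= s" "s < t" "t <= T" and y: "y \<in> S" and A: "A \<in> sets (Gh s)"
begin

abbreviation "rf i x u om \<equiv> feller_real S (%x u. kil x u om) (%x z u. lamL L x z u om) y t i x u"
abbreviation "rs x p q om \<equiv> surv_real (%x u. kil x u om) x p q"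
abbreviation "df i x z p q w om \<equiv> freeze_defect S (%x u. kil x u om) (%x z u. lamL L x z u om) y t exit_rate i x z p q w"
abbreviation "rel x z u om \<equiv> lamL L x z u om / a x z"
abbreviation "gw m j om \<equiv> grid_weight (%x u. kil x u om) exit_rate (%x z u. rel x z u om) (%u. X u om) s t m j"
abbreviation "gJ m j om \<equiv> card (grid_changes (%u. X u om) s t m j)"
abbreviation "g \<equiv> grid s t"

text \<open>The interpolation between the two sides of the identity: the weight of the first
  \<open>j\<close> cells times the mass of the remaining paths to \<open>y\<close> with at most the
  remaining number of jumps.\<close>
definition "gval m j om = indicator A om * gw m j om * rf (n - gJ m j om) (X (g m j) om) (g m j) om"

lemma feller_ctx:
 assumes "om \<in> space Q"
 shows "finite S" "y \<in> S" "\<And>x. (%u. kil x u om) \<in> borel_measurable borel"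
  "\<And>x z. (%u. lamL L x z u om) \<in> borel_measurable borel"
  "\<And>x z u. 0 <= lamL L x z u om" "\<And>x z u. lamL L x z u om <= real L"
  "\<And>x u. (\<Sum>z\<in>S - {x}. ennreal (lamL L x z u om)) <= kil x u om"
proof -
 show "finite S" by simp
 show "y \<in> S" by (rule y)
qed (rule kil_path_meas[OF assms] lamL_path_meas[OF assms] lamL_bounds lamL_sub)+

lemmas rf_nonneg = feller_real_nonneg

lemma rf_le_1: "om \<in> space Q ==> u <= t ==> rf i x u om <= 1"
 by (rule feller_rfeller(2)[OF feller_ctx])

lemmas rs_bounds = surv_real_bounds

lemma rf_meas_gen:
 assumes [measurable]: "u \<in> borel_measurable R" "f \<in> measurable R (F T)"
 shows "(%q. rf i x (u q) (f q)) \<in> borel_measurable R"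
 unfolding feller_real_def
 by (intro measurable_compose[OF _ borel_measurable_enn2real] measurable_feller_param[where M="F T"])
   (use kil_meas lamL_meas in \<open>auto simp: split_beta intro: measurable_compose[OF _ measurable_ennreal] assms\<close>)

lemma rs_meas_gen:
 assumes "p \<in> borel_measurable R" "q \<in> borel_measurable R" "f \<in> measurable R (F T)"
 shows "(%v. rs x (p v) (q v) (f v)) \<in> borel_measurable R"
 unfolding surv_real_def
 by (rule borel_measurable_enn2real, rule measurable_surv_param[where M="F T", OF kil_meas assms])

lemma lamL_meas_gen:
 assumes "u \<in> borel_measurable R" "f \<in> measurable R (F T)"
 shows "(%q. lamL L x z (u q) (f q)) \<in> borel_measurable R"
 using measurable_compose[OF measurable_Pair[OF assms] lamL_meas] by simp

lemma FT_Q: "f \<in> measurable (F T) M ==> f \<in> measurable Q M"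
 using F_subalg[of T] T_pos by (auto intro: measurable_from_subalg)

lemma FT_Gh': "0 <= r ==> r <= T ==> f \<in> measurable (F T) M ==> f \<in> measurable (Gh r) M"
 using T_pos by (intro measurable_F_Gh[of T]) auto

lemma g_bounds: "j <= m ==> 0 < m ==> 0 <= g m j \<and> g m j <= t \<and> g m j <= T \<and> s <= g m j"
 using grid_bounds[of s t j m] st by auto

definition cr :: real where "cr = 1 + (\<Sum>p\<in>I. real L / ap p)"
definition CW :: real where "CW = exp (a_total * T) * cr ^ n"

lemma cr_ge_1: "1 <= cr"
 unfolding cr_def using ap_nonneg by (auto intro!: sum_nonneg divide_nonneg_nonneg)

lemma rel_bounds: "x \<in> S ==> z \<in> S ==> x ~= z ==> 0 <= rel x z u om \<and> rel x z u om <= cr"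
proof -
 assume "x \<in> S" "z \<in> S" "x ~= z"
 then have p: "(x, z) \<in> I" by (auto simp: state_pairs_def)
 have "rel x z u om <= real L / a x z"
  using lamL_bounds a_pos[OF p] by (intro divide_right_mono) (auto intro: less_imp_le)
 also have "... <= (\<Sum>p\<in>I. real L / ap p)"
  using member_le_sum[OF p, of "%p. real L / ap p"] ap_nonneg by (auto intro!: divide_nonneg_nonneg)
 finally have "rel x z u om <= cr" by (simp add: cr_def)
 moreover have "0 <= rel x z u om" using lamL_bounds a_pos[OF p] by (intro divide_nonneg_nonneg) (auto intro: less_imp_le)
 ultimately show ?thesis by simp
qed

lemma gJ_Suc: "gJ m (Suc j) om = gJ m j om + of_bool (X (g m j) om ~= X (g m (Suc j)) om)"
proof -
 have "grid_changes (%u. X u om) s t m (Suc j) = (if X (g m j) om ~= X (g m (Suc j)) om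
   then insert j (grid_changes (%u. X u om) s t m j) else grid_changes (%u. X u om) s t m j)"
  by (auto simp: grid_changes_def less_Suc_eq)
 moreover have "finite (grid_changes (%u. X u om) s t m j)" "j \<notin> grid_changes (%u. X u om) s t m j"
  by (auto simp: grid_changes_def)
 ultimately show ?thesis by simp
qed

lemma gw_Suc: "gw m (Suc j) om = gw m j om *
  grid_factor (%x u. kil x u om) exit_rate (%x z u. rel x z u om) (%u. X u om) (g m j) (g m (Suc j))"
 by (simp add: grid_weight_def)

text \<open>Truncation of the rates and the bound on the number of changes keep all integrands
  bounded.\<close>
lemma gw_bounds:
 assumes m: "0 < m" "j <= m" and om: "om \<in> space Q"
 shows "0 <= gw m j om \<and> gw m j om <= exp (a_total * (g m j - s)) * cr ^ gJ m j om"
 using m(2)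
proof (induction j)
 case 0
 then show ?case by (simp add: grid_weight_def grid_changes_def)
next
 case (Suc j)
 let ?p = "g m j" and ?q = "g m (Suc j)"
 have b: "0 <= ?p" "?p <= T" "0 <= ?q" "?q <= T" using g_bounds[of j m] g_bounds[of "Suc j" m] Suc.prems m by auto
 then have XS: "X ?p om \<in> S" "X ?q om \<in> S" using X_S om by auto
 have pq: "?p <= ?q" using st by (intro grid_mono) auto
 have e: "exp (exit_rate (X ?p om) * (?q - ?p)) <= exp (a_total * (?q - ?p))"
  using exit_rate_bounds[OF XS(1)] pq by (simp add: mult_right_mono)
 let ?W = "grid_factor (%x u. kil x u om) exit_rate (%x z u. rel x z u om) (%u. X u om) ?p ?q"
 have W: "0 <= ?W" "?W <= exp (a_total * (?q - ?p)) * cr ^ of_bool (X ?p om ~= X ?q om)"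
 proof -
  let ?v = "if X ?p om = X ?q om then rs (X ?p om) ?p ?q om else rel (X ?p om) (X ?q om) ?p om"
  have v: "0 <= ?v" "?v <= cr ^ of_bool (X ?p om ~= X ?q om)"
   using rs_bounds[of "%x u. kil x u om" "X ?p om" ?p ?q] rel_bounds[OF XS] by auto
  have W: "?W = exp (exit_rate (X ?p om) * (?q - ?p)) * ?v"
   by (simp add: grid_factor_def surv_real_def)
  show "0 <= ?W" unfolding W using v by (intro mult_nonneg_nonneg) auto
  show "?W <= exp (a_total * (?q - ?p)) * cr ^ of_bool (X ?p om ~= X ?q om)"
   unfolding W using v e by (intro mult_mono) auto
 qed
 have "gw m j om * ?W <= (exp (a_total * (?p - s)) * cr ^ gJ m j om) * (exp (a_total * (?q - ?p)) * cr ^ of_bool (X ?p om ~= X ?q om))"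
  using Suc W cr_ge_1 by (intro mult_mono) auto
 also have "... = (exp (a_total * (?p - s)) * exp (a_total * (?q - ?p))) * cr ^ gJ m (Suc j) om"
  by (simp only: gJ_Suc power_add mult_ac)
 also have "exp (a_total * (?p - s)) * exp (a_total * (?q - ?p)) = exp (a_total * (?q - s))"
  by (simp add: exp_add[symmetric] algebra_simps)
 finally show ?case using Suc W by (simp add: gw_Suc)
qed

lemma gw_CW:
 assumes "0 < m" "j <= m" "om \<in> space Q" "gJ m j om < n"
 shows "gw m j om <= CW"
proof -
 have "gw m j om <= exp (a_total * (g m j - s)) * cr ^ gJ m j om" using gw_bounds assms by auto
 also have "... <= exp (a_total * T) * cr ^ n"
  using assms cr_ge_1 a_total_nonneg g_bounds[of j m] st
  by (intro mult_mono power_increasing) (auto intro!: mult_left_mono)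
 finally show ?thesis by (simp add: CW_def)
qed

lemma X_grid_meas: "i <= j ==> j <= m ==> 0 < m ==> X (g m i) \<in> measurable (Gh (g m j)) (count_space UNIV)"
 using g_bounds[of i m] g_bounds[of j m] grid_mono[of s t i j m] st
 by (intro measurable_Gh_mono[OF _ _ _ X_meas_Gh]) auto

lemma of_bool_X_eq_meas:
 assumes "f \<in> measurable M (count_space UNIV)" "h \<in> measurable M (count_space UNIV)"
 shows "Measurable.pred M (%om. f om = (h om :: nat))"
proof -
 have "Measurable.pred M (%om. real (f om) = real (h om))"
  using measurable_compose[OF assms(1), of real borel] measurable_compose[OF assms(2), of real borel]
  unfolding pred_def by (intro borel_measurable_eq) auto
 then show ?thesis by simp
qed

lemma gJ_meas: "j <= m ==> 0 < m ==> gJ m j \<in> measurable (Gh (g m j)) (count_space UNIV)"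
proof (induction j)
 case 0
 then show ?case by (simp add: grid_changes_def)
next
 case (Suc j)
 have mono: "0 <= g m j" "g m j <= g m (Suc j)" "g m (Suc j) <= T"
  using g_bounds[of j m] g_bounds[of "Suc j" m] grid_mono[of s t j "Suc j" m] st Suc.prems by auto
 have [measurable]: "gJ m j \<in> measurable (Gh (g m (Suc j))) (count_space UNIV)"
  using Suc by (intro measurable_Gh_mono[OF mono]) auto
 have [measurable]: "Measurable.pred (Gh (g m (Suc j))) (%om. X (g m j) om = X (g m (Suc j)) om)"
  using Suc.prems by (intro of_bool_X_eq_meas X_grid_meas) auto
 have "(%om. gJ m j om + (if X (g m j) om = X (g m (Suc j)) om then 0 else 1)) \<in> measurable (Gh (g m (Suc j))) (count_space UNIV)"
  by measurable
 then show ?case by (simp add: gJ_Suc if_distrib of_bool_def cong: if_cong)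
qed

lemma gw_meas: "j <= m ==> 0 < m ==> gw m j \<in> borel_measurable (Gh (g m j))"
proof (induction j)
 case 0
 then show ?case by (simp add: grid_weight_def)
next
 case (Suc j)
 let ?p = "g m j" and ?q = "g m (Suc j)"
 have mono: "0 <= ?p" "?p <= ?q" "?q <= T" "0 <= ?q"
  using g_bounds[of j m] g_bounds[of "Suc j" m] grid_mono[of s t j "Suc j" m] st Suc.prems by auto
 have Xp: "X ?p \<in> measurable (Gh ?q) (count_space UNIV)" and Xq: "X ?q \<in> measurable (Gh ?q) (count_space UNIV)"
  using Suc.prems by (auto intro!: X_grid_meas)
 have 1: "gw m j \<in> borel_measurable (Gh ?q)"
  using Suc by (intro measurable_Gh_mono[OF mono(1-3)]) auto
 have 2: "(%om. exp (exit_rate (X ?p om) * (?q - ?p))) \<in> borel_measurable (Gh ?q)"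
  using Xp by (rule measurable_compose) simp
 have 3: "(%om. rs (X ?p om) ?p ?q om) \<in> borel_measurable (Gh ?q)"
  by (rule measurable_compose_countable[OF _ Xp], rule FT_Gh'[OF mono(4,3)], rule rs_meas_gen) auto
 have 4: "(%om. rel (X ?p om) (X ?q om) ?p om) \<in> borel_measurable (Gh ?q)"
 proof (rule measurable_compose_countable[OF _ Xp], rule measurable_compose_countable[OF _ Xq])
  fix x z show "(%om. rel x z ?p om) \<in> borel_measurable (Gh ?q)"
   by (intro borel_measurable_divide FT_Gh'[OF mono(4,3)] lamL_meas_gen) auto
 qed
 have 5: "Measurable.pred (Gh ?q) (%om. X ?p om = X ?q om)" by (rule of_bool_X_eq_meas[OF Xp Xq])
 show ?case
  unfolding gw_Suc grid_factor_def
  using 1 2 3[unfolded surv_real_def] 4 5 by (intro borel_measurable_times measurable_If) (auto simp: pred_def)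
qed

lemma A_meas: "0 <= r ==> s <= r ==> r <= T ==> A \<in> sets (Gh r)"
 using A Gh_mono[of s r] st by auto

definition "cell_defect m j om = (\<Sum>i<n. \<Sum>x\<in>S. \<Sum>z\<in>S - {x}.
  \<integral>w. df i x z (g m j) (g m (Suc j)) w om * indicator {g m j<..g m (Suc j)} w \<partial>lborel)"

definition "C2 = CW * exp (a_total * T) * cr"

lemma CW_nonneg: "0 <= CW" "CW <= C2" "0 <= C2"
proof -
 show C: "0 <= CW" using cr_ge_1 by (simp add: CW_def)
 have "CW * 1 <= CW * (exp (a_total * T) * cr)"
  using C cr_ge_1 a_total_nonneg T_pos mult_mono[of 1 "exp (a_total * T)" 1 cr] by (intro mult_left_mono) auto
 then show "CW <= C2" by (simp add: C2_def mult.assoc)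
 with C show "0 <= C2" by simp
qed

lemma df_meas_gen:
 assumes "p \<in> borel_measurable R" "q \<in> borel_measurable R" "w \<in> borel_measurable R" "f \<in> measurable R (F T)"
 shows "(%v. df i x z (p v) (q v) (w v) (f v)) \<in> borel_measurable R"
proof -
 note [measurable] = assms(1,2)
 have e: "(%v. exp (exit_rate x * (q v - p v))) \<in> borel_measurable R" by measurable
 show ?thesis
  unfolding freeze_defect_def jump_density_def
  by (intro borel_measurable_abs borel_measurable_diff borel_measurable_times e
    rf_meas_gen rs_meas_gen lamL_meas_gen assms)
qed

lemma df_bounds:
 assumes om: "om \<in> space Q" and pq: "0 <= p" "p <= q" "q <= t" "w <= t" and x: "x \<in> S"
 shows "0 <= df i x z p q w om" "df i x z p q w om <= exp (a_total * T) * real L + real L"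
proof -
 show "0 <= df i x z p q w om" by (simp add: freeze_defect_def)
 have "exit_rate x * (q - p) <= a_total * T"
  using exit_rate_bounds[OF x] pq st a_total_nonneg by (intro mult_mono) auto
 then show "df i x z p q w om <= exp (a_total * T) * real L + real L"
  using pq by (intro defect_bound[OF feller_ctx[OF om]]) auto
qed

lemma df_integrable:
 assumes om: "om \<in> space Q" and pq: "0 <= p" "p <= q" "q <= t" and x: "x \<in> S"
 shows "integrable lborel (%w. df i x z p q w om * indicator {p<..q} w)"
proof (rule Bochner_Integration.integrable_bound)
 show "integrable lborel (%w. (exp (a_total * T) * real L + real L) * indicator {p<..q} w)"
  using pq by (intro integrable_mult_right integrable_real_indicator) auto
 have "(%w. df i x z p q w om) \<in> borel_measurable borel"
  using om by (intro df_meas_gen) (auto simp: space_FT)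
 then show "(%w. df i x z p q w om * indicator {p<..q} w) \<in> borel_measurable lborel" by measurable
 show "AE w in lborel. norm (df i x z p q w om * indicator {p<..q} w) <= norm ((exp (a_total * T) * real L + real L) * indicator {p<..q} w)"
 proof (rule AE_I2)
  fix w
  show "norm (df i x z p q w om * indicator {p<..q} w) <= norm ((exp (a_total * T) * real L + real L) * indicator {p<..q} w)"
  proof (cases "w \<in> {p<..q}")
   case True
   then show ?thesis using df_bounds[OF om pq _ x, of w i z] pq by simp
  qed simp
 qed
qed

lemma cell_defect_ge:
 assumes om: "om \<in> space Q" and m: "0 < m" "j < m" and i: "i < n" and x: "x \<in> S"
 shows "(\<integral>w. (\<Sum>z\<in>S - {x}. df i x z (g m j) (g m (Suc j)) w om) * indicator {g m j<..g m (Suc j)} w \<partial>lborel)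
  <= cell_defect m j om"
proof -
 have b: "0 <= g m j" "g m j <= g m (Suc j)" "g m (Suc j) <= t"
  using g_bounds[of j m] g_bounds[of "Suc j" m] grid_mono[of s t j "Suc j" m] st m by auto
 let ?d = "%i x z. \<integral>w. df i x z (g m j) (g m (Suc j)) w om * indicator {g m j<..g m (Suc j)} w \<partial>lborel"
 have d0: "0 <= ?d i x z" for i x z
  by (intro integral_nonneg_AE AE_I2 mult_nonneg_nonneg) (auto simp: freeze_defect_def)
 have "(\<integral>w. (\<Sum>z\<in>S - {x}. df i x z (g m j) (g m (Suc j)) w om) * indicator {g m j<..g m (Suc j)} w \<partial>lborel) = (\<Sum>z\<in>S - {x}. ?d i x z)"
  unfolding sum_distrib_right using om b x by (intro Bochner_Integration.integral_sum df_integrable)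
 also have "... <= (\<Sum>x\<in>S. \<Sum>z\<in>S - {x}. ?d i x z)"
  using x d0 by (intro member_le_sum[of x S "%x. \<Sum>z\<in>S - {x}. ?d i x z"]) (auto intro!: sum_nonneg)
 also have "... <= cell_defect m j om"
  unfolding cell_defect_def using i d0
  by (intro member_le_sum[of i "{..<n}" "%i. \<Sum>x\<in>S. \<Sum>z\<in>S - {x}. ?d i x z"]) (auto intro!: sum_nonneg)
 finally show ?thesis .
qed

lemma cell_defect_meas: "cell_defect m j \<in> borel_measurable Q"
 unfolding cell_defect_def
proof (intro borel_measurable_sum)
 fix i x z
 have "(%om. \<integral>w. df i x z (g m j) (g m (Suc j)) w om * indicator {g m j<..g m (Suc j)} w \<partial>lborel) \<in> borel_measurable (F T)"
 proof (rule lborel.borel_measurable_lebesgue_integral)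
  have "(%v. df i x z (g m j) (g m (Suc j)) (snd v) (fst v)) \<in> borel_measurable (F T \<Otimes>\<^sub>M lborel)"
   by (intro df_meas_gen) auto
  then show "(%(om, w). df i x z (g m j) (g m (Suc j)) w om * indicator {g m j<..g m (Suc j)} w) \<in> borel_measurable (F T \<Otimes>\<^sub>M lborel)"
   unfolding split_beta
   by (rule borel_measurable_times[OF _ measurable_compose[OF measurable_snd]]) simp
 qed
 then show "(%om. \<integral>w. df i x z (g m j) (g m (Suc j)) w om * indicator {g m j<..g m (Suc j)} w \<partial>lborel) \<in> borel_measurable Q"
  by (rule FT_Q)
qed

definition "Bd = exp (a_total * T) * real L + real L"

lemma Bd_nonneg: "0 <= Bd"
 by (simp add: Bd_def)

lemma df_integral_bounds:
 assumes om: "om \<in> space Q" and pq: "0 <= p" "p <= q" "q <= t" and x: "x \<in> S"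
 shows "0 <= (\<integral>w. df i x z p q w om * indicator {p<..q} w \<partial>lborel)"
  "(\<integral>w. df i x z p q w om * indicator {p<..q} w \<partial>lborel) <= Bd * (q - p)"
proof -
 show "0 <= (\<integral>w. df i x z p q w om * indicator {p<..q} w \<partial>lborel)"
  by (intro integral_nonneg_AE AE_I2 mult_nonneg_nonneg) (auto simp: freeze_defect_def)
 have "(\<integral>w. df i x z p q w om * indicator {p<..q} w \<partial>lborel) <= (\<integral>w. Bd * indicator {p<..q} w \<partial>lborel)"
 proof (intro integral_mono_AE AE_I2 df_integrable om pq x)
  show "integrable lborel (%w. Bd * indicator {p<..q} w)"
   using pq by (intro integrable_mult_right integrable_real_indicator) auto
  fix w show "df i x z p q w om * indicator {p<..q} w <= Bd * indicator {p<..q} w"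
   using df_bounds(2)[OF om pq _ x, of w i z] pq by (cases "w \<in> {p<..q}") (auto simp: Bd_def)
 qed
 also have "... = Bd * (q - p)" using pq by simp
 finally show "(\<integral>w. df i x z p q w om * indicator {p<..q} w \<partial>lborel) <= Bd * (q - p)" .
qed

lemma cell_bounds': "0 < m ==> j < m ==> 0 <= g m j \<and> g m j < g m (Suc j) \<and> g m j <= g m (Suc j) \<and> g m (Suc j) <= t \<and> s <= g m j \<and> g m (Suc j) <= T"
 using g_bounds[of j m] g_bounds[of "Suc j" m] grid_less[of s t m j "Suc j"] st by auto

lemma cell_defect_integrable:
 assumes m: "0 < m" "j < m"
 shows "integrable Q (cell_defect m j)"
proof (rule integrable_const_bound[where B="\<Sum>i<n. \<Sum>x\<in>S. \<Sum>z\<in>S - {x}. Bd * (g m (Suc j) - g m j)"])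
 show "AE om in Q. norm (cell_defect m j om) <= (\<Sum>i<n. \<Sum>x\<in>S. \<Sum>z\<in>S - {x}. Bd * (g m (Suc j) - g m j))"
 proof (rule AE_I2)
  fix om assume om: "om \<in> space Q"
  have "0 <= cell_defect m j om" unfolding cell_defect_def
   using cell_bounds'[OF m] by (intro sum_nonneg df_integral_bounds om) auto
  moreover have "cell_defect m j om <= (\<Sum>i<n. \<Sum>x\<in>S. \<Sum>z\<in>S - {x}. Bd * (g m (Suc j) - g m j))"
   unfolding cell_defect_def using cell_bounds'[OF m] by (intro sum_mono df_integral_bounds om) auto
  ultimately show "norm (cell_defect m j om) <= (\<Sum>i<n. \<Sum>x\<in>S. \<Sum>z\<in>S - {x}. Bd * (g m (Suc j) - g m j))" by simp
 qed
qed (rule cell_defect_meas)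

lemma gval_bounds:
 assumes "0 < m" "j <= m" "om \<in> space Q"
 shows "0 <= gval m j om" "gval m j om <= CW"
proof -
 have b: "g m j <= t" using g_bounds[of j m] assms by auto
 note gb = gw_bounds[OF assms]
 show "0 <= gval m j om" unfolding gval_def using gb rf_nonneg by (intro mult_nonneg_nonneg) auto
 show "gval m j om <= CW"
 proof (cases "gJ m j om < n")
  case True
  have "gval m j om <= 1 * CW * 1"
   unfolding gval_def using gb gw_CW[OF assms True] rf_nonneg rf_le_1[OF assms(3) b] CW_nonneg
   by (intro mult_mono) (auto simp: indicator_def)
  then show ?thesis by simp
 next
  case False
  then show ?thesis using CW_nonneg by (simp add: gval_def feller_real_def)
 qed
qed

lemma gval_meas: "0 < m ==> j <= m ==> gval m j \<in> borel_measurable Q"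
proof -
 assume m: "0 < m" "j <= m"
 have b: "0 <= g m j" "g m j <= T" "s <= g m j" using g_bounds[of j m] m by auto
 have "(%om. rf (n - gJ m j om) (X (g m j) om) (g m j) om) \<in> borel_measurable (Gh (g m j))"
 proof (rule measurable_compose_countable[OF _ X_meas_Gh[OF b(1,2)]], rule measurable_compose_countable[OF _ gJ_meas[OF m(2,1)]])
  fix x i show "(%om. rf (n - i) x (g m j) om) \<in> borel_measurable (Gh (g m j))"
   by (intro FT_Gh'[OF b(1,2)] rf_meas_gen) auto
 qed
 then have "gval m j \<in> borel_measurable (Gh (g m j))"
  unfolding gval_def using gw_meas[OF m(2,1)] A_meas[OF b(1,3,2)]
  by (intro borel_measurable_times) auto
 then show ?thesis using b by (intro measurable_Gh_Q[OF b(1,2)])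
qed

lemma gval_integrable: "0 < m ==> j <= m ==> integrable Q (gval m j)"
 using gval_bounds by (intro integrable_const_bound[where B=CW] gval_meas AE_I2) auto

text \<open>One grid step conserves the expectation up to the one-step error and the defect of the cell.\<close>
lemma gval_step:
 assumes m: "0 < m" "j < m"
 shows "\<bar>(\<integral>om. gval m (Suc j) om \<partial>Q) - (\<integral>om. gval m j om \<partial>Q)\<bar> <=
  step_error * ((t - s) / real m)\<^sup>2 * (CW + real (card S) * C2) + CW * (\<integral>om. cell_defect m j om \<partial>Q)"
proof -
 define p q h where "p = g m j" and "q = g m (Suc j)" and "h = (t - s) / real m"
 have qp: "q - p = h" by (simp add: p_def q_def h_def grid_Suc)
 have b: "0 <= p" "p < q" "q <= t" "s <= p" "q <= T" "p <= T" "p <= t"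
  using cell_bounds'[OF m] by (auto simp: p_def q_def)
 have h0: "0 < h" using st m by (simp add: h_def)
 have XS: "X p om \<in> S" "X q om \<in> S" if "om \<in> space Q" for om using X_S b that by auto
 define \<Psi> where "\<Psi> om = indicator A om * gw m j om * of_bool (gJ m j om < n)" for om
 define i where "i om = n - gJ m j om - 1" for om
 define \<alpha> where "\<alpha> om = \<Psi> om * (rs (X p om) p q om * rf (Suc (i om)) (X p om) q om)" for om
 define \<beta> where "\<beta> z om = \<Psi> om * (exp (exit_rate (X p om) * h) * (rel (X p om) z p om * rf (i om) z q om)) * of_bool (X p om ~= z)" for z om
 have \<Psi>: "0 <= \<Psi> om" "\<Psi> om <= CW" if "om \<in> space Q" for om
  using gw_bounds[of m j om] gw_CW[of m j om] m that CW_nonneg by (auto simp: \<Psi>_def indicator_def)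
 have Xp: "X p \<in> measurable (Gh p) (count_space UNIV)" using b by (intro X_meas_Gh) auto
 have J: "gJ m j \<in> measurable (Gh p) (count_space UNIV)" unfolding p_def using m by (intro gJ_meas) auto
 have i_meas: "i \<in> measurable (Gh p) (count_space UNIV)"
  unfolding i_def using J by (rule measurable_compose) simp
 have \<Psi>_meas: "\<Psi> \<in> borel_measurable (Gh p)"
 proof -
  have "(%om. of_bool (gJ m j om < n) :: real) \<in> borel_measurable (Gh p)" using J by (rule measurable_compose) simp
  moreover have "gw m j \<in> borel_measurable (Gh p)" unfolding p_def using m by (intro gw_meas) auto
  ultimately show ?thesis
   unfolding \<Psi>_def using A_meas[OF b(1,4,6)] by (intro borel_measurable_times) auto
 qed
 have \<alpha>_meas: "\<alpha> \<in> borel_measurable (Gh p)"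
  unfolding \<alpha>_def
 proof (intro borel_measurable_times \<Psi>_meas)
  show "(%om. rs (X p om) p q om) \<in> borel_measurable (Gh p)"
   by (rule measurable_compose_countable[OF _ Xp], rule FT_Gh'[OF b(1,6)], rule rs_meas_gen) auto
  show "(%om. rf (Suc (i om)) (X p om) q om) \<in> borel_measurable (Gh p)"
   by (rule measurable_compose_countable[OF _ Xp], rule measurable_compose_countable[OF _ i_meas],
     rule FT_Gh'[OF b(1,6)], rule rf_meas_gen) auto
 qed
 have \<beta>_meas: "\<beta> z \<in> borel_measurable (Gh p)" for z
  unfolding \<beta>_def
 proof (intro borel_measurable_times \<Psi>_meas)
  show "(%om. exp (exit_rate (X p om) * h)) \<in> borel_measurable (Gh p)"
   using Xp by (rule measurable_compose) simp
  show "(%om. of_bool (X p om ~= z) :: real) \<in> borel_measurable (Gh p)"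
   using Xp by (rule measurable_compose) simp
  show "(%om. rel (X p om) z p om) \<in> borel_measurable (Gh p)"
  proof (rule measurable_compose_countable[OF _ Xp])
   fix x show "(%om. rel x z p om) \<in> borel_measurable (Gh p)"
    by (intro borel_measurable_divide FT_Gh'[OF b(1,6)] lamL_meas_gen) auto
  qed
  show "(%om. rf (i om) z q om) \<in> borel_measurable (Gh p)"
   by (rule measurable_compose_countable[OF _ i_meas], rule FT_Gh'[OF b(1,6)], rule rf_meas_gen) auto
 qed
 have \<alpha>: "0 <= \<alpha> om" "\<alpha> om <= CW" if om: "om \<in> space Q" for om
 proof -
  show "0 <= \<alpha> om" unfolding \<alpha>_def using \<Psi>[OF om] rs_bounds rf_nonneg by (intro mult_nonneg_nonneg)
  have "\<alpha> om <= CW * (1 * 1)"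
   unfolding \<alpha>_def using \<Psi>[OF om] rs_bounds rf_nonneg rf_le_1[OF om b(3)] CW_nonneg
   by (intro mult_mono) (auto intro!: mult_nonneg_nonneg)
  then show "\<alpha> om <= CW" by simp
 qed
 have \<beta>: "0 <= \<beta> z om" "\<beta> z om <= C2" if om: "om \<in> space Q" and z: "z \<in> S" for z om
 proof -
  have r: "X p om ~= z ==> 0 <= rel (X p om) z p om \<and> rel (X p om) z p om <= cr" using rel_bounds[OF XS(1)[OF om] z] by auto
  show "0 <= \<beta> z om"
  proof (cases "X p om = z")
   case False
   have "0 <= \<Psi> om * (exp (exit_rate (X p om) * h) * (rel (X p om) z p om * rf (i om) z q om))"
    using \<Psi>[OF om] conjunct1[OF r[OF False]] rf_nonneg by (intro mult_nonneg_nonneg exp_ge_zero) blast+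
   then show ?thesis using False by (simp add: \<beta>_def mult.assoc)
  qed (simp add: \<beta>_def)
  have e: "exp (exit_rate (X p om) * h) <= exp (a_total * T)"
   using exit_rate_bounds[OF XS(1)[OF om]] qp b h0 a_total_nonneg by (auto intro!: mult_mono)
  show "\<beta> z om <= C2"
  proof (cases "X p om = z")
   case False
   have "\<Psi> om * (exp (exit_rate (X p om) * h) * (rel (X p om) z p om * rf (i om) z q om)) <=
     CW * (exp (a_total * T) * (cr * 1))"
    using \<Psi>[OF om] r[OF False] e rf_nonneg rf_le_1[OF om b(3)] CW_nonneg cr_ge_1
    by (intro mult_mono mult_nonneg_nonneg exp_ge_zero) auto
   then show ?thesis using False by (simp add: \<beta>_def C2_def mult.assoc)
  qed (simp add: \<beta>_def CW_nonneg)
 qed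
 have next_val: "gval m (Suc j) om = \<alpha> om * (exp (exit_rate (X p om) * h) * of_bool (X q om = X p om)) +
   (\<Sum>z\<in>S. \<beta> z om * of_bool (X q om = z \<and> X p om ~= z))" if om: "om \<in> space Q" for om
 proof -
  have sum: "(\<Sum>z\<in>S. \<beta> z om * of_bool (X q om = z \<and> X p om ~= z)) = \<beta> (X q om) om * of_bool (X p om ~= X q om)"
  proof -
   have "(\<Sum>z\<in>S. \<beta> z om * of_bool (X q om = z \<and> X p om ~= z)) = (\<Sum>z\<in>S. if z = X q om then \<beta> z om * of_bool (X p om ~= z) else 0)"
    by (intro sum.cong refl) auto
   then show ?thesis using XS[OF om] by (simp add: sum.delta)
  qed
  have gv: "gval m (Suc j) om = indicator A om * (gw m j om * (exp (exit_rate (X p om) * h) *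
    (if X p om = X q om then rs (X p om) p q om else rel (X p om) (X q om) p om))) *
    rf (n - (gJ m j om + of_bool (X p om ~= X q om))) (X q om) q om"
   unfolding gval_def gw_Suc gJ_Suc grid_factor_def surv_real_def by (simp add: p_def[symmetric] q_def[symmetric] qp)
  show ?thesis
  proof (cases "gJ m j om < n")
   case True
   then have i: "n - gJ m j om = Suc (i om)" "n - Suc (gJ m j om) = i om" by (auto simp: i_def)
   show ?thesis
    unfolding sum gv using True i
    by (cases "X p om = X q om") (simp_all add: \<alpha>_def \<beta>_def \<Psi>_def mult_ac)
  next
   case False
   then have "\<Psi> om = 0" "n - (gJ m j om + of_bool (X p om ~= X q om)) = 0" by (auto simp: \<Psi>_def)
   then show ?thesis unfolding sum gv by (simp add: \<alpha>_def \<beta>_def feller_real_def)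
  qed
 qed
 define R where "R z om = \<beta> z om * (h * a (X p om) z * of_bool (X p om ~= z))" for z om
 have stay: "\<bar>(\<integral>om. \<alpha> om * (exp (exit_rate (X p om) * h) * of_bool (X q om = X p om)) \<partial>Q) - (\<integral>om. \<alpha> om \<partial>Q)\<bar> <=
   step_error * h\<^sup>2 * (\<integral>om. \<alpha> om \<partial>Q)"
  using one_step_stay[OF b(1,2,5) \<alpha>_meas \<alpha>] by (simp add: qp)
 have change: "\<bar>(\<integral>om. \<beta> z om * of_bool (X q om = z \<and> X p om ~= z) \<partial>Q) - (\<integral>om. R z om \<partial>Q)\<bar> <=
   step_error * h\<^sup>2 * (\<integral>om. \<beta> z om \<partial>Q)" if "z \<in> S" for z
  using one_step_change[OF b(1,2,5) \<beta>_meas \<beta>[OF _ that] that] by (simp add: qp R_def)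
 have \<alpha>Q: "\<alpha> \<in> borel_measurable Q" and \<beta>Q: "\<beta> z \<in> borel_measurable Q" for z
  using \<alpha>_meas \<beta>_meas measurable_Gh_Q[OF b(1,6)] by auto
 have i\<alpha>: "integrable Q \<alpha>" using \<alpha> by (intro integrable_const_bound[where B=CW] \<alpha>Q AE_I2) auto
 have i\<beta>: "integrable Q (\<beta> z)" if "z \<in> S" for z using \<beta> that by (intro integrable_const_bound[where B=C2] \<beta>Q AE_I2) auto
 have \<alpha>_le: "(\<integral>om. \<alpha> om \<partial>Q) <= CW"
  by (rule integral_le_const[OF i\<alpha> AE_I2[OF \<alpha>(2)]])
 have \<beta>_le: "(\<integral>om. \<beta> z om \<partial>Q) <= C2" if "z \<in> S" for z
  by (rule integral_le_const[OF i\<beta>[OF that] AE_I2[OF \<beta>(2)[OF _ that]]])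
 have XpQ: "X p \<in> measurable Q (count_space UNIV)" and XqQ: "X q \<in> measurable Q (count_space UNIV)" by (rule X_meas; use b in linarith)+
 have int_stay: "integrable Q (%om. \<alpha> om * (exp (exit_rate (X p om) * h) * of_bool (X q om = X p om)))"
 proof (rule integrable_const_bound[where B="CW * exp (a_total * h)"])
  show "AE om in Q. norm (\<alpha> om * (exp (exit_rate (X p om) * h) * of_bool (X q om = X p om))) <= CW * exp (a_total * h)"
  proof (rule AE_I2)
   fix om assume om: "om \<in> space Q"
   have "exp (exit_rate (X p om) * h) * of_bool (X q om = X p om) <= exp (a_total * h) * 1"
    using exit_rate_bounds[OF XS(1)[OF om]] h0 by (intro mult_mono) auto
   then have "\<alpha> om * (exp (exit_rate (X p om) * h) * of_bool (X q om = X p om)) <= CW * (exp (a_total * h) * 1)"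
    by (rule mult_mono[OF \<alpha>(2)[OF om]]) (use CW_nonneg in auto)
   then show "norm (\<alpha> om * (exp (exit_rate (X p om) * h) * of_bool (X q om = X p om))) <= CW * exp (a_total * h)"
    using \<alpha>[OF om] by (simp add: abs_mult)
  qed
  have "(%om. exp (exit_rate (X p om) * h)) \<in> borel_measurable Q" using XpQ by (rule measurable_compose) simp
  moreover have "Measurable.pred Q (%om. X q om = X p om)" by (rule of_bool_X_eq_meas[OF XqQ XpQ])
  ultimately show "(%om. \<alpha> om * (exp (exit_rate (X p om) * h) * of_bool (X q om = X p om))) \<in> borel_measurable Q"
   using \<alpha>Q by measurable
 qed
 have ob: "(%om. of_bool (X q om = z \<and> X p om ~= z) :: real) \<in> borel_measurable Q" for z
 proof -
  have "(%om. of_bool (X q om = z) :: real) \<in> borel_measurable Q" using XqQ by (rule measurable_compose) simp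
  moreover have "(%om. of_bool (X p om ~= z) :: real) \<in> borel_measurable Q" using XpQ by (rule measurable_compose) simp
  ultimately have "(%om. of_bool (X q om = z) * of_bool (X p om ~= z) :: real) \<in> borel_measurable Q" by (rule borel_measurable_times)
  then show ?thesis by (simp add: of_bool_conj)
 qed
 have ic: "integrable Q (%om. \<beta> z om * of_bool (X q om = z \<and> X p om ~= z))" if "z \<in> S" for z
  using \<beta> that CW_nonneg by (intro integrable_const_bound[where B=C2] borel_measurable_times \<beta>Q ob AE_I2) auto
 have iR: "integrable Q (R z)" if z: "z \<in> S" for z
 proof (rule integrable_const_bound[where B="C2 * (h * a_total)"])
  show "AE om in Q. norm (R z om) <= C2 * (h * a_total)"
  proof (rule AE_I2)
   fix om assume om: "om \<in> space Q"
   have *: "0 <= h * a (X p om) z * of_bool (X p om ~= z)" "h * a (X p om) z * of_bool (X p om ~= z) <= h * a_total"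
   proof -
    have "0 <= a (X p om) z \<and> a (X p om) z <= a_total" if "X p om ~= z"
    proof -
     have "(X p om, z) \<in> I" using XS(1)[OF om] z that by (auto simp: state_pairs_def)
     then show ?thesis
      using ap_nonneg member_le_sum[of "(X p om, z)" I ap] by (force simp: a_total_def)
    qed
    then show "0 <= h * a (X p om) z * of_bool (X p om ~= z)" "h * a (X p om) z * of_bool (X p om ~= z) <= h * a_total"
     using h0 a_total_nonneg by (auto simp: of_bool_def)
   qed
   have "R z om <= C2 * (h * a_total)"
    unfolding R_def by (rule mult_mono[OF \<beta>(2)[OF om z] *(2) _ *(1)]) (use CW_nonneg in linarith)
   moreover have "0 <= R z om" unfolding R_def by (rule mult_nonneg_nonneg[OF \<beta>(1)[OF om z] *(1)])
   ultimately show "norm (R z om) <= C2 * (h * a_total)" by simp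
  qed
  have "(%om. h * a (X p om) z * of_bool (X p om ~= z)) \<in> borel_measurable Q"
   by (rule measurable_compose[OF XpQ, of "%x. h * a x z * of_bool (x ~= z)"]) simp
  then show "R z \<in> borel_measurable Q" unfolding R_def by (rule borel_measurable_times[OF \<beta>Q])
 qed
 have E1: "(\<integral>om. gval m (Suc j) om \<partial>Q) = (\<integral>om. \<alpha> om * (exp (exit_rate (X p om) * h) * of_bool (X q om = X p om)) \<partial>Q) +
   (\<Sum>z\<in>S. \<integral>om. \<beta> z om * of_bool (X q om = z \<and> X p om ~= z) \<partial>Q)"
 proof -
  have "(\<integral>om. gval m (Suc j) om \<partial>Q) = (\<integral>om. \<alpha> om * (exp (exit_rate (X p om) * h) * of_bool (X q om = X p om)) +
   (\<Sum>z\<in>S. \<beta> z om * of_bool (X q om = z \<and> X p om ~= z)) \<partial>Q)"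
   by (intro Bochner_Integration.integral_cong refl next_val)
  also have "... = (\<integral>om. \<alpha> om * (exp (exit_rate (X p om) * h) * of_bool (X q om = X p om)) \<partial>Q) +
    (\<integral>om. (\<Sum>z\<in>S. \<beta> z om * of_bool (X q om = z \<and> X p om ~= z)) \<partial>Q)"
   by (intro Bochner_Integration.integral_add int_stay Bochner_Integration.integrable_sum ic)
  also have "(\<integral>om. (\<Sum>z\<in>S. \<beta> z om * of_bool (X q om = z \<and> X p om ~= z)) \<partial>Q) =
    (\<Sum>z\<in>S. \<integral>om. \<beta> z om * of_bool (X q om = z \<and> X p om ~= z) \<partial>Q)"
   by (intro Bochner_Integration.integral_sum ic)
  finally show ?thesis .
 qed
 have se: "0 <= step_error * h\<^sup>2" by (simp add: step_error_def)
 have err1: "\<bar>(\<integral>om. gval m (Suc j) om \<partial>Q) - ((\<integral>om. \<alpha> om \<partial>Q) + (\<Sum>z\<in>S. \<integral>om. R z om \<partial>Q))\<bar> <=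
   step_error * h\<^sup>2 * (CW + real (card S) * C2)"
 proof -
  have "\<bar>(\<Sum>z\<in>S. \<integral>om. \<beta> z om * of_bool (X q om = z \<and> X p om ~= z) \<partial>Q) - (\<Sum>z\<in>S. \<integral>om. R z om \<partial>Q)\<bar> <=
    (\<Sum>z\<in>S. \<bar>(\<integral>om. \<beta> z om * of_bool (X q om = z \<and> X p om ~= z) \<partial>Q) - (\<integral>om. R z om \<partial>Q)\<bar>)"
   unfolding sum_subtractf[symmetric] by (rule sum_abs)
  also have "... <= (\<Sum>z\<in>S. step_error * h\<^sup>2 * C2)"
   using \<beta>_le se by (intro sum_mono order_trans[OF change] mult_left_mono) auto
  finally have "\<bar>(\<Sum>z\<in>S. \<integral>om. \<beta> z om * of_bool (X q om = z \<and> X p om ~= z) \<partial>Q) - (\<Sum>z\<in>S. \<integral>om. R z om \<partial>Q)\<bar> <=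
   real (card S) * (step_error * h\<^sup>2 * C2)" by simp
  moreover have "\<bar>(\<integral>om. \<alpha> om * (exp (exit_rate (X p om) * h) * of_bool (X q om = X p om)) \<partial>Q) - (\<integral>om. \<alpha> om \<partial>Q)\<bar> <= step_error * h\<^sup>2 * CW"
   using stay mult_left_mono[OF \<alpha>_le se] by linarith
  moreover have "step_error * h\<^sup>2 * (CW + real (card S) * C2) = step_error * h\<^sup>2 * CW + real (card S) * (step_error * h\<^sup>2 * C2)"
   by (simp add: distrib_left mult_ac)
  ultimately show ?thesis unfolding E1 by linarith
 qed
 have E2: "(\<integral>om. \<alpha> om \<partial>Q) + (\<Sum>z\<in>S. \<integral>om. R z om \<partial>Q) - (\<integral>om. gval m j om \<partial>Q) = (\<integral>om. \<alpha> om + (\<Sum>z\<in>S. R z om) - gval m j om \<partial>Q)"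
 proof -
  have sR: "integrable Q (%om. \<Sum>z\<in>S. R z om)" by (intro Bochner_Integration.integrable_sum iR)
  have "(\<integral>om. (\<Sum>z\<in>S. R z om) \<partial>Q) = (\<Sum>z\<in>S. \<integral>om. R z om \<partial>Q)"
   by (intro Bochner_Integration.integral_sum iR)
  moreover have "integrable Q (gval m j)" using m by (intro gval_integrable) auto
  ultimately show ?thesis
   using Bochner_Integration.integral_diff[OF Bochner_Integration.integrable_add[OF i\<alpha> sR], of "gval m j"]
    Bochner_Integration.integral_add[OF i\<alpha> sR] by simp
 qed
 have "\<bar>(\<integral>om. \<alpha> om \<partial>Q) + (\<Sum>z\<in>S. \<integral>om. R z om \<partial>Q) - (\<integral>om. gval m j om \<partial>Q)\<bar> <= (\<integral>om. \<bar>\<alpha> om + (\<Sum>z\<in>S. R z om) - gval m j om\<bar> \<partial>Q)"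
  unfolding E2 by (rule integral_abs_bound)
 also have "... <= (\<integral>om. CW * cell_defect m j om \<partial>Q)"
 proof (intro integral_mono_AE AE_I2)
  show "integrable Q (%om. \<bar>\<alpha> om + (\<Sum>z\<in>S. R z om) - gval m j om\<bar>)"
   using i\<alpha> iR gval_integrable[of m j] m
   by (intro integrable_abs Bochner_Integration.integrable_diff Bochner_Integration.integrable_add Bochner_Integration.integrable_sum) auto
  show "integrable Q (%om. CW * cell_defect m j om)" using cell_defect_integrable[OF m] by simp
  fix om assume om: "om \<in> space Q"
  have cd0: "0 <= cell_defect m j om" unfolding cell_defect_def
   using cell_bounds'[OF m] by (intro sum_nonneg df_integral_bounds om) auto
  show "\<bar>\<alpha> om + (\<Sum>z\<in>S. R z om) - gval m j om\<bar> <= CW * cell_defect m j om"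
  proof (cases "gJ m j om < n")
   case True
   then have i: "n - gJ m j om = Suc (i om)" "i om < n" by (auto simp: i_def)
   let ?x = "X p om"
   have R: "R z om = (if z \<in> S - {?x} then \<Psi> om * ((q - p) * (exp (exit_rate ?x * (q - p)) * (lamL L ?x z p om * rf (i om) z q om))) else 0)" if "z \<in> S" for z
   proof (cases "z = ?x")
    case False
    then have "a ?x z ~= 0" using a_pos[of ?x z] XS(1)[OF om] that by (auto simp: state_pairs_def)
    then show ?thesis using False that by (simp add: R_def \<beta>_def qp)
   qed (simp add: R_def)
   have "(\<Sum>z\<in>S. R z om) = (\<Sum>z\<in>S. if z \<in> S - {?x} then \<Psi> om * ((q - p) * (exp (exit_rate ?x * (q - p)) * (lamL L ?x z p om * rf (i om) z q om))) else 0)"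
    by (intro sum.cong refl R)
   also have "... = (\<Sum>z\<in>S - {?x}. \<Psi> om * ((q - p) * (exp (exit_rate ?x * (q - p)) * (lamL L ?x z p om * rf (i om) z q om))))"
    by (intro sum.mono_neutral_cong_right) auto
   finally have "\<alpha> om + (\<Sum>z\<in>S. R z om) - gval m j om = \<Psi> om * (rs ?x p q om * rf (Suc (i om)) ?x q om +
    (\<Sum>z\<in>S - {?x}. (q - p) * (exp (exit_rate ?x * (q - p)) * (lamL L ?x z p om * rf (i om) z q om))) - rf (Suc (i om)) ?x p om)"
    using True i by (simp add: \<alpha>_def gval_def \<Psi>_def p_def[symmetric] sum_distrib_left algebra_simps)
   moreover have "\<bar>rs ?x p q om * rf (Suc (i om)) ?x q om +
    (\<Sum>z\<in>S - {?x}. (q - p) * (exp (exit_rate ?x * (q - p)) * (lamL L ?x z p om * rf (i om) z q om))) - rf (Suc (i om)) ?x p om\<bar>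
    <= cell_defect m j om"
    using rfeller_step_error[OF feller_ctx[OF om] less_imp_le[OF b(2)] b(3), of ?x "i om" exit_rate]
     cell_defect_ge[OF om m i(2) XS(1)[OF om]]
    unfolding p_def q_def by linarith
   ultimately show ?thesis
    using \<Psi>[OF om] cd0 CW_nonneg by (simp add: abs_mult mult_mono)
  next
   case False
   then have "\<Psi> om = 0" by (simp add: \<Psi>_def)
   then have "\<alpha> om = 0" "R z om = 0" "gval m j om = 0" for z
    using False by (auto simp: \<alpha>_def R_def \<beta>_def gval_def feller_real_def)
   then show ?thesis using cd0 CW_nonneg by simp
  qed
 qed
 finally have err2: "\<bar>(\<integral>om. \<alpha> om \<partial>Q) + (\<Sum>z\<in>S. \<integral>om. R z om \<partial>Q) - (\<integral>om. gval m j om \<partial>Q)\<bar> <= CW * (\<integral>om. cell_defect m j om \<partial>Q)"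
  by simp
 show ?thesis using err1 err2 unfolding h_def[symmetric] by linarith
qed

definition "defect_total i x z m om = (\<Sum>j<m. \<integral>w. df i x z (g m j) (g m (Suc j)) w om * indicator {g m j<..g m (Suc j)} w \<partial>lborel)"

lemma defect_total_meas: "defect_total i x z m \<in> borel_measurable Q"
 unfolding defect_total_def
proof (intro borel_measurable_sum)
 fix j
 have "(%om. \<integral>w. df i x z (g m j) (g m (Suc j)) w om * indicator {g m j<..g m (Suc j)} w \<partial>lborel) \<in> borel_measurable (F T)"
 proof (rule lborel.borel_measurable_lebesgue_integral)
  have "(%v. df i x z (g m j) (g m (Suc j)) (snd v) (fst v)) \<in> borel_measurable (F T \<Otimes>\<^sub>M lborel)"
   by (intro df_meas_gen) auto
  then show "(%(om, w). df i x z (g m j) (g m (Suc j)) w om * indicator {g m j<..g m (Suc j)} w) \<in> borel_measurable (F T \<Otimes>\<^sub>M lborel)"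
   unfolding split_beta
   by (rule borel_measurable_times[OF _ measurable_compose[OF measurable_snd]]) simp
 qed
 then show "(%om. \<integral>w. df i x z (g m j) (g m (Suc j)) w om * indicator {g m j<..g m (Suc j)} w \<partial>lborel) \<in> borel_measurable Q"
  by (rule FT_Q)
qed

lemma defect_total_bounds:
 assumes m: "0 < m" and om: "om \<in> space Q" and x: "x \<in> S"
 shows "0 <= defect_total i x z m om" "defect_total i x z m om <= Bd * (t - s)"
proof -
 show "0 <= defect_total i x z m om"
  unfolding defect_total_def using cell_bounds'[OF m] by (intro sum_nonneg df_integral_bounds om x) auto
 have "defect_total i x z m om <= (\<Sum>j<m. Bd * (g m (Suc j) - g m j))"
  unfolding defect_total_def using cell_bounds'[OF m] by (intro sum_mono df_integral_bounds om x) auto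
 also have "... = Bd * (t - s)"
  using m by (simp add: sum_distrib_left[symmetric] sum_lessThan_telescope)
 finally show "defect_total i x z m om <= Bd * (t - s)" .
qed

lemma defect_total_eq:
 assumes m: "0 < m" and om: "om \<in> space Q" and x: "x \<in> S"
 shows "defect_total i x z m om = (\<integral>w. df i x z (cell_lo s t m w) (cell_hi s t m w) w om * indicator {s<..t} w \<partial>lborel)"
proof -
 have "defect_total i x z m om = (\<integral>w. (\<Sum>j<m. df i x z (g m j) (g m (Suc j)) w om * indicator {g m j<..g m (Suc j)} w) \<partial>lborel)"
  unfolding defect_total_def using cell_bounds'[OF m]
  by (intro Bochner_Integration.integral_sum[symmetric] df_integrable om x) auto
 also have "... = (\<integral>w. df i x z (cell_lo s t m w) (cell_hi s t m w) w om * indicator {s<..t} w \<partial>lborel)"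
  by (intro Bochner_Integration.integral_cong refl sum_cells[OF st(2) m])
 finally show ?thesis .
qed

lemma defect_total_tendsto_0:
 assumes x: "x \<in> S" and z: "z \<in> S"
 shows "(%m. \<integral>om. defect_total i x z (Suc m) om \<partial>Q) \<longlonglongrightarrow> 0"
proof -
 have "(%m. \<integral>om. defect_total i x z (Suc m) om \<partial>Q) \<longlonglongrightarrow> (\<integral>om. 0 \<partial>Q)"
 proof (rule integral_dominated_convergence[where w="%_. Bd * (t - s)"])
  show "AE om in Q. norm (defect_total i x z (Suc m) om) <= Bd * (t - s)" for m
   using defect_total_bounds[of "Suc m" _ x i z] x by (intro AE_I2) auto
  show "AE om in Q. (%m. defect_total i x z (Suc m) om) \<longlonglongrightarrow> 0"
   using lamL_left_AE[of L]
  proof eventually_elim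
   case (elim om)
   then have om: "om \<in> space Q" by simp
   have "(%m. \<integral>w. df i x z (cell_lo s t (Suc m) w) (cell_hi s t (Suc m) w) w om * indicator {s<..t} w \<partial>lborel) \<longlonglongrightarrow> (\<integral>w. 0 \<partial>(lborel :: real measure))"
   proof (rule integral_dominated_convergence[where w="%w. Bd * indicator {s<..t} w"])
    show "integrable lborel (%w. Bd * indicator {s<..t} w)"
     using st by (intro integrable_mult_right integrable_real_indicator) auto
    show "(%w. df i x z (cell_lo s t (Suc m) w) (cell_hi s t (Suc m) w) w om * indicator {s<..t} w) \<in> borel_measurable lborel" for m
    proof -
     have 1: "(%w. cell_lo s t (Suc m) w) \<in> borel_measurable lborel" "(%w. cell_hi s t (Suc m) w) \<in> borel_measurable lborel"
      by measurable
     have "(%w. df i x z (cell_lo s t (Suc m) w) (cell_hi s t (Suc m) w) w om) \<in> borel_measurable lborel"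
      using om by (intro df_meas_gen 1) (auto simp: space_FT)
     then show ?thesis by measurable
    qed
    show "AE w in lborel. norm (df i x z (cell_lo s t (Suc m) w) (cell_hi s t (Suc m) w) w om * indicator {s<..t} w) <= Bd * indicator {s<..t} w" for m
    proof (rule AE_I2)
     fix w
     show "norm (df i x z (cell_lo s t (Suc m) w) (cell_hi s t (Suc m) w) w om * indicator {s<..t} w) <= Bd * indicator {s<..t} w"
     proof (cases "w \<in> {s<..t}")
      case True
      then show ?thesis
       using df_bounds[OF om _ _ _ _ x, of "cell_lo s t (Suc m) w" "cell_hi s t (Suc m) w" w i z]
        cell_bounds[OF st(2) zero_less_Suc, of w m] cell_lo_hi_bounds[OF st(2) zero_less_Suc, of w m] st
       by (auto simp: Bd_def)
     qed simp
    qed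
    show "AE w in lborel. (%m. df i x z (cell_lo s t (Suc m) w) (cell_hi s t (Suc m) w) w om * indicator {s<..t} w) \<longlonglongrightarrow> 0"
     using elim[THEN conjunct2] AE_lborel_singleton[of t]
    proof eventually_elim
     case (elim w)
     show ?case
     proof (cases "s < w \<and> w < t")
      case True
      then obtain C where "eventually (%u. kil x u om <= ennreal C) (at_left w)"
       "((%r. lamL L x z r om) \<longlongrightarrow> lamL L x z w om) (at_left w)"
       using elim(1) x z st by force
      then have "(%m. df i x z (cell_lo s t m w) (cell_hi s t m w) w om) \<longlonglongrightarrow> 0"
       using True st by (intro defect_tendsto[OF feller_ctx[OF om]]) auto
      then have "(%m. df i x z (cell_lo s t (Suc m) w) (cell_hi s t (Suc m) w) w om) \<longlonglongrightarrow> 0" by (rule LIMSEQ_Suc)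
      then show ?thesis by (rule tendsto_mult_left_zero)
     next
      case False
      then have "w \<notin> {s<..t}" using elim(2) by auto
      then show ?thesis by simp
     qed
    qed
   qed simp
   then show ?case using om x by (simp add: defect_total_eq)
  qed
 qed (auto intro: defect_total_meas)
 then show ?thesis by simp
qed

text \<open>Telescoping over the \<open>m\<close> cells: the one-step errors are of order \<open>1 /
  m\<^sup>2\<close> each, and the total defect tends to zero by dominated convergence.\<close>
lemma grid_expectation_tendsto:
 "(%m. \<integral>om. gval (Suc m) (Suc m) om \<partial>Q) \<longlonglongrightarrow> (\<integral>om. indicator A om * rf n (X s om) s om \<partial>Q)"
proof -
 define C3 where "C3 = step_error * (t - s)\<^sup>2 * (CW + real (card S) * C2)"
 define e where "e m = C3 / real m + CW * (\<Sum>i<n. \<Sum>x\<in>S. \<Sum>z\<in>S - {x}. \<integral>om. defect_total i x z m om \<partial>Q)" for m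
 have le: "\<bar>(\<integral>om. gval m m om \<partial>Q) - (\<integral>om. gval m 0 om \<partial>Q)\<bar> <= e m" if m: "0 < m" for m
 proof -
  have "\<bar>(\<integral>om. gval m m om \<partial>Q) - (\<integral>om. gval m 0 om \<partial>Q)\<bar> = \<bar>\<Sum>j<m. (\<integral>om. gval m (Suc j) om \<partial>Q) - (\<integral>om. gval m j om \<partial>Q)\<bar>"
   by (subst sum_lessThan_telescope[of "%j. \<integral>om. gval m j om \<partial>Q"]) (rule refl)
  also have "... <= (\<Sum>j<m. \<bar>(\<integral>om. gval m (Suc j) om \<partial>Q) - (\<integral>om. gval m j om \<partial>Q)\<bar>)" by (rule sum_abs)
  also have "... <= (\<Sum>j<m. step_error * ((t - s) / real m)\<^sup>2 * (CW + real (card S) * C2) + CW * (\<integral>om. cell_defect m j om \<partial>Q))"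
   by (intro sum_mono gval_step m) auto
  also have "... = real m * (step_error * ((t - s) / real m)\<^sup>2 * (CW + real (card S) * C2)) + CW * (\<Sum>j<m. \<integral>om. cell_defect m j om \<partial>Q)"
   by (simp add: sum.distrib sum_distrib_left)
  also have "real m * (step_error * ((t - s) / real m)\<^sup>2 * (CW + real (card S) * C2)) = C3 / real m"
   using m by (simp add: C3_def power2_eq_square)
  also have "(\<Sum>j<m. \<integral>om. cell_defect m j om \<partial>Q) = (\<integral>om. (\<Sum>j<m. cell_defect m j om) \<partial>Q)"
   using m by (intro Bochner_Integration.integral_sum[symmetric] cell_defect_integrable) auto
  also have "... = (\<integral>om. (\<Sum>i<n. \<Sum>x\<in>S. \<Sum>z\<in>S - {x}. defect_total i x z m om) \<partial>Q)"
  proof (intro Bochner_Integration.integral_cong refl)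
   fix om
   let ?d = "%j i x z. \<integral>w. df i x z (g m j) (g m (Suc j)) w om * indicator {g m j<..g m (Suc j)} w \<partial>lborel"
   have "(\<Sum>j<m. cell_defect m j om) = (\<Sum>i<n. \<Sum>j<m. \<Sum>x\<in>S. \<Sum>z\<in>S - {x}. ?d j i x z)"
    unfolding cell_defect_def by (rule sum.swap)
   also have "... = (\<Sum>i<n. \<Sum>x\<in>S. \<Sum>j<m. \<Sum>z\<in>S - {x}. ?d j i x z)"
    by (intro sum.cong refl sum.swap)
   also have "... = (\<Sum>i<n. \<Sum>x\<in>S. \<Sum>z\<in>S - {x}. defect_total i x z m om)"
    unfolding defect_total_def by (intro sum.cong refl sum.swap)
   finally show "(\<Sum>j<m. cell_defect m j om) = (\<Sum>i<n. \<Sum>x\<in>S. \<Sum>z\<in>S - {x}. defect_total i x z m om)" .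
  qed
  also have "... = (\<Sum>i<n. \<Sum>x\<in>S. \<Sum>z\<in>S - {x}. \<integral>om. defect_total i x z m om \<partial>Q)"
  proof -
   have int: "integrable Q (defect_total i x z m)" if "x \<in> S" for i x z
    using defect_total_bounds[OF m _ that, of _ i z] that
    by (intro integrable_const_bound[where B="Bd * (t - s)"] defect_total_meas AE_I2) auto
   have "(\<integral>om. (\<Sum>z\<in>S - {x}. defect_total i x z m om) \<partial>Q) = (\<Sum>z\<in>S - {x}. \<integral>om. defect_total i x z m om \<partial>Q)" if "x \<in> S" for i x
    by (intro Bochner_Integration.integral_sum int that)
   moreover have "(\<integral>om. (\<Sum>x\<in>S. \<Sum>z\<in>S - {x}. defect_total i x z m om) \<partial>Q) = (\<Sum>x\<in>S. \<integral>om. (\<Sum>z\<in>S - {x}. defect_total i x z m om) \<partial>Q)" for i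
    by (intro Bochner_Integration.integral_sum Bochner_Integration.integrable_sum int)
   moreover have "(\<integral>om. (\<Sum>i<n. \<Sum>x\<in>S. \<Sum>z\<in>S - {x}. defect_total i x z m om) \<partial>Q) = (\<Sum>i<n. \<integral>om. (\<Sum>x\<in>S. \<Sum>z\<in>S - {x}. defect_total i x z m om) \<partial>Q)"
    by (intro Bochner_Integration.integral_sum Bochner_Integration.integrable_sum int)
   ultimately show ?thesis by simp
  qed
  finally show ?thesis unfolding e_def .
 qed
 have "(%m. C3 / real (Suc m) + CW * (\<Sum>i<n. \<Sum>x\<in>S. \<Sum>z\<in>S - {x}. \<integral>om. defect_total i x z (Suc m) om \<partial>Q)) \<longlonglongrightarrow>
   0 + CW * (\<Sum>i<n. \<Sum>x\<in>S. \<Sum>z\<in>S - {x}. 0)"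
  by (intro tendsto_add tendsto_mult tendsto_const tendsto_sum defect_total_tendsto_0 LIMSEQ_Suc[OF lim_const_over_n]) auto
 then have e0: "(%m. e (Suc m)) \<longlonglongrightarrow> 0" by (simp add: e_def)
 have "gval m 0 om = indicator A om * rf n (X s om) s om" for m om
  by (simp add: gval_def grid_weight_def grid_changes_def)
 then have "(%m. (\<integral>om. gval (Suc m) (Suc m) om \<partial>Q) - (\<integral>om. indicator A om * rf n (X s om) s om \<partial>Q)) \<longlonglongrightarrow> 0"
  using le[OF zero_less_Suc] by (intro Lim_null_comparison[OF _ e0]) (auto intro!: always_eventually)
 then show ?thesis by (rule Lim_null[THEN iffD2])
qed

lemma rel_nonneg: "0 <= rel x z u om"
 using a_pos[of x z] lamL_bounds(1)[of L x z u om]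
 by (cases "(x, z) \<in> I") (auto simp: lamL_def lam_def intro: divide_nonneg_pos)

lemma grid_weight_tendsto_AE:
 "AE om in Q. (%m. ennreal (gw m m om)) \<longlonglongrightarrow> path_weight (%x u. kil x u om) exit_rate (%x z u. min (lam_left x z u om) (real L) / a x z) (%u. X u om) s t \<and>
   eventually (%m. gJ m m om = card (jump_times (%u. X u om) s t)) sequentially"
 using lam_left_limits_AE AE_space
proof eventually_elim
 case (elim om)
  have r: "((%r. rel x z r om) \<longlongrightarrow> min (lam_left x z u om) (real L) / a x z) (at_left u)" if "s < u" "u <= t" for x z u
   unfolding lamL_def divide_inverse using elim(1) that st by (intro tendsto_mult tendsto_min tendsto_const) auto
  have gl1: "(%m. ennreal (gw m m om)) \<longlonglongrightarrow> path_weight (%x u. kil x u om) exit_rate (%x z u. min (lam_left x z u om) (real L) / a x z) (%u. X u om) s t"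
  proof (rule grid_weight_tendsto(1)[OF X_step[OF elim(2)] st finite_atLeastAtMost])
   show "X u om \<in> S" if "0 <= u" "u <= T" for u by (rule X_S[OF that elim(2)])
   show "(%u. kil x u om) \<in> borel_measurable borel" for x by (rule kil_path_meas[OF elim(2)])
  qed (fact r rel_nonneg)+
  have gl2: "eventually (%m. gJ m m om = card (jump_times (%u. X u om) s t)) sequentially"
  proof (rule grid_weight_tendsto(2)[OF X_step[OF elim(2)] st finite_atLeastAtMost])
   show "X u om \<in> S" if "0 <= u" "u <= T" for u by (rule X_S[OF that elim(2)])
   show "(%u. kil x u om) \<in> borel_measurable borel" for x by (rule kil_path_meas[OF elim(2)])
  qed (fact r rel_nonneg)+
  show ?case using gl1 gl2 by blast
qed

lemma measurable_truncated_path_weight: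
 "(%om. path_weight (%x u. kil x u om) exit_rate (%x z u. min (lam_left x z u om) (real L) / a x z) (%u. X u om) s t) \<in> borel_measurable (Gh t)"
proof (rule measurable_AE_version[where u="%om. liminf (%m. ennreal (gw (Suc m) (Suc m) om))"])
 have t: "0 <= t" using st by simp
 show "\<And>om. om \<in> space Q ==> path_weight (%x u. kil x u om) exit_rate (%x z u. min (lam_left x z u om) (real L) / a x z) (%u. X u om) s t \<in> space borel" by simp
 show "space (Gh t) = space Q" "null_sets Q \<subseteq> sets (Gh t)" using Gh_null[OF t st(3)] by simp_all
 have "(%om. gw (Suc m) (Suc m) om) \<in> borel_measurable (Gh t)" for m
  using gw_meas[of "Suc m" "Suc m"] by simp
 then show "(%om. liminf (%m. ennreal (gw (Suc m) (Suc m) om))) \<in> borel_measurable (Gh t)"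
  by (intro borel_measurable_liminf measurable_compose[OF _ measurable_ennreal])
 show "AE om in Q. path_weight (%x u. kil x u om) exit_rate (%x z u. min (lam_left x z u om) (real L) / a x z) (%u. X u om) s t = liminf (%m. ennreal (gw (Suc m) (Suc m) om))"
  using grid_weight_tendsto_AE
 proof eventually_elim
  case (elim om)
  show ?case by (rule lim_imp_Liminf[OF sequentially_bot LIMSEQ_Suc[OF conjunct1[OF elim]], symmetric])
 qed
qed

lemma measurable_jump_count:
 "(%om. of_bool (card (jump_times (%u. X u om) s t) < n) :: ennreal) \<in> borel_measurable (Gh t)"
proof (rule measurable_AE_version[where u="%om. liminf (%m. of_bool (gJ (Suc m) (Suc m) om < n) :: ennreal)"])
 have t: "0 <= t" using st by simp
 show "space (Gh t) = space Q" "null_sets Q \<subseteq> sets (Gh t)" using Gh_null[OF t st(3)] by simp_all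
 have "gJ (Suc m) (Suc m) \<in> measurable (Gh t) (count_space UNIV)" for m
  using gJ_meas[of "Suc m" "Suc m"] by simp
 from measurable_compose[OF this, of "%j. of_bool (j < n) :: ennreal" borel]
 show "(%om. liminf (%m. of_bool (gJ (Suc m) (Suc m) om < n) :: ennreal)) \<in> borel_measurable (Gh t)"
  by (intro borel_measurable_liminf) simp
 show "AE om in Q. of_bool (card (jump_times (%u. X u om) s t) < n) =
   liminf (%m. of_bool (gJ (Suc m) (Suc m) om < n) :: ennreal)"
  using grid_weight_tendsto_AE
 proof eventually_elim
  case (elim om)
  have "eventually (%m. gJ (Suc m) (Suc m) om = card (jump_times (%u. X u om) s t)) sequentially"
   by (rule eventually_sequentially_Suc[THEN iffD2, OF conjunct2[OF elim]])
  then have "eventually (%m. (of_bool (gJ (Suc m) (Suc m) om < n) :: ennreal) = of_bool (card (jump_times (%u. X u om) s t) < n)) sequentially"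
   by eventually_elim simp
  then show ?case
   by (rule lim_imp_Liminf[OF sequentially_bot tendsto_eventually, symmetric])
 qed
qed simp

text \<open>At \<open>j = 0\<close> the grid functional is the right hand side, and at \<open>j = m\<close>
  it converges to the integrand on the left as the grid becomes finer.\<close>
lemma truncated_identity:
 "(\<integral>\<^sup>+om. indicator A om * path_weight (%x u. kil x u om) exit_rate (%x z u. min (lam_left x z u om) (real L) / a x z)
   (%u. X u om) s t * of_bool (card (jump_times (%u. X u om) s t) < n \<and> X t om = y) \<partial>Q) =
  (\<integral>\<^sup>+om. indicator A om * feller S (%x u. kil x u om) (%x z u. ennreal (lamL L x z u om)) n (X s om) y s t \<partial>Q)"
  (is "(\<integral>\<^sup>+om. ?l om \<partial>Q) = (\<integral>\<^sup>+om. ?r om \<partial>Q)")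
proof -
 define u where "u om = liminf (%m. ennreal (gval (Suc m) (Suc m) om))" for om
 have gm: "(%om. ennreal (gval (Suc m) (Suc m) om)) \<in> borel_measurable Q" for m
  using gval_meas[of "Suc m" "Suc m"] by simp
 have u_meas: "u \<in> borel_measurable Q" unfolding u_def by (intro borel_measurable_liminf gm)
 have lim: "AE om in Q. (%m. ennreal (gval (Suc m) (Suc m) om)) \<longlonglongrightarrow> ?l om"
  using grid_weight_tendsto_AE AE_space
 proof eventually_elim
  case (elim om)
  note gl1 = elim(1)[THEN conjunct1] and gl2 = elim(1)[THEN conjunct2]
  have "eventually (%m. gJ m m om = card (jump_times (%u. X u om) s t)) sequentially"
   using gl2 by blast
  then have evJ: "eventually (%m. gJ (Suc m) (Suc m) om = card (jump_times (%u. X u om) s t)) sequentially"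
   by (rule eventually_sequentially_Suc[THEN iffD2])
  let ?w = "path_weight (%x u. kil x u om) exit_rate (%x z u. min (lam_left x z u om) (real L) / a x z) (%u. X u om) s t"
  let ?c = "indicator A om * of_bool (card (jump_times (%u. X u om) s t) < n \<and> X t om = y) :: ennreal"
  have "(%m. ennreal (gw m m om)) \<longlonglongrightarrow> ?w" using gl1 by blast
  then have "(%m. ?c * ennreal (gw (Suc m) (Suc m) om)) \<longlonglongrightarrow> ?c * ?w"
   by (intro ennreal_tendsto_cmult LIMSEQ_Suc) (auto simp: indicator_def)
  moreover have "eventually (%m. ?c * ennreal (gw (Suc m) (Suc m) om) = ennreal (gval (Suc m) (Suc m) om)) sequentially"
   using evJ
  proof eventually_elim
   case (elim m)
   have gwn: "0 <= gw (Suc m) (Suc m) om" using gw_bounds[of "Suc m" "Suc m" om] \<open>om \<in> space Q\<close> by simp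
   have "gval (Suc m) (Suc m) om = indicator A om * gw (Suc m) (Suc m) om *
     rf (n - card (jump_times (%u. X u om) s t)) (X t om) t om"
    unfolding gval_def elim by simp
   also have "rf (n - card (jump_times (%u. X u om) s t)) (X t om) t om =
     of_bool (card (jump_times (%u. X u om) s t) < n \<and> X t om = y)"
   proof (cases "card (jump_times (%u. X u om) s t) < n")
    case True
    then obtain i where "n - card (jump_times (%u. X u om) s t) = Suc i" by (metis Suc_diff_Suc)
    then show ?thesis using True by (simp add: feller_real_def)
   qed (simp add: feller_real_def)
   finally show ?case using gwn by (auto simp: indicator_def)
  qed
  ultimately have "(%m. ennreal (gval (Suc m) (Suc m) om)) \<longlonglongrightarrow> ?c * ?w" by (rule Lim_transform_eventually)
  then show ?case by (simp only: mult_ac)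
 qed
 have lu: "AE om in Q. ?l om = u om"
  using lim by eventually_elim (simp add: u_def lim_imp_Liminf)
 have "(%m. \<integral>\<^sup>+om. ennreal (gval (Suc m) (Suc m) om) \<partial>Q) \<longlonglongrightarrow> (\<integral>\<^sup>+om. u om \<partial>Q)"
 proof (rule nn_integral_dominated_convergence[where w="%_. ennreal CW"])
  show "AE om in Q. ennreal (gval (Suc m) (Suc m) om) <= ennreal CW" for m
   using gval_bounds[of "Suc m" "Suc m"] by (intro AE_I2 ennreal_leI) auto
  show "(\<integral>\<^sup>+om. ennreal CW \<partial>Q) < \<infinity>" by (simp add: emeasure_space_1)
  show "AE om in Q. (%m. ennreal (gval (Suc m) (Suc m) om)) \<longlonglongrightarrow> u om"
   using lim lu by eventually_elim simp
 qed (use gm u_meas in auto)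
 moreover have "(\<integral>\<^sup>+om. ennreal (gval (Suc m) (Suc m) om) \<partial>Q) = ennreal (\<integral>om. gval (Suc m) (Suc m) om \<partial>Q)" for m
  using gval_bounds[of "Suc m" "Suc m"] by (intro nn_integral_eq_integral gval_integrable AE_I2) auto
 moreover have "(%m. ennreal (\<integral>om. gval (Suc m) (Suc m) om \<partial>Q)) \<longlonglongrightarrow> ennreal (\<integral>om. indicator A om * rf n (X s om) s om \<partial>Q)"
  by (intro tendsto_ennrealI grid_expectation_tendsto)
 ultimately have "(\<integral>\<^sup>+om. u om \<partial>Q) = ennreal (\<integral>om. indicator A om * rf n (X s om) s om \<partial>Q)"
  using LIMSEQ_unique by simp
 also have "... = (\<integral>\<^sup>+om. ennreal (indicator A om * rf n (X s om) s om) \<partial>Q)"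
 proof -
  have "gval 1 0 = (%om. indicator A om * rf n (X s om) s om)"
   by (simp add: gval_def grid_weight_def grid_changes_def fun_eq_iff)
  then show ?thesis
   using gval_bounds[of 1 0] gval_integrable[of 1 0] by (intro nn_integral_eq_integral[symmetric] AE_I2) auto
 qed
 also have "... = (\<integral>\<^sup>+om. ?r om \<partial>Q)"
 proof (intro nn_integral_cong)
  fix om assume om: "om \<in> space Q"
  have "feller S (%x u. kil x u om) (%x z u. ennreal (lamL L x z u om)) n (X s om) y s t = ennreal (rf n (X s om) s om)"
   by (rule feller_rfeller(1)[OF feller_ctx[OF om] less_imp_le[OF st(2)]])
  then show "ennreal (indicator A om * rf n (X s om) s om) = ?r om"
   by (cases "om \<in> A") simp_all
 qed
 finally show ?thesis using nn_integral_cong_AE[OF lu] by simp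
qed

end

text \<open>The part of the density that belongs to \<open>]s,t]\<close>.\<close>
definition weight :: "real => real => 'a => ennreal" where
 "weight s t om = path_weight (%x u. kil x u om) exit_rate (%x z u. lam_left x z u om / a x z) (%u. X u om) s t"

definition trans :: "nat => nat => real => real => 'a => ennreal" where
 "trans x y s t om = min_trans S (%x u. kil x u om) (%x z u. ennreal (lam x z u om)) x y s t"

end

section \<open>The key identity\<close>

lemma SUP_eventually_const:
 fixes f :: "nat => ennreal"
 assumes "incseq f" "eventually (%n. f n = c) sequentially"
 shows "(SUP n. f n) = c"
 using LIMSEQ_unique[OF LIMSEQ_SUP[OF assms(1)] tendsto_eventually[OF assms(2)]] .

text \<open>Both integrals define the same measure on the smaller \<open>\<sigma>\<close>-algebra.\<close>
lemma nn_integral_eq_on_subalgebra: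
 assumes N: "subalgebra M N" and [measurable]: "f \<in> borel_measurable M" "g \<in> borel_measurable M"
  and eq: "\<And>A. A \<in> sets N ==> (\<integral>\<^sup>+x. indicator A x * f x \<partial>M) = (\<integral>\<^sup>+x. indicator A x * g x \<partial>M)"
  and h: "h \<in> borel_measurable N"
 shows "(\<integral>\<^sup>+x. h x * f x \<partial>M) = (\<integral>\<^sup>+x. h x * g x \<partial>M)"
proof -
 have N': "subalgebra (density M f) N" "subalgebra (density M g) N"
  using N by (auto simp: subalgebra_def)
 have "restr_to_subalg (density M f) N = restr_to_subalg (density M g) N"
 proof (rule measure_eqI)
  show "sets (restr_to_subalg (density M f) N) = sets (restr_to_subalg (density M g) N)"
   using N' by (simp add: sets_restr_to_subalg)
  fix A assume "A \<in> sets (restr_to_subalg (density M f) N)"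
  then have A: "A \<in> sets N" using N' by (simp add: sets_restr_to_subalg)
  then have "A \<in> sets M" using N by (auto simp: subalgebra_def)
  then show "emeasure (restr_to_subalg (density M f) N) A = emeasure (restr_to_subalg (density M g) N) A"
   using eq[OF A] A by (simp add: emeasure_restr_to_subalg[OF N'(1)] emeasure_restr_to_subalg[OF N'(2)] emeasure_density mult.commute)
 qed
 then have "(\<integral>\<^sup>+x. h x \<partial>density M f) = (\<integral>\<^sup>+x. h x \<partial>density M g)"
  using nn_integral_subalgebra2[OF N'(1) h] nn_integral_subalgebra2[OF N'(2) h] by simp
 moreover have [measurable]: "h \<in> borel_measurable M" using N h by (rule measurable_from_subalg)
 ultimately show ?thesis by (simp add: nn_integral_density mult.commute)
qed

lemma AE_eq_of_nn_integral_eq: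
 fixes f g :: "'b => ennreal"
 assumes [measurable]: "f \<in> borel_measurable M" "g \<in> borel_measurable M"
  and le: "AE x in M. f x <= g x" and eq: "(\<integral>\<^sup>+x. g x \<partial>M) <= (\<integral>\<^sup>+x. f x \<partial>M)" and fin: "(\<integral>\<^sup>+x. f x \<partial>M) < \<top>"
 shows "AE x in M. f x = g x"
proof -
 have "(\<integral>\<^sup>+x. g x - f x \<partial>M) = (\<integral>\<^sup>+x. g x \<partial>M) - (\<integral>\<^sup>+x. f x \<partial>M)"
  using fin le by (intro nn_integral_diff) auto
 also have "... = 0" using eq fin by (simp add: diff_eq_0_iff_ennreal)
 finally have "AE x in M. g x - f x = 0" by (subst (asm) nn_integral_0_iff_AE) auto
 moreover have "AE x in M. f x ~= \<infinity>" using fin by (intro nn_integral_PInf_AE) auto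
 ultimately show ?thesis using le by eventually_elim (auto simp: diff_eq_0_iff_ennreal less_top)
qed

context driven_chain_rates
begin

abbreviation "kpath om \<equiv> (%x u. kil x u om)"
abbreviation "lpath om \<equiv> (%x z u. ennreal (lam x z u om))"
abbreviation "weightL L s t om \<equiv> path_weight (%x u. kil x u om) exit_rate (%x z u. min (lam_left x z u om) (real L) / a x z) (%u. X u om) s t"

lemma FTQ: "f \<in> measurable (F T) M ==> f \<in> measurable Q M"
 using F_subalg[of T] T_pos by (auto intro: measurable_from_subalg)

lemma lamL_SUP: "(SUP L. ennreal (lamL L x z u om)) = ennreal (lam x z u om)"
proof (rule antisym)
 show "(SUP L. ennreal (lamL L x z u om)) <= ennreal (lam x z u om)"
  by (intro SUP_least ennreal_leI lamL_bounds)
 obtain L where "lam x z u om <= real L" using real_arch_simple by blast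
 then have "lamL L x z u om = lam x z u om" by (simp add: lamL_def)
 then show "ennreal (lam x z u om) <= (SUP L. ennreal (lamL L x z u om))" by (intro SUP_upper2[of L]) auto
qed

lemma trans_eq_SUP:
 assumes om: "om \<in> space Q"
 shows "trans x y s t om = (SUP L. feller S (kpath om) (%x z u. ennreal (lamL L x z u om)) L x y s t)"
proof -
 let ?f = "%L n. feller S (kpath om) (%x z u. ennreal (lamL L x z u om)) n x y s t"
 have mono: "?f L n <= ?f L' n'" if "L <= L'" "n <= n'" for L L' n n'
  using that by (intro feller_mono ennreal_leI) (auto simp: lamL_def)
 have "trans x y s t om = (SUP n. feller S (kpath om) (%x z u. SUP L. ennreal (lamL L x z u om)) n x y s t)"
  by (simp add: trans_def min_trans_def lamL_SUP)
 also have "... = (SUP n. SUP L. ?f L n)"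
 proof (intro SUP_cong refl feller_SUP_rates[symmetric])
  show "incseq (%L. ennreal (lamL L x z u om))" for x z u
   by (auto simp: incseq_def lamL_def intro!: ennreal_leI)
  show "(%u. ennreal (lamL L x z u om)) \<in> borel_measurable borel" for L x z
   using lamL_path_meas[OF om] by (rule measurable_compose) simp
 qed (use om in auto)
 also have "... = (SUP L. ?f L L)"
 proof (rule antisym)
  show "(SUP n. SUP L. ?f L n) <= (SUP L. ?f L L)"
  proof (intro SUP_least)
   fix n L show "?f L n <= (SUP L. ?f L L)"
    by (rule SUP_upper2[of "max L n"]) (rule UNIV_I, rule mono, simp_all)
  qed
  show "(SUP L. ?f L L) <= (SUP n. SUP L. ?f L n)"
   by (intro SUP_least) (meson SUP_upper SUP_upper2 UNIV_I)
 qed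
 finally show ?thesis .
qed

lemma weightL_mono: "L <= L' ==> weightL L s t om <= weightL L' s t om"
proof -
 assume L: "L <= L'"
 have "min (lam_left x z u om) (real L) / a x z <= min (lam_left x z u om) (real L') / a x z" for x z u
 proof (cases "(x, z) \<in> I")
  case True
  then show ?thesis using L a_pos[OF True] by (intro divide_right_mono) auto
 qed (simp add: lam_left_def)
 then show ?thesis
  unfolding path_weight_def by (intro mult_left_mono prod_mono_ennreal ennreal_leI) auto
qed

text \<open>A path has finitely many jumps, so only finitely many values of the rates occur as
  factors.\<close>
lemma weightL_eventually:
 assumes "0 <= s" "t <= T" and om: "om \<in> space Q"
 shows "eventually (%L. weightL L s t om = weight s t om) sequentially"
proof -
 let ?J = "jump_times (%u. X u om) s t"
 let ?l = "%u. lam_left (left_val (%u. X u om) u) (X u om) u om"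
 have "finite ?J" by (rule finite_jump_times[OF X_step[OF om] assms(1,2)])
 moreover have "eventually (%L. ?l u <= real L) sequentially" for u
  using filterlim_real_sequentially by (auto simp: filterlim_at_top)
 ultimately have "eventually (%L. \<forall>u\<in>?J. ?l u <= real L) sequentially" by (simp add: eventually_ball_finite)
 then show ?thesis
  unfolding weight_def path_weight_def
 proof eventually_elim
  case (elim L)
  then have "(\<Prod>u\<in>?J. ennreal (min (?l u) (real L) / a (left_val (%u. X u om) u) (X u om))) =
    (\<Prod>u\<in>?J. ennreal (?l u / a (left_val (%u. X u om) u) (X u om)))"
   by (intro prod.cong refl) (simp add: min_absorb1)
  then show ?case by simp
 qed
qed

lemma weight_refl [simp]: "weight s s om = 1"
 by (simp add: weight_def path_weight_def jump_times_def set_lebesgue_integral_def)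

lemma feller_ctx_rates:
 assumes "om \<in> space Q"
 shows "finite S" "\<And>x. (%u. kil x u om) \<in> borel_measurable borel"
  "\<And>x z. (%u. ennreal (lam x z u om)) \<in> borel_measurable borel"
 using assms by auto

lemma trans_refl:
 assumes "om \<in> space Q"
 shows "trans x y s s om = of_bool (x = y)"
 unfolding trans_def by (subst min_trans_first_jump[OF feller_ctx_rates[OF assms] order_refl]) simp

lemma trans_sum_le_1: "om \<in> space Q ==> s <= t ==> (\<Sum>y\<in>S. trans x y s t om) <= 1"
 unfolding trans_def by (rule min_trans_sum_le_1[OF feller_ctx_rates]) (auto simp: kil_def)

lemma trans_meas:
 assumes t: "0 <= t" "t <= T"
 shows "trans x y s t \<in> borel_measurable (F t)"
proof -
 have l: "(%(u, om). ennreal (lam x z u om * indicator {..t} u)) \<in> borel_measurable (borel \<Otimes>\<^sub>M F t)" for x z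
  using measurable_compose[OF lam_meas_upto[OF t] measurable_ennreal] by (simp add: split_beta)
 have k: "(%(u, om). \<Sum>z\<in>S - {x}. ennreal (lam x z u om * indicator {..t} u)) \<in> borel_measurable (borel \<Otimes>\<^sub>M F t)" for x
  unfolding split_beta by (intro borel_measurable_sum l[unfolded split_beta])
 have "trans x y s t = (%om. min_trans S (%x u. \<Sum>z\<in>S - {x}. ennreal (lam x z u om * indicator {..t} u))
   (%x z u. ennreal (lam x z u om * indicator {..t} u)) x y s t)"
  unfolding trans_def by (intro ext min_trans_cong) (simp_all add: kil_def)
 also have "... \<in> borel_measurable (F t)"
  by (rule measurable_min_trans_param[OF k l]) auto
 finally show ?thesis .
qed

lemma trans_X_meas:
 assumes "0 <= s" "s <= r" "r <= T" "0 <= t" "t <= T"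
 shows "(%om. trans (X s om) y v t om) \<in> borel_measurable (Gh r)"
proof (rule measurable_compose_countable[where f="%x om. trans x y v t om" and g="X s"])
 show "(%om. trans x y v t om) \<in> borel_measurable (Gh r)" for x
  using assms by (intro measurable_F_Gh[of t] trans_meas) auto
 show "X s \<in> measurable (Gh r) (count_space UNIV)"
  using assms by (intro measurable_Gh_mono[of s r] X_meas_Gh) auto
qed

lemma S_nonempty: obtains y where "y \<in> S"
 using not_empty X_S[of 0] T_pos by auto

lemma weightL_meas:
 assumes "0 <= s" "s < t" "t <= T"
 shows "(%om. weightL L s t om) \<in> borel_measurable (Gh t)"
  and "(%om. of_bool (card (jump_times (%u. X u om) s t) < n) :: ennreal) \<in> borel_measurable (Gh t)"
proof -
 obtain y where "y \<in> S" by (rule S_nonempty)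
 then show "(%om. weightL L s t om) \<in> borel_measurable (Gh t)"
  "(%om. of_bool (card (jump_times (%u. X u om) s t) < n) :: ennreal) \<in> borel_measurable (Gh t)"
  using measurable_truncated_path_weight[OF assms _ sets.empty_sets] measurable_jump_count[OF assms _ sets.empty_sets] by blast+
qed

lemma weight_meas:
 assumes "0 <= s" "s <= t" "t <= T"
 shows "weight s t \<in> borel_measurable (Gh t)"
proof (cases "s = t")
 case True
 then have "weight s t = (%_. 1)" by (intro ext) simp
 then show ?thesis by simp
next
 case False
 have "(%om. SUP L. weightL L s t om) \<in> borel_measurable (Gh t)"
  using assms False by (intro borel_measurable_SUP weightL_meas) auto
 moreover have "(SUP L. weightL L s t om) = weight s t om" if "om \<in> space (Gh t)" for om
  using that assms by (intro SUP_eventually_const weightL_eventually) (auto simp: incseq_def intro: weightL_mono)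
 ultimately show ?thesis by (subst measurable_cong[of "Gh t" _ "%om. SUP L. weightL L s t om"]) auto
qed

lemma of_bool_X_meas:
 assumes "0 <= t" "t <= r" "r <= T"
 shows "(%om. of_bool (X t om = y) :: ennreal) \<in> borel_measurable (Gh r)"
 using assms by (intro measurable_compose[OF measurable_Gh_mono[OF assms X_meas_Gh]]) auto

text \<open>Monotone convergence removes the truncation of the rates and the bound on the number of jumps.\<close>
lemma weight_identity:
 assumes st: "0 <= s" "s <= t" "t <= T" and y: "y \<in> S" and A: "A \<in> sets (Gh s)"
 shows "(\<integral>\<^sup>+om. indicator A om * (weight s t om * of_bool (X t om = y)) \<partial>Q) =
  (\<integral>\<^sup>+om. indicator A om * trans (X s om) y s t om \<partial>Q)"
proof (cases "s = t")
 case True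
 then show ?thesis by (intro nn_integral_cong) (simp add: trans_refl)
next
 case False
 then have st': "0 <= s" "s < t" "t <= T" using st by auto
 define gl where "gl L om = indicator A om * weightL L s t om * of_bool (card (jump_times (%u. X u om) s t) < L \<and> X t om = y)" for L om
 define gr where "gr L om = indicator A om * feller S (%x u. kil x u om) (%x z u. ennreal (lamL L x z u om)) L (X s om) y s t" for L om
 have eq: "(\<integral>\<^sup>+om. gl L om \<partial>Q) = (\<integral>\<^sup>+om. gr L om \<partial>Q)" for L
  unfolding gl_def gr_def by (rule truncated_identity[OF st' y A])
 have AQ: "A \<in> sets Q" using A Gh_subalg[of s] st by (auto simp: subalgebra_def)
 have gl_meas: "gl L \<in> borel_measurable Q" for L
 proof -
  have t: "0 <= t" using st by simp
  have "(%om. indicator A om * weightL L s t om *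
    (of_bool (card (jump_times (%u. X u om) s t) < L) * of_bool (X t om = y))) \<in> borel_measurable Q"
   using weightL_meas[OF st', THEN measurable_Gh_Q[OF t st(3)]] AQ
    of_bool_X_meas[OF t order_refl st(3), THEN measurable_Gh_Q[OF t st(3)]]
   by (intro borel_measurable_times_ennreal borel_measurable_indicator) auto
  then show ?thesis by (simp add: gl_def[abs_def] of_bool_conj)
 qed
 have gr_meas: "gr L \<in> borel_measurable Q" for L
 proof -
  have "(%om. feller S (%x u. kil x u om) (%x z u. ennreal (lamL L x z u om)) L x y s t) \<in> borel_measurable (F T)" for x
   by (rule measurable_feller_param[where M="F T" and f="%om. om"])
     (use kil_meas lamL_meas in \<open>auto simp: split_beta intro: measurable_compose[OF _ measurable_ennreal]\<close>)
  then have "(%om. feller S (%x u. kil x u om) (%x z u. ennreal (lamL L x z u om)) L (X s om) y s t) \<in> borel_measurable Q"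
   using st by (intro measurable_compose_countable[OF FTQ X_meas]) auto
  then show ?thesis unfolding gr_def using AQ by (intro borel_measurable_times_ennreal borel_measurable_indicator)
 qed
 have "(\<integral>\<^sup>+om. indicator A om * (weight s t om * of_bool (X t om = y)) \<partial>Q) = (\<integral>\<^sup>+om. (SUP L. gl L om) \<partial>Q)"
 proof (intro nn_integral_cong SUP_eventually_const[symmetric])
  fix om assume om: "om \<in> space Q"
  show "incseq (%L. gl L om)"
   unfolding gl_def incseq_def by (intro allI impI mult_mono weightL_mono) auto
  show "eventually (%L. gl L om = indicator A om * (weight s t om * of_bool (X t om = y))) sequentially"
   using weightL_eventually[OF st(1,3) om] eventually_gt_at_top[of "card (jump_times (%u. X u om) s t)"]
   by eventually_elim (simp add: gl_def mult.assoc)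
 qed
 also have "... = (SUP L. \<integral>\<^sup>+om. gl L om \<partial>Q)"
 proof (intro nn_integral_monotone_convergence_SUP_AE AE_I2 gl_meas)
  show "gl L om <= gl (Suc L) om" for L om
   unfolding gl_def by (intro mult_mono weightL_mono) auto
 qed
 also have "... = (SUP L. \<integral>\<^sup>+om. gr L om \<partial>Q)" by (simp only: eq)
 also have "... = (\<integral>\<^sup>+om. (SUP L. gr L om) \<partial>Q)"
 proof (intro nn_integral_monotone_convergence_SUP_AE[symmetric] AE_I2 gr_meas)
  show "gr L om <= gr (Suc L) om" for L om
   unfolding gr_def by (intro mult_left_mono feller_mono ennreal_leI) (auto simp: lamL_def)
 qed
 also have "... = (\<integral>\<^sup>+om. indicator A om * trans (X s om) y s t om \<partial>Q)"
  unfolding gr_def by (intro nn_integral_cong) (simp add: trans_eq_SUP SUP_mult_left_ennreal)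
 finally show ?thesis .
qed

lemma weight_identity_fun:
 assumes st: "0 <= s" "s <= t" "t <= T" and y: "y \<in> S" and h: "h \<in> borel_measurable (Gh s)"
 shows "(\<integral>\<^sup>+om. h om * (weight s t om * of_bool (X t om = y)) \<partial>Q) = (\<integral>\<^sup>+om. h om * trans (X s om) y s t om \<partial>Q)"
proof (rule nn_integral_eq_on_subalgebra[OF Gh_subalg _ _ weight_identity[OF st y] h])
 have t: "0 <= t" using st by simp
 show "(%om. weight s t om * of_bool (X t om = y)) \<in> borel_measurable Q"
  using weight_meas[OF st] of_bool_X_meas[OF t order_refl st(3), of y]
  by (intro measurable_Gh_Q[OF t st(3)] borel_measurable_times_ennreal)
 show "(%om. trans (X s om) y s t om) \<in> borel_measurable Q"
  using st by (intro measurable_Gh_Q[OF t st(3)] trans_X_meas) auto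
qed (use st in auto)

lemma weight_total:
 assumes st: "0 <= s" "s <= t" "t <= T" and h: "h \<in> borel_measurable (Gh s)"
 shows "(\<integral>\<^sup>+om. h om * weight s t om \<partial>Q) = (\<integral>\<^sup>+om. h om * (\<Sum>y\<in>S. trans (X s om) y s t om) \<partial>Q)"
proof -
 have t: "0 <= t" and s: "s <= T" using st by auto
 have hQ: "h \<in> borel_measurable Q" by (rule measurable_Gh_Q[OF st(1) s h])
 have m1: "(%om. h om * (weight s t om * of_bool (X t om = y))) \<in> borel_measurable Q" for y
  using weight_meas[OF st] of_bool_X_meas[OF t order_refl st(3), of y]
  by (intro borel_measurable_times_ennreal[OF hQ] measurable_Gh_Q[OF t st(3)] borel_measurable_times_ennreal)
 have m2: "(%om. h om * trans (X s om) y s t om) \<in> borel_measurable Q" for y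
  using st by (intro borel_measurable_times_ennreal[OF hQ] measurable_Gh_Q[OF t st(3)] trans_X_meas) auto
 have "(\<integral>\<^sup>+om. h om * weight s t om \<partial>Q) = (\<integral>\<^sup>+om. (\<Sum>y\<in>S. h om * (weight s t om * of_bool (X t om = y))) \<partial>Q)"
 proof (intro nn_integral_cong)
  fix om assume om: "om \<in> space Q"
  have "(\<Sum>y\<in>S. h om * (weight s t om * of_bool (X t om = y))) = (\<Sum>y\<in>S. if y = X t om then h om * weight s t om else 0)"
   by (intro sum.cong refl) auto
  also have "... = h om * weight s t om" using X_S[OF t st(3) om] by (subst sum.delta) auto
  finally show "h om * weight s t om = (\<Sum>y\<in>S. h om * (weight s t om * of_bool (X t om = y)))" by simp
 qed
 also have "... = (\<Sum>y\<in>S. \<integral>\<^sup>+om. h om * trans (X s om) y s t om \<partial>Q)"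
  unfolding nn_integral_sum[OF m1] by (intro sum.cong refl weight_identity_fun[OF st _ h])
 also have "... = (\<integral>\<^sup>+om. (\<Sum>y\<in>S. h om * trans (X s om) y s t om) \<partial>Q)"
  by (rule nn_integral_sum[OF m2, symmetric])
 finally show ?thesis by (simp only: sum_distrib_left)
qed

lemma weight_le_1:
 assumes st: "0 <= s" "s <= t" "t <= T"
 shows "(\<integral>\<^sup>+om. weight s t om \<partial>Q) <= 1"
proof -
 have "(\<integral>\<^sup>+om. weight s t om \<partial>Q) = (\<integral>\<^sup>+om. (\<Sum>y\<in>S. trans (X s om) y s t om) \<partial>Q)"
  using weight_total[OF st, of "%_. 1"] by simp
 also have "... <= (\<integral>\<^sup>+om. 1 \<partial>Q)" using trans_sum_le_1[OF _ st(2)] by (intro nn_integral_mono) auto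
 finally show ?thesis by (simp add: emeasure_space_1)
qed

lemma exit_integral_split:
 assumes om: "om \<in> space Q" and r: "0 <= r" "r <= s" "s <= t" "t <= T"
 shows "(LINT u:{r<..<t}|lborel. exit_rate (X u om)) =
  (LINT u:{r<..<s}|lborel. exit_rate (X u om)) + (LINT u:{s<..<t}|lborel. exit_rate (X u om))"
proof -
 let ?e = "%u. exit_rate (X u om)"
 have meas: "(%u. ?e u * indicator {p<..<q} u) \<in> borel_measurable borel" if "0 <= p" "q <= T" for p q
 proof (cases "p < q")
  case True
  then show ?thesis by (intro measurable_path_comp[OF X_step[OF om] that(1) True that(2) finite_atLeastAtMost]) (rule X_S[OF _ _ om])
 qed simp
 have int: "integrable lborel (%u. ?e u * indicator {p<..<q} u)" if "0 <= p" "q <= T" for p q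
 proof (rule Bochner_Integration.integrable_bound[where f="%u. a_total * indicator {p<..<q} u"])
  show "integrable lborel (%u. a_total * indicator {p<..<q} u)"
   by (cases "p <= q") (auto intro!: integrable_mult_right integrable_real_indicator)
  have "norm (?e u * indicator {p<..<q} u) <= norm (a_total * indicator {p<..<q} u)" for u
   using exit_rate_bounds[OF X_S[OF _ _ om], of u] that by (auto simp: indicator_def)
  then show "AE u in lborel. norm (?e u * indicator {p<..<q} u) <= norm (a_total * indicator {p<..<q} u)" by simp
 qed (use meas[OF that] in simp)
 have "(\<integral>u. ?e u * indicator {r<..<t} u \<partial>lborel) = (\<integral>u. ?e u * indicator {r<..<s} u + ?e u * indicator {s<..<t} u \<partial>lborel)"
 proof (rule integral_cong_AE)
  show "AE u in lborel. ?e u * indicator {r<..<t} u = ?e u * indicator {r<..<s} u + ?e u * indicator {s<..<t} u"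
   using AE_lborel_singleton[of s] by eventually_elim (use r in \<open>auto simp: indicator_def\<close>)
 qed (use meas[of r t] meas[of r s] meas[of s t] r in auto)
 also have "... = (\<integral>u. ?e u * indicator {r<..<s} u \<partial>lborel) + (\<integral>u. ?e u * indicator {s<..<t} u \<partial>lborel)"
  using r by (intro Bochner_Integration.integral_add int) auto
 finally show ?thesis by (simp add: set_lebesgue_integral_def mult.commute)
qed

lemma kil_path_integral_split:
 assumes om: "om \<in> space Q" and r: "0 <= r" "r <= s" "s <= t" "t <= T"
 shows "(\<integral>\<^sup>+u\<in>{r<..<t}. kil (X u om) u om \<partial>lborel) =
  (\<integral>\<^sup>+u\<in>{r<..<s}. kil (X u om) u om \<partial>lborel) + (\<integral>\<^sup>+u\<in>{s<..<t}. kil (X u om) u om \<partial>lborel)"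
proof -
 have meas: "(%u. kil (X u om) u om * indicator {p<..<q} u) \<in> borel_measurable borel" if "0 <= p" "q <= T" for p q
 proof (cases "p < q")
  case True
  show ?thesis by (rule measurable_path_rate[where k="%x u. kil x u om", OF X_step[OF om] that(1) True that(2) finite_atLeastAtMost])
    (assumption | rule X_S[OF _ _ om] kil_path_meas[OF om])+
 qed simp
 have "(\<integral>\<^sup>+u\<in>{r<..<t}. kil (X u om) u om \<partial>lborel) =
   (\<integral>\<^sup>+u. kil (X u om) u om * indicator {r<..<s} u + kil (X u om) u om * indicator {s<..<t} u \<partial>lborel)"
 proof (rule nn_integral_cong_AE)
  show "AE u in lborel. kil (X u om) u om * indicator {r<..<t} u = kil (X u om) u om * indicator {r<..<s} u + kil (X u om) u om * indicator {s<..<t} u"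
   using AE_lborel_singleton[of s] by eventually_elim (use r in \<open>auto simp: indicator_def\<close>)
 qed
 also have "... = (\<integral>\<^sup>+u\<in>{r<..<s}. kil (X u om) u om \<partial>lborel) + (\<integral>\<^sup>+u\<in>{s<..<t}. kil (X u om) u om \<partial>lborel)"
  using meas[of r s] meas[of s t] r by (intro nn_integral_add) auto
 finally show ?thesis .
qed

lemma weight_mult:
 assumes om: "om \<in> space Q" and r: "0 <= r" "r <= s" "s <= t" "t <= T"
 shows "weight r t om = weight r s om * weight s t om"
proof -
 let ?c = "%u. X u om"
 have J: "jump_times ?c r t = jump_times ?c r s \<union> jump_times ?c s t" "jump_times ?c r s \<inter> jump_times ?c s t = {}"
  using r by (auto simp: jump_times_def)
 have fin: "finite (jump_times ?c r s)" "finite (jump_times ?c s t)"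
  using finite_jump_times[OF X_step[OF om]] r by auto
 show ?thesis
  unfolding weight_def path_weight_def exit_integral_split[OF om r] kil_path_integral_split[OF om r] J(1)
   prod.union_disjoint[OF fin J(2)] neg_exp_add exp_add ennreal_mult[OF exp_ge_zero exp_ge_zero]
  by (simp only: mult_ac)
qed

text \<open>If the total mass at time \<open>T\<close> is \<open>1\<close>, then no mass is lost after time \<open>t\<close> on the event that the
 weight up to \<open>t\<close> is positive.\<close>
lemma weight_full_mass:
 assumes full: "(\<integral>\<^sup>+om. weight 0 T om \<partial>Q) = 1" and t: "0 <= t" "t <= T"
 shows "AE om in Q. weight 0 t om * (\<Sum>y\<in>S. trans (X t om) y t T om) = weight 0 t om"
proof (rule AE_eq_of_nn_integral_eq)
 have w: "weight 0 t \<in> borel_measurable (Gh t)" using t by (intro weight_meas) auto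
 show "weight 0 t \<in> borel_measurable Q" by (rule measurable_Gh_Q[OF t w])
 then show "(%om. weight 0 t om * (\<Sum>y\<in>S. trans (X t om) y t T om)) \<in> borel_measurable Q"
 proof (rule borel_measurable_times_ennreal)
  show "(%om. \<Sum>y\<in>S. trans (X t om) y t T om) \<in> borel_measurable Q"
   using t T_pos by (intro borel_measurable_sum measurable_Gh_Q[OF t] trans_X_meas) auto
 qed
 show "AE om in Q. weight 0 t om * (\<Sum>y\<in>S. trans (X t om) y t T om) <= weight 0 t om"
 proof (rule AE_I2)
  fix om assume "om \<in> space Q"
  then show "weight 0 t om * (\<Sum>y\<in>S. trans (X t om) y t T om) <= weight 0 t om"
   using mult_left_mono[OF trans_sum_le_1[OF _ t(2)], of om "weight 0 t om" "X t om"] by simp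
 qed
 have "(\<integral>\<^sup>+om. weight 0 t om * (\<Sum>y\<in>S. trans (X t om) y t T om) \<partial>Q) = (\<integral>\<^sup>+om. weight 0 t om * weight t T om \<partial>Q)"
  by (rule weight_total[OF t order_refl w, symmetric])
 also have "... = (\<integral>\<^sup>+om. weight 0 T om \<partial>Q)"
  using t by (intro nn_integral_cong weight_mult[symmetric]) auto
 finally have 1: "(\<integral>\<^sup>+om. weight 0 t om * (\<Sum>y\<in>S. trans (X t om) y t T om) \<partial>Q) = 1" using full by simp
 then show "(\<integral>\<^sup>+om. weight 0 t om * (\<Sum>y\<in>S. trans (X t om) y t T om) \<partial>Q) < \<top>" by simp
 show "(\<integral>\<^sup>+om. weight 0 t om \<partial>Q) <= (\<integral>\<^sup>+om. weight 0 t om * (\<Sum>y\<in>S. trans (X t om) y t T om) \<partial>Q)"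
  unfolding 1 using t by (intro weight_le_1) auto
qed

text \<open>Conservation of mass makes \<open>weight 0 t\<close> the projection of the density to the
  past.\<close>
lemma weight_martingale:
 assumes full: "(\<integral>\<^sup>+om. weight 0 T om \<partial>Q) = 1" and t: "0 <= t" "t <= T" and h: "h \<in> borel_measurable (Gh t)"
 shows "(\<integral>\<^sup>+om. h om * weight 0 T om \<partial>Q) = (\<integral>\<^sup>+om. h om * weight 0 t om \<partial>Q)"
proof -
 have w: "weight 0 t \<in> borel_measurable (Gh t)" using t by (intro weight_meas) auto
 have "(\<integral>\<^sup>+om. h om * weight 0 T om \<partial>Q) = (\<integral>\<^sup>+om. (h om * weight 0 t om) * weight t T om \<partial>Q)"
  using t by (intro nn_integral_cong) (simp add: weight_mult[of _ 0 t T] mult.assoc)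
 also have "... = (\<integral>\<^sup>+om. (h om * weight 0 t om) * (\<Sum>y\<in>S. trans (X t om) y t T om) \<partial>Q)"
  by (rule weight_total[OF t order_refl borel_measurable_times_ennreal[OF h w]])
 also have "... = (\<integral>\<^sup>+om. h om * weight 0 t om \<partial>Q)"
  using weight_full_mass[OF full t] by (intro nn_integral_cong_AE) (auto simp: mult.assoc)
 finally show ?thesis .
qed

end

section \<open>The density as a path weight\<close>

text \<open>If \<open>p\<close> is not integrable, both sides are zero. The exceptional set has to be
  countable, not only null, because \<open>f\<close> must be Borel.\<close>
lemma exp_neg_integral_split:
 fixes p q f :: "real => real"
 assumes [measurable]: "p \<in> borel_measurable borel" and p: "\<And>u. 0 <= p u" and q: "integrable lborel q"
  and X: "countable X" and eq: "\<And>u. u \<notin> X ==> indicator {0..T} u * f u = p u - q u"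
 shows "ennreal (exp_neg_integral T f) = ennreal (exp (\<integral>u. q u \<partial>lborel)) * neg_exp (\<integral>\<^sup>+u. ennreal (p u) \<partial>lborel)"
proof -
 have 1: "set_integrable lborel {0..T} f \<longleftrightarrow> integrable lborel (%u. p u - q u)"
  unfolding set_integrable_def by (rule integrable_discrete_difference[OF X]) (use eq in auto)
 have 2: "(LINT u:{0..T}|lborel. f u) = (\<integral>u. p u - q u \<partial>lborel)"
  unfolding set_lebesgue_integral_def by (rule integral_discrete_difference[OF X]) (use eq in auto)
 have 3: "integrable lborel (%u. p u - q u) \<longleftrightarrow> integrable lborel p"
 proof
  assume "integrable lborel (%u. p u - q u)"
  from Bochner_Integration.integrable_add[OF this q] show "integrable lborel p" by simp
 qed (use q in auto)
 show ?thesis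
 proof (cases "integrable lborel p")
  case True
  have "exp_neg_integral T f = exp (- (\<integral>u. p u - q u \<partial>lborel))"
   using True by (simp add: exp_neg_integral_def 1 2 3)
  also have "(\<integral>u. p u - q u \<partial>lborel) = (\<integral>u. p u \<partial>lborel) - (\<integral>u. q u \<partial>lborel)"
   by (rule Bochner_Integration.integral_diff[OF True q])
  finally have "exp_neg_integral T f = exp (\<integral>u. q u \<partial>lborel) * exp (- (\<integral>u. p u \<partial>lborel))"
   by (simp add: exp_add[symmetric])
  moreover have "(\<integral>\<^sup>+u. ennreal (p u) \<partial>lborel) = ennreal (\<integral>u. p u \<partial>lborel)"
   using p by (intro nn_integral_eq_integral True) auto
  moreover have "0 <= (\<integral>u. p u \<partial>lborel)" using p by simp
  ultimately show ?thesis by (simp add: neg_exp_ennreal ennreal_mult)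
 next
  case False
  then have "\<not> (\<integral>\<^sup>+u. ennreal (norm (p u)) \<partial>lborel) < \<infinity>" by (simp add: integrable_iff_bounded)
  then have "(\<integral>\<^sup>+u. ennreal (p u) \<partial>lborel) = \<top>" using p by (simp add: not_less top_unique)
  then show ?thesis using False by (simp add: exp_neg_integral_def 1 3)
 qed
qed

context driven_chain_rates
begin

lemma left_val_S:
 assumes om: "om \<in> space Q" and u: "0 < u" "u <= T"
 shows "left_val (%r. X r om) u \<in> S"
proof -
 have "eventually (%r. X r om = left_val (%r. X r om) u) (at_left u)"
  by (rule step_path_left[OF X_step[OF om] u])
 moreover have "eventually (%r. r \<in> {0<..<u}) (at_left u)" by (rule eventually_at_left_real[OF u(1)])
 ultimately have "eventually (%r. left_val (%r. X r om) u \<in> S) (at_left u)"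
 proof eventually_elim
  case (elim r)
  then show ?case using X_S[OF _ _ om, of r] u by auto
 qed
 then show ?thesis by simp
qed

lemma state_ind_left:
 assumes om: "om \<in> space Q" and u: "0 < u" "u <= T"
 shows "left_lim (%s. state_ind X x s om) u = indicator {x} (left_val (%r. X r om) u)"
  and "jump (%s. state_ind X x s om) u = indicator {x} (X u om) - indicator {x} (left_val (%r. X r om) u)"
proof -
 have st: "step_path T (%s. state_ind X x s om)"
  unfolding state_ind_def by (rule step_path_comp[OF X_step[OF om]])
 have lv: "left_val (%s. state_ind X x s om) u = indicator {x} (left_val (%r. X r om) u)"
  unfolding state_ind_def by (rule left_val_comp[OF X_step[OF om] u])
 show "left_lim (%s. state_ind X x s om) u = indicator {x} (left_val (%r. X r om) u)"
  using u Lim_at_left_step[OF st u] lv by (simp add: left_lim_def)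
 show "jump (%s. state_ind X x s om) u = indicator {x} (X u om) - indicator {x} (left_val (%r. X r om) u)"
  using jump_step[OF st u] lv by (simp add: state_ind_def)
qed

definition pair_jumps :: "nat => nat => 'a => real set" where
 "pair_jumps x y om = {u\<in>jump_times (%r. X r om) 0 T. left_val (%r. X r om) u = x \<and> X u om = y}"

lemma finite_pair_jumps: "om \<in> space Q ==> finite (pair_jumps x y om)"
 unfolding pair_jumps_def using finite_jump_times[OF X_step, of om 0 T] by simp

text \<open>The process of transitions from \<open>x\<close> to \<open>y\<close> counts the jumps of that kind.\<close>
lemma transitions_eq:
 assumes om: "om \<in> space Q" and xy: "x ~= y" and t: "0 <= t" "t <= T"
 shows "transitions X x y t om = (\<Sum>v\<in>pair_jumps x y om. of_bool (v <= t))"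
proof -
 let ?lv = "left_val (%r. X r om)"
 let ?h = "%u. left_lim (%s. state_ind X x s om) u * jump (%s. state_ind X y s om) u"
 have h: "?h u = of_bool (u \<in> pair_jumps x y om)" if "0 < u" "u <= T" for u
  using that xy by (auto simp: state_ind_left[OF om that] pair_jumps_def jump_times_def indicator_def)
 let ?J = "{u\<in>{0<..t}. jump (%s. state_ind X y s om) u ~= 0}"
 have fin: "finite ?J"
 proof (rule finite_subset)
  show "?J \<subseteq> jump_times (%r. X r om) 0 T"
   using t state_ind_left(2)[OF om] by (auto simp: jump_times_def)
  show "finite (jump_times (%r. X r om) 0 T)" by (rule finite_jump_times[OF X_step[OF om]]) auto
 qed
 have "transitions X x y t om = (\<Sum>u\<in>?J. of_bool (u \<in> pair_jumps x y om))"
  unfolding transitions_def jump_integral_def using t by (intro sum.cong refl h) auto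
 also have "... = (\<Sum>u\<in>?J \<inter> pair_jumps x y om. 1)"
  by (simp only: of_bool_def sum.inter_restrict[OF fin])
 also have "?J \<inter> pair_jumps x y om = {v\<in>pair_jumps x y om. v <= t}"
  using t xy state_ind_left(2)[OF om] by (auto simp: pair_jumps_def jump_times_def)
 also have "(\<Sum>u\<in>{v\<in>pair_jumps x y om. v <= t}. 1) = (\<Sum>v\<in>pair_jumps x y om. of_bool (v <= t) :: real)"
  by (simp only: of_bool_def sum.inter_filter[OF finite_pair_jumps[OF om]])
 finally show ?thesis .
qed

text \<open>Hence the jumps of the counting process are of size one, and its jump factors in the density are
  the relative rates.\<close>
lemma jump_transitions:
 assumes om: "om \<in> space Q" and xy: "x ~= y" and u: "0 < u" "u <= T"
 shows "jump (%s. transitions X x y s om) u = of_bool (u \<in> pair_jumps x y om)"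
proof -
 let ?P = "pair_jumps x y om"
 have "eventually (%r. (v <= r) = (v < u)) (at_left u)" for v
 proof (cases "v < u")
  case True
  from eventually_at_left_real[OF this] show ?thesis by eventually_elim (use True in auto)
 next
  case False
  from eventually_at_left_real[OF u(1)] show ?thesis by eventually_elim (use False in auto)
 qed
 then have "eventually (%r. \<forall>v\<in>?P. (v <= r) = (v < u)) (at_left u)"
  using finite_pair_jumps[OF om] by (intro eventually_ball_finite) auto
 with eventually_at_left_real[OF u(1)]
 have "eventually (%r. transitions X x y r om = (\<Sum>v\<in>?P. of_bool (v < u))) (at_left u)"
 proof eventually_elim
  case (elim r)
  then have "transitions X x y r om = (\<Sum>v\<in>?P. of_bool (v <= r))"
   using u by (intro transitions_eq[OF om xy]) auto
  also have "... = (\<Sum>v\<in>?P. of_bool (v < u))" using elim by (intro sum.cong refl) auto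
  finally show ?case .
 qed
 then have "left_lim (%s. transitions X x y s om) u = (\<Sum>v\<in>?P. of_bool (v < u))"
  using u unfolding left_lim_def by (auto intro!: tendsto_Lim tendsto_eventually)
 then have "jump (%s. transitions X x y s om) u = (\<Sum>v\<in>?P. of_bool (v <= u)) - (\<Sum>v\<in>?P. of_bool (v < u))"
  using transitions_eq[OF om xy, of u] u by (simp add: jump_def)
 also have "... = (\<Sum>v\<in>?P. if u = v then 1 else 0)"
  unfolding sum_subtractf[symmetric] by (intro sum.cong refl) auto
 also have "... = of_bool (u \<in> ?P)" using finite_pair_jumps[OF om] by (subst sum.delta') auto
 finally show ?thesis .
qed

lemma sum_pairs:
 fixes g :: "nat => nat => 'c::comm_monoid_add"
 assumes "v \<in> S"
 shows "(\<Sum>p\<in>I. if fst p = v then g v (snd p) else 0) = (\<Sum>z\<in>S - {v}. g v z)"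
proof -
 have "(\<Sum>p\<in>I. if fst p = v then g v (snd p) else 0) = (\<Sum>p\<in>{p\<in>I. fst p = v}. g v (snd p))"
  by (rule sum.inter_filter[symmetric]) simp
 also have "{p\<in>I. fst p = v} = Pair v ` (S - {v})"
  using assms by (auto simp: state_pairs_def)
 also have "(\<Sum>p\<in>Pair v ` (S - {v}). g v (snd p)) = (\<Sum>z\<in>S - {v}. g v z)"
  by (subst sum.reindex) (auto simp: inj_on_def)
 finally show ?thesis .
qed

lemma lam_left_eq_lim: "(x, z) \<in> I ==> lam_left x z u om = left_lim (%s. \<Lambda> x z s om) u"
 by (simp add: lam_left_def)

text \<open>Changing a Borel function at countably many times affects neither its measurability nor its
 integral, so the left limits in the density may be replaced by the processes themselves.\<close>
lemma theta_eq_weight: "AE om in Q. 0 <= theta T d a \<Lambda> X om \<and> ennreal (theta T d a \<Lambda> X om) = weight 0 T om"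
 using lam_left_limits_AE AE_space
proof eventually_elim
 case (elim om)
 note om = elim(2)
 let ?c = "%r. X r om"
 let ?J = "jump_times ?c 0 T"
 have fJ: "finite ?J" by (rule finite_jump_times[OF X_step[OF om]]) auto
 have ll0: "0 <= lam_left x z u om" if "0 < u" "u <= T" for x z u
  using elim(1) that by (intro tendsto_lowerbound[of "%r. lam x z r om" _ "at_left u"]) auto
 let ?E = "%p. exp_neg_integral T (%u. left_lim (%s. state_ind X (fst p) s om) u * ap p * kappa a \<Lambda> (fst p) (snd p) u om)"
 let ?R = "%p. \<Prod>u\<in>{u\<in>{0<..T}. jump (%s. transitions X (fst p) (snd p) s om) u ~= 0}.
   1 + kappa a \<Lambda> (fst p) (snd p) u om * jump (%s. transitions X (fst p) (snd p) s om) u"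
 have theta: "theta T d a \<Lambda> X om = (\<Prod>p\<in>I. ?E p * ?R p)"
  by (simp add: theta_def split_beta)
 have E0: "0 <= ?E p" for p by (simp add: exp_neg_integral_def)
 have R: "?R p = (\<Prod>u\<in>pair_jumps (fst p) (snd p) om. lam_left (fst p) (snd p) u om / ap p)" if p: "p \<in> I" for p
 proof -
  have ne: "fst p ~= snd p" using p by (auto simp: state_pairs_def)
  have set: "{u\<in>{0<..T}. jump (%s. transitions X (fst p) (snd p) s om) u ~= 0} = pair_jumps (fst p) (snd p) om"
   using jump_transitions[OF om ne] by (auto simp: pair_jumps_def jump_times_def)
  have "1 + kappa a \<Lambda> (fst p) (snd p) u om * jump (%s. transitions X (fst p) (snd p) s om) u = lam_left (fst p) (snd p) u om / ap p"
   if u: "u \<in> pair_jumps (fst p) (snd p) om" for u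
  proof -
   have "0 < u" "u <= T" using u by (auto simp: pair_jumps_def jump_times_def)
   then show ?thesis using jump_transitions[OF om ne] u p lam_left_eq_lim[of "fst p" "snd p" u om] by (simp add: kappa_def)
  qed
  then show ?thesis unfolding set by (intro prod.cong refl)
 qed
 have R0: "0 <= ?R p" if p: "p \<in> I" for p
  unfolding R[OF p] using ap_nonneg[OF p] ll0
  by (intro prod_nonneg divide_nonneg_nonneg) (auto simp: pair_jumps_def jump_times_def)
 define rq where "rq u = ennreal (lam_left (left_val ?c u) (X u om) u om / a (left_val ?c u) (X u om))" for u
 have RR: "(\<Prod>p\<in>I. ennreal (?R p)) = (\<Prod>u\<in>?J. rq u)"
 proof -
  have "(\<Prod>p\<in>I. ennreal (?R p)) = (\<Prod>p\<in>I. \<Prod>u\<in>{u\<in>?J. (left_val ?c u, X u om) = p}. rq u)"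
  proof (intro prod.cong refl)
   fix p assume p: "p \<in> I"
   have "ennreal (?R p) = (\<Prod>u\<in>pair_jumps (fst p) (snd p) om. ennreal (lam_left (fst p) (snd p) u om / ap p))"
    unfolding R[OF p] using ap_nonneg[OF p] ll0
    by (intro prod_ennreal[symmetric] divide_nonneg_nonneg) (auto simp: pair_jumps_def jump_times_def)
   also have "... = (\<Prod>u\<in>{u\<in>?J. (left_val ?c u, X u om) = p}. rq u)"
    by (rule prod.cong) (auto simp: pair_jumps_def rq_def)
   finally show "ennreal (?R p) = (\<Prod>u\<in>{u\<in>?J. (left_val ?c u, X u om) = p}. rq u)" .
  qed
  also have "... = (\<Prod>u\<in>?J. rq u)"
  proof (rule prod.group[OF fJ finite_I])
   show "(%u. (left_val ?c u, X u om)) ` ?J \<subseteq> I"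
   proof (rule image_subsetI)
    fix u assume "u \<in> ?J"
    then have "0 < u" "u <= T" "X u om ~= left_val ?c u" by (auto simp: jump_times_def)
    then show "(left_val ?c u, X u om) \<in> I"
     using left_val_S[OF om, of u] X_S[OF _ _ om, of u] by (auto simp: state_pairs_def)
   qed
  qed
  finally show ?thesis .
 qed
 define pp where "pp p u = indicator {fst p} (X u om) * lam (fst p) (snd p) u om * indicator {0<..<T} u" for p u
 define qq where "qq p u = indicator {fst p} (X u om) * ap p * indicator {0<..<T} u" for p u
 have pm: "pp p \<in> borel_measurable borel" for p
 proof -
  have "(%u. indicator {fst p} (X u om) * indicator {0<..<T} u :: real) \<in> borel_measurable borel"
   by (rule measurable_path_comp[OF X_step[OF om] order_refl T_pos order_refl finite_atLeastAtMost]) (rule X_S[OF _ _ om])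
  from borel_measurable_times[OF this lam_path_meas[OF om, of "fst p" "snd p"]]
  show ?thesis by (simp add: pp_def[abs_def] mult_ac)
 qed
 have qi: "integrable lborel (qq p)" for p
 proof (rule Bochner_Integration.integrable_bound[where f="%u. \<bar>ap p\<bar> * indicator {0<..<T} u"])
  show "integrable lborel (%u. \<bar>ap p\<bar> * indicator {0<..<T} u)"
   using T_pos by (intro integrable_mult_right integrable_real_indicator) auto
  have "(%u. (indicator {fst p} (X u om) * ap p) * indicator {0<..<T} u :: real) \<in> borel_measurable borel"
   by (rule measurable_path_comp[OF X_step[OF om] order_refl T_pos order_refl finite_atLeastAtMost]) (rule X_S[OF _ _ om])
  then show "qq p \<in> borel_measurable lborel" by (simp add: qq_def[abs_def])
  show "AE u in lborel. norm (qq p u) <= norm (\<bar>ap p\<bar> * indicator {0<..<T} u)"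
   by (auto simp: qq_def indicator_def)
 qed
 have EE: "ennreal (?E p) = ennreal (exp (\<integral>u. qq p u \<partial>lborel)) * neg_exp (\<integral>\<^sup>+u. ennreal (pp p u) \<partial>lborel)" if p: "p \<in> I" for p
 proof (rule exp_neg_integral_split[OF pm _ qi])
  let ?X = "?J \<union> {u\<in>{0<..T}. lam (fst p) (snd p) u om ~= lam_left (fst p) (snd p) u om} \<union> {0, T}"
  show "countable ?X" using elim(1) fJ by (auto intro: countable_finite)
  show "0 <= pp p u" for u by (simp add: pp_def)
  fix u assume u: "u \<notin> ?X"
  show "indicator {0..T} u * (left_lim (%s. state_ind X (fst p) s om) u * ap p * kappa a \<Lambda> (fst p) (snd p) u om) = pp p u - qq p u"
  proof (cases "0 < u \<and> u < T")
   case True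
   have lv: "left_val ?c u = X u om" and ll: "lam (fst p) (snd p) u om = lam_left (fst p) (snd p) u om"
    using u True by (auto simp: jump_times_def)
   have "ap p * kappa a \<Lambda> (fst p) (snd p) u om = lam (fst p) (snd p) u om - ap p"
    using ap_pos[OF p] p lam_left_eq_lim[of "fst p" "snd p" u om] unfolding ll by (simp add: kappa_def field_simps)
   then show ?thesis
    using True state_ind_left(1)[OF om, of u "fst p"] lv by (simp add: pp_def qq_def indicator_def)
  next
   case False
   then have "u \<notin> {0..T}" using u by auto
   then show ?thesis using False by (auto simp: pp_def qq_def indicator_def)
  qed
 qed
 have q_sum: "(\<Sum>p\<in>I. \<integral>u. qq p u \<partial>lborel) = (LINT u:{0<..<T}|lborel. exit_rate (X u om))"
 proof -
  have "(\<Sum>p\<in>I. \<integral>u. qq p u \<partial>lborel) = (\<integral>u. (\<Sum>p\<in>I. qq p u) \<partial>lborel)"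
   by (rule Bochner_Integration.integral_sum[symmetric]) (rule qi)
  also have "... = (\<integral>u. indicator {0<..<T} u * exit_rate (X u om) \<partial>lborel)"
  proof (intro Bochner_Integration.integral_cong refl)
   fix u
   show "(\<Sum>p\<in>I. qq p u) = indicator {0<..<T} u * exit_rate (X u om)"
   proof (cases "u \<in> {0<..<T}")
    case True
    then have "(\<Sum>p\<in>I. qq p u) = (\<Sum>p\<in>I. if fst p = X u om then a (X u om) (snd p) else 0)"
     by (intro sum.cong refl) (auto simp: qq_def indicator_def)
    also have "... = exit_rate (X u om)"
     using True X_S[OF _ _ om, of u] unfolding exit_rate_def by (intro sum_pairs) auto
    finally show ?thesis using True by simp
   qed (simp add: qq_def)
  qed
  finally show ?thesis by (simp add: set_lebesgue_integral_def)
 qed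
 have p_sum: "(\<Sum>p\<in>I. \<integral>\<^sup>+u. ennreal (pp p u) \<partial>lborel) = (\<integral>\<^sup>+u\<in>{0<..<T}. kil (X u om) u om \<partial>lborel)"
 proof -
  have "(\<Sum>p\<in>I. \<integral>\<^sup>+u. ennreal (pp p u) \<partial>lborel) = (\<integral>\<^sup>+u. (\<Sum>p\<in>I. ennreal (pp p u)) \<partial>lborel)"
   by (rule nn_integral_sum[symmetric]) (use pm in auto)
  also have "... = (\<integral>\<^sup>+u\<in>{0<..<T}. kil (X u om) u om \<partial>lborel)"
  proof (intro nn_integral_cong)
   fix u
   show "(\<Sum>p\<in>I. ennreal (pp p u)) = kil (X u om) u om * indicator {0<..<T} u"
   proof (cases "u \<in> {0<..<T}")
    case True
    then have "(\<Sum>p\<in>I. ennreal (pp p u)) = (\<Sum>p\<in>I. if fst p = X u om then ennreal (lam (X u om) (snd p) u om) else 0)"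
     by (intro sum.cong refl) (auto simp: pp_def indicator_def)
    also have "... = kil (X u om) u om"
     using True X_S[OF _ _ om, of u] unfolding kil_def by (intro sum_pairs) auto
    finally show ?thesis using True by simp
   qed (simp add: pp_def)
  qed
  finally show ?thesis .
 qed
 have "ennreal (theta T d a \<Lambda> X om) = (\<Prod>p\<in>I. ennreal (?E p * ?R p))"
  unfolding theta using E0 R0 by (intro prod_ennreal[symmetric] mult_nonneg_nonneg)
 also have "... = (\<Prod>p\<in>I. ennreal (?E p)) * (\<Prod>p\<in>I. ennreal (?R p))"
  unfolding prod.distrib[symmetric] using E0 R0 by (intro prod.cong refl ennreal_mult)
 also have "(\<Prod>p\<in>I. ennreal (?E p)) = (\<Prod>p\<in>I. ennreal (exp (\<integral>u. qq p u \<partial>lborel))) * (\<Prod>p\<in>I. neg_exp (\<integral>\<^sup>+u. ennreal (pp p u) \<partial>lborel))"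
  unfolding prod.distrib[symmetric] by (intro prod.cong refl EE)
 also have "(\<Prod>p\<in>I. ennreal (exp (\<integral>u. qq p u \<partial>lborel))) = ennreal (exp (LINT u:{0<..<T}|lborel. exit_rate (X u om)))"
  unfolding q_sum[symmetric] exp_sum[OF finite_I] by (rule prod_ennreal) simp
 also have "(\<Prod>p\<in>I. neg_exp (\<integral>\<^sup>+u. ennreal (pp p u) \<partial>lborel)) = neg_exp (\<integral>\<^sup>+u\<in>{0<..<T}. kil (X u om) u om \<partial>lborel)"
  unfolding p_sum[symmetric] neg_exp_sum ..
 finally have "ennreal (theta T d a \<Lambda> X om) = weight 0 T om"
  unfolding RR by (simp add: weight_def path_weight_def rq_def)
 moreover have "0 <= theta T d a \<Lambda> X om"
  unfolding theta
 proof (rule prod_nonneg)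
  fix p assume "p \<in> I"
  then show "0 <= ?E p * ?R p" by (rule mult_nonneg_nonneg[OF E0 R0])
 qed
 ultimately show ?case by simp
qed

lemma theta_meas: "theta T d a \<Lambda> X \<in> borel_measurable (Gh T)"
proof (rule measurable_AE_version[where u="%om. enn2real (weight 0 T om)"])
 show "space (Gh T) = space Q" "null_sets Q \<subseteq> sets (Gh T)" using Gh_null[of T] T_pos by auto
 show "(%om. enn2real (weight 0 T om)) \<in> borel_measurable (Gh T)"
  using T_pos by (intro borel_measurable_enn2real weight_meas) auto
 show "AE om in Q. theta T d a \<Lambda> X om = enn2real (weight 0 T om)"
  using theta_eq_weight by eventually_elim (metis enn2real_ennreal)
qed simp

lemma weight_full:
 assumes "(\<integral>om. theta T d a \<Lambda> X om \<partial>Q) = 1"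
 shows "(\<integral>\<^sup>+om. weight 0 T om \<partial>Q) = 1"
proof -
 have "integrable Q (theta T d a \<Lambda> X)" using assms not_integrable_integral_eq by fastforce
 then have "(\<integral>\<^sup>+om. ennreal (theta T d a \<Lambda> X om) \<partial>Q) = ennreal 1"
  using theta_eq_weight assms by (subst nn_integral_eq_integral) (auto elim: eventually_mono)
 moreover have "(\<integral>\<^sup>+om. ennreal (theta T d a \<Lambda> X om) \<partial>Q) = (\<integral>\<^sup>+om. weight 0 T om \<partial>Q)"
  using theta_eq_weight by (intro nn_integral_cong_AE) (auto elim: eventually_mono)
 ultimately show ?thesis by simp
qed

end

section \<open>The doubly stochastic Markov property\<close>

lemma nn_integral_set_eq_integral:
 fixes f :: "'b => real"
 assumes f: "integrable M f" "AE x in M. 0 <= f x" and A: "A \<in> sets M"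
 shows "(\<integral>\<^sup>+x. indicator A x * ennreal (f x) \<partial>M) = ennreal (LINT x:A|M. f x)"
proof -
 have "(\<integral>\<^sup>+x. indicator A x * ennreal (f x) \<partial>M) = (\<integral>\<^sup>+x. ennreal (indicator A x * f x) \<partial>M)"
  by (intro nn_integral_cong) (auto simp: indicator_def)
 also have "... = ennreal (\<integral>x. indicator A x * f x \<partial>M)"
  using f(2) integrable_mult_indicator[OF A f(1)]
  by (intro nn_integral_eq_integral) (auto elim: eventually_mono)
 finally show ?thesis by (simp add: set_lebesgue_integral_def)
qed

lemma real_cond_exp_nn_intg:
 fixes f :: "'b => real"
 assumes M: "finite_measure M" and F: "subalgebra M F" and f: "integrable M f" "AE x in M. 0 <= f x"
  and h: "h \<in> borel_measurable F"
 shows "(\<integral>\<^sup>+x. h x * ennreal (real_cond_exp M F f x) \<partial>M) = (\<integral>\<^sup>+x. h x * ennreal (f x) \<partial>M)"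
proof -
 interpret M: finite_measure M by (rule M)
 interpret finite_measure_subalgebra M F by standard (rule F)
 have r: "integrable M (real_cond_exp M F f)" "AE x in M. 0 <= real_cond_exp M F f x"
  using real_cond_exp_int(1)[OF f(1)] real_cond_exp_pos[OF f(2)] f(1) by auto
 show ?thesis
 proof (rule nn_integral_eq_on_subalgebra[OF F _ _ _ h])
  fix A assume A: "A \<in> sets F"
  then have AM: "A \<in> sets M" using F by (auto simp: subalgebra_def)
  show "(\<integral>\<^sup>+x. indicator A x * ennreal (real_cond_exp M F f x) \<partial>M) = (\<integral>\<^sup>+x. indicator A x * ennreal (f x) \<partial>M)"
   unfolding nn_integral_set_eq_integral[OF r AM] nn_integral_set_eq_integral[OF f AM] real_cond_exp_intA[OF f(1) A] ..
 qed (use f(1) r(1) in auto)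
qed

text \<open>The defining property in terms of nonnegative integrals, the form in which the identities for
  the weights are available.\<close>
lemma real_cond_exp_eqI:
 fixes f g :: "'b => real"
 assumes M: "finite_measure M" and F: "subalgebra M F" and f: "integrable M f" "\<And>x. 0 <= f x"
  and g: "g \<in> borel_measurable F" "\<And>x. 0 <= g x"
  and eq: "\<And>A. A \<in> sets F ==> (\<integral>\<^sup>+x. indicator A x * ennreal (f x) \<partial>M) = (\<integral>\<^sup>+x. indicator A x * ennreal (g x) \<partial>M)"
 shows "AE x in M. real_cond_exp M F f x = g x"
proof -
 interpret M: finite_measure M by (rule M)
 interpret finite_measure_subalgebra M F by standard (rule F)
 have gM: "g \<in> borel_measurable M" using F g(1) by (rule measurable_from_subalg)
 have sp: "space F = space M" using F by (auto simp: subalgebra_def)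
 have fi: "(\<integral>\<^sup>+x. ennreal (f x) \<partial>M) < \<infinity>"
  using f by (simp add: nn_integral_eq_integral)
 have "(\<integral>\<^sup>+x. ennreal (g x) \<partial>M) = (\<integral>\<^sup>+x. indicator (space M) x * ennreal (g x) \<partial>M)"
  by (intro nn_integral_cong) simp
 also have "... = (\<integral>\<^sup>+x. indicator (space M) x * ennreal (f x) \<partial>M)"
  using eq[of "space M"] sets.top[of F] by (simp add: sp)
 also have "... = (\<integral>\<^sup>+x. ennreal (f x) \<partial>M)"
  by (intro nn_integral_cong) simp
 finally have gi: "integrable M g"
  using fi gM g(2) by (intro integrableI_bounded) (simp_all add: less_top)
 show ?thesis
 proof (rule real_cond_exp_charact[OF _ f(1) gi g(1)])
  fix A assume A: "A \<in> sets F"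
  then have AM: "A \<in> sets M" using F by (auto simp: subalgebra_def)
  have "ennreal (LINT x:A|M. f x) = ennreal (LINT x:A|M. g x)"
   using eq[OF A] nn_integral_set_eq_integral[OF f(1) AE_I2[OF f(2)] AM] nn_integral_set_eq_integral[OF gi AE_I2[OF g(2)] AM] by simp
  moreover have "0 <= (LINT x:A|M. f x)" "0 <= (LINT x:A|M. g x)"
   using f(2) g(2) by (auto simp: set_lebesgue_integral_def)
  ultimately show "(LINT x:A|M. f x) = (LINT x:A|M. g x)" by simp
 qed
qed

locale driven_chain_density = driven_chain_rates +
 fixes \<mu> :: "nat => 'a => real"
 assumes \<mu>: "\<And>x. x \<in> S ==> \<mu> x \<in> borel_measurable (F 0) \<and> (\<forall>om\<in>space Q. 0 <= \<mu> x om \<and> \<mu> x om <= 1) \<and>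
      (AE om in Q. cond_probability Q (F T) (%om. \<xi> om = x) om = \<mu> x om)"
  and density_1: "(\<integral>om. theta T d a \<Lambda> X om \<partial>Q) = 1"
begin

definition P :: "'a measure" where
 "P = density (restr_to_subalg Q (Gh T)) (%om. ennreal (theta T d a \<Lambda> X om))"

lemma T_range: "0 <= T" "T <= T"
 using T_pos by auto

lemma sets_P: "sets P = sets (Gh T)" and space_P [simp]: "space P = space Q"
 unfolding P_def by (simp_all add: sets_restr_to_subalg[OF Gh_subalg[OF T_range]] space_restr_to_subalg)

lemma measurable_P: "measurable P M = measurable (Gh T) M"
 by (rule measurable_cong_sets) (auto simp: sets_P)

lemma nn_integral_P:
 assumes f: "f \<in> borel_measurable (Gh T)"
 shows "(\<integral>\<^sup>+om. f om \<partial>P) = (\<integral>\<^sup>+om. f om * weight 0 T om \<partial>Q)"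
proof -
 have sub: "subalgebra Q (Gh T)" by (rule Gh_subalg[OF T_range])
 have m: "measurable (restr_to_subalg Q (Gh T)) M = measurable (Gh T) M" for M :: "'c measure"
  by (rule measurable_cong_sets) (simp_all add: sets_restr_to_subalg[OF sub])
 have th: "(%om. ennreal (theta T d a \<Lambda> X om)) \<in> borel_measurable (Gh T)"
  using theta_meas by (rule measurable_compose) simp
 have "(\<integral>\<^sup>+om. f om \<partial>P) = (\<integral>\<^sup>+om. ennreal (theta T d a \<Lambda> X om) * f om \<partial>restr_to_subalg Q (Gh T))"
  unfolding P_def using f th by (intro nn_integral_density) (simp_all add: m)
 also have "... = (\<integral>\<^sup>+om. ennreal (theta T d a \<Lambda> X om) * f om \<partial>Q)"
  using f th by (intro nn_integral_subalgebra2[OF sub] borel_measurable_times_ennreal)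
 also have "... = (\<integral>\<^sup>+om. f om * weight 0 T om \<partial>Q)"
 proof (rule nn_integral_cong_AE)
  show "AE om in Q. ennreal (theta T d a \<Lambda> X om) * f om = f om * weight 0 T om"
   using theta_eq_weight by eventually_elim (simp add: mult.commute)
 qed
 finally show ?thesis .
qed

text \<open>For functionals of the past, the density may be replaced by the weight of the past.\<close>
lemma nn_integral_P_past:
 assumes t: "0 <= t" "t <= T" and f: "f \<in> borel_measurable (Gh t)"
 shows "(\<integral>\<^sup>+om. f om \<partial>P) = (\<integral>\<^sup>+om. f om * weight 0 t om \<partial>Q)"
 using nn_integral_P[OF measurable_Gh_mono[OF t order_refl f]] weight_martingale[OF weight_full[OF density_1] t f] by simp

lemma prob_space_P: "prob_space P"
proof
 have "emeasure P (space P) = (\<integral>\<^sup>+om. 1 \<partial>P)" by simp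
 also have "... = (\<integral>\<^sup>+om. weight 0 T om \<partial>Q)" by (subst nn_integral_P) auto
 finally show "emeasure P (space P) = 1" using weight_full[OF density_1] by simp
qed

sublocale P: prob_space P
 by (rule prob_space_P)

lemma AE_P:
 assumes "AE om in Q. R om"
 shows "AE om in P. R om"
proof -
 obtain Z where Z: "{om\<in>space Q. \<not> R om} \<subseteq> Z" "Z \<in> null_sets Q"
  using assms by (auto elim!: AE_E simp: null_sets_def)
 have ZG: "Z \<in> sets (Gh T)" using Gh_null[OF T_range] Z(2) by auto
 have "emeasure P Z = (\<integral>\<^sup>+om. indicator Z om \<partial>P)"
  using ZG by (simp add: sets_P)
 also have "... = (\<integral>\<^sup>+om. indicator Z om * weight 0 T om \<partial>Q)"
  using ZG by (intro nn_integral_P) simp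
 also have "... = (\<integral>\<^sup>+om. 0 \<partial>Q)"
  using AE_not_in[OF Z(2)] by (intro nn_integral_cong_AE) (auto elim!: eventually_mono)
 finally have "Z \<in> null_sets P" using ZG by (simp add: null_sets_def sets_P)
 then show ?thesis by (rule AE_I') (use Z(1) in auto)
qed

lemma subalgebra_P_Gh: "0 <= t ==> t <= T ==> space M = space Q ==> sets M \<subseteq> sets (Gh t) ==> subalgebra P M"
 using Gh_mono[of t T] by (auto simp: subalgebra_def sets_P)

lemma trans_le_1:
 assumes "om \<in> space Q" "s <= t" "y \<in> S"
 shows "trans x y s t om <= 1"
 using member_le_sum[of y S "%y. trans x y s t om"] trans_sum_le_1[OF assms(1,2), of x] assms(3) order_trans by auto

definition ptrans :: "nat => nat => real => real => 'a => real" where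
 "ptrans x y s t om = enn2real (trans x y s t om)"

lemma ptrans_nonneg [simp]: "0 <= ptrans x y s t om"
 by (simp add: ptrans_def)

lemma ennreal_ptrans:
 assumes "om \<in> space Q" "s <= t" "y \<in> S"
 shows "ennreal (ptrans x y s t om) = trans x y s t om"
 using trans_le_1[OF assms, of x] unfolding ptrans_def
 by (intro ennreal_enn2real) (metis ennreal_one_less_top le_less_trans)

lemma ptrans_meas: "0 <= t ==> t <= T ==> ptrans x y s t \<in> borel_measurable (F t)"
 unfolding ptrans_def[abs_def] by (intro borel_measurable_enn2real trans_meas)

text \<open>Conditionally on the past up to \<open>s\<close>, enlarged by all of \<open>F T\<close>, the chain moves according to
 the minimal transition function.\<close>
lemma nn_integral_P_transition:
 assumes st: "0 <= s" "s <= t" "t <= T" and y: "y \<in> S" and h: "h \<in> borel_measurable (Gh s)"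
 shows "(\<integral>\<^sup>+om. h om * of_bool (X t om = y) \<partial>P) = (\<integral>\<^sup>+om. h om * trans (X s om) y s t om \<partial>P)"
proof -
 have t: "0 <= t" and s: "s <= T" using st by auto
 have ws: "weight 0 s \<in> borel_measurable (Gh s)" by (rule weight_meas[OF order_refl st(1) s])
 have ht: "h \<in> borel_measurable (Gh t)" by (rule measurable_Gh_mono[OF st h])
 have "(\<integral>\<^sup>+om. h om * of_bool (X t om = y) \<partial>P) = (\<integral>\<^sup>+om. h om * of_bool (X t om = y) * weight 0 t om \<partial>Q)"
  by (intro nn_integral_P_past[OF t st(3)] borel_measurable_times_ennreal ht of_bool_X_meas[OF t order_refl st(3)])
 also have "... = (\<integral>\<^sup>+om. (h om * weight 0 s om) * (weight s t om * of_bool (X t om = y)) \<partial>Q)"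
  using st by (intro nn_integral_cong) (simp add: weight_mult[of _ 0 s t] mult_ac)
 also have "... = (\<integral>\<^sup>+om. (h om * weight 0 s om) * trans (X s om) y s t om \<partial>Q)"
  by (rule weight_identity_fun[OF st y borel_measurable_times_ennreal[OF h ws]])
 also have "... = (\<integral>\<^sup>+om. (h om * trans (X s om) y s t om) * weight 0 s om \<partial>Q)"
  by (simp only: mult_ac)
 also have "... = (\<integral>\<^sup>+om. h om * trans (X s om) y s t om \<partial>P)"
  by (intro nn_integral_P_past[OF st(1) s, symmetric] borel_measurable_times_ennreal h trans_X_meas[OF st(1) order_refl s t st(3)])
 finally show ?thesis .
qed

lemma indicator_X_meas_P:
 assumes "0 <= t" "t <= T"
 shows "{om\<in>space P. X t om = y} \<in> sets P"
 using measurable_sets[OF measurable_Gh_mono[OF assms order_refl X_meas_Gh[OF assms]], of "{y}"]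
 by (simp add: sets_P vimage_def Int_def conj_commute)

text \<open>Applies both to the full past and to \<open>F t\<close> joined with the present state, which is
  the Markov property.\<close>
lemma cond_probability_eq_ptrans:
 assumes st: "0 <= s" "s <= t" "t <= T" and y: "y \<in> S"
  and M: "space M = space Q" "sets M \<subseteq> sets (Gh s)" and meas: "(%om. ptrans (X s om) y s t om) \<in> borel_measurable M"
 shows "AE om in P. cond_probability P M (%om. X t om = y) om = ptrans (X s om) y s t om"
 unfolding cond_probability_def
proof (rule real_cond_exp_eqI[OF P.finite_measure_axioms subalgebra_P_Gh[OF st(1) _ M] _ _ meas])
 have t: "0 <= t" and s: "s <= T" using st by auto
 show "integrable P (indicator {om \<in> space P. X t om = y} :: 'a => real)"
  using indicator_X_meas_P[OF t st(3), of y] by (intro integrable_real_indicator) (auto simp: P.emeasure_eq_measure)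
 fix A assume A: "A \<in> sets M"
 have "(\<integral>\<^sup>+om. indicator A om * ennreal (indicator {om \<in> space P. X t om = y} om) \<partial>P) = (\<integral>\<^sup>+om. indicator A om * of_bool (X t om = y) \<partial>P)"
  by (intro nn_integral_cong) (auto simp: indicator_def)
 also have "... = (\<integral>\<^sup>+om. indicator A om * trans (X s om) y s t om \<partial>P)"
  using A M by (intro nn_integral_P_transition[OF st y]) auto
 also have "... = (\<integral>\<^sup>+om. indicator A om * ennreal (ptrans (X s om) y s t om) \<partial>P)"
  using st y by (intro nn_integral_cong) (simp add: ennreal_ptrans)
 finally show "(\<integral>\<^sup>+om. indicator A om * ennreal (indicator {om \<in> space P. X t om = y} om) \<partial>P) =
   (\<integral>\<^sup>+om. indicator A om * ennreal (ptrans (X s om) y s t om) \<partial>P)" .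
qed (use st in auto)

theorem dsmc: "is_dsmc T P d F G X"
 unfolding is_dsmc_def
proof (intro conjI ballI)
 show "X t om \<in> S" if "t \<in> {0..T}" "om \<in> space P" for t om using that X_S by auto
 show "adapted T G (count_space UNIV) X" using X_meas_G by (auto simp: adapted_def)
 show "cadlag_on T (%t. X t om)" if "om \<in> space P" for om using that X_cadlag by auto
 fix s t y assume "s \<in> {0..T}" "t \<in> {s..T}" and y: "y \<in> S"
 then have st: "0 <= s" "s <= t" "t <= T" by auto
 then have t: "0 <= t" and s: "s <= T" by auto
 let ?M = "sigma_join P (F t) (sigma_var P (X s))"
 have Gh: "sigma_join P (F T) (G s) = Gh s" by (simp add: Gh_def sigma_join_def)
 have M: "?M = sigma_join Q (F t) (sigma_var Q (X s))" by (simp add: sigma_join_def sigma_var_def)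
 have sv: "subalgebra Q (sigma_var Q (X s))" by (rule subalgebra_sigma_var[OF X_meas[OF st(1) s]])
 have Ft: "subalgebra Q (F t)" by (rule F_subalg[OF t st(3)])
 have sub: "sets ?M \<subseteq> sets (Gh s)"
  unfolding M
 proof (rule sigma_join_least[OF Ft sv])
  show "sets (F t) \<subseteq> sets (Gh s)" by (rule F_Gh[OF t st(3,1) s])
  show "sets (sigma_var Q (X s)) \<subseteq> sets (Gh s)"
   using subalgebra_sigma_var[OF X_meas_Gh[OF st(1) s]] by (simp add: subalgebra_def sigma_var_def)
 qed simp
 have sp: "space ?M = space Q" by simp
 have 1: "AE om in P. cond_probability P (Gh s) (%om. X t om = y) om = ptrans (X s om) y s t om"
  unfolding ptrans_def
  by (rule cond_probability_eq_ptrans[OF st y, unfolded ptrans_def])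
    (auto intro!: borel_measurable_enn2real trans_X_meas[OF st(1) order_refl s t st(3)])
 have 2: "AE om in P. cond_probability P ?M (%om. X t om = y) om = ptrans (X s om) y s t om"
 proof (rule cond_probability_eq_ptrans[OF st y sp sub])
  have subM: "subalgebra ?M (F t)" "subalgebra ?M (sigma_var Q (X s))"
   unfolding M using subalgebra_sigma_join(2,3)[OF Ft sv] Ft sv by (simp_all add: subalgebra_def)
  have F': "f \<in> measurable ?M N" if "f \<in> measurable (F t) N" for f :: "'a => real" and N
   by (rule measurable_from_subalg[OF subM(1) that])
  have X': "X s \<in> measurable ?M (count_space UNIV)"
   by (rule measurable_from_subalg[OF subM(2) measurable_sigma_var])
  show "(%om. ptrans (X s om) y s t om) \<in> borel_measurable ?M"
   by (rule measurable_compose_countable[where f="%x om. ptrans x y s t om" and g="X s", OF F'[OF ptrans_meas[OF t st(3)]] X'])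
 qed
 show "AE om in P. cond_probability P (sigma_join P (F T) (G s)) (%om. X t om = y) om = cond_probability P ?M (%om. X t om = y) om"
  unfolding Gh using 1 2 by eventually_elim simp
qed

end

section \<open>The intensity\<close>

lemma neg_exp_pos: "a < \<top> ==> 0 < neg_exp a"
 by (cases a) (auto simp: neg_exp_ennreal)

text \<open>A rate that is bounded to the left of every time can fail to be integrable only through an
 explosion to the right of a first time \<open>c\<close>, up to which its integral is finite.\<close>
lemma first_explosion:
 fixes k :: "real => ennreal"
 assumes [measurable]: "k \<in> borel_measurable borel" and T: "0 <= T"
  and left: "\<And>w. 0 < w ==> w <= T ==> \<exists>C. eventually (%u. k u <= ennreal C) (at_left w)"
  and infinite: "(\<integral>\<^sup>+u\<in>{0<..<T}. k u \<partial>lborel) = \<top>"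
 obtains c where "0 <= c" "c < T" "(\<integral>\<^sup>+u\<in>{0<..<c}. k u \<partial>lborel) < \<top>"
  "\<And>w. c < w ==> (\<integral>\<^sup>+u\<in>{c<..<w}. k u \<partial>lborel) = \<top>"
proof -
 define K where "K t = (\<integral>\<^sup>+u\<in>{0<..<t}. k u \<partial>lborel)" for t
 define A where "A = {t\<in>{0..T}. K t < \<top>}"
 define c where "c = Sup A"
 have 0: "0 \<in> A" using T by (simp add: A_def K_def)
 have bdd: "bdd_above A" by (rule bdd_aboveI[of _ T]) (auto simp: A_def)
 have c: "0 <= c" "c <= T"
  unfolding c_def using 0 by (auto intro!: cSup_upper cSup_least bdd simp: A_def)
 have split: "K w = K v + (\<integral>\<^sup>+u\<in>{v<..<w}. k u \<partial>lborel)" if "0 <= v" "v <= w" for v w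
  unfolding K_def using that by (intro nn_integral_interval_split) auto
 have Kc: "K c < \<top>"
 proof (cases "c = 0")
  case False
  then obtain C where "eventually (%u. k u <= ennreal C) (at_left c)" using left c by force
  then obtain b where b: "b < c" "\<And>u. b < u ==> u < c ==> k u <= ennreal C"
   by (auto simp: eventually_at_left_field)
  obtain t where t: "t \<in> A" "b < t" using less_cSupE[OF b(1)[unfolded c_def]] 0 by blast
  have tc: "t <= c" unfolding c_def by (rule cSup_upper[OF t(1) bdd])
  have "(\<integral>\<^sup>+u\<in>{t<..<c}. k u \<partial>lborel) <= (\<integral>\<^sup>+u. ennreal C * indicator {t<..<c} u \<partial>lborel)"
   using b t(2) by (intro nn_integral_mono) (auto simp: indicator_def)
  also have "... < \<top>" using tc by (simp add: nn_integral_cmult ennreal_mult_less_top)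
  finally show ?thesis using split[OF _ tc] t(1) by (simp add: A_def)
 qed (simp add: K_def)
 have cT: "c < T" using c Kc infinite by (cases "c = T") (auto simp: K_def)
 have "(\<integral>\<^sup>+u\<in>{c<..<w}. k u \<partial>lborel) = \<top>" if w: "c < w" for w
 proof -
  have w': "c < min w T" "min w T <= T" using w cT by auto
  have "min w T \<notin> A" using cSup_upper[OF _ bdd, of "min w T"] w' by (auto simp: c_def[symmetric])
  then have "K (min w T) = \<top>" using w' c by (simp add: A_def not_less top_unique)
  then have "(\<integral>\<^sup>+u\<in>{c<..<min w T}. k u \<partial>lborel) = \<top>" using split[OF c(1), of "min w T"] w' Kc by auto
  moreover have "(\<integral>\<^sup>+u\<in>{c<..<min w T}. k u \<partial>lborel) <= (\<integral>\<^sup>+u\<in>{c<..<w}. k u \<partial>lborel)"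
   by (intro nn_integral_mono) (auto simp: indicator_def)
  ultimately show ?thesis by (simp add: top_unique)
 qed
 with that c(1) cT Kc show ?thesis by (auto simp: K_def)
qed

text \<open>Passage from equations between nonnegative integrals over open intervals to the real integral of
  a difference over the closed interval.\<close>
lemma integral_equation_real:
 fixes f g h :: "real => real"
 assumes [measurable]: "f \<in> borel_measurable borel" "g \<in> borel_measurable borel"
  and nn: "\<And>u. 0 <= f u" "\<And>u. 0 <= g u" "0 <= z" "0 <= \<delta>"
  and fin: "(\<integral>\<^sup>+u\<in>{v<..<t}. ennreal (f u) \<partial>lborel) < \<top>"
  and eq: "ennreal z + (\<integral>\<^sup>+u\<in>{v<..<t}. ennreal (f u) \<partial>lborel) = ennreal \<delta> + (\<integral>\<^sup>+u\<in>{v<..<t}. ennreal (g u) \<partial>lborel)"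
  and h: "\<And>u. v < u ==> u < t ==> h u = g u - f u"
 shows "set_integrable lborel {v..t} h \<and> z - \<delta> = (LINT u:{v..t}|lborel. h u)"
proof
 have fin': "(\<integral>\<^sup>+u\<in>{v<..<t}. ennreal (g u) \<partial>lborel) < \<top>"
  using fin eq by (metis ennreal_add_eq_top ennreal_neq_top less_top)
 have int: "integrable lborel (%u. indicator {v<..<t} u * q u)"
   "(\<integral>\<^sup>+u\<in>{v<..<t}. ennreal (q u) \<partial>lborel) = ennreal (\<integral>u. indicator {v<..<t} u * q u \<partial>lborel)"
   "0 <= (\<integral>u. indicator {v<..<t} u * q u \<partial>lborel)"
  if q: "q \<in> borel_measurable borel" "\<And>u. 0 <= q u" "(\<integral>\<^sup>+u\<in>{v<..<t}. ennreal (q u) \<partial>lborel) < \<top>" for q :: "real => real"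
 proof -
  have *: "(\<integral>\<^sup>+u\<in>{v<..<t}. ennreal (q u) \<partial>lborel) = (\<integral>\<^sup>+u. ennreal (indicator {v<..<t} u * q u) \<partial>lborel)"
   by (intro nn_integral_cong) (auto simp: indicator_def)
  show i: "integrable lborel (%u. indicator {v<..<t} u * q u)"
   using q * by (intro integrableI_bounded) (simp_all add: abs_mult)
  show "(\<integral>\<^sup>+u\<in>{v<..<t}. ennreal (q u) \<partial>lborel) = ennreal (\<integral>u. indicator {v<..<t} u * q u \<partial>lborel)"
   unfolding * using q(2) by (intro nn_integral_eq_integral[OF i]) simp
  show "0 <= (\<integral>u. indicator {v<..<t} u * q u \<partial>lborel)" using q(2) by simp
 qed
 note F = int[OF assms(1) nn(1) fin] and G = int[OF assms(2) nn(2) fin']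
 have X: "countable {v, t}" by simp
 have hX: "indicator {v..t} u * h u = indicator {v<..<t} u * g u - indicator {v<..<t} u * f u" if "u \<notin> {v, t}" for u
  using that h[of u] by (auto simp: indicator_def)
 have 1: "integrable lborel (%u. indicator {v..t} u * h u) = integrable lborel (%u. indicator {v<..<t} u * g u - indicator {v<..<t} u * f u)"
  by (rule integrable_discrete_difference[OF X]) (use hX in auto)
 have 2: "(\<integral>u. indicator {v..t} u * h u \<partial>lborel) = (\<integral>u. indicator {v<..<t} u * g u - indicator {v<..<t} u * f u \<partial>lborel)"
  by (rule integral_discrete_difference[OF X]) (use hX in auto)
 show "set_integrable lborel {v..t} h"
  unfolding set_integrable_def using 1 F(1) G(1) by simp
 have "z + (\<integral>u. indicator {v<..<t} u * f u \<partial>lborel) = \<delta> + (\<integral>u. indicator {v<..<t} u * g u \<partial>lborel)"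
  using eq nn(3,4) F(3) G(3) unfolding F(2) G(2) by (simp flip: ennreal_plus)
 then show "z - \<delta> = (LINT u:{v..t}|lborel. h u)"
  unfolding set_lebesgue_integral_def using 2 Bochner_Integration.integral_diff[OF G(1) F(1)] by simp
qed

context driven_chain_density
begin

lemma X_0_AE: "AE om in Q. X 0 om = \<xi> om"
proof -
 have "AE om in Q. \<forall>t\<in>{0..T}. real (X t om) = real (\<xi> om) + (\<Sum>(x, y)\<in>state_pairs d. (real y - real x) *
       jump_integral (%u. indicator {x} (Lim (at_left u) (%s. X s om))) (%u. N x y u om) t)"
  using sde by (simp add: solves_sde_def)
 then show ?thesis
 proof eventually_elim
  case (elim om)
  have "real (X 0 om) = real (\<xi> om) + (\<Sum>(x, y)\<in>state_pairs d. (real y - real x) *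
       jump_integral (%u. indicator {x} (Lim (at_left u) (%s. X s om))) (%u. N x y u om) 0)"
   using elim T_pos by (meson atLeastAtMost_iff less_imp_le order_refl)
  then show ?case by (simp add: jump_integral_def split_beta)
 qed
qed

text \<open>The initial state is independent of \<open>F T\<close> up to the density \<open>\<mu>
  x\<close>.\<close>
lemma nn_integral_initial:
 assumes x: "x \<in> S" and h: "h \<in> borel_measurable (F T)"
 shows "(\<integral>\<^sup>+om. h om * of_bool (X 0 om = x) \<partial>Q) = (\<integral>\<^sup>+om. h om * ennreal (\<mu> x om) \<partial>Q)"
proof -
 let ?A = "{om\<in>space Q. \<xi> om = x}"
 have A: "?A \<in> sets Q" using measurable_sets[OF \<xi>_meas, of "{x}"] by (simp add: vimage_def Int_def conj_commute)
 have int: "integrable Q (indicator ?A :: 'a => real)"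
  using A by (intro integrable_real_indicator) (auto simp: emeasure_eq_measure)
 have "(\<integral>\<^sup>+om. h om * of_bool (X 0 om = x) \<partial>Q) = (\<integral>\<^sup>+om. h om * ennreal (indicator ?A om) \<partial>Q)"
  using X_0_AE AE_space by (intro nn_integral_cong_AE) (auto elim!: eventually_elim2 simp: indicator_def)
 also have "... = (\<integral>\<^sup>+om. h om * ennreal (real_cond_exp Q (F T) (indicator ?A) om) \<partial>Q)"
  by (rule real_cond_exp_nn_intg[OF finite_measure_axioms F_subalg[OF T_range] int _ h, symmetric]) simp
 also have "... = (\<integral>\<^sup>+om. h om * ennreal (\<mu> x om) \<partial>Q)"
 proof (rule nn_integral_cong_AE)
  have "AE om in Q. real_cond_exp Q (F T) (indicator ?A) om = \<mu> x om"
   using \<mu>[OF x] by (simp add: cond_probability_def)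
  then show "AE om in Q. h om * ennreal (real_cond_exp Q (F T) (indicator ?A) om) = h om * ennreal (\<mu> x om)"
   by eventually_elim simp
 qed
 finally show ?thesis .
qed

lemma \<mu>_meas_T: "x \<in> S ==> \<mu> x \<in> borel_measurable (F T)"
proof -
 assume x: "x \<in> S"
 have "sets (F 0) \<subseteq> sets (F T)" "space (F 0) = space (F T)"
  using F_mono[of 0 T] F_subalg[of 0] F_subalg[of T] T_pos by (auto simp: subalgebra_def)
 then show "\<mu> x \<in> borel_measurable (F T)" using \<mu>[OF x] by (auto simp: measurable_def)
qed

text \<open>Conservation of mass at time \<open>0\<close>, integrated against the conditional law of the
  initial state.\<close>
lemma no_mass_lost:
 assumes x: "x \<in> S"
 shows "AE om in Q. 0 < \<mu> x om --> (\<Sum>y\<in>S. trans x y 0 T om) = 1"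
proof -
 let ?m = "%om. 1 - (\<Sum>y\<in>S. trans x y 0 T om)"
 have m: "?m \<in> borel_measurable (F T)"
  by (intro borel_measurable_minus_ennreal borel_measurable_sum trans_meas[OF T_range]) auto
 have "(\<integral>\<^sup>+om. ?m om * ennreal (\<mu> x om) \<partial>Q) = (\<integral>\<^sup>+om. ?m om * of_bool (X 0 om = x) \<partial>Q)"
  by (rule nn_integral_initial[OF x m, symmetric])
 also have "... = (\<integral>\<^sup>+om. 0 \<partial>Q)"
 proof (rule nn_integral_cong_AE)
  show "AE om in Q. ?m om * of_bool (X 0 om = x) = 0"
   using weight_full_mass[OF weight_full[OF density_1], of 0] T_pos by (auto elim!: eventually_mono)
 qed
 finally have "AE om in Q. ?m om * ennreal (\<mu> x om) = 0"
  using borel_measurable_times_ennreal[OF FTQ[OF m] measurable_compose[OF FTQ[OF \<mu>_meas_T[OF x]] measurable_ennreal]]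
  by (simp add: nn_integral_0_iff_AE)
 with AE_space show ?thesis
 proof eventually_elim
  case (elim om)
  show ?case
  proof
   assume "0 < \<mu> x om"
   then have "?m om = 0" using elim(2) by simp
   then have "1 <= (\<Sum>y\<in>S. trans x y 0 T om)" by (simp add: diff_eq_0_iff_ennreal)
   then show "(\<Sum>y\<in>S. trans x y 0 T om) = 1"
    using trans_sum_le_1[OF elim(1), of 0 T x] T_pos by (intro antisym) auto
  qed
 qed
qed

text \<open>After the first explosion time of \<open>kil x\<close> the paths that have not left
  \<open>x\<close> before are lost, and these have positive mass.\<close>
lemma kil_integral_finite:
 assumes om: "om \<in> space Q" and left: "\<And>w. 0 < w ==> w <= T ==> \<exists>C. eventually (%u. kil x u om <= ennreal C) (at_left w)"
  and mass: "(\<Sum>y\<in>S. trans x y 0 T om) = 1"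
 shows "(\<integral>\<^sup>+u\<in>{0<..<T}. kil x u om \<partial>lborel) < \<top>"
proof (rule ccontr)
 assume "\<not> ?thesis"
 then have "(\<integral>\<^sup>+u\<in>{0<..<T}. kil x u om \<partial>lborel) = \<top>" by (simp add: not_less top_unique)
 then obtain c where c: "0 <= c" "c < T" "(\<integral>\<^sup>+u\<in>{0<..<c}. kil x u om \<partial>lborel) < \<top>"
  "\<And>w. c < w ==> (\<integral>\<^sup>+u\<in>{c<..<w}. kil x u om \<partial>lborel) = \<top>"
  using first_explosion[OF kil_path_meas[OF om] T_range(1) left] by blast
 have "(\<Sum>y\<in>S. trans x y 0 T om) < 1"
  unfolding trans_def
 proof (rule min_trans_explosion[OF feller_ctx_rates[OF om] _ c(1,2)])
  show "0 < surv (kpath om x) 0 c" unfolding surv_def by (rule neg_exp_pos[OF c(3)])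
  show "surv (kpath om x) c w = 0" if "c < w" for w unfolding surv_def using c(4)[OF that] by simp
 qed (simp add: kil_def)
 then show False using mass by simp
qed

lemma kil_left_bounded_AE:
 "AE om in Q. \<forall>x. \<forall>w. 0 < w --> w <= T --> (\<exists>C. eventually (%u. kil x u om <= ennreal C) (at_left w))"
 using lam_left_limits_AE
proof eventually_elim
 case (elim om)
 have "\<exists>C. eventually (%u. kil x u om <= ennreal C) (at_left w)" if w: "0 < w" "w <= T" for x w
 proof -
  have "((%r. \<Sum>z\<in>S - {x}. lam x z r om) \<longlongrightarrow> (\<Sum>z\<in>S - {x}. lam_left x z w om)) (at_left w)"
   using elim w by (intro tendsto_sum) auto
  then have "eventually (%r. (\<Sum>z\<in>S - {x}. lam x z r om) < (\<Sum>z\<in>S - {x}. lam_left x z w om) + 1) (at_left w)"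
   by (auto simp: order_tendsto_iff)
  then have "eventually (%r. kil x r om <= ennreal ((\<Sum>z\<in>S - {x}. lam_left x z w om) + 1)) (at_left w)"
   by eventually_elim (auto simp: kil_def sum_ennreal intro!: ennreal_leI)
  then show ?thesis by blast
 qed
 then show ?case by blast
qed

text \<open>Where \<open>\<mu> x\<close> is positive, conservation of mass forces integrability; where it is
  zero, the rates vanish by assumption.\<close>
lemma kil_integrable_AE:
 assumes absorbing: "null_initial_states_absorbing T Q d \<mu> \<Lambda>"
 shows "AE om in Q. \<forall>x\<in>S. (\<integral>\<^sup>+u\<in>{0<..<T}. kil x u om \<partial>lborel) < \<top> \<and>
  (\<mu> x om = 0 --> (\<integral>\<^sup>+u\<in>{0<..<T}. kil x u om \<partial>lborel) = 0)"
proof -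
 have "AE om in Q. \<forall>x\<in>S. 0 < \<mu> x om --> (\<Sum>y\<in>S. trans x y 0 T om) = 1"
  by (intro AE_finite_allI no_mass_lost) auto
 with kil_left_bounded_AE absorbing[unfolded null_initial_states_absorbing_def] AE_space show ?thesis
 proof eventually_elim
  case (elim om)
  have zero: "(\<integral>\<^sup>+u\<in>{0<..<T}. kil x u om \<partial>lborel) = 0" if x: "x \<in> S" and m: "\<mu> x om = 0" for x
  proof -
   have "AE u in lborel. \<forall>z\<in>S - {x}. u \<in> {0..T} --> \<Lambda> x z u om = 0"
    using elim(2) x m by (intro AE_finite_allI) (auto simp: state_pairs_def)
   then have "AE u in lborel. kil x u om * indicator {0<..<T} u = 0"
   proof eventually_elim
    case (elim u)
    show ?case
    proof (cases "u \<in> {0<..<T}")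
     case True
     then have "kil x u om = 0"
      unfolding kil_def using elim by (intro sum.neutral) (auto simp: lam_def)
     then show ?thesis by simp
    qed simp
   qed
   then have "(\<integral>\<^sup>+u\<in>{0<..<T}. kil x u om \<partial>lborel) = (\<integral>\<^sup>+u. 0 \<partial>(lborel :: real measure))" by (rule nn_integral_cong_AE)
   then show ?thesis by simp
  qed
  have "(\<integral>\<^sup>+u\<in>{0<..<T}. kil x u om \<partial>lborel) < \<top>" if x: "x \<in> S" for x
  proof (cases "\<mu> x om = 0")
   case True
   then show ?thesis using zero[OF x] by simp
  next
   case False
   then have "0 < \<mu> x om" using \<mu>[OF x] elim(3) by (metis order_le_less)
   then show ?thesis using kil_integral_finite[OF elim(3)] elim(1,4) x by blast
  qed
  then show ?case using zero by blast
 qed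
qed

lemma trans_diag_ge:
 assumes "om \<in> space Q" "s <= t"
 shows "neg_exp (\<integral>\<^sup>+u\<in>{s<..<t}. kil x u om \<partial>lborel) <= trans x x s t om"
proof -
 have "trans x x s t om = of_bool (x = x) * surv (kpath om x) s t + (\<integral>\<^sup>+w\<in>{s<..<t}. surv (kpath om x) s w *
   (\<Sum>z\<in>S - {x}. lpath om x z w * min_trans S (kpath om) (lpath om) z x w t) \<partial>lborel)"
  unfolding trans_def by (rule min_trans_first_jump[OF feller_ctx_rates[OF assms(1)] assms(2)])
 then have "surv (kpath om x) s t <= trans x x s t om" 
  by (simp only: simp_thms of_bool_eq mult_1) (rule add_increasing2[OF zero_le order_refl])
 then show ?thesis unfolding surv_def .
qed

abbreviation "past_prob x s t \<equiv> cond_probability P (F t) (%om. X s om = x)"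

lemma subalgebra_P_F: "0 <= t ==> t <= T ==> subalgebra P (F t)"
 using F_subalg[of t] F_Gh[of t T] T_range by (auto simp: subalgebra_def sets_P)

lemma integrable_indicator_P: "A \<in> sets P ==> integrable P (indicator A :: 'a => real)"
 by (intro integrable_real_indicator) (auto simp: P.emeasure_eq_measure)

lemma past_prob_intg:
 assumes st: "0 <= s" "s <= t" "t <= T" and h: "h \<in> borel_measurable (F t)"
 shows "(\<integral>\<^sup>+om. h om * ennreal (past_prob x s t om) \<partial>P) = (\<integral>\<^sup>+om. h om * of_bool (X s om = x) \<partial>P)"
proof -
 have t: "0 <= t" and s: "s <= T" using st by auto
 have "(\<integral>\<^sup>+om. h om * ennreal (past_prob x s t om) \<partial>P) = (\<integral>\<^sup>+om. h om * ennreal (indicator {om\<in>space P. X s om = x} om) \<partial>P)"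
  unfolding cond_probability_def
  by (rule real_cond_exp_nn_intg[OF P.finite_measure_axioms subalgebra_P_F[OF t st(3)] integrable_indicator_P[OF indicator_X_meas_P[OF st(1) s]] _ h]) simp
 also have "... = (\<integral>\<^sup>+om. h om * of_bool (X s om = x) \<partial>P)"
  by (intro nn_integral_cong) (auto simp: indicator_def)
 finally show ?thesis .
qed

lemma past_prob_nonneg:
 assumes st: "0 <= s" "s <= t" "t <= T"
 shows "AE om in P. 0 <= past_prob x s t om"
proof -
 have t: "0 <= t" and s: "s <= T" using st by auto
 interpret finite_measure_subalgebra P "F t" by standard (rule subalgebra_P_F[OF t st(3)])
 show ?thesis
  unfolding cond_probability_def using indicator_X_meas_P[OF st(1) s, of x] by (intro real_cond_exp_pos) auto
qed

lemma past_prob_meas: "past_prob x s t \<in> borel_measurable (F t)"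
 unfolding cond_probability_def by simp

text \<open>Since \<open>F t\<close> is contained in \<open>Gh s\<close>, the transition function may be
  pulled out of the conditional expectation.\<close>
lemma joint_cond_probability:
 assumes st: "0 <= s" "s <= t" "t <= T" and y: "y \<in> S"
 shows "AE om in P. cond_probability P (F t) (%om. X t om = y \<and> X s om = x) om = ptrans x y s t om * past_prob x s t om"
proof -
 have t: "0 <= t" and s: "s <= T" using st by auto
 let ?B = "{om\<in>space P. X t om = y \<and> X s om = x}"
 have eq: "?B = {om\<in>space P. X t om = y} \<inter> {om\<in>space P. X s om = x}" by auto
 have B: "?B \<in> sets P" unfolding eq by (rule sets.Int[OF indicator_X_meas_P[OF t st(3)] indicator_X_meas_P[OF st(1) s]])
 have "AE om in P. real_cond_exp P (F t) (indicator ?B) om = ptrans x y s t om * max 0 (past_prob x s t om)"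
 proof (rule real_cond_exp_eqI[OF P.finite_measure_axioms subalgebra_P_F[OF t st(3)] integrable_indicator_P[OF B]])
  show "(%om. ptrans x y s t om * max 0 (past_prob x s t om)) \<in> borel_measurable (F t)"
   using ptrans_meas[OF t st(3)] past_prob_meas by measurable
  fix A assume A: "A \<in> sets (F t)"
  then have AG: "A \<in> sets (Gh s)" using F_Gh[OF t st(3,1) s] by auto
  have hG: "(%om. indicator A om * of_bool (X s om = x) :: ennreal) \<in> borel_measurable (Gh s)"
   using AG of_bool_X_meas[OF st(1) order_refl s, of x] by (intro borel_measurable_times_ennreal borel_measurable_indicator)
  have hF: "(%om. indicator A om * trans x y s t om) \<in> borel_measurable (F t)"
   using A trans_meas[OF t st(3)] by (intro borel_measurable_times_ennreal borel_measurable_indicator)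
  have "(\<integral>\<^sup>+om. indicator A om * ennreal (indicator ?B om) \<partial>P) = (\<integral>\<^sup>+om. indicator A om * of_bool (X s om = x) * of_bool (X t om = y) \<partial>P)"
   by (intro nn_integral_cong) (auto simp: indicator_def)
  also have "... = (\<integral>\<^sup>+om. indicator A om * of_bool (X s om = x) * trans (X s om) y s t om \<partial>P)"
   by (rule nn_integral_P_transition[OF st y hG])
  also have "... = (\<integral>\<^sup>+om. (indicator A om * trans x y s t om) * of_bool (X s om = x) \<partial>P)"
   by (intro nn_integral_cong) auto
  also have "... = (\<integral>\<^sup>+om. (indicator A om * trans x y s t om) * ennreal (past_prob x s t om) \<partial>P)"
   by (rule past_prob_intg[OF st hF, symmetric])
  also have "... = (\<integral>\<^sup>+om. indicator A om * ennreal (ptrans x y s t om * max 0 (past_prob x s t om)) \<partial>P)"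
  proof (rule nn_integral_cong)
   fix om assume "om \<in> space P"
   then show "(indicator A om * trans x y s t om) * ennreal (past_prob x s t om) = indicator A om * ennreal (ptrans x y s t om * max 0 (past_prob x s t om))"
    using ennreal_ptrans[of om s t y x] st y by (simp add: ennreal_mult mult.assoc max_def ennreal_neg)
  qed
  finally show "(\<integral>\<^sup>+om. indicator A om * ennreal (indicator ?B om) \<partial>P) =
    (\<integral>\<^sup>+om. indicator A om * ennreal (ptrans x y s t om * max 0 (past_prob x s t om)) \<partial>P)" .
 qed auto
 with past_prob_nonneg[OF st, of x] show ?thesis
  by eventually_elim (simp add: cond_probability_def max_def)
qed

text \<open>A state that cannot be occupied at time \<open>s\<close> cannot be occupied at time \<open>0\<close> either, because the
 chain stays in its initial state with positive conditional probability.\<close>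
lemma null_past_prob:
 assumes absorbing: "null_initial_states_absorbing T Q d \<mu> \<Lambda>"
  and st: "0 <= s" "s <= t" "t <= T" and x: "x \<in> S"
 shows "AE om in P. past_prob x s t om = 0 --> \<mu> x om = 0"
proof (rule AE_P)
 have t: "0 <= t" and s: "s <= T" using st by auto
 define E where "E = {om\<in>space (F t). past_prob x s t om = 0}"
 have spF: "space (F t) = space Q" using F_subalg[OF t st(3)] by (auto simp: subalgebra_def)
 have E: "E \<in> sets (F t)" unfolding E_def using past_prob_meas by measurable
 have EG: "E \<in> sets (Gh 0)" and ET: "E \<in> sets (F T)"
  using E F_Gh[OF t st(3), of 0] F_mono[of t T] t st(3) T_range by auto
 have hG: "(%om. indicator E om * trans (X 0 om) x 0 s om) \<in> borel_measurable (Gh 0)"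
  using EG trans_X_meas[OF order_refl order_refl T_range(1) st(1) s] by (intro borel_measurable_times_ennreal borel_measurable_indicator)
 have hT: "(%om. indicator E om * trans x x 0 s om) \<in> borel_measurable (F T)"
 proof -
  have "trans x x 0 s \<in> borel_measurable (F T)"
   using trans_meas[OF st(1) s, of x x 0] F_mono[OF st(1) s order_refl] F_subalg[OF st(1) s] by (auto simp: measurable_def subalgebra_def space_FT)
  then show ?thesis using ET by (intro borel_measurable_times_ennreal borel_measurable_indicator)
 qed
 have "(\<integral>\<^sup>+om. indicator E om * trans x x 0 s om * ennreal (\<mu> x om) \<partial>Q) = (\<integral>\<^sup>+om. indicator E om * trans x x 0 s om * of_bool (X 0 om = x) \<partial>Q)"
  by (rule nn_integral_initial[OF x hT, symmetric])
 also have "... <= (\<integral>\<^sup>+om. indicator E om * trans (X 0 om) x 0 s om * weight 0 0 om \<partial>Q)"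
  by (intro nn_integral_mono) auto
 also have "... = (\<integral>\<^sup>+om. indicator E om * trans (X 0 om) x 0 s om \<partial>P)"
  by (rule nn_integral_P_past[OF order_refl T_range(1) hG, symmetric])
 also have "... = (\<integral>\<^sup>+om. indicator E om * of_bool (X s om = x) \<partial>P)"
  using EG by (intro nn_integral_P_transition[OF order_refl st(1) s x, symmetric]) auto
 also have "... = (\<integral>\<^sup>+om. indicator E om * ennreal (past_prob x s t om) \<partial>P)"
  using E by (intro past_prob_intg[OF st, symmetric]) auto
 also have "... = (\<integral>\<^sup>+om. 0 \<partial>P)"
  by (intro nn_integral_cong) (auto simp: E_def indicator_def)
 finally have "(\<integral>\<^sup>+om. indicator E om * trans x x 0 s om * ennreal (\<mu> x om) \<partial>Q) = 0" by simp
 moreover have "(%om. indicator E om * trans x x 0 s om * ennreal (\<mu> x om)) \<in> borel_measurable Q"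
  by (rule borel_measurable_times_ennreal[OF FTQ[OF hT] measurable_compose[OF FTQ[OF \<mu>_meas_T[OF x]] measurable_ennreal]])
 ultimately have "AE om in Q. indicator E om * trans x x 0 s om * ennreal (\<mu> x om) = 0"
  by (simp add: nn_integral_0_iff_AE)
 with kil_integrable_AE[OF absorbing] AE_space show "AE om in Q. past_prob x s t om = 0 --> \<mu> x om = 0"
 proof eventually_elim
  case (elim om)
  have "(\<integral>\<^sup>+u\<in>{0<..<s}. kil x u om \<partial>lborel) <= (\<integral>\<^sup>+u\<in>{0<..<T}. kil x u om \<partial>lborel)"
   using s by (intro nn_integral_mono) (auto simp: indicator_def)
  also have "... < \<top>" using elim(1) x by blast
  finally have "0 < trans x x 0 s om"
   using less_le_trans[OF neg_exp_pos trans_diag_ge[OF elim(2) st(1)]] by blast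
  moreover have "0 <= \<mu> x om" using \<mu>[OF x] elim(2) by blast
  ultimately show ?case using elim(2,3) by (auto simp: E_def spF indicator_def)
 qed
qed

text \<open>Without exit from \<open>x\<close> the diagonal entry is one, and the total mass leaves nothing
  for the other states.\<close>
lemma trans_absorbing:
 assumes om: "om \<in> space Q" and st: "0 <= s" "s <= t" "t <= T" and xy: "x \<in> S" "y \<in> S"
  and zero: "(\<integral>\<^sup>+u\<in>{0<..<T}. kil x u om \<partial>lborel) = 0"
 shows "ptrans x y s t om = of_bool (x = y)"
proof -
 have "(\<integral>\<^sup>+u\<in>{s<..<t}. kil x u om \<partial>lborel) <= (\<integral>\<^sup>+u\<in>{0<..<T}. kil x u om \<partial>lborel)"
  using st by (intro nn_integral_mono) (auto simp: indicator_def)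
 then have d: "1 <= trans x x s t om" using trans_diag_ge[OF om st(2), of x] zero by simp
 then have 1: "trans x x s t om = 1" using trans_le_1[OF om st(2) xy(1), of x] by simp
 show ?thesis
 proof (cases "x = y")
  case False
  have "(\<Sum>z\<in>{x, y}. trans x z s t om) <= (\<Sum>z\<in>S. trans x z s t om)"
   using xy by (intro sum_mono2) auto
  also have "... <= 1" by (rule trans_sum_le_1[OF om st(2)])
  finally have "1 + trans x y s t om <= 1" using False 1 by simp
  then have "trans x y s t om = 0" by (cases "trans x y s t om") (auto simp: top_unique simp flip: ennreal_1 ennreal_plus)
  then show ?thesis using False by (simp add: ptrans_def)
 qed (use 1 in \<open>simp add: ptrans_def\<close>)
qed

lemma ptrans_c_transition_field:
 assumes absorbing: "null_initial_states_absorbing T Q d \<mu> \<Lambda>"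
 shows "c_transition_field T P d F X ptrans"
 unfolding c_transition_field_def
proof (intro ballI conjI)
 fix s t x y assume "s \<in> {0..T}" "t \<in> {s..T}" and x: "x \<in> S" and y: "y \<in> S"
 then have st: "0 <= s" "s <= t" "t <= T" by auto
 show "ptrans x y s t \<in> borel_measurable (F t)" using st by (intro ptrans_meas) auto
 show "AE om in P. ptrans x y s t om = cond_probability P (F t) (%om. X t om = y \<and> X s om = x) om / past_prob x s t om *
   of_bool (past_prob x s t om > 0) + of_bool (x = y) * of_bool (past_prob x s t om = 0)"
  using joint_cond_probability[OF st y, of x] past_prob_nonneg[OF st, of x] null_past_prob[OF absorbing st x]
   AE_P[OF kil_integrable_AE[OF absorbing]] AE_space
 proof eventually_elim
  case (elim om)
  show ?case
  proof (cases "past_prob x s t om = 0")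
   case True
   then have "(\<integral>\<^sup>+u\<in>{0<..<T}. kil x u om \<partial>lborel) = 0" using elim(3,4) x by blast
   then show ?thesis using True trans_absorbing[OF _ st x y, of om] elim(5) by simp
  next
   case False
   then show ?thesis using elim(1,2) by simp
  qed
 qed
qed

lemma \<Lambda>_adapted: "x \<in> S ==> y \<in> S ==> adapted T F borel (\<Lambda> x y)"
 unfolding adapted_def
proof
 fix t assume "x \<in> S" "y \<in> S" and t: "t \<in> {0..T}"
 then have m: "(%(s, om). \<Lambda> x y s om) \<in> borel_measurable (restrict_space borel {0..t} \<Otimes>\<^sub>M F t)"
  using canonical by (auto simp: canonical_conditions_def progressive_def)
 have "(%om. (t, om)) \<in> measurable (F t) (restrict_space borel {0..t} \<Otimes>\<^sub>M F t)"
  using t by (intro measurable_Pair1') (auto simp: space_restrict_space)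
 from measurable_compose[OF this m] show "\<Lambda> x y t \<in> borel_measurable (F t)" by simp
qed

lemma \<Lambda>_diag:
 assumes "0 <= t" "t <= T" "om \<in> space Q" "x \<in> S"
 shows "\<Lambda> x x t om = - (\<Sum>z\<in>S - {x}. \<Lambda> x z t om)" "\<Lambda> x x t om = - (\<Sum>z\<in>S - {x}. lam x z t om)"
proof -
 have "(\<Sum>y\<in>S. \<Lambda> x y t om) = 0"
  using canonical assms by (auto simp: canonical_conditions_def)
 then show 1: "\<Lambda> x x t om = - (\<Sum>z\<in>S - {x}. \<Lambda> x z t om)"
  using sum.remove[of S x "%y. \<Lambda> x y t om"] assms(4) by simp
 have "(\<Sum>z\<in>S - {x}. lam x z t om) = (\<Sum>z\<in>S - {x}. \<Lambda> x z t om)"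
  using assms by (intro sum.cong refl lam_eq) (auto simp: state_pairs_def)
 then show "\<Lambda> x x t om = - (\<Sum>z\<in>S - {x}. lam x z t om)" using 1 by simp
qed

lemma kil_eq: "kil x u om = ennreal (\<Sum>z\<in>S - {x}. lam x z u om)"
 by (simp add: kil_def sum_ennreal)

lemma ptrans_path_meas:
 assumes "om \<in> space Q"
 shows "(%u. ptrans x y u t om) \<in> borel_measurable borel" "(%u. ptrans x y v u om) \<in> borel_measurable borel"
 unfolding ptrans_def trans_def
 by (intro borel_measurable_enn2real measurable_min_trans[OF feller_ctx_rates[OF assms]]; simp)+

lemma kolmogorov_equations:
 assumes om: "om \<in> space Q" and fin: "\<And>x. x \<in> S ==> (\<integral>\<^sup>+u\<in>{0<..<T}. kil x u om \<partial>lborel) < \<top>"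
  and vt: "0 <= v" "v <= t" "t <= T" and x: "x \<in> S" and y: "y \<in> S"
 shows "set_integrable lborel {v..t} (%u. \<Sum>z\<in>S. \<Lambda> x z u om * ptrans z y u t om)" (is ?B1)
  and "ptrans x y v t om - of_bool (x = y) = (LINT u:{v..t}|lborel. (\<Sum>z\<in>S. \<Lambda> x z u om * ptrans z y u t om))" (is ?B2)
  and "set_integrable lborel {v..t} (%u. \<Sum>z\<in>S. ptrans x z v u om * \<Lambda> z y u om)" (is ?F1)
  and "ptrans x y v t om - of_bool (x = y) = (LINT u:{v..t}|lborel. (\<Sum>z\<in>S. ptrans x z v u om * \<Lambda> z y u om))" (is ?F2)
proof -
 note ctx = feller_ctx_rates[OF om]
 note [measurable] = lam_path_meas[OF om] ptrans_path_meas[OF om]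
 have fin': "(\<integral>\<^sup>+u\<in>{v<..<t}. kil x u om \<partial>lborel) < \<top>" if "x \<in> S" for x
 proof -
  have "(\<integral>\<^sup>+u\<in>{v<..<t}. kil x u om \<partial>lborel) <= (\<integral>\<^sup>+u\<in>{0<..<T}. kil x u om \<partial>lborel)"
   using vt by (intro nn_integral_mono) (auto simp: indicator_def)
  then show ?thesis using fin[OF that] by (rule le_less_trans)
 qed
 have le1: "kil x u om * q <= kil x u om" if "q <= 1" for x u and q :: ennreal
  using mult_left_mono[OF that, of "kil x u om"] by simp
 let ?k = "%x u. \<Sum>z\<in>S - {x}. lam x z u om"
 have k0: "0 <= ?k x u" for x u by (intro sum_nonneg) simp
 define f1 where "f1 u = ?k x u * ptrans x y u t om" for u
 define g1 where "g1 u = (\<Sum>z\<in>S - {x}. lam x z u om * ptrans z y u t om)" for u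
 have f1: "ennreal (f1 u) = kil x u om * trans x y u t om" if "u < t" for u
  unfolding f1_def kil_eq using ennreal_ptrans[OF om, of u t y x] that y k0 by (simp add: ennreal_mult)
 have g1: "ennreal (g1 u) = (\<Sum>z\<in>S - {x}. ennreal (lam x z u om) * trans z y u t om)" if "u < t" for u
 proof -
  have "ennreal (g1 u) = (\<Sum>z\<in>S - {x}. ennreal (lam x z u om * ptrans z y u t om))"
   unfolding g1_def by (rule sum_ennreal[symmetric]) simp
  also have "... = (\<Sum>z\<in>S - {x}. ennreal (lam x z u om) * trans z y u t om)"
   using ennreal_ptrans[OF om, of u t y] that y by (intro sum.cong refl) (simp add: ennreal_mult)
  finally show ?thesis .
 qed
 have if1: "(\<integral>\<^sup>+u\<in>{v<..<t}. ennreal (f1 u) \<partial>lborel) = (\<integral>\<^sup>+u\<in>{v<..<t}. kil x u om * trans x y u t om \<partial>lborel)"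
  by (intro nn_integral_cong) (auto simp: indicator_def f1)
 have ig1: "(\<integral>\<^sup>+u\<in>{v<..<t}. ennreal (g1 u) \<partial>lborel) = (\<integral>\<^sup>+u\<in>{v<..<t}. (\<Sum>z\<in>S - {x}. ennreal (lam x z u om) * trans z y u t om) \<partial>lborel)"
  by (intro nn_integral_cong) (auto simp: indicator_def g1)
 have B: "?B1 \<and> ?B2"
 proof (rule integral_equation_real[where f=f1 and g=g1])
  show "f1 \<in> borel_measurable borel" "g1 \<in> borel_measurable borel" unfolding f1_def[abs_def] g1_def[abs_def] by measurable
  show "0 <= f1 u" for u unfolding f1_def by (intro mult_nonneg_nonneg k0 ptrans_nonneg)
  show "0 <= g1 u" for u unfolding g1_def by (intro sum_nonneg mult_nonneg_nonneg lam_nonneg ptrans_nonneg)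
  have "(\<integral>\<^sup>+u\<in>{v<..<t}. ennreal (f1 u) \<partial>lborel) <= (\<integral>\<^sup>+u\<in>{v<..<t}. kil x u om \<partial>lborel)"
   unfolding if1 using trans_le_1[OF om _ y] by (intro nn_integral_mono) (auto simp: indicator_def intro!: le1)
  then show "(\<integral>\<^sup>+u\<in>{v<..<t}. ennreal (f1 u) \<partial>lborel) < \<top>" using fin'[OF x] by (rule le_less_trans)
  show "ennreal (ptrans x y v t om) + (\<integral>\<^sup>+u\<in>{v<..<t}. ennreal (f1 u) \<partial>lborel) = ennreal (of_bool (x = y)) + (\<integral>\<^sup>+u\<in>{v<..<t}. ennreal (g1 u) \<partial>lborel)"
   using min_trans_backward[where k="kpath om" and l="lpath om" and x=x and y=y, OF ctx vt(2) fin'[OF x]] ennreal_ptrans[OF om vt(2) y, of x]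
   unfolding if1 ig1 by (simp add: trans_def)
  show "(\<Sum>z\<in>S. \<Lambda> x z u om * ptrans z y u t om) = g1 u - f1 u" if u: "v < u" "u < t" for u
  proof -
   have u': "0 <= u" "u <= T" using u vt by auto
   have "(\<Sum>z\<in>S - {x}. \<Lambda> x z u om * ptrans z y u t om) = g1 u"
    unfolding g1_def using lam_eq[OF _ u' om] x by (intro sum.cong refl) (auto simp: state_pairs_def)
   then show ?thesis
    using sum.remove[of S x "%z. \<Lambda> x z u om * ptrans z y u t om"] x \<Lambda>_diag(2)[OF u' om x] by (simp add: f1_def)
  qed
 qed auto
 then show ?B1 ?B2 by blast+
 define f2 where "f2 u = ptrans x y v u om * ?k y u" for u
 define g2 where "g2 u = (\<Sum>z\<in>S - {y}. ptrans x z v u om * lam z y u om)" for u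
 have f2: "ennreal (f2 u) = trans x y v u om * kil y u om" if "v < u" for u
  unfolding f2_def kil_eq using ennreal_ptrans[OF om, of v u y x] that y k0 by (simp add: ennreal_mult)
 have g2: "ennreal (g2 u) = (\<Sum>z\<in>S - {y}. trans x z v u om * ennreal (lam z y u om))" if "v < u" for u
 proof -
  have "ennreal (g2 u) = (\<Sum>z\<in>S - {y}. ennreal (ptrans x z v u om * lam z y u om))"
   unfolding g2_def by (rule sum_ennreal[symmetric]) simp
  also have "... = (\<Sum>z\<in>S - {y}. trans x z v u om * ennreal (lam z y u om))"
   using ennreal_ptrans[OF om, of v u _ x] that by (intro sum.cong refl) (simp add: ennreal_mult)
  finally show ?thesis .
 qed
 have if2: "(\<integral>\<^sup>+u\<in>{v<..<t}. ennreal (f2 u) \<partial>lborel) = (\<integral>\<^sup>+u\<in>{v<..<t}. trans x y v u om * kil y u om \<partial>lborel)"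
  by (intro nn_integral_cong) (auto simp: indicator_def f2)
 have ig2: "(\<integral>\<^sup>+u\<in>{v<..<t}. ennreal (g2 u) \<partial>lborel) = (\<integral>\<^sup>+u\<in>{v<..<t}. (\<Sum>z\<in>S - {y}. trans x z v u om * ennreal (lam z y u om)) \<partial>lborel)"
  by (intro nn_integral_cong) (auto simp: indicator_def g2)
 have Fw: "?F1 \<and> ?F2"
 proof (rule integral_equation_real[where f=f2 and g=g2])
  show "f2 \<in> borel_measurable borel" "g2 \<in> borel_measurable borel" unfolding f2_def[abs_def] g2_def[abs_def] by measurable
  show "0 <= f2 u" for u unfolding f2_def by (intro mult_nonneg_nonneg k0 ptrans_nonneg)
  show "0 <= g2 u" for u unfolding g2_def by (intro sum_nonneg mult_nonneg_nonneg lam_nonneg ptrans_nonneg)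
  have "(\<integral>\<^sup>+u\<in>{v<..<t}. ennreal (f2 u) \<partial>lborel) <= (\<integral>\<^sup>+u\<in>{v<..<t}. kil y u om \<partial>lborel)"
   unfolding if2 mult.commute[of "trans x y v _ om"] using trans_le_1[OF om _ y] by (intro nn_integral_mono) (auto simp: indicator_def intro!: le1)
  then show "(\<integral>\<^sup>+u\<in>{v<..<t}. ennreal (f2 u) \<partial>lborel) < \<top>" using fin'[OF y] by (rule le_less_trans)
  show "ennreal (ptrans x y v t om) + (\<integral>\<^sup>+u\<in>{v<..<t}. ennreal (f2 u) \<partial>lborel) = ennreal (of_bool (x = y)) + (\<integral>\<^sup>+u\<in>{v<..<t}. ennreal (g2 u) \<partial>lborel)"
   using min_trans_forward[where k="kpath om" and l="lpath om" and x=x and y=y, OF ctx vt(2) x y fin'] ennreal_ptrans[OF om vt(2) y, of x]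
   unfolding if2 ig2 by (simp add: trans_def)
  show "(\<Sum>z\<in>S. ptrans x z v u om * \<Lambda> z y u om) = g2 u - f2 u" if u: "v < u" "u < t" for u
  proof -
   have u': "0 <= u" "u <= T" using u vt by auto
   have "(\<Sum>z\<in>S - {y}. ptrans x z v u om * \<Lambda> z y u om) = g2 u"
    unfolding g2_def using lam_eq[OF _ u' om] y by (intro sum.cong refl) (auto simp: state_pairs_def)
   then show ?thesis
    using sum.remove[of S y "%z. ptrans x z v u om * \<Lambda> z y u om"] y \<Lambda>_diag(2)[OF u' om y] by (simp add: f2_def)
  qed
 qed auto
 then show ?F1 ?F2 by blast+
qed

lemma diagonal_integrable:
 assumes om: "om \<in> space Q" and fin: "\<And>x. x \<in> S ==> (\<integral>\<^sup>+u\<in>{0<..<T}. kil x u om \<partial>lborel) < \<top>"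
 shows "set_integrable lborel {0<..T} (%s. \<Sum>x\<in>S. \<bar>\<Lambda> x x s om\<bar>)"
proof -
 note [measurable] = lam_path_meas[OF om]
 let ?k = "%x u. \<Sum>z\<in>S - {x}. lam x z u om"
 have k0: "0 <= ?k x u" for x u by (intro sum_nonneg) simp
 have int: "integrable lborel (%u. indicator {0<..<T} u * ?k x u)" if x: "x \<in> S" for x
 proof (rule integrableI_bounded)
  have "(\<integral>\<^sup>+u. ennreal (norm (indicator {0<..<T} u * ?k x u)) \<partial>lborel) = (\<integral>\<^sup>+u\<in>{0<..<T}. kil x u om \<partial>lborel)"
   using k0 by (intro nn_integral_cong) (auto simp: indicator_def kil_eq)
  then show "(\<integral>\<^sup>+u. ennreal (norm (indicator {0<..<T} u * ?k x u)) \<partial>lborel) < \<infinity>" using fin[OF x] by simp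
 qed measurable
 have "integrable lborel (%u. \<Sum>x\<in>S. indicator {0<..<T} u * ?k x u)"
  by (intro Bochner_Integration.integrable_sum int)
 moreover have "integrable lborel (%u. \<Sum>x\<in>S. indicator {0<..<T} u * ?k x u) = integrable lborel (%u. indicator {0<..T} u * (\<Sum>x\<in>S. \<bar>\<Lambda> x x u om\<bar>))"
 proof (rule integrable_discrete_difference[where X="{T}"])
  fix u assume "u \<notin> {T}"
  then have i: "indicator {0<..<T} u = (indicator {0<..T} u :: real)" by (auto simp: indicator_def)
  show "(\<Sum>x\<in>S. indicator {0<..<T} u * ?k x u) = indicator {0<..T} u * (\<Sum>x\<in>S. \<bar>\<Lambda> x x u om\<bar>)"
  proof (cases "u \<in> {0<..T}")
   case True
   then have "(\<Sum>x\<in>S. \<bar>\<Lambda> x x u om\<bar>) = (\<Sum>x\<in>S. ?k x u)"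
    using k0 \<Lambda>_diag(2)[OF _ _ om, of u] by (intro sum.cong refl) auto
   then show ?thesis unfolding i using True by simp
  qed (simp add: i)
 qed auto
 ultimately show ?thesis by (simp add: set_integrable_def)
qed

theorem intensity:
 assumes absorbing: "null_initial_states_absorbing T Q d \<mu> \<Lambda>"
 shows "is_dsmc_intensity T P d F X \<Lambda>"
 unfolding is_dsmc_intensity_def
proof (intro conjI exI[of _ ptrans])
 have good: "AE om in P. om \<in> space Q \<and> (\<forall>x\<in>S. (\<integral>\<^sup>+u\<in>{0<..<T}. kil x u om \<partial>lborel) < \<top>)"
  using AE_P[OF kil_integrable_AE[OF absorbing]] AE_space by eventually_elim simp
 show "\<forall>x\<in>S. \<forall>y\<in>S. adapted T F borel (\<Lambda> x y)" using \<Lambda>_adapted by blast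
 show "AE om in P. set_integrable lborel {0<..T} (%s. \<Sum>x\<in>S. \<bar>\<Lambda> x x s om\<bar>)"
  using good by eventually_elim (intro diagonal_integrable; blast)
 show "\<forall>t\<in>{0..T}. \<forall>om\<in>space P. (\<forall>(x, y)\<in>I. 0 <= \<Lambda> x y t om) \<and> (\<forall>x\<in>S. \<Lambda> x x t om = - (\<Sum>y\<in>S - {x}. \<Lambda> x y t om))"
 proof (intro ballI conjI)
  fix t om assume t: "t \<in> {0..T}" and om: "om \<in> space P"
  show "case p of (x, y) => 0 <= \<Lambda> x y t om" if "p \<in> I" for p using that \<Lambda>_nonneg[of "fst p" "snd p" t om] t om by (simp add: split_beta)
  show "\<Lambda> x x t om = - (\<Sum>y\<in>S - {x}. \<Lambda> x y t om)" if "x \<in> S" for x using that t om by (intro \<Lambda>_diag(1)) auto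
 qed
 show "c_transition_field T P d F X ptrans" by (rule ptrans_c_transition_field[OF absorbing])
 show "AE om in P. \<forall>v\<in>{0..T}. \<forall>t\<in>{v..T}. \<forall>x\<in>S. \<forall>y\<in>S.
      set_integrable lborel {v..t} (%u. \<Sum>z\<in>S. \<Lambda> x z u om * ptrans z y u t om) \<and>
      ptrans x y v t om - of_bool (x = y) =
       (LINT u:{v..t}|lborel. (\<Sum>z\<in>S. \<Lambda> x z u om * ptrans z y u t om)) \<and>
      set_integrable lborel {v..t} (%u. \<Sum>z\<in>S. ptrans x z v u om * \<Lambda> z y u om) \<and>
      ptrans x y v t om - of_bool (x = y) =
       (LINT u:{v..t}|lborel. (\<Sum>z\<in>S. ptrans x z v u om * \<Lambda> z y u om))"
  using good
 proof eventually_elim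
  case (elim om)
  show ?case
  proof (intro ballI)
   fix v t x y assume "v \<in> {0..T}" "t \<in> {v..T}" and xy: "x \<in> S" "y \<in> S"
   then have vt: "0 <= v" "v <= t" "t <= T" by auto
   have om: "om \<in> space Q" and fin: "\<And>x. x \<in> S ==> (\<integral>\<^sup>+u\<in>{0<..<T}. kil x u om \<partial>lborel) < \<top>" using elim by auto
   note K = kolmogorov_equations[OF om fin vt xy]
   show "set_integrable lborel {v..t} (%u. \<Sum>z\<in>S. \<Lambda> x z u om * ptrans z y u t om) \<and>
      ptrans x y v t om - of_bool (x = y) =
       (LINT u:{v..t}|lborel. (\<Sum>z\<in>S. \<Lambda> x z u om * ptrans z y u t om)) \<and>
      set_integrable lborel {v..t} (%u. \<Sum>z\<in>S. ptrans x z v u om * \<Lambda> z y u om) \<and>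
      ptrans x y v t om - of_bool (x = y) =
       (LINT u:{v..t}|lborel. (\<Sum>z\<in>S. ptrans x z v u om * \<Lambda> z y u om))"
    by (intro conjI K)
  qed
 qed
qed

end

section \<open>Conclusion\<close>

theorem proposition4p17:
  fixes T :: real and d :: nat and Q P :: "'a measure"
    and F G :: "real \<Rightarrow> 'a measure"
    and \<xi> :: "'a \<Rightarrow> nat" and \<mu> :: "nat \<Rightarrow> 'a \<Rightarrow> real"
    and a :: "nat \<Rightarrow> nat \<Rightarrow> real"
    and N \<Lambda> :: "nat \<Rightarrow> nat \<Rightarrow> real \<Rightarrow> 'a \<Rightarrow> real"
    and X :: "real \<Rightarrow> 'a \<Rightarrow> nat"
  assumes "T > 0"
    and "prob_space Q" and "complete_measure Q"
    and "usual_conditions T Q F"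
    and "\<xi> \<in> measurable Q (count_space UNIV)" and "\<forall>\<omega>\<in>space Q. \<xi> \<omega> \<in> {1..d}"
    and "indep_poisson_family T Q d a N (sigma_join Q (F T) (sigma_var Q \<xi>))"
    and "G = driving_filtration T Q d N \<xi>"
    and "canonical_conditions T Q d F \<Lambda>"
    and "\<forall>x\<in>{1..d}. \<mu> x \<in> borel_measurable (F 0) \<and> (\<forall>\<omega>\<in>space Q. 0 \<le> \<mu> x \<omega> \<and> \<mu> x \<omega> \<le> 1) \<and>
           (AE \<omega> in Q. cond_probability Q (F T) (\<lambda>\<omega>. \<xi> \<omega> = x) \<omega> = \<mu> x \<omega>)"
    and "\<forall>(x, y)\<in>state_pairs d. a x y > 0"
    and "solves_sde T Q d G N \<xi> X"
    and "(\<integral>\<omega>. theta T d a \<Lambda> X \<omega> \<partial>Q) = 1"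
    and "P = density (restr_to_subalg Q (sigma_join Q (F T) (G T)))
               (\<lambda>\<omega>. ennreal (theta T d a \<Lambda> X \<omega>))"
  shows "is_dsmc T P d F G X \<and>
         (null_initial_states_absorbing T Q d \<mu> \<Lambda> \<longrightarrow> is_dsmc_intensity T P d F X \<Lambda>)"
proof -
  have "driven_chain Q T d F \<xi> a N X"
  proof (rule driven_chain.intro[OF assms(2)], rule driven_chain_axioms.intro)
    show "\<And>x y. (x, y) \<in> state_pairs d \<Longrightarrow> 0 < a x y" using assms(11) by blast
    show "solves_sde T Q d (driving_filtration T Q d N \<xi>) N \<xi> X" using assms(8,12) by simp
  qed (rule assms(1) assms(3) assms(4) assms(5) assms(7))+
  then have rates: "driven_chain_rates Q T d F \<xi> a N X \<Lambda>"
    by (rule driven_chain_rates.intro) (rule driven_chain_rates_axioms.intro[OF assms(9)])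
  have "driven_chain_density_axioms Q T d F \<xi> a X \<Lambda> \<mu>"
    using assms(10,13) by (intro driven_chain_density_axioms.intro) blast+
  with rates interpret C: driven_chain_density Q T d F \<xi> a N X \<Lambda> \<mu>
    by (rule driven_chain_density.intro)
  have "C.P = P" unfolding C.P_def C.Gh_def using assms(8,14) by simp
  then show ?thesis using C.dsmc C.intensity assms(8) by simp
qed

end
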